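(* Let $K=(-1/2,1/2)\times(-1/2,1/2)$ and, for $h_{\rm ex}>0$, $\varepsilon>0$, let $m_{\rm p}(h_{\rm ex},\varepsilon)$ be the magnetic-periodic ground state energy defined in the context. Assume that $h_{\rm ex}=h_{\rm ex}(\varepsilon)$ is a function of $\varepsilon$ such that $|\ln\varepsilon|\ll h_{\rm ex}\ll\varepsilon^{-2}$ as $\varepsilon\to0$. Then $$m_{\rm p}(h_{\rm ex},\varepsilon)=h_{\rm ex}\ln\frac{1}{\varepsilon\sqrt{h_{\rm ex}}}\,\big(1+o(1)\big)\quad\text{as }\varepsilon\to0.$$
   Context: Notation: $a\ll b$ means $a/b\to0$ as $\varepsilon\to0$. Let $\mathbf A_0(x_1,x_2)=\frac12(-x_2,x_1)$ on $\mathbb{R}^2$. For $u\in H^1(K;\mathbb{C})$, $$E^{2D}(u)=\int_K\Big(|(\nabla-ih_{\rm ex}\mathbf A_0)u|^2+\frac{1}{2\varepsilon^2}(1-|u|^2)^2\Big)dx.$$ Let $E_{h_{\rm ex}}=\{u\in H^1_{\rm loc}(\mathbb{R}^2;\mathbb{C}):\ u(x_1+1,x_2)=e^{ih_{\rm ex}x_2/2}u(x_1,x_2),\ u(x_1,x_2+1)=e^{-ih_{\rm ex}x_1/2}u(x_1,x_2)\}$ and $m_{\rm p}(h_{\rm ex},\varepsilon)=\inf\{E^{2D}(u):u\in E_{h_{\rm ex}}\}$ (with $E^{2D}(u)$ computed on the restriction of $u$ to $K$).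
   Formalization: Adds the assumption that h_ex(ε) is an integer multiple of 2π for every ε>0; otherwise the two periodicity conditions force u=0, so m_p = 1/(2ε²) and the claimed asymptotics fail. *)

theory Defs
  imports "HOL-Analysis.Analysis" "HOL-Library.Landau_Symbols"
begin

definition K_sq :: "(real \<times> real) set" where
  "K_sq = box (-1/2, -1/2) (1/2, 1/2)"

definition A0 :: "real \<times> real \<Rightarrow> real \<times> real" where
  "A0 x = (- snd x / 2, fst x / 2)"

definition test_fn :: "(real \<times> real \<Rightarrow> real) \<Rightarrow> bool" where
  "test_fn \<phi> \<longleftrightarrow> bounded {x. \<phi> x \<noteq> 0} \<and>
     (\<forall>e\<in>Basis. \<exists>d. continuous_on UNIV d \<and>
        (\<forall>x. ((\<lambda>t. \<phi> (x + t *\<^sub>R e)) has_real_derivative d x) (at 0)))"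

definition L2_loc :: "(real \<times> real \<Rightarrow> complex) \<Rightarrow> bool" where
  "L2_loc u \<longleftrightarrow> u \<in> borel_measurable lborel \<and>
     (\<forall>C. compact C \<longrightarrow> (\<integral>\<^sup>+x. ennreal ((cmod (u x))\<^sup>2) * indicator C x \<partial>lborel) < \<infinity>)"

definition weak_pderiv :: "(real \<times> real \<Rightarrow> complex) \<Rightarrow> real \<times> real \<Rightarrow> (real \<times> real \<Rightarrow> complex) \<Rightarrow> bool" where
  "weak_pderiv u e g \<longleftrightarrow>
     (\<forall>\<phi>. test_fn \<phi> \<longrightarrow>
        (\<integral>x. u x * complex_of_real (deriv (\<lambda>t. \<phi> (x + t *\<^sub>R e)) 0) \<partial>lborel)
          = - (\<integral>x. g x * complex_of_real (\<phi> x) \<partial>lborel))"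

definition H1_loc_grad :: "(real \<times> real \<Rightarrow> complex) \<Rightarrow> (real \<times> real \<Rightarrow> complex) \<Rightarrow> (real \<times> real \<Rightarrow> complex) \<Rightarrow> bool" where
  "H1_loc_grad u g1 g2 \<longleftrightarrow> L2_loc u \<and> L2_loc g1 \<and> L2_loc g2 \<and>
     weak_pderiv u (1, 0) g1 \<and> weak_pderiv u (0, 1) g2"

definition mag_periodic :: "real \<Rightarrow> (real \<times> real \<Rightarrow> complex) \<Rightarrow> bool" where
  "mag_periodic h u \<longleftrightarrow>
     (AE x in lborel. u (fst x + 1, snd x) = exp (\<i> * complex_of_real (h * snd x / 2)) * u x) \<and>
     (AE x in lborel. u (fst x, snd x + 1) = exp (- \<i> * complex_of_real (h * fst x / 2)) * u x)"

definition E2D :: "real \<Rightarrow> real \<Rightarrow> (real \<times> real \<Rightarrow> complex) \<Rightarrow> (real \<times> real \<Rightarrow> complex) \<Rightarrow> (real \<times> real \<Rightarrow> complex) \<Rightarrow> ennreal" where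
  "E2D h \<epsilon> u g1 g2 =
     (\<integral>\<^sup>+x. ennreal (
        (cmod (g1 x - \<i> * complex_of_real (h * fst (A0 x)) * u x))\<^sup>2
      + (cmod (g2 x - \<i> * complex_of_real (h * snd (A0 x)) * u x))\<^sup>2
      + (1 / (2 * \<epsilon>\<^sup>2)) * (1 - (cmod (u x))\<^sup>2)\<^sup>2) * indicator K_sq x \<partial>lborel)"

definition m_p :: "real \<Rightarrow> real \<Rightarrow> real" where
  "m_p h \<epsilon> = enn2real (INF ugg \<in> {(u, g1, g2). H1_loc_grad u g1 g2 \<and> mag_periodic h u}.
                           E2D h \<epsilon> (fst ugg) (fst (snd ugg)) (snd (snd ugg)))"

end

theory Submission
  imports Defs "HOL-Complex_Analysis.Complex_Analysis" "HOL-Library.Nat_Bijection"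
begin

text \<open>
  Lower bound. For \<open>u\<close> with \<open>|u|\<close> near 1 on the circle of radius \<open>r\<close> around \<open>x\<close>, the circulation of the
  velocity \<open>v = Im (\<nabla>\<^sub>A u \<sqdot> cnj u) / |u|\<^sup>2\<close> is \<open>2\<pi>n - h\<pi>r\<^sup>2\<close> with an integer \<open>n\<close>, so the flux
  \<open>F = 2\<pi>n\<close> satisfies \<open>F\<^sup>2 \<ge> 2\<pi>F\<close>; on a circle where \<open>|u| < 1 - \<theta>\<close> somewhere the energy is at least a multiple
  of \<open>1/\<epsilon>\<close> and pays for the failure of this inequality. The average of \<open>F\<close> over \<open>x\<close> is \<open>h\<pi>r\<^sup>2\<close>, because the
  velocity is periodic, hence the mean square of the circulations at radius \<open>r\<close> is bounded below by about
  \<open>2\<pi>\<^sup>2hr\<^sup>2\<close> as long as \<open>r \<lesssim> h powr (-1/2)\<close>. On the other hand circulations over circles are first Fourier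
  coefficients along circles, and their mean squares, integrated against \<open>dr/r\<close> over all scales, are controlled by
  the \<open>L\<^sup>2\<close> norm of \<open>v\<close>. Integrating from \<open>r = M\<epsilon>\<close> to \<open>r = h powr (-1/2)\<close> gives the leading term without any
  construction of vortex balls. General \<open>H\<^sup>1\<close> functions are reduced to smooth ones by a mollification that commutes
  with magnetic translations.

  Upper bound. Let \<open>\<Theta>\<close> be a section of the lowest Landau level, \<open>c = \<epsilon>\<surd>h\<close> and
  \<open>u = \<Theta> / sqrt (|\<Theta>|\<^sup>2 + c\<^sup>2)\<close>. A divergence identity bounds the kinetic energy by \<open>h ln (1/c) + O(h)\<close>
  wherever the zeros of \<open>\<Theta>\<close> are, provided only that \<open>|\<Theta>|\<close> is bounded. For the potential energy take
  \<open>\<Theta> = a p + q\<close> where \<open>p\<close>, \<open>q\<close> are sparse theta series without common near-zeros: the average over the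
  complex number \<open>a\<close> of \<open>c\<^sup>4 / (|a p + q|\<^sup>2 + c\<^sup>2)\<^sup>2\<close> is \<open>O(c\<^sup>2)\<close> at every point.
\<close>

section \<open>Mean squares of Fourier coefficients along circles\<close>

text \<open>The square carries \<open>h / (2 * pi)\<close> vortices at distances of order
  \<open>h powr (-1/2)\<close> with cores of size \<open>\<epsilon>\<close>, and each of them costs
  \<open>2 * pi * ln (1 / (\<epsilon> * sqrt h))\<close>. Since \<open>\<epsilon> * sqrt h\<close>
  tends to 0, errors of order \<open>h\<close> are harmless on both sides, but every constant in
  front of the logarithm has to be exact. In the lower bound, \<open>F^2 \<ge> 2 * pi * F\<close> is
  an equality for circles around at most one vortex, and the square function estimate has the
  constant \<open>4 * pi^2\<close> that matches it. The threshold \<open>\<theta>\<close> and the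
  smallest radius in units of \<open>\<epsilon>\<close> stay fixed while \<open>\<epsilon>\<close>
  tends to 0; the former costs a factor near 1, the latter costs \<open>h\<close> times a constant
  and a small fraction of the energy. In the upper bound the zeros of a section with prescribed flux
  are hard to locate, so the estimates avoid locating them. The average over \<open>a\<close> is
  small because \<open>c^4 / (|w|^2 + c^2)^2\<close> is integrable over the plane with integral of
  order \<open>c^2\<close>: wherever \<open>p\<close> is not small the average sees just such an
  integral, and elsewhere \<open>q\<close> keeps the section away from 0.\<close>

lemma integral_periodic_interval:
  fixes f :: "real \<Rightarrow> 'a::banach"
  assumes f: "continuous_on UNIV f" and per: "\<And>x. f (x + p) = f x" and p: "p > 0"
  shows "integral {a..a+p} f = integral {b..b+p} f"
proof -
  have *: "integral {a..a+p} f = integral {b..b+p} f" if ab: "a \<le> b" for a b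
  proof -
    have int: "f integrable_on {c..d}" for c d
      by (intro integrable_continuous_interval continuous_on_subset[OF f]) auto
    have "integral {a..a+p} f + integral {a+p..b+p} f = integral {a..b+p} f"
      by (rule Henstock_Kurzweil_Integration.integral_combine) (use ab p int in auto)
    also have "\<dots> = integral {a..b} f + integral {b..b+p} f"
      by (rule Henstock_Kurzweil_Integration.integral_combine[symmetric]) (use ab p int in auto)
    also have "integral {a+p..b+p} f = integral {a..b} f"
      using integral_shift_real_ivl[of "a+p" p "b+p" f] by (simp add: per)
    finally show ?thesis by simp
  qed
  show ?thesis
    using *[of a b] *[of b a] linear[of a b] by metis
qed

lemma integral_periodic_shift:
  fixes f :: "real \<Rightarrow> 'a::banach"
  assumes f: "continuous_on UNIV f" and per: "\<And>x. f (x + (b - a)) = f x" and ab: "a < b"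
  shows "integral {a..b} (\<lambda>x. f (x + c)) = integral {a..b} f"
proof -
  have "integral {a..b} (\<lambda>x. f (x + c)) = integral {a+c..a+c+(b-a)} f"
    using integral_shift_real_ivl[of "a+c" c "b+c" f]
    by (simp only: add_diff_cancel_right' add_diff_eq diff_add_cancel add.commute[of _ b] add.assoc[symmetric])
       (simp add: algebra_simps)
  also have "\<dots> = integral {a..a+(b-a)} f"
    by (rule integral_periodic_interval) (use assms in auto)
  finally show ?thesis by simp
qed

text \<open>Gauge integrals of continuous functions are taken over the closed square;
  \<open>AE_K_sq\<close> identifies it, up to a null set, with the open square of the
  energy.\<close>

definition Kc :: "(real \<times> real) set" where
  "Kc = cbox (-1/2, -1/2) (1/2, 1/2)"

lemma integral_Kc:
  fixes F :: "real \<times> real \<Rightarrow> 'a::banach"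
  assumes "continuous_on UNIV F"
  shows "integral Kc F = integral {-1/2..1/2} (\<lambda>x. integral {-1/2..1/2} (\<lambda>y. F (x, y)))"
  unfolding Kc_def
  by (subst integral_prod_continuous) (auto intro: continuous_on_subset[OF assms] simp: cbox_interval)

lemma integral_Kc_shift:
  fixes F :: "real \<times> real \<Rightarrow> 'a::banach"
  assumes F: "continuous_on UNIV F"
    and p1: "\<And>x y. F (x + 1, y) = F (x, y)" and p2: "\<And>x y. F (x, y + 1) = F (x, y)"
  shows "integral Kc (\<lambda>x. F (x + y)) = integral Kc F"
proof -
  have cs: "continuous_on UNIV (\<lambda>x. F (x + y))"
    by (rule continuous_on_compose2[OF F]) (auto intro!: continuous_intros)
  have cp: "continuous_on UNIV (\<lambda>t. F (a, t))" for a
    by (rule continuous_on_compose2[OF F]) (auto intro!: continuous_intros)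
  have cI: "continuous_on UNIV (\<lambda>x. integral {-1/2..1/2} (\<lambda>y. F (x, y)))"
    using integral_continuous_on_param[of UNIV "-1/2" "1/2" "\<lambda>x y. F (x, y)"] F
    by (auto simp: cbox_interval continuous_on_subset)
  have "integral Kc (\<lambda>x. F (x + y))
      = integral {-1/2..1/2} (\<lambda>a. integral {-1/2..1/2} (\<lambda>b. F (a + fst y, b + snd y)))"
    by (subst integral_Kc[OF cs]) (simp add: plus_prod_def)
  also have "\<dots> = integral {-1/2..1/2} (\<lambda>a. integral {-1/2..1/2} (\<lambda>b. F (a + fst y, b)))"
    by (subst integral_periodic_shift[OF cp]) (auto simp: p2)
  also have "\<dots> = integral {-1/2..1/2} (\<lambda>a. integral {-1/2..1/2} (\<lambda>b. F (a, b)))"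
    by (subst integral_periodic_shift[OF cI, where c="fst y"]) (auto simp: p1)
  also have "\<dots> = integral Kc F"
    by (rule integral_Kc[OF F, symmetric])
  finally show ?thesis .
qed

lemma content_Kc: "measure lborel Kc = 1"
  by (simp add: Kc_def content_Pair)

lemma integrable_Kc: "continuous_on UNIV (F :: real \<times> real \<Rightarrow> 'a::banach) \<Longrightarrow> F integrable_on Kc"
  unfolding Kc_def by (rule integrable_continuous, rule continuous_on_subset) auto

section \<open>Circles, and means over pairs of points on a circle\<close>

definition circ :: "real \<Rightarrow> real \<Rightarrow> real \<times> real" where
  "circ r t = (r * cos t, r * sin t)"

lemma continuous_circ [continuous_intros]:
  fixes f g :: "'a::t2_space \<Rightarrow> real"
  shows
  "continuous_on S f \<Longrightarrow> continuous_on S g \<Longrightarrow> continuous_on S (\<lambda>x. circ (f x) (g x))"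
  unfolding circ_def
  by (auto intro!: continuous_intros)

lemma circ_periodic [simp]: "circ r (t + 2 * pi) = circ r t" "circ r (2 * pi + t) = circ r t"
  by (simp_all add: circ_def sin_add cos_add)

lemma continuous_integral_param:
  fixes f :: "'a::topological_space \<Rightarrow> real \<Rightarrow> 'c::banach"
  assumes "continuous_on (S \<times> UNIV) (\<lambda>p. f (fst p) (snd p))"
  shows "continuous_on S (\<lambda>x. integral {a..b} (f x))"
  using integral_continuous_on_param[of S a b f] assms
  by (auto simp: case_prod_beta cbox_interval intro: continuous_on_subset)

lemma integral_Kc_swap:
  fixes F :: "real \<times> real \<Rightarrow> real \<Rightarrow> 'a::banach"
  assumes "continuous_on UNIV (\<lambda>p. F (fst p) (snd p))"
  shows "integral Kc (\<lambda>x. integral {a..b} (F x)) = integral {a..b} (\<lambda>t. integral Kc (\<lambda>x. F x t))"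
  unfolding Kc_def
  using integral_swap_continuous[of "(-1/2,-1/2)" a "(1/2,1/2)" b F] assms
  by (auto simp: case_prod_beta cbox_interval intro: continuous_on_subset)

text \<open>
  Two points of the circle of radius \<open>r\<close> at angular distance \<open>a\<close> are \<open>2 r sin (a/2)\<close> apart, so for \<open>\<Phi>\<close> the
  angular mean of the autocorrelation of \<open>f\<close>, \<open>mC \<Phi> r\<close> is the mean square of the first Fourier coefficient of
  \<open>f\<close> along these circles and \<open>mT \<Phi> r\<close> adds the one of the zeroth. The relation \<open>(mT \<Phi>)' = - (2/r) mC \<Phi>\<close> is the
  energy identity of the Euler-Poisson-Darboux equation.
\<close>

definition mT :: "(real \<Rightarrow> real) \<Rightarrow> real \<Rightarrow> real" where
  "mT \<Phi> r = integral {0..2*pi} (\<lambda>a. \<Phi> (2 * r * sin (a/2)) * (1 + cos a))"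

definition mC :: "(real \<Rightarrow> real) \<Rightarrow> real \<Rightarrow> real" where
  "mC \<Phi> r = integral {0..2*pi} (\<lambda>a. \<Phi> (2 * r * sin (a/2)) * cos a)"

lemma continuous_mC:
  assumes "continuous_on UNIV \<Phi>"
  shows "continuous_on UNIV (mC \<Phi>)"
  unfolding mC_def
  by (rule continuous_integral_param)
     (auto intro!: continuous_intros continuous_on_compose2[OF assms])

text \<open>Differentiation under the integral produces \<open>g'\<close> with the weight
  \<open>2 * sin (a/2) * (1 + cos a) = 2 * cos (a/2) * sin a\<close>. Up to the factor
  \<open>2 / r\<close> this is one term in the derivative of
  \<open>g (2 * r * sin (a/2)) * sin a\<close>, which vanishes at both ends; integration by parts
  leaves the cosine moment.\<close>

lemma mT_deriv:
  assumes g: "\<And>x. (g has_real_derivative g' x) (at x)" and g': "continuous_on UNIV g'" and r: "r > 0"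
  shows "(mT g has_real_derivative - (2 / r) * mC g r) (at r)"
proof -
  have cg: "continuous_on UNIV g"
    using g by (meson DERIV_continuous_on has_field_derivative_at_within)
  have "((\<lambda>r. integral (cbox 0 (2*pi)) (\<lambda>a. g (2 * r * sin (a/2)) * (1 + cos a))) has_real_derivative
      integral (cbox 0 (2*pi)) (\<lambda>a. g' (2 * r * sin (a/2)) * (2 * sin (a/2)) * (1 + cos a))) (at r within UNIV)"
  proof (rule leibniz_rule_field_derivative)
    fix x t :: real
    show "((\<lambda>x. g (2 * x * sin (t / 2)) * (1 + cos t)) has_real_derivative
            g' (2 * x * sin (t / 2)) * (2 * sin (t / 2)) * (1 + cos t)) (at x within UNIV)"
      by (auto intro!: derivative_eq_intros DERIV_chain2[OF g])
  next
    fix x :: real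
    show "(\<lambda>a. g (2 * x * sin (a / 2)) * (1 + cos a)) integrable_on cbox 0 (2 * pi)"
      by (intro integrable_continuous) (auto intro!: continuous_intros continuous_on_compose2[OF cg])
  next
    show "continuous_on (UNIV \<times> cbox 0 (2 * pi))
       (\<lambda>(x, a). g' (2 * x * sin (a / 2)) * (2 * sin (a / 2)) * (1 + cos a))"
      by (auto simp: case_prod_beta intro!: continuous_intros continuous_on_compose2[OF g'])
  qed auto
  moreover have "integral (cbox 0 (2*pi)) (\<lambda>a. g' (2 * r * sin (a/2)) * (2 * sin (a/2)) * (1 + cos a))
      = - (2 / r) * mC g r"
  proof -
    have "((\<lambda>a. g' (2 * r * sin (a/2)) * (r * cos (a/2)) * sin a + g (2 * r * sin (a/2)) * cos a)
       has_integral (g (2 * r * sin (2*pi/2)) * sin (2*pi) - g (2 * r * sin (0/2)) * sin 0)) {0..2*pi}"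
      by (rule fundamental_theorem_of_calculus)
         (auto simp flip: has_real_derivative_iff_has_vector_derivative
           intro!: derivative_eq_intros DERIV_chain2[OF g])
    hence "integral {0..2*pi} (\<lambda>a. g' (2 * r * sin (a/2)) * (r * cos (a/2)) * sin a + g (2 * r * sin (a/2)) * cos a) = 0"
      by (simp add: integral_unique)
    moreover have "integral {0..2*pi} (\<lambda>a. g' (2 * r * sin (a/2)) * (r * cos (a/2)) * sin a + g (2 * r * sin (a/2)) * cos a)
      = integral {0..2*pi} (\<lambda>a. g' (2 * r * sin (a/2)) * (r * cos (a/2)) * sin a) + mC g r"
      unfolding mC_def
      by (rule Henstock_Kurzweil_Integration.integral_add)
         (auto intro!: integrable_continuous_interval continuous_intros continuous_on_compose2[OF g'] continuous_on_compose2[OF cg])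
    moreover have "g' (2 * r * sin (a/2)) * (2 * sin (a/2)) * (1 + cos a)
      = (2 / r) * (g' (2 * r * sin (a/2)) * (r * cos (a/2)) * sin a)" for a
    proof -
      have "sin a = 2 * sin (a/2) * cos (a/2)" "1 + cos a = 2 * (cos (a/2))\<^sup>2"
        using sin_double[of "a/2"] cos_double_cos[of "a/2"] by auto
      thus ?thesis using r by (simp add: power2_eq_square)
    qed
    ultimately show ?thesis
      by (simp only: cbox_interval integral_mult_right) (simp add: add_eq_0_iff cbox_interval)
  qed
  ultimately show ?thesis by (simp add: mT_def[abs_def] cbox_interval)
qed

lemma mean_energy_C1:
  assumes g: "\<And>x. (g has_real_derivative g' x) (at x)" and g': "continuous_on UNIV g'"
    and r: "0 < r0" "r0 \<le> r1"
  shows "integral {r0..r1} (\<lambda>r. 2 / r * mC g r) = mT g r0 - mT g r1"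
proof -
  have "((\<lambda>r. - (2 / r) * mC g r) has_integral (mT g r1 - mT g r0)) {r0..r1}"
    by (rule fundamental_theorem_of_calculus)
       (use r mT_deriv[OF g g'] in \<open>auto simp flip: has_real_derivative_iff_has_vector_derivative
          intro: has_field_derivative_at_within\<close>)
  from has_integral_neg[OF this] show ?thesis
    by (simp add: integral_unique)
qed

text \<open>An autocorrelation is merely continuous. Both sides are bounded functionals of
  \<open>\<Phi>\<close> in the uniform norm on \<open>{-2*r1..2*r1}\<close>, where polynomials are
  dense, so the identity extends from the C1 case.\<close>

lemma mean_energy:
  assumes c: "continuous_on UNIV \<Phi>" and r: "0 < r0" "r0 \<le> r1"
  shows "integral {r0..r1} (\<lambda>r. 2 / r * mC \<Phi> r) = mT \<Phi> r0 - mT \<Phi> r1"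
proof -
  \<comment> \<open>\<open>8 * pi\<close> collects the errors of the two values of
    \<open>mT\<close>, whose weight is at most 2; the other summand is the error of the integral
    over \<open>{r0..r1}\<close>, where \<open>2 / r \<le> 2 / r0\<close>.\<close>
  define A where "A = 8 * pi + 4 * pi / r0 * (r1 - r0)"
  have bound: "\<bar>integral {r0..r1} (\<lambda>r. 2 / r * mC \<Phi> r) - (mT \<Phi> r0 - mT \<Phi> r1)\<bar> \<le> A * e" if e: "e > 0" for e
  proof -
    have "compact {-2*r1..2*r1}" by simp
    from Stone_Weierstrass_real_polynomial_function[OF this continuous_on_subset[OF c] e]
    obtain g where g: "real_polynomial_function g" and ge: "\<And>x. x \<in> {-2*r1..2*r1} \<Longrightarrow> \<bar>\<Phi> x - g x\<bar> < e"
      by auto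
    from has_real_derivative_polynomial_function[OF g] obtain g' where
      g'1: "real_polynomial_function g'" and g'2: "\<And>x. (g has_real_derivative g' x) (at x)" by auto
    have cg': "continuous_on UNIV g'"
      using g'1 by (simp add: continuous_on_polymonial_function real_polynomial_function_eq)
    have cg: "continuous_on UNIV g"
      using g by (simp add: continuous_on_polymonial_function real_polynomial_function_eq)
    have in1: "2 * r * sin (a/2) \<in> {-2*r1..2*r1}" if "0 \<le> r" "r \<le> r1" for r a
    proof -
      have "\<bar>2 * r * sin (a/2)\<bar> \<le> 2 * r1 * 1"
        unfolding abs_mult using that by (intro mult_mono) auto
      thus ?thesis by auto
    qed
    have T: "\<bar>mT \<Phi> r - mT g r\<bar> \<le> 4 * pi * e" if r': "0 \<le> r" "r \<le> r1" for r
    proof -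
      have "mT \<Phi> r - mT g r = integral {0..2*pi} (\<lambda>a. (\<Phi> (2 * r * sin (a/2)) - g (2 * r * sin (a/2))) * (1 + cos a))"
        unfolding mT_def left_diff_distrib
        by (rule Henstock_Kurzweil_Integration.integral_diff[symmetric])
           (auto intro!: integrable_continuous_interval continuous_intros continuous_on_compose2[OF c] continuous_on_compose2[OF cg])
      also have "norm \<dots> \<le> (e * 2) * (2 * pi - 0)"
      proof (rule integral_bound)
        show "continuous_on {0..2*pi} (\<lambda>a. (\<Phi> (2 * r * sin (a/2)) - g (2 * r * sin (a/2))) * (1 + cos a))"
          by (auto intro!: continuous_intros continuous_on_compose2[OF c] continuous_on_compose2[OF cg])
        show "norm ((\<Phi> (2 * r * sin (a/2)) - g (2 * r * sin (a/2))) * (1 + cos a)) \<le> e * 2" if "a \<in> {0..2*pi}" for a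
        proof -
          have "\<bar>1 + cos a\<bar> \<le> 2" using cos_le_one[of a] cos_ge_minus_one[of a] by linarith
          thus "norm ((\<Phi> (2 * r * sin (a/2)) - g (2 * r * sin (a/2))) * (1 + cos a)) \<le> e * 2"
            unfolding norm_mult real_norm_def abs_mult using ge[OF in1[OF r', of a]] e
            by (intro mult_mono) auto
        qed
      qed auto
      finally show ?thesis by (simp add: mult_ac)
    qed
    have C: "\<bar>mC \<Phi> r - mC g r\<bar> \<le> 2 * pi * e" if r': "0 \<le> r" "r \<le> r1" for r
    proof -
      have "mC \<Phi> r - mC g r = integral {0..2*pi} (\<lambda>a. (\<Phi> (2 * r * sin (a/2)) - g (2 * r * sin (a/2))) * cos a)"
        unfolding mC_def left_diff_distrib
        by (rule Henstock_Kurzweil_Integration.integral_diff[symmetric])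
           (auto intro!: integrable_continuous_interval continuous_intros continuous_on_compose2[OF c] continuous_on_compose2[OF cg])
      also have "norm \<dots> \<le> (e * 1) * (2 * pi - 0)"
      proof (rule integral_bound)
        show "continuous_on {0..2*pi} (\<lambda>a. (\<Phi> (2 * r * sin (a/2)) - g (2 * r * sin (a/2))) * cos a)"
          by (auto intro!: continuous_intros continuous_on_compose2[OF c] continuous_on_compose2[OF cg])
        show "norm ((\<Phi> (2 * r * sin (a/2)) - g (2 * r * sin (a/2))) * cos a) \<le> e * 1" if "a \<in> {0..2*pi}" for a
        proof -
          show "norm ((\<Phi> (2 * r * sin (a/2)) - g (2 * r * sin (a/2))) * cos a) \<le> e * 1"
            unfolding norm_mult real_norm_def abs_mult using ge[OF in1[OF r', of a]] e
            by (intro mult_mono) auto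
        qed
      qed auto
      finally show ?thesis by (simp add: mult_ac)
    qed
    have "integral {r0..r1} (\<lambda>r. 2 / r * mC \<Phi> r) - integral {r0..r1} (\<lambda>r. 2 / r * mC g r)
        = integral {r0..r1} (\<lambda>r. 2 / r * (mC \<Phi> r - mC g r))"
      unfolding right_diff_distrib
      by (rule Henstock_Kurzweil_Integration.integral_diff[symmetric])
         (use r in \<open>auto intro!: integrable_continuous_interval continuous_intros
            continuous_on_subset[OF continuous_mC[OF c]] continuous_on_subset[OF continuous_mC[OF cg]]\<close>)
    also have "norm \<dots> \<le> (2 / r0 * (2 * pi * e)) * (r1 - r0)"
    proof (rule integral_bound)
      show "continuous_on {r0..r1} (\<lambda>r. 2 / r * (mC \<Phi> r - mC g r))"
        using r by (auto intro!: continuous_intros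
            continuous_on_subset[OF continuous_mC[OF c]] continuous_on_subset[OF continuous_mC[OF cg]])
      show "norm (2 / r * (mC \<Phi> r - mC g r)) \<le> 2 / r0 * (2 * pi * e)" if "r \<in> {r0..r1}" for r
      proof -
        have "\<bar>mC \<Phi> r - mC g r\<bar> \<le> 2 * pi * e" using that r by (intro C) auto
        moreover have "2 / r \<le> 2 / r0" using that r by (intro divide_left_mono) auto
        ultimately show ?thesis unfolding real_norm_def abs_mult
          using that r by (intro mult_mono) auto
      qed
    qed (use r in auto)
    finally have "\<bar>integral {r0..r1} (\<lambda>r. 2 / r * mC \<Phi> r) - integral {r0..r1} (\<lambda>r. 2 / r * mC g r)\<bar>
       \<le> 4 * pi / r0 * (r1 - r0) * e"
      by (simp add: mult_ac)
    moreover have "integral {r0..r1} (\<lambda>r. 2 / r * mC g r) = mT g r0 - mT g r1"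
      by (rule mean_energy_C1[OF g'2 cg' r])
    ultimately show ?thesis
      using T[of r0] T[of r1] r unfolding A_def distrib_right by linarith
  qed
  have A: "A > 0" unfolding A_def using r by (intro add_pos_nonneg mult_nonneg_nonneg divide_nonneg_nonneg) auto
  have "\<bar>integral {r0..r1} (\<lambda>r. 2 / r * mC \<Phi> r) - (mT \<Phi> r0 - mT \<Phi> r1)\<bar> \<le> 0"
  proof (rule field_le_epsilon)
    fix e :: real assume "e > 0"
    thus "\<bar>integral {r0..r1} (\<lambda>r. 2 / r * mC \<Phi> r) - (mT \<Phi> r0 - mT \<Phi> r1)\<bar> \<le> 0 + e"
      using bound[of "e / A"] A by simp
  qed
  thus ?thesis by simp
qed

section \<open>Fourier coefficients along circles and autocorrelation on the torus\<close>

definition circ_coeff :: "real \<Rightarrow> (real \<times> real \<Rightarrow> complex) \<Rightarrow> real \<Rightarrow> real \<times> real \<Rightarrow> complex" where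
  "circ_coeff k f r x = integral {0..2*pi} (\<lambda>t. f (x + circ r t) * cis (- k * t))"

definition acorr :: "(real \<times> real \<Rightarrow> complex) \<Rightarrow> real \<times> real \<Rightarrow> complex" where
  "acorr f y = integral Kc (\<lambda>x. f (x + y) * cnj (f x))"

definition acorr_circ :: "(real \<times> real \<Rightarrow> complex) \<Rightarrow> real \<Rightarrow> complex" where
  "acorr_circ f \<rho> = integral {0..2*pi} (\<lambda>t. acorr f (circ \<rho> t))"

lemma continuous_on_cis' [continuous_intros]:
  fixes f :: "'a::t2_space \<Rightarrow> real"
  shows "continuous_on S f \<Longrightarrow> continuous_on S (\<lambda>x. cis (f x))"
  unfolding cis_conv_exp by (intro continuous_intros)

lemma cis_of_nat_periodic: "cis (- real k * (t + 2 * pi)) = cis (- real k * t)"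
proof -
  have "cis (- real k * (t + 2 * pi)) = cis (- real k * t) * cnj (cis (2 * pi * real k))"
    by (simp add: cis_mult algebra_simps cis_cnj)
  also have "cis (2 * pi * real k) = 1"
    using cis_multiple_2pi[of "real k"] by simp
  finally show ?thesis by simp
qed

text \<open>The chord in polar form: its length is independent of the base angle \<open>s\<close>
  and its direction turns with \<open>s\<close>. Averaging a function of the chord over
  \<open>s\<close> therefore gives a mean over a circle whose radius is the chord length.\<close>

lemma circ_diff: "circ r (s + a) - circ r s = circ (2 * r * sin (a/2)) (s + (a/2 + pi/2))"
proof -
  have 1: "cos (s + a) - cos s = - 2 * sin (s + a/2) * sin (a/2)"
    using cos_diff_cos[of "s+a" s] sin_minus[of "a/2"] by (simp add: algebra_simps add_divide_distrib)
  have 2: "sin (s + a) - sin s = 2 * sin (a/2) * cos (s + a/2)"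
    using sin_diff_sin[of "s+a" s] by (simp add: algebra_simps add_divide_distrib)
  have "r * cos (s + a) - r * cos s = r * (cos (s + a) - cos s)"
       "r * sin (s + a) - r * sin s = r * (sin (s + a) - sin s)" by (simp_all add: right_diff_distrib)
  moreover have "cos (s + (a/2 + pi/2)) = - sin (s + a/2)" "sin (s + (a/2 + pi/2)) = cos (s + a/2)"
    by (simp_all add: cos_add[of _ "pi/2"] sin_add[of _ "pi/2"] flip: add.assoc)
  ultimately show ?thesis unfolding circ_def 1 2 by (simp add: 1 2)
qed

context
  fixes f :: "real \<times> real \<Rightarrow> complex"
  assumes f: "continuous_on UNIV f"
    and p1: "\<And>x y. f (x + 1, y) = f (x, y)" and p2: "\<And>x y. f (x, y + 1) = f (x, y)"
begin

lemmas cf = continuous_on_compose2[OF f, OF _ subset_UNIV]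

lemma continuous_acorr: "continuous_on UNIV (acorr f)"
proof -
  have "continuous_on (UNIV \<times> cbox (-1/2,-1/2) (1/2,1/2)) (\<lambda>(y, x). f (x + y) * cnj (f x))"
    unfolding case_prod_beta by (intro continuous_intros cf)
  from integral_continuous_on_param[OF this] show ?thesis
    unfolding acorr_def[abs_def] Kc_def .
qed

lemma continuous_acorr_circ: "continuous_on UNIV (acorr_circ f)"
  unfolding acorr_circ_def[abs_def]
  by (rule continuous_integral_param) (intro continuous_intros continuous_on_compose2[OF continuous_acorr] subset_UNIV)

lemma acorr_shift: "integral Kc (\<lambda>x. f (x + a) * cnj (f (x + b))) = acorr f (a - b)"
proof -
  have s: "(x::real) + 1 + y = (x + y) + 1" for x y by simp
  have sh: "f ((x, y) + d + (1, 0)) = f ((x, y) + d)" "f ((x, y) + d + (0, 1)) = f ((x, y) + d)" for x y d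
    using p1[of "x + fst d" "y + snd d"] p2[of "x + fst d" "y + snd d"] by (cases d; simp)+
  have "integral Kc (\<lambda>x. (\<lambda>z. f (z + (a - b)) * cnj (f z)) (x + b)) = integral Kc (\<lambda>z. f (z + (a - b)) * cnj (f z))"
  proof (rule integral_Kc_shift)
    show "continuous_on UNIV (\<lambda>z. f (z + (a - b)) * cnj (f z))"
      by (intro continuous_intros cf)
    show "f ((x + 1, y) + (a - b)) * cnj (f (x + 1, y)) = f ((x, y) + (a - b)) * cnj (f (x, y))" for x y
      using sh(1)[of x y "a - b"] p1[of x y] by (simp add: plus_prod_def s)
    show "f ((x, y + 1) + (a - b)) * cnj (f (x, y + 1)) = f ((x, y) + (a - b)) * cnj (f (x, y))" for x y
      using sh(2)[of x y "a - b"] p2[of x y] by (simp add: plus_prod_def s)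
  qed
  thus ?thesis by (simp add: acorr_def add.assoc)
qed

lemma continuous_circ_coeff: "continuous_on UNIV (circ_coeff k f r)"
  unfolding circ_coeff_def[abs_def]
  by (rule continuous_integral_param) (intro continuous_intros cf)

lemma circ_coeff_norm_double:
  "complex_of_real ((cmod (circ_coeff k f r x))\<^sup>2) =
    integral {0..2*pi} (\<lambda>s. integral {0..2*pi} (\<lambda>t. f (x + circ r t) * cnj (f (x + circ r s)) * cis (k * s - k * t)))"
proof -
  let ?g = "\<lambda>t. f (x + circ r t) * cis (- k * t)"
  have ig: "?g integrable_on {0..2*pi}"
    by (intro integrable_continuous_interval continuous_intros cf)
  have "complex_of_real ((cmod (circ_coeff k f r x))\<^sup>2) = integral {0..2*pi} ?g * cnj (integral {0..2*pi} ?g)"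
    by (simp only: circ_coeff_def complex_norm_square)
  also have "cnj (integral {0..2*pi} ?g) = integral {0..2*pi} (\<lambda>s. cnj (?g s))"
    using integral_linear[OF ig bounded_linear_cnj] by (simp add: o_def)
  also have "integral {0..2*pi} ?g * \<dots> = integral {0..2*pi} (\<lambda>s. integral {0..2*pi} ?g * cnj (?g s))"
    by (rule integral_mult_right[symmetric])
  also have "\<dots> = integral {0..2*pi} (\<lambda>s. integral {0..2*pi} (\<lambda>t. ?g t * cnj (?g s)))"
    by (simp only: integral_mult_left)
  also have "(\<lambda>s. integral {0..2*pi} (\<lambda>t. ?g t * cnj (?g s))) =
      (\<lambda>s. integral {0..2*pi} (\<lambda>t. f (x + circ r t) * cnj (f (x + circ r s)) * cis (k * s - k * t)))"
    by (intro ext integral_cong) (simp add: cis_cnj mult_ac cis_mult)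
  finally show ?thesis .
qed

text \<open>The squared coefficient is a double integral over angles \<open>s\<close> and
  \<open>t\<close>. Integration in \<open>x\<close> first gives the autocorrelation at the chord;
  with \<open>t = s + a\<close> the exponential depends on \<open>a\<close> alone, and the integral
  over \<open>s\<close> runs over all directions of the chord.\<close>

lemma circ_coeff_L2_complex:
  "complex_of_real (integral Kc (\<lambda>x. (cmod (circ_coeff (real k) f r x))\<^sup>2))
     = integral {0..2*pi} (\<lambda>a. acorr_circ f (2 * r * sin (a/2)) * cis (- real k * a))"
proof -
  let ?k = "real k"
  have "complex_of_real (integral Kc (\<lambda>x. (cmod (circ_coeff ?k f r x))\<^sup>2))
     = integral Kc (\<lambda>x. complex_of_real ((cmod (circ_coeff ?k f r x))\<^sup>2))"
  proof -
    have "(\<lambda>x. (cmod (circ_coeff ?k f r x))\<^sup>2) integrable_on Kc"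
      by (rule integrable_Kc) (intro continuous_intros continuous_circ_coeff)
    from integral_linear[OF this bounded_linear_of_real, symmetric] show ?thesis by (simp only: o_def)
  qed
  also have "\<dots> = integral Kc (\<lambda>x. integral {0..2*pi} (\<lambda>s. integral {0..2*pi} (\<lambda>t. f (x + circ r t) * cnj (f (x + circ r s)) * cis (?k * s - ?k * t))))"
    by (simp only: circ_coeff_norm_double)
  also have "\<dots> = integral {0..2*pi} (\<lambda>s. integral Kc (\<lambda>x. integral {0..2*pi} (\<lambda>t. f (x + circ r t) * cnj (f (x + circ r s)) * cis (?k * s - ?k * t))))"
    by (rule integral_Kc_swap, rule continuous_integral_param) (intro continuous_intros cf)
  also have "\<dots> = integral {0..2*pi} (\<lambda>s. integral {0..2*pi} (\<lambda>t. integral Kc (\<lambda>x. f (x + circ r t) * cnj (f (x + circ r s)) * cis (?k * s - ?k * t))))"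
    by (intro integral_cong integral_Kc_swap continuous_intros cf)
  also have "\<dots> = integral {0..2*pi} (\<lambda>s. integral {0..2*pi} (\<lambda>t. acorr f (circ r t - circ r s) * cis (?k * s - ?k * t)))"
    by (simp only: integral_mult_left acorr_shift)
  also have "\<dots> = integral {0..2*pi} (\<lambda>s. integral {0..2*pi} (\<lambda>a. acorr f (circ r (s + a) - circ r s) * cis (- ?k * a)))"
  proof (rule integral_cong)
    fix s
    have "integral {0..2*pi} (\<lambda>a. (\<lambda>t. acorr f (circ r t - circ r s) * cis (?k * s - ?k * t)) (a + s))
       = integral {0..2*pi} (\<lambda>t. acorr f (circ r t - circ r s) * cis (?k * s - ?k * t))"
    proof (rule integral_periodic_shift)
      show "continuous_on UNIV (\<lambda>t. acorr f (circ r t - circ r s) * cis (?k * s - ?k * t))"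
        by (intro continuous_intros continuous_on_compose2[OF continuous_acorr] subset_UNIV)
      fix t
      have "cis (?k * s - ?k * (t + 2*pi)) = cis (?k * s) * cis (- ?k * (t + 2*pi))"
        by (simp add: cis_mult algebra_simps)
      also have "\<dots> = cis (?k * s) * cis (- ?k * t)" by (simp only: cis_of_nat_periodic)
      also have "\<dots> = cis (?k * s - ?k * t)" by (simp add: cis_mult)
      finally show "acorr f (circ r (t + (2*pi - 0)) - circ r s) * cis (?k * s - ?k * (t + (2*pi - 0)))
         = acorr f (circ r t - circ r s) * cis (?k * s - ?k * t)" by simp
    qed simp
    thus "integral {0..2*pi} (\<lambda>t. acorr f (circ r t - circ r s) * cis (?k * s - ?k * t))
       = integral {0..2*pi} (\<lambda>a. acorr f (circ r (s + a) - circ r s) * cis (- ?k * a))"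
      by (simp add: algebra_simps)
  qed
  also have "\<dots> = integral {0..2*pi} (\<lambda>s. integral {0..2*pi} (\<lambda>a. acorr f (circ (2 * r * sin (a/2)) (s + (a/2 + pi/2))) * cis (- ?k * a)))"
    by (simp only: circ_diff)
  also have "\<dots> = integral {0..2*pi} (\<lambda>a. integral {0..2*pi} (\<lambda>s. acorr f (circ (2 * r * sin (a/2)) (s + (a/2 + pi/2))) * cis (- ?k * a)))"
  proof -
    have "continuous_on (cbox (0,0) (2*pi,2*pi)) (\<lambda>(s, a). acorr f (circ (2 * r * sin (a/2)) (s + (a/2 + pi/2))) * cis (- ?k * a))"
      unfolding case_prod_beta
      by (intro continuous_intros continuous_on_compose2[OF continuous_acorr] subset_UNIV) auto
    from integral_swap_continuous[OF this] show ?thesis by (simp only: cbox_interval)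
  qed
  also have "\<dots> = integral {0..2*pi} (\<lambda>a. acorr_circ f (2 * r * sin (a/2)) * cis (- ?k * a))"
  proof (rule integral_cong)
    fix a
    have "integral {0..2*pi} (\<lambda>s. (\<lambda>s. acorr f (circ (2 * r * sin (a/2)) s)) (s + (a/2 + pi/2)))
       = acorr_circ f (2 * r * sin (a/2))" unfolding acorr_circ_def
      by (rule integral_periodic_shift) (auto intro!: continuous_intros continuous_on_compose2[OF continuous_acorr] subset_UNIV)
    thus "integral {0..2*pi} (\<lambda>s. acorr f (circ (2 * r * sin (a/2)) (s + (a/2 + pi/2))) * cis (- ?k * a))
      = acorr_circ f (2 * r * sin (a/2)) * cis (- ?k * a)"
      by (simp only: integral_mult_left)
  qed
  finally show ?thesis .
qed

text \<open>The reflection of \<open>a\<close> at \<open>pi\<close> fixes \<open>sin (a/2)\<close>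
  and reverses \<open>sin a\<close>. This removes the imaginary part of the autocorrelation.\<close>

lemma integral_sin_symmetric:
  fixes g :: "real \<Rightarrow> real"
  assumes g: "continuous_on UNIV g"
  shows "integral {0..2*pi} (\<lambda>a. g (sin (a/2)) * sin a) = 0"
proof -
  let ?h = "\<lambda>a. g (sin (a/2)) * sin a"
  have "integral {0..2*pi} (\<lambda>a. ?h a) = integral {-(2*pi)..-0} (\<lambda>a. ?h (- a))"
    by (rule Henstock_Kurzweil_Integration.integral_reflect_real[where f = ?h, symmetric])
  also have "\<dots> = integral {-(2*pi)..-0} (\<lambda>a. - ?h (a + 2*pi))"
    by (intro integral_cong) (simp add: add_divide_distrib sin_add)
  also have "\<dots> = - integral {-(2*pi)..-0} (\<lambda>a. ?h (a + 2*pi))"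
    by (rule Henstock_Kurzweil_Integration.integral_neg)
  also have "integral {-(2*pi)..-0} (\<lambda>a. ?h (a + 2*pi)) = integral {0..2*pi} ?h"
    using integral_shift_real_ivl[of 0 "2*pi" "2*pi" ?h] by simp
  finally show ?thesis by simp
qed

lemma circ_coeff_L2:
  "integral Kc (\<lambda>x. (cmod (circ_coeff (real k) f r x))\<^sup>2)
     = integral {0..2*pi} (\<lambda>a. Re (acorr_circ f (2 * r * sin (a/2))) * cos (real k * a))
     + integral {0..2*pi} (\<lambda>a. Im (acorr_circ f (2 * r * sin (a/2))) * sin (real k * a))"
proof -
  note ca = continuous_on_compose2[OF continuous_acorr_circ, OF _ subset_UNIV]
  let ?F = "\<lambda>a. acorr_circ f (2 * r * sin (a/2)) * cis (- real k * a)"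
  have iF: "?F integrable_on {0..2*pi}"
    by (intro integrable_continuous_interval continuous_intros ca) auto
  have "integral Kc (\<lambda>x. (cmod (circ_coeff (real k) f r x))\<^sup>2) = Re (integral {0..2*pi} ?F)"
    by (simp only: circ_coeff_L2_complex[symmetric] Re_complex_of_real)
  also have "\<dots> = integral {0..2*pi} (\<lambda>a. Re (?F a))"
    using integral_linear[OF iF bounded_linear_Re] by (simp add: o_def)
  also have "\<dots> = integral {0..2*pi} (\<lambda>a. Re (acorr_circ f (2 * r * sin (a/2))) * cos (real k * a)
      + Im (acorr_circ f (2 * r * sin (a/2))) * sin (real k * a))"
    by (intro integral_cong) simp
  also have "\<dots> = integral {0..2*pi} (\<lambda>a. Re (acorr_circ f (2 * r * sin (a/2))) * cos (real k * a))
     + integral {0..2*pi} (\<lambda>a. Im (acorr_circ f (2 * r * sin (a/2))) * sin (real k * a))"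
    by (rule Henstock_Kurzweil_Integration.integral_add) (intro integrable_continuous_interval continuous_intros ca; simp)+
  finally show ?thesis .
qed

lemma circle_bessel:
  fixes F :: "real \<Rightarrow> complex"
  assumes F: "continuous_on UNIV F"
  shows "(cmod (integral {0..2*pi} F))\<^sup>2 + (cmod (integral {0..2*pi} (\<lambda>t. F t * cis (- t))))\<^sup>2
     \<le> 2 * pi * integral {0..2*pi} (\<lambda>t. (cmod (F t))\<^sup>2)"
proof -
  note cF = continuous_on_compose2[OF F, OF _ subset_UNIV]
  define M where "M = integral {0..2*pi} F"
  define C where "C = integral {0..2*pi} (\<lambda>t. F t * cis (- t))"
  define S where "S = integral {0..2*pi} (\<lambda>t. (cmod (F t))\<^sup>2)"
  have h1: "((\<lambda>t. (cmod (F t))\<^sup>2) has_integral S) {0..2*pi}"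
    unfolding S_def by (intro integrable_integral integrable_continuous_interval continuous_intros cF)
  have "(F has_integral M) {0..2*pi}"
    unfolding M_def by (intro integrable_integral integrable_continuous_interval continuous_intros cF)
  from has_integral_linear[OF has_integral_mult_left[OF this, of "cnj M"] bounded_linear_Re]
  have h2: "((\<lambda>t. Re (F t * cnj M)) has_integral (cmod M)\<^sup>2) {0..2*pi}"
    by (simp only: o_def complex_norm_square[symmetric] Re_complex_of_real)
  have "((\<lambda>t. F t * cis (- t)) has_integral C) {0..2*pi}"
    unfolding C_def by (intro integrable_integral integrable_continuous_interval continuous_intros cF)
  from has_integral_linear[OF has_integral_mult_left[OF this, of "cnj C"] bounded_linear_Re]
  have h3: "((\<lambda>t. Re (F t * cis (- t) * cnj C)) has_integral (cmod C)\<^sup>2) {0..2*pi}"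
    by (simp only: o_def complex_norm_square[symmetric] Re_complex_of_real)
  have "((\<lambda>t. cis (- t)) has_integral (\<i> * cis (- (2*pi)) - \<i> * cis (- 0))) {0..2*pi}"
  proof (rule fundamental_theorem_of_calculus)
    show "((\<lambda>t. \<i> * cis (- t)) has_vector_derivative cis (- t)) (at t within {0..2*pi})" for t
      unfolding cis_conv_exp
      by (auto intro!: derivative_eq_intros has_vector_derivative_real_field simp: field_simps)
  qed auto
  from has_integral_linear[OF has_integral_mult_right[OF this, of "M * cnj C"] bounded_linear_Re]
  have h4: "((\<lambda>t. Re (M * cnj C * cis (- t))) has_integral 0) {0..2*pi}"
    by (simp add: o_def flip: cis_cnj)
  have h5: "((\<lambda>t. ((cmod M)\<^sup>2 + (cmod C)\<^sup>2) / (2*pi)) has_integral ((cmod M)\<^sup>2 + (cmod C)\<^sup>2)) {0..2*pi}"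
    using has_integral_const_real[of "((cmod M)\<^sup>2 + (cmod C)\<^sup>2) / (2*pi)" 0 "2*pi"] by simp
  have H: "((\<lambda>t. 2 * pi * (cmod (F t))\<^sup>2 - 2 * Re (F t * cnj M) - 2 * Re (F t * cis (- t) * cnj C)
       + (1/pi) * Re (M * cnj C * cis (- t)) + ((cmod M)\<^sup>2 + (cmod C)\<^sup>2) / (2*pi))
     has_integral (2 * pi * S - 2 * (cmod M)\<^sup>2 - 2 * (cmod C)\<^sup>2 + (1/pi) * 0 + ((cmod M)\<^sup>2 + (cmod C)\<^sup>2))) {0..2*pi}"
    by (intro has_integral_add has_integral_diff has_integral_mult_right h1 h2 h3 h4 h5)
  have "0 \<le> 2 * pi * S - 2 * (cmod M)\<^sup>2 - 2 * (cmod C)\<^sup>2 + (1/pi) * 0 + ((cmod M)\<^sup>2 + (cmod C)\<^sup>2)"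
  proof (rule has_integral_nonneg[OF H])
    fix t
    define e where "e = cis (- t)"
    \<comment> \<open>Up to scale, what is left of \<open>F\<close> after its modes 0 and 1 are
      removed; Bessel's inequality says that its squared modulus has a nonnegative mean.\<close>
    let ?Z = "of_real (2*pi) * F t - M - C * cnj e"
    have exp: "(cmod (a - b - c))\<^sup>2 = (cmod a)\<^sup>2 + (cmod b)\<^sup>2 + (cmod c)\<^sup>2
       - 2 * Re (a * cnj b) - 2 * Re (a * cnj c) + 2 * Re (b * cnj c)" for a b c
      by (simp only: cmod_power2) (simp add: algebra_simps power2_eq_square)
    have "(cmod ?Z)\<^sup>2 = (2*pi)\<^sup>2 * (cmod (F t))\<^sup>2 + (cmod M)\<^sup>2 + (cmod C)\<^sup>2
       - 2 * (2*pi * Re (F t * cnj M)) - 2 * (2*pi * Re (F t * e * cnj C)) + 2 * Re (M * cnj C * e)"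
    proof -
      have "(cmod (of_real (2*pi) * F t))\<^sup>2 = (2*pi)\<^sup>2 * (cmod (F t))\<^sup>2"
        by (simp add: norm_mult power_mult_distrib)
      moreover have "(cmod (C * cnj e))\<^sup>2 = (cmod C)\<^sup>2"
        by (simp add: norm_mult e_def cis_cnj)
      moreover have "Re (of_real (2*pi) * F t * cnj M) = 2*pi * Re (F t * cnj M)"
        by (simp add: algebra_simps)
      moreover have "Re (of_real (2*pi) * F t * cnj (C * cnj e)) = 2*pi * Re (F t * e * cnj C)"
        by (simp add: algebra_simps)
      moreover have "M * cnj (C * cnj e) = M * cnj C * e" by simp
      ultimately show ?thesis by (simp only: exp)
    qed
    moreover have "(2*pi)\<^sup>2 * A + MM + CC - 2 * (2*pi * B) - 2 * (2*pi * D) + 2 * E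
      = 2 * pi * (2 * pi * A - 2 * B - 2 * D + (1/pi) * E + (MM + CC) / (2*pi))" for A B D E MM CC :: real
      by (simp add: field_simps power2_eq_square)
    ultimately have "(cmod ?Z)\<^sup>2 = 2 * pi * (2 * pi * (cmod (F t))\<^sup>2 - 2 * Re (F t * cnj M) - 2 * Re (F t * e * cnj C)
       + (1/pi) * Re (M * cnj C * e) + ((cmod M)\<^sup>2 + (cmod C)\<^sup>2) / (2*pi))"
      by (simp only:)
    hence "0 \<le> 2 * pi * (2 * pi * (cmod (F t))\<^sup>2 - 2 * Re (F t * cnj M) - 2 * Re (F t * e * cnj C)
       + (1/pi) * Re (M * cnj C * e) + ((cmod M)\<^sup>2 + (cmod C)\<^sup>2) / (2*pi))"
      by (metis zero_le_power2)
    thus "0 \<le> 2 * pi * (cmod (F t))\<^sup>2 - 2 * Re (F t * cnj M) - 2 * Re (F t * cis (- t) * cnj C)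
       + (1/pi) * Re (M * cnj C * cis (- t)) + ((cmod M)\<^sup>2 + (cmod C)\<^sup>2) / (2*pi)"
      unfolding e_def using pi_gt_zero by (metis zero_le_mult_iff mult_pos_pos not_le zero_less_numeral)
  qed
  thus ?thesis unfolding M_def C_def S_def by simp
qed

text \<open>By \<open>mean_energy\<close> the integral telescopes to \<open>mT\<close> at
  \<open>r0\<close> minus \<open>mT\<close> at \<open>r1\<close>. The latter is a sum of squares,
  and Bessel's inequality on each circle bounds the former. Hence the right-hand side does not grow
  with the number of scales between \<open>r0\<close> and \<open>r1\<close>.\<close>

theorem circ_coeff_square_function:
  assumes r: "0 < r0" "r0 \<le> r1"
  shows "integral {r0..r1} (\<lambda>r. 2 / r * integral Kc (\<lambda>x. (cmod (circ_coeff 1 f r x))\<^sup>2))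
     \<le> 4 * pi\<^sup>2 * integral Kc (\<lambda>x. (cmod (f x))\<^sup>2)"
proof -
  note ca = continuous_on_compose2[OF continuous_acorr_circ, OF _ subset_UNIV]
  define \<Phi> where "\<Phi> = (\<lambda>\<rho>. Re (acorr_circ f \<rho>))"
  have c\<Phi>: "continuous_on UNIV \<Phi>" unfolding \<Phi>_def by (intro continuous_intros continuous_acorr_circ)
  have C: "integral Kc (\<lambda>x. (cmod (circ_coeff 1 f r x))\<^sup>2) = mC \<Phi> r" for r
  proof -
    have "integral {0..2*pi} (\<lambda>a. (\<lambda>s. Im (acorr_circ f (2 * r * s))) (sin (a/2)) * sin a) = 0"
      by (rule integral_sin_symmetric) (intro continuous_intros ca)
    thus ?thesis using circ_coeff_L2[of 1 r] by (simp add: mC_def \<Phi>_def)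
  qed
  have M: "integral Kc (\<lambda>x. (cmod (circ_coeff 0 f r x))\<^sup>2) + integral Kc (\<lambda>x. (cmod (circ_coeff 1 f r x))\<^sup>2) = mT \<Phi> r" for r
  proof -
    have "integral Kc (\<lambda>x. (cmod (circ_coeff 0 f r x))\<^sup>2) = integral {0..2*pi} (\<lambda>a. \<Phi> (2 * r * sin (a/2)))"
      using circ_coeff_L2[of 0 r] by (simp add: \<Phi>_def)
    moreover have "mT \<Phi> r = integral {0..2*pi} (\<lambda>a. \<Phi> (2 * r * sin (a/2))) + mC \<Phi> r"
      unfolding mT_def mC_def distrib_left mult_1_right
      by (rule Henstock_Kurzweil_Integration.integral_add)
        (auto intro!: integrable_continuous_interval continuous_intros continuous_on_compose2[OF c\<Phi>])
    ultimately show ?thesis using C by simp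
  qed
  have "mT \<Phi> r1 \<ge> 0"
    unfolding M[symmetric]
    by (intro add_nonneg_nonneg Henstock_Kurzweil_Integration.integral_nonneg integrable_Kc continuous_intros continuous_circ_coeff) auto
  moreover have "mT \<Phi> r0 \<le> 4 * pi\<^sup>2 * integral Kc (\<lambda>x. (cmod (f x))\<^sup>2)"
  proof -
    have "mT \<Phi> r0 = integral Kc (\<lambda>x. (cmod (circ_coeff 0 f r0 x))\<^sup>2 + (cmod (circ_coeff 1 f r0 x))\<^sup>2)"
      unfolding M[symmetric]
      by (intro Henstock_Kurzweil_Integration.integral_add[symmetric] integrable_Kc continuous_intros continuous_circ_coeff)
    also have "\<dots> \<le> integral Kc (\<lambda>x. 2 * pi * integral {0..2*pi} (\<lambda>t. (cmod (f (x + circ r0 t)))\<^sup>2))"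
    proof (rule integral_le)
      show "(\<lambda>x. (cmod (circ_coeff 0 f r0 x))\<^sup>2 + (cmod (circ_coeff 1 f r0 x))\<^sup>2) integrable_on Kc"
        by (intro integrable_Kc continuous_intros continuous_circ_coeff)
      show "(\<lambda>x. 2 * pi * integral {0..2*pi} (\<lambda>t. (cmod (f (x + circ r0 t)))\<^sup>2)) integrable_on Kc"
        by (intro integrable_Kc continuous_intros continuous_integral_param cf)
      show "(cmod (circ_coeff 0 f r0 x))\<^sup>2 + (cmod (circ_coeff 1 f r0 x))\<^sup>2
         \<le> 2 * pi * integral {0..2*pi} (\<lambda>t. (cmod (f (x + circ r0 t)))\<^sup>2)" for x
        using circle_bessel[of "\<lambda>t. f (x + circ r0 t)"]
        by (simp add: circ_coeff_def cf continuous_intros)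
    qed
    also have "\<dots> = 2 * pi * integral {0..2*pi} (\<lambda>t. integral Kc (\<lambda>x. (cmod (f (x + circ r0 t)))\<^sup>2))"
      by (subst integral_Kc_swap[symmetric]) (auto intro!: continuous_intros cf)
    also have "\<dots> = 2 * pi * integral {0..2*pi} (\<lambda>t. integral Kc (\<lambda>x. (cmod (f x))\<^sup>2))"
      by (subst integral_Kc_shift[where F="\<lambda>x. (cmod (f x))\<^sup>2"]) (auto intro!: continuous_intros cf simp: p1 p2)
    finally show ?thesis by (simp add: power2_eq_square)
  qed
  moreover have "integral {r0..r1} (\<lambda>r. 2 / r * integral Kc (\<lambda>x. (cmod (circ_coeff 1 f r x))\<^sup>2)) = mT \<Phi> r0 - mT \<Phi> r1"
    unfolding C by (rule mean_energy[OF c\<Phi> r])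
  ultimately show ?thesis by linarith
qed

end

section \<open>Circulations of smooth magnetic-periodic functions\<close>

text \<open>A logarithm of \<open>\<gamma>\<close> without choice of a branch: the primitive
  \<open>L\<close> of \<open>a / \<gamma>\<close> plus \<open>\<i> * \<psi>\<close>, since
  \<open>\<gamma>\<close> times the exponential of its negative has derivative 0. For a closed curve
  the increment of this logarithm lies in \<open>2 * pi * \<i>\<close> times the integers.\<close>

lemma covariant_winding:
  fixes \<gamma> a :: "real \<Rightarrow> complex" and \<psi> \<psi>' :: "real \<Rightarrow> real"
  assumes \<gamma>: "\<And>t. (\<gamma> has_vector_derivative (a t + \<i> * of_real (\<psi>' t) * \<gamma> t)) (at t)"
    and \<psi>: "\<And>t. (\<psi> has_real_derivative \<psi>' t) (at t)"
    and a: "continuous_on UNIV a" and closed: "\<gamma> (2*pi) = \<gamma> 0" and nz: "\<And>t. \<gamma> t \<noteq> 0"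
  shows "\<exists>n::int. integral {0..2*pi} (\<lambda>t. Im (a t * cnj (\<gamma> t)) / (cmod (\<gamma> t))\<^sup>2)
    = 2 * pi * of_int n - (\<psi> (2*pi) - \<psi> 0)"
proof -
  have c\<gamma>: "continuous_on UNIV \<gamma>"
    using \<gamma> by (auto intro!: continuous_at_imp_continuous_on has_vector_derivative_continuous)
  define q where "q = (\<lambda>t. a t / \<gamma> t)"
  have cq: "continuous_on UNIV q" unfolding q_def using nz by (intro continuous_intros a c\<gamma>) auto
  define L where "L = (\<lambda>t. integral {0..t} q)"
  have dL: "(L has_vector_derivative q t) (at t within {0..2*pi})" if "t \<in> {0..2*pi}" for t
    unfolding L_def
    by (rule integral_has_vector_derivative) (use that cq in \<open>auto intro: continuous_on_subset\<close>)
  define G where "G = (\<lambda>t. \<gamma> t * exp (- (L t + \<i> * of_real (\<psi> t))))"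
  have "(G has_vector_derivative 0) (at t within {0..2*pi})" if "t \<in> {0..2*pi}" for t
  proof -
    have 1: "((\<lambda>t. - (L t + \<i> * of_real (\<psi> t))) has_vector_derivative - (q t + \<i> * of_real (\<psi>' t))) (at t within {0..2*pi})"
      using \<psi>[of t]
      by (intro derivative_intros dL that has_vector_derivative_mult_right has_vector_derivative_of_real)
         (auto simp flip: has_real_derivative_iff_has_vector_derivative intro: has_field_derivative_at_within)
    have "((\<lambda>t. exp (- (L t + \<i> * of_real (\<psi> t)))) has_vector_derivative
        (- (q t + \<i> * of_real (\<psi>' t))) * exp (- (L t + \<i> * of_real (\<psi> t)))) (at t within {0..2*pi})"
      using field_vector_diff_chain_within[OF 1 has_field_derivative_at_within[OF DERIV_exp]]
      by (simp add: o_def)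
    from has_vector_derivative_mult[OF has_vector_derivative_at_within[OF \<gamma>] this]
    have "(G has_vector_derivative
      \<gamma> t * ((- (q t + \<i> * of_real (\<psi>' t))) * exp (- (L t + \<i> * of_real (\<psi> t))))
      + (a t + \<i> * of_real (\<psi>' t) * \<gamma> t) * exp (- (L t + \<i> * of_real (\<psi> t)))) (at t within {0..2*pi})"
      unfolding G_def .
    moreover have "\<gamma> t * (q t * w) = a t * w" for w using nz by (simp add: q_def)
    ultimately show ?thesis by (simp add: algebra_simps)
  qed
  from has_vector_derivative_zero_constant[OF _ this] obtain c where c: "\<And>t. t \<in> {0..2*pi} \<Longrightarrow> G t = c"
    by auto
  have "G (2*pi) = G 0" using c by simp
  hence "exp (- (L (2*pi) + \<i> * of_real (\<psi> (2*pi)))) = exp (- (\<i> * of_real (\<psi> 0)))"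
    using nz[of 0] closed by (simp add: G_def L_def)
  hence "exp (L (2*pi) + \<i> * of_real (\<psi> (2*pi))) = exp (\<i> * of_real (\<psi> 0))"
    unfolding exp_minus by simp
  then obtain n :: int where n: "L (2*pi) + \<i> * of_real (\<psi> (2*pi)) = \<i> * of_real (\<psi> 0) + of_real (of_int (2 * n) * pi) * \<i>"
    unfolding exp_eq by blast
  have iq: "q integrable_on {0..2*pi}"
    by (intro integrable_continuous_interval continuous_on_subset[OF cq]) auto
  have "integral {0..2*pi} (\<lambda>t. Im (a t * cnj (\<gamma> t)) / (cmod (\<gamma> t))\<^sup>2) = integral {0..2*pi} (\<lambda>t. Im (q t))"
    by (intro integral_cong) (simp only: q_def Im_divide cmod_power2, simp add: mult.commute)
  also have "\<dots> = Im (L (2*pi))"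
    using integral_linear[OF iq bounded_linear_Im] by (simp add: L_def o_def)
  also have "\<dots> = 2 * pi * of_int n - (\<psi> (2*pi) - \<psi> 0)"
    using arg_cong[OF n, of Im] by (simp add: mult_ac)
  finally show ?thesis by blast
qed

text \<open>Starting from a point with modulus below \<open>1 - \<theta>\<close>, either the
  derivative costs a multiple of \<open>1 / \<epsilon>\<close> at once, or the modulus stays below
  \<open>1 - \<theta>/2\<close> along an arc of length proportional to \<open>\<epsilon>\<close>,
  and the potential pays there.\<close>

lemma bad_circle_energy:
  fixes \<gamma> d :: "real \<Rightarrow> complex" and \<psi> \<psi>' :: "real \<Rightarrow> real"
  assumes \<gamma>: "\<And>t. (\<gamma> has_vector_derivative (of_real r * d t + \<i> * of_real (\<psi>' t) * \<gamma> t)) (at t)"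
    and \<psi>: "\<And>t. (\<psi> has_real_derivative \<psi>' t) (at t)"
    and d: "continuous_on UNIV d"
    and per: "\<And>t. \<gamma> (t + 2*pi) = \<gamma> t" "\<And>t. d (t + 2*pi) = d t"
    and \<theta>: "0 < \<theta>" "\<theta> < 1" and \<epsilon>: "0 < \<epsilon>" "\<epsilon> \<le> r" and bad: "cmod (\<gamma> t0) < 1 - \<theta>"
  shows "\<theta>^4 / (32 * \<epsilon>) \<le> integral {0..2*pi} (\<lambda>t. r * ((cmod (d t))\<^sup>2 + (1 - cmod (\<gamma> t))\<^sup>2 / (2 * \<epsilon>\<^sup>2)))"
proof (rule ccontr)
  assume neg: "\<not> ?thesis"
  have r: "r > 0" using \<epsilon> by simp
  have c\<gamma>: "continuous_on UNIV \<gamma>"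
    using \<gamma> by (auto intro!: continuous_at_imp_continuous_on has_vector_derivative_continuous)
  note cd = continuous_on_subset[OF d subset_UNIV] and c\<gamma>' = continuous_on_subset[OF c\<gamma> subset_UNIV]
  let ?e = "\<lambda>t. r * ((cmod (d t))\<^sup>2 + (1 - cmod (\<gamma> t))\<^sup>2 / (2 * \<epsilon>\<^sup>2))"
  have ce: "continuous_on S ?e" for S
    using \<epsilon> by (intro continuous_intros cd c\<gamma>') auto
  have e0: "?e t \<ge> 0" for t using r by simp
  have J: "integral {t0..t0+2*pi} ?e < \<theta>^4 / (32 * \<epsilon>)"
  proof -
    have "integral {t0..t0+2*pi} ?e = integral {0..0+2*pi} ?e"
      by (rule integral_periodic_interval[OF ce]) (simp_all add: per)
    thus ?thesis using neg by (simp only: add_0 not_le)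
  qed
  \<comment> \<open>The length of that arc. With \<open>lam\<close> below it makes both terms of
    Young's inequality equal to \<open>\<theta>/4\<close>, and multiplied by the potential
    \<open>(\<theta>/2)^2 / (2 * \<epsilon>^2)\<close> it gives
    \<open>\<theta>^4 / (32 * \<epsilon>)\<close>. Because of \<open>\<epsilon> \<le> r\<close> the
    arc fits into the circle.\<close>
  define l where "l = \<theta>\<^sup>2 * \<epsilon> / 4"
  have "\<theta>\<^sup>2 \<le> 1" using \<theta> by (simp add: power_le_one)
  hence "l / r \<le> 1 / 4" unfolding l_def using \<epsilon> r mult_mono[of "\<theta>\<^sup>2" 1 \<epsilon> r] by (simp add: field_simps)
  hence lr: "l / r \<le> 2 * pi" using pi_gt3 by linarith
  have l0: "l > 0" using \<theta> \<epsilon> by (simp add: l_def)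
  have close: "cmod (\<gamma> t) \<le> 1 - \<theta>/2" if t: "t \<in> {t0..t0+l/r}" for t
  proof -
    \<comment> \<open>Removing the phase keeps the modulus and leaves only the covariant derivative
      in the derivative of \<open>G\<close>.\<close>
    define G where "G = (\<lambda>t. \<gamma> t * cis (- \<psi> t))"
    define lam where "lam = \<theta> * \<epsilon> / 2"
    have lam: "lam > 0" using \<theta> \<epsilon> by (simp add: lam_def)
    have c\<psi>: "continuous_on S \<psi>" for S
      using \<psi> by (meson DERIV_continuous_on has_field_derivative_at_within continuous_on_subset subset_UNIV)
    have dG: "(G has_vector_derivative of_real r * d s * cis (- \<psi> s)) (at s)" for s
    proof -
      have "((\<lambda>t. - (\<i> * of_real (\<psi> t))) has_vector_derivative - (\<i> * of_real (\<psi>' s))) (at s)"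
        using \<psi>[of s]
        by (intro derivative_intros has_vector_derivative_mult_right has_vector_derivative_of_real)
           (auto simp flip: has_real_derivative_iff_has_vector_derivative)
      from field_vector_diff_chain_at[OF this DERIV_exp]
      have 2: "((\<lambda>t. cis (- \<psi> t)) has_vector_derivative - (\<i> * of_real (\<psi>' s)) * cis (- \<psi> s)) (at s)"
        by (simp add: o_def cis_conv_exp)
      show ?thesis unfolding G_def
        using has_vector_derivative_mult[OF \<gamma>[of s] 2] by (simp add: algebra_simps)
    qed
    have cont: "continuous_on {t0..t} (\<lambda>s. of_real r * d s * cis (- \<psi> s))"
      by (intro continuous_intros cd c\<psi>)
    have "((\<lambda>s. of_real r * d s * cis (- \<psi> s)) has_integral (G t - G t0)) {t0..t}"
      by (rule fundamental_theorem_of_calculus) (use t dG in \<open>auto intro: has_vector_derivative_at_within\<close>)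
    hence "cmod (G t - G t0) = cmod (integral {t0..t} (\<lambda>s. of_real r * d s * cis (- \<psi> s)))"
      by (simp add: integral_unique)
    also have "\<dots> \<le> integral {t0..t} (\<lambda>s. (lam/2) * ?e s + r / (2 * lam))"
    proof (rule integral_norm_bound_integral)
      show "(\<lambda>s. of_real r * d s * cis (- \<psi> s)) integrable_on {t0..t}"
        by (rule integrable_continuous_interval[OF cont])
      show "(\<lambda>s. (lam/2) * ?e s + r / (2 * lam)) integrable_on {t0..t}"
         using lam by (intro integrable_continuous_interval continuous_intros ce) auto
      fix s
      have "0 \<le> (lam * cmod (d s) - 1)\<^sup>2" by simp
      hence "2 * lam * cmod (d s) \<le> lam\<^sup>2 * (cmod (d s))\<^sup>2 + 1"
        by (simp add: power2_eq_square algebra_simps)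
      hence "cmod (d s) \<le> (lam/2) * (cmod (d s))\<^sup>2 + 1 / (2*lam)"
         using lam by (simp add: field_simps power2_eq_square)
      also have "\<dots> \<le> (lam/2) * ((cmod (d s))\<^sup>2 + (1 - cmod (\<gamma> s))\<^sup>2 / (2 * \<epsilon>\<^sup>2)) + 1 / (2*lam)"
         using lam by (intro add_right_mono mult_left_mono) auto
      finally have "r * cmod (d s) \<le> r * ((lam/2) * ((cmod (d s))\<^sup>2 + (1 - cmod (\<gamma> s))\<^sup>2 / (2 * \<epsilon>\<^sup>2)) + 1 / (2*lam))"
        using r by (intro mult_left_mono) auto
      also have "\<dots> = (lam/2) * ?e s + r / (2 * lam)" by (simp add: algebra_simps)
      finally show "cmod (of_real r * d s * cis (- \<psi> s)) \<le> (lam/2) * ?e s + r / (2 * lam)"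
        using r by (simp add: norm_mult)
    qed
    also have "\<dots> = (lam/2) * integral {t0..t} ?e + (t - t0) * (r / (2 * lam))"
      using t lam by (subst Henstock_Kurzweil_Integration.integral_add)
        (auto intro!: integrable_continuous_interval continuous_intros ce)
    also have "\<dots> \<le> (lam/2) * (1 / \<epsilon>) + (l / r) * (r / (2 * lam))"
    proof (intro add_mono mult_left_mono mult_right_mono)
      have "integral {t0..t} ?e \<le> integral {t0..t0+2*pi} ?e"
        by (rule integral_subset_le)
           (use t lr e0 in \<open>auto intro!: integrable_continuous_interval ce\<close>)
      also have "\<dots> \<le> \<theta>^4 / (32 * \<epsilon>)" using J by simp
      also have "\<dots> \<le> 1 / \<epsilon>"
        using power_le_one[of \<theta> 4] \<theta> \<epsilon> by (simp add: field_simps)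
      finally show "integral {t0..t} ?e \<le> 1 / \<epsilon>" .
    qed (use t r lam in auto)
    also have "\<dots> = \<theta> / 2"
      using \<theta> \<epsilon> r by (simp add: lam_def l_def field_simps power2_eq_square)
    finally have "cmod (G t - G t0) \<le> \<theta> / 2" .
    hence "cmod (G t) \<le> cmod (G t0) + \<theta> / 2" using norm_triangle_sub[of "G t" "G t0"] by linarith
    thus ?thesis using bad by (simp add: G_def norm_mult)
  qed
  have "\<theta>^4 / (32 * \<epsilon>) = integral {t0..t0+l/r} (\<lambda>t. r * ((\<theta>/2)\<^sup>2 / (2 * \<epsilon>\<^sup>2)))"
    using l0 r \<epsilon> by (simp add: l_def field_simps power2_eq_square power4_eq_xxxx)
  also have "\<dots> \<le> integral {t0..t0+l/r} ?e"
  proof (rule integral_le)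
    show "?e integrable_on {t0..t0+l/r}" by (intro integrable_continuous_interval ce)
    fix t assume t: "t \<in> {t0..t0+l/r}"
    have "(\<theta>/2)\<^sup>2 \<le> (1 - cmod (\<gamma> t))\<^sup>2" using close[OF t] \<theta> by (intro power_mono) auto
    hence "(\<theta>/2)\<^sup>2 / (2 * \<epsilon>\<^sup>2) \<le> (cmod (d t))\<^sup>2 + (1 - cmod (\<gamma> t))\<^sup>2 / (2 * \<epsilon>\<^sup>2)"
      by (intro add_increasing divide_right_mono) auto
    thus "r * ((\<theta>/2)\<^sup>2 / (2 * \<epsilon>\<^sup>2)) \<le> ?e t" using r by (intro mult_left_mono) auto
  qed auto
  also have "\<dots> \<le> integral {t0..t0+2*pi} ?e"
    by (rule integral_subset_le)
       (use lr e0 in \<open>auto intro!: integrable_continuous_interval ce\<close>)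
  finally show False using J by simp
qed

section \<open>Gauge-invariant quantities of a smooth magnetic-periodic function\<close>

lemma circ_phase_deriv:
  "((\<lambda>t. h * r / 2 * (fst x * sin t - snd x * cos t + r * t)) has_real_derivative
      h * r / 2 * (snd x * sin t + fst x * cos t + r)) (at t)"
  by (auto intro!: derivative_eq_intros simp: algebra_simps)

text \<open>\<open>D1\<close> and \<open>D2\<close> are the components of the covariant derivative
  of \<open>U\<close>. They transform under lattice translations as \<open>U\<close> does, so
  products such as \<open>D1 x * cnj (U x)\<close> are periodic.\<close>

locale smooth_magnetic =
  fixes h :: real and U D1 D2 :: "real \<times> real \<Rightarrow> complex"
  assumes deriv: "\<And>x. (U has_derivative (\<lambda>v. fst v *\<^sub>R (D1 x - \<i> * of_real (h * snd x / 2) * U x)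
      + snd v *\<^sub>R (D2 x + \<i> * of_real (h * fst x / 2) * U x))) (at x)"
    and D1: "continuous_on UNIV D1" and D2: "continuous_on UNIV D2"
    and per1: "\<And>x y. U (x + 1, y) = cis (h * y / 2) * U (x, y)"
      "\<And>x y. D1 (x + 1, y) = cis (h * y / 2) * D1 (x, y)"
      "\<And>x y. D2 (x + 1, y) = cis (h * y / 2) * D2 (x, y)"
    and per2: "\<And>x y. U (x, y + 1) = cis (- h * x / 2) * U (x, y)"
      "\<And>x y. D1 (x, y + 1) = cis (- h * x / 2) * D1 (x, y)"
      "\<And>x y. D2 (x, y + 1) = cis (- h * x / 2) * D2 (x, y)"
begin

lemma cont_U: "continuous_on UNIV U"
  using deriv by (auto intro!: continuous_at_imp_continuous_on has_derivative_continuous)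

lemmas cU = continuous_on_compose2[OF cont_U, OF _ subset_UNIV]
  and cD1 = continuous_on_compose2[OF D1, OF _ subset_UNIV]
  and cD2 = continuous_on_compose2[OF D2, OF _ subset_UNIV]

text \<open>The potential is built from \<open>1 - cmod (U x)\<close>, so that this density lies
  below the one of the energy. The square root of this potential is Lipschitz in \<open>U\<close>,
  which lets L2 convergence of mollified functions control it.\<close>

definition dens :: "real \<Rightarrow> real \<times> real \<Rightarrow> real" where
  "dens \<epsilon> x = (cmod (D1 x))\<^sup>2 + (cmod (D2 x))\<^sup>2 + (1 - cmod (U x))\<^sup>2 / (2 * \<epsilon>\<^sup>2)"

text \<open>The maximum cuts off the vortex cores; on circles where \<open>cmod U \<ge> 1 - \<theta>\<close> it changes nothing.\<close>

definition velo :: "real \<Rightarrow> real \<times> real \<Rightarrow> complex" where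
  "velo \<theta> x = (of_real (Im (D1 x * cnj (U x))) + \<i> * of_real (Im (D2 x * cnj (U x))))
      / of_real ((max (cmod (U x)) (1 - \<theta>))\<^sup>2)"

lemma cont_dens: "\<epsilon> > 0 \<Longrightarrow> continuous_on UNIV (dens \<epsilon>)"
  unfolding dens_def by (intro continuous_intros cU cD1 cD2) auto

lemma cont_velo: "\<theta> < 1 \<Longrightarrow> continuous_on UNIV (velo \<theta>)"
  unfolding velo_def by (intro continuous_intros cU cD1 cD2) (auto simp: max_def)

lemma dens_periodic: "dens \<epsilon> (x + 1, y) = dens \<epsilon> (x, y)" "dens \<epsilon> (x, y + 1) = dens \<epsilon> (x, y)"
  by (simp_all add: dens_def per1 per2 norm_mult)

lemma cis_cancel: "(cis a * z) * cnj (cis a * w) = z * cnj w"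
proof -
  have "cis a * cnj (cis a) = 1" by (simp add: cis_cnj cis_mult)
  thus ?thesis by (metis complex_cnj_mult mult.left_commute mult.right_neutral mult.assoc)
qed

lemma velo_periodic: "velo \<theta> (x + 1, y) = velo \<theta> (x, y)" "velo \<theta> (x, y + 1) = velo \<theta> (x, y)"
  by (simp_all only: velo_def per1 per2 norm_mult norm_cis cis_cancel mult_1_left)

lemma dens_nonneg: "0 \<le> dens \<epsilon> x"
  by (simp add: dens_def)

lemma velo_le: 
  assumes "\<theta> < 1"
  shows "(cmod (velo \<theta> x))\<^sup>2 \<le> dens \<epsilon> x / (1 - \<theta>)\<^sup>2"
proof -
  define m where "m = max (cmod (U x)) (1 - \<theta>)"
  have m: "cmod (U x) \<le> m" "1 - \<theta> \<le> m" "0 < m" using assms by (auto simp: m_def max_def)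
  have *: "(Im (z * cnj (U x)))\<^sup>2 \<le> (cmod z)\<^sup>2 * m\<^sup>2" for z
  proof -
    have "\<bar>Im (z * cnj (U x))\<bar> \<le> cmod z * cmod (U x)"
      using abs_Im_le_cmod[of "z * cnj (U x)"] by (simp add: norm_mult)
    also have "\<dots> \<le> cmod z * m" using m by (intro mult_left_mono) auto
    finally have "\<bar>Im (z * cnj (U x))\<bar>\<^sup>2 \<le> (cmod z * m)\<^sup>2" by (intro power_mono) auto
    thus ?thesis by (simp add: power_mult_distrib)
  qed
  have "(cmod (velo \<theta> x))\<^sup>2 = ((Im (D1 x * cnj (U x)))\<^sup>2 + (Im (D2 x * cnj (U x)))\<^sup>2) / m^4"
  proof -
    have "(cmod (of_real a + \<i> * of_real b))\<^sup>2 = a\<^sup>2 + b\<^sup>2" for a b by (simp add: cmod_power2)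
    moreover have "cmod (of_real (m\<^sup>2)) = m\<^sup>2" using m by (simp only: norm_of_real) simp
    moreover have "(m\<^sup>2)\<^sup>2 = m^4" by (simp flip: power_mult)
    ultimately show ?thesis
      unfolding velo_def m_def[symmetric] norm_divide power_divide by (simp only:)
  qed
  also have "\<dots> \<le> ((cmod (D1 x))\<^sup>2 * m\<^sup>2 + (cmod (D2 x))\<^sup>2 * m\<^sup>2) / m^4"
    by (intro divide_right_mono add_mono *) auto
  also have "\<dots> = ((cmod (D1 x))\<^sup>2 + (cmod (D2 x))\<^sup>2) / m\<^sup>2"
    using m by (simp add: field_simps power2_eq_square power4_eq_xxxx)
  also have "\<dots> \<le> ((cmod (D1 x))\<^sup>2 + (cmod (D2 x))\<^sup>2) / (1 - \<theta>)\<^sup>2"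
    using m assms by (intro divide_left_mono mult_pos_pos power_mono) auto
  also have "\<dots> \<le> dens \<epsilon> x / (1 - \<theta>)\<^sup>2"
    unfolding dens_def by (intro divide_right_mono) auto
  finally show ?thesis .
qed

text \<open>With the velocity stored as the complex number \<open>v1 + \<i> * v2\<close>, its
  tangential component at angle \<open>t\<close> is the imaginary part of its product with
  \<open>cis (- t)\<close>. The first summand is thus the circulation, and the second is the flux of
  the magnetic field through the disc.\<close>

definition flux :: "real \<Rightarrow> real \<Rightarrow> real \<times> real \<Rightarrow> real" where
  "flux \<theta> r x = r * Im (circ_coeff 1 (velo \<theta>) r x) + h * pi * r\<^sup>2"

lemma circ_deriv:
  "((\<lambda>t. U (x + circ r t)) has_vector_derivative
     (of_real r * (of_real (- sin t) * D1 (x + circ r t) + of_real (cos t) * D2 (x + circ r t))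
      + \<i> * of_real (h * r / 2 * (snd x * sin t + fst x * cos t + r)) * U (x + circ r t))) (at t)"
proof -
  let ?y = "x + circ r t"
  have "((\<lambda>t. x + circ r t) has_derivative (\<lambda>s. (- r * sin t * s, r * cos t * s))) (at t)"
    unfolding circ_def by (auto intro!: derivative_eq_intros simp: plus_prod_def zero_prod_def)
  from has_derivative_compose[OF this deriv]
  have "((\<lambda>t. U (x + circ r t)) has_derivative (\<lambda>s. (- r * sin t * s) *\<^sub>R (D1 ?y - \<i> * of_real (h * snd ?y / 2) * U ?y)
      + (r * cos t * s) *\<^sub>R (D2 ?y + \<i> * of_real (h * fst ?y / 2) * U ?y))) (at t)"
    by simp
  moreover have "(- r * sin t * s) *\<^sub>R (D1 ?y - \<i> * of_real (h * snd ?y / 2) * U ?y)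
      + (r * cos t * s) *\<^sub>R (D2 ?y + \<i> * of_real (h * fst ?y / 2) * U ?y)
     = s *\<^sub>R (of_real r * (of_real (- sin t) * D1 ?y + of_real (cos t) * D2 ?y)
      + \<i> * of_real (h * r / 2 * (snd x * sin t + fst x * cos t + r)) * U ?y)" for s
  proof -
    have "snd x * sin t + fst x * cos t + r = sin t * snd ?y + cos t * fst ?y"
    proof -
      have "r * (sin t * sin t) + r * (cos t * cos t) = r"
        using sin_cos_squared_add3[of t] by (metis add.commute distrib_left mult.right_neutral)
      thus ?thesis by (simp add: circ_def algebra_simps)
    qed
    moreover have "(- r * a * s) *\<^sub>R (A - \<i> * of_real (h * y2 / 2) * u) + (r * b * s) *\<^sub>R (B + \<i> * of_real (h * y1 / 2) * u)
      = s *\<^sub>R (of_real r * (of_real (- a) * A + of_real b * B) + \<i> * of_real (h * r / 2 * (a * y2 + b * y1)) * u)"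
      for a b y1 y2 :: real and A B u :: complex
      by (simp add: scaleR_conv_of_real field_simps)
    ultimately show ?thesis by (simp only:)
  qed
  ultimately show ?thesis unfolding has_vector_derivative_def by simp
qed

text \<open>On a circle where the modulus stays above \<open>1 - \<theta>\<close> the flux is
  \<open>2 * pi * n\<close>, and \<open>n \<le> n^2\<close> for integers. On any other circle the
  inequality fails by at most \<open>pi^2\<close>, because \<open>(flux - pi)^2\<close> is
  nonnegative, and \<open>bad_circle_energy\<close> makes the energy term exceed that
  amount.\<close>

lemma flux_pointwise:
  assumes \<theta>: "0 < \<theta>" "\<theta> < 1" and \<epsilon>: "0 < \<epsilon>" "\<epsilon> \<le> r"
  shows "(flux \<theta> r x)\<^sup>2 \<ge> 2 * pi * flux \<theta> r x
     - pi\<^sup>2 * (32 * \<epsilon> / \<theta>^4) * integral {0..2*pi} (\<lambda>t. r * dens \<epsilon> (x + circ r t))"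
proof -
  have r: "r > 0" using \<epsilon> by simp
  define \<gamma> where "\<gamma> = (\<lambda>t. U (x + circ r t))"
  define d where "d = (\<lambda>t. of_real (- sin t) * D1 (x + circ r t) + of_real (cos t) * D2 (x + circ r t))"
  define \<psi> where "\<psi> = (\<lambda>t. h * r / 2 * (fst x * sin t - snd x * cos t + r * t))"
  define \<psi>' where "\<psi>' = (\<lambda>t. h * r / 2 * (snd x * sin t + fst x * cos t + r))"
  have d\<gamma>: "(\<gamma> has_vector_derivative (of_real r * d t + \<i> * of_real (\<psi>' t) * \<gamma> t)) (at t)" for t
    unfolding \<gamma>_def d_def \<psi>'_def by (rule circ_deriv)
  have d\<psi>: "(\<psi> has_real_derivative \<psi>' t) (at t)" for t
    unfolding \<psi>_def \<psi>'_def by (rule circ_phase_deriv)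
  have cd: "continuous_on UNIV d"
    unfolding d_def by (intro continuous_intros cD1 cD2)
  \<comment> \<open>\<open>\<psi>\<close> is the line integral of the vector potential along the
    circle; over a full turn it collects the flux through the disc.\<close>
  have d\<psi>2: "\<psi> (2*pi) - \<psi> 0 = h * pi * r\<^sup>2" by (simp add: \<psi>_def algebra_simps power2_eq_square)
  let ?J = "integral {0..2*pi} (\<lambda>t. r * dens \<epsilon> (x + circ r t))"
  note cdens = continuous_on_compose2[OF cont_dens[OF \<epsilon>(1)], OF _ subset_UNIV]
  have iJ: "(\<lambda>t. r * dens \<epsilon> (x + circ r t)) integrable_on {0..2*pi}"
    by (intro integrable_continuous_interval continuous_intros cdens)
  have J0: "?J \<ge> 0"
    by (intro Henstock_Kurzweil_Integration.integral_nonneg iJ) (use r dens_nonneg in auto)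
  show ?thesis
  proof (cases "\<exists>t0. cmod (\<gamma> t0) < 1 - \<theta>")
    case True
    then obtain t0 where "cmod (\<gamma> t0) < 1 - \<theta>" by blast
    from bad_circle_energy[OF d\<gamma> d\<psi> cd _ _ \<theta> \<epsilon> this]
    have "\<theta>^4 / (32 * \<epsilon>) \<le> integral {0..2*pi} (\<lambda>t. r * ((cmod (d t))\<^sup>2 + (1 - cmod (\<gamma> t))\<^sup>2 / (2 * \<epsilon>\<^sup>2)))"
      by (simp add: \<gamma>_def d_def)
    also have "\<dots> \<le> ?J"
    proof (rule integral_le[OF _ iJ])
      show "(\<lambda>t. r * ((cmod (d t))\<^sup>2 + (1 - cmod (\<gamma> t))\<^sup>2 / (2 * \<epsilon>\<^sup>2))) integrable_on {0..2*pi}"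
        unfolding \<gamma>_def using \<epsilon>
        by (intro integrable_continuous_interval continuous_intros cU continuous_on_subset[OF cd]) auto
      fix t
      have "(cmod (d t))\<^sup>2 \<le> (\<bar>sin t\<bar> * cmod (D1 (x + circ r t)) + \<bar>cos t\<bar> * cmod (D2 (x + circ r t)))\<^sup>2"
        unfolding d_def by (intro power_mono norm_triangle_le) (auto simp: norm_mult)
      also have "\<dots> \<le> (\<bar>sin t\<bar>\<^sup>2 + \<bar>cos t\<bar>\<^sup>2) * ((cmod (D1 (x + circ r t)))\<^sup>2 + (cmod (D2 (x + circ r t)))\<^sup>2)"
      proof -
        have "(a * b + c * e)\<^sup>2 \<le> (a\<^sup>2 + c\<^sup>2) * (b\<^sup>2 + e\<^sup>2)" for a b c e :: real
          using zero_le_power2[of "a * e - c * b"] by (simp add: power2_eq_square algebra_simps)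
        thus ?thesis .
      qed
      finally show "r * ((cmod (d t))\<^sup>2 + (1 - cmod (\<gamma> t))\<^sup>2 / (2 * \<epsilon>\<^sup>2)) \<le> r * dens \<epsilon> (x + circ r t)"
        using r by (intro mult_left_mono) (auto simp: dens_def \<gamma>_def)
    qed
    finally have "1 \<le> (32 * \<epsilon> / \<theta>^4) * ?J" using \<theta> \<epsilon> by (simp add: field_simps)
    hence "pi\<^sup>2 * 1 \<le> pi\<^sup>2 * ((32 * \<epsilon> / \<theta>^4) * ?J)" by (intro mult_left_mono) auto
    moreover have "0 \<le> (flux \<theta> r x - pi)\<^sup>2" by simp
    ultimately show ?thesis by (simp add: power2_eq_square algebra_simps)
  next
    case False
    hence good: "1 - \<theta> \<le> cmod (\<gamma> t)" for t by (simp add: not_less)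
    hence nz: "\<gamma> t \<noteq> 0" for t using \<theta> by (metis diff_gt_0_iff_gt norm_zero not_le)
    have "\<exists>n::int. integral {0..2*pi} (\<lambda>t. Im ((of_real r * d t) * cnj (\<gamma> t)) / (cmod (\<gamma> t))\<^sup>2)
        = 2 * pi * of_int n - (\<psi> (2*pi) - \<psi> 0)"
      by (rule covariant_winding[OF d\<gamma> d\<psi> _ _ nz]) (auto simp: \<gamma>_def circ_def intro!: continuous_intros continuous_on_subset[OF cd])
    then obtain n :: int where n: "integral {0..2*pi} (\<lambda>t. Im ((of_real r * d t) * cnj (\<gamma> t)) / (cmod (\<gamma> t))\<^sup>2)
        = 2 * pi * of_int n - h * pi * r\<^sup>2" unfolding d\<psi>2 by blast
    have Im_v: "r * Im (velo \<theta> (x + circ r t) * cis (- t)) = Im ((of_real r * d t) * cnj (\<gamma> t)) / (cmod (\<gamma> t))\<^sup>2" for t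
    proof -
      have m: "max (cmod (U (x + circ r t))) (1 - \<theta>) = cmod (\<gamma> t)"
        using good[of t] by (simp add: \<gamma>_def)
      define q where "q = (cmod (\<gamma> t))\<^sup>2"
      have "velo \<theta> (x + circ r t) = (of_real (Im (D1 (x + circ r t) * cnj (\<gamma> t))) + \<i> * of_real (Im (D2 (x + circ r t) * cnj (\<gamma> t)))) / of_real q"
        unfolding velo_def m by (simp add: \<gamma>_def q_def)
      hence "Im (velo \<theta> (x + circ r t) * cis (- t)) = (cos t * Im (D2 (x + circ r t) * cnj (\<gamma> t)) - sin t * Im (D1 (x + circ r t) * cnj (\<gamma> t))) / q"
        by (simp add: diff_divide_distrib mult_ac Re_divide_of_real Im_divide_of_real)
      also have "r * \<dots> = Im ((of_real r * d t) * cnj (\<gamma> t)) / q"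
        by (simp add: d_def algebra_simps)
      finally show ?thesis by (simp add: q_def)
    qed
    note cv = continuous_on_compose2[OF cont_velo[OF \<theta>(2)], OF _ subset_UNIV]
    have iv: "(\<lambda>t. velo \<theta> (x + circ r t) * cis (- 1 * t)) integrable_on {0..2*pi}"
      by (intro integrable_continuous_interval continuous_intros cv)
    have "r * Im (circ_coeff 1 (velo \<theta>) r x) = integral {0..2*pi} (\<lambda>t. r * Im (velo \<theta> (x + circ r t) * cis (- t)))"
      using integral_linear[OF iv bounded_linear_Im] by (simp add: circ_coeff_def o_def)
    hence "flux \<theta> r x = 2 * pi * of_int n" unfolding flux_def Im_v n by simp
    moreover have "of_int n \<le> (of_int n :: real)\<^sup>2"
    proof -
      have "n \<le> n\<^sup>2" by (cases "n \<le> 0") (auto simp: power2_eq_square mult_le_cancel_left1 intro: order_trans[of _ 0])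
      thus ?thesis by (metis of_int_le_iff of_int_power)
    qed
    hence "(2 * pi)\<^sup>2 * of_int n \<le> (2 * pi)\<^sup>2 * (of_int n :: real)\<^sup>2" by (intro mult_left_mono) auto
    ultimately have "2 * pi * flux \<theta> r x \<le> (flux \<theta> r x)\<^sup>2"
      by (simp add: power_mult_distrib power2_eq_square mult_ac)
    moreover have "0 \<le> pi\<^sup>2 * (32 * \<epsilon> / \<theta>^4) * ?J" using J0 \<epsilon> \<theta> by (intro mult_nonneg_nonneg) auto
    ultimately show ?thesis by linarith
  qed
qed

lemma flux_cont: "\<theta> < 1 \<Longrightarrow> continuous_on UNIV (flux \<theta> r)"
  unfolding flux_def by (intro continuous_intros continuous_circ_coeff cont_velo velo_periodic)

lemma integral_flux:
  assumes "\<theta> < 1"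
  shows "integral Kc (flux \<theta> r) = h * pi * r\<^sup>2"
proof -
  note cv = continuous_on_compose2[OF cont_velo[OF assms], OF _ subset_UNIV]
  have "integral Kc (circ_coeff 1 (velo \<theta>) r)
      = integral {0..2*pi} (\<lambda>t. integral Kc (\<lambda>x. velo \<theta> (x + circ r t) * cis (- 1 * t)))"
    unfolding circ_coeff_def[abs_def] by (rule integral_Kc_swap) (intro continuous_intros cv)
  also have "\<dots> = integral {0..2*pi} (\<lambda>t. integral Kc (velo \<theta>) * cis (- 1 * t))"
    by (simp only: integral_mult_left integral_Kc_shift[OF cont_velo[OF assms] velo_periodic])
  also have "\<dots> = integral Kc (velo \<theta>) * integral {0..2*pi} (\<lambda>t. cis (- 1 * t))"
    by (rule integral_mult_right)
  also have "integral {0..2*pi} (\<lambda>t. cis (- 1 * t)) = 0"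
  proof -
    have "((\<lambda>t. cis (- 1 * t)) has_integral (\<i> * cis (- 1 * (2*pi)) - \<i> * cis (- 1 * 0))) {0..2*pi}"
    proof (rule fundamental_theorem_of_calculus)
      show "((\<lambda>t. \<i> * cis (- 1 * t)) has_vector_derivative cis (- 1 * t)) (at t within {0..2*pi})" for t
        unfolding cis_conv_exp
        by (auto intro!: derivative_eq_intros has_vector_derivative_real_field simp: field_simps)
    qed auto
    thus ?thesis by (simp add: integral_unique flip: cis_cnj)
  qed
  finally have z: "integral Kc (circ_coeff 1 (velo \<theta>) r) = 0" by simp
  have ic: "circ_coeff 1 (velo \<theta>) r integrable_on Kc"
    by (intro integrable_Kc continuous_circ_coeff cont_velo velo_periodic assms)
  have "integral Kc (flux \<theta> r) = integral Kc (\<lambda>x. r * Im (circ_coeff 1 (velo \<theta>) r x)) + integral Kc (\<lambda>x. h * pi * r\<^sup>2)"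
    unfolding flux_def
    by (intro Henstock_Kurzweil_Integration.integral_add integrable_Kc continuous_intros continuous_circ_coeff cont_velo velo_periodic assms)
  also have "integral Kc (\<lambda>x. r * Im (circ_coeff 1 (velo \<theta>) r x)) = r * Im (integral Kc (circ_coeff 1 (velo \<theta>) r))"
    using integral_linear[OF ic bounded_linear_Im] by (simp add: o_def)
  also have "integral Kc (\<lambda>x. h * pi * r\<^sup>2) = h * pi * r\<^sup>2"
    using content_Kc by (simp add: Kc_def)
  finally show ?thesis using z by simp
qed

text \<open>The circulation is \<open>flux\<close> minus its mean \<open>a = h * pi * r^2\<close>,
  so its mean square is a variance. The mean of the squared flux is at least
  \<open>2 * pi * a\<close> up to bad circles, which gives \<open>2 * pi * a - a^2\<close>; this is
  then divided by \<open>r^2\<close>.\<close>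

lemma coeff_lower:
  assumes \<theta>: "0 < \<theta>" "\<theta> < 1" and \<epsilon>: "0 < \<epsilon>" "\<epsilon> \<le> r"
  shows "integral Kc (\<lambda>x. (cmod (circ_coeff 1 (velo \<theta>) r x))\<^sup>2) \<ge>
     2 * pi\<^sup>2 * h - pi\<^sup>2 * h\<^sup>2 * r\<^sup>2 - 64 * pi^3 * \<epsilon> / (\<theta>^4 * r) * integral Kc (dens \<epsilon>)"
proof -
  have r: "r > 0" using \<epsilon> by simp
  define E where "E = integral Kc (dens \<epsilon>)"
  define B where "B = pi\<^sup>2 * (32 * \<epsilon> / \<theta>^4)"
  define a where "a = h * pi * r\<^sup>2"
  note cdens = continuous_on_compose2[OF cont_dens[OF \<epsilon>(1)], OF _ subset_UNIV]
  have E: "integral Kc (\<lambda>x. integral {0..2*pi} (\<lambda>t. r * dens \<epsilon> (x + circ r t))) = 2 * pi * r * E"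
  proof -
    have "integral Kc (\<lambda>x. integral {0..2*pi} (\<lambda>t. r * dens \<epsilon> (x + circ r t)))
      = integral {0..2*pi} (\<lambda>t. integral Kc (\<lambda>x. r * dens \<epsilon> (x + circ r t)))"
      by (rule integral_Kc_swap) (intro continuous_intros cdens)
    also have "\<dots> = integral {0..2*pi} (\<lambda>t. r * E)"
      by (simp only: integral_mult_right integral_Kc_shift[OF cont_dens[OF \<epsilon>(1)] dens_periodic] E_def)
    also have "\<dots> = 2 * pi * r * E" by simp
    finally show ?thesis .
  qed
  \<comment> \<open>This minorant of the squared circulation is affine in \<open>flux\<close>, so
    its integral follows from the mean of \<open>flux\<close> alone.\<close>
  have L: "((\<lambda>x. (2 * pi - 2 * a) * flux \<theta> r x - B * integral {0..2*pi} (\<lambda>t. r * dens \<epsilon> (x + circ r t)) + a\<^sup>2)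
      has_integral ((2 * pi - 2 * a) * a - B * (2 * pi * r * E) + a\<^sup>2)) Kc"
  proof (intro has_integral_add has_integral_diff has_integral_mult_right)
    show "(flux \<theta> r has_integral a) Kc"
      using integrable_integral[OF integrable_Kc[OF flux_cont[OF \<theta>(2)]]] integral_flux[OF \<theta>(2)]
      by (simp add: a_def)
    show "((\<lambda>x. integral {0..2*pi} (\<lambda>t. r * dens \<epsilon> (x + circ r t))) has_integral 2 * pi * r * E) Kc"
      unfolding E[symmetric]
      by (intro integrable_integral integrable_Kc continuous_integral_param continuous_intros cdens)
    show "((\<lambda>x. a\<^sup>2) has_integral a\<^sup>2) Kc"
      using has_integral_const[of "a\<^sup>2" "(-1/2,-1/2) :: real \<times> real" "(1/2,1/2)"] content_Kc by (simp add: Kc_def)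
  qed
  have "(2 * pi - 2 * a) * a - B * (2 * pi * r * E) + a\<^sup>2
     \<le> integral Kc (\<lambda>x. r\<^sup>2 * (cmod (circ_coeff 1 (velo \<theta>) r x))\<^sup>2)"
  proof (rule has_integral_le[OF L integrable_integral])
    show "(\<lambda>x. r\<^sup>2 * (cmod (circ_coeff 1 (velo \<theta>) r x))\<^sup>2) integrable_on Kc"
      by (intro integrable_Kc continuous_intros continuous_circ_coeff cont_velo velo_periodic \<theta>)
    fix x
    have "2 * pi * flux \<theta> r x - B * integral {0..2*pi} (\<lambda>t. r * dens \<epsilon> (x + circ r t)) \<le> (flux \<theta> r x)\<^sup>2"
      unfolding B_def using flux_pointwise[OF \<theta> \<epsilon>, of x] by simp
    hence "(2 * pi - 2 * a) * flux \<theta> r x - B * integral {0..2*pi} (\<lambda>t. r * dens \<epsilon> (x + circ r t)) + a\<^sup>2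
       \<le> (flux \<theta> r x - a)\<^sup>2"
      by (simp add: power2_eq_square algebra_simps)
    also have "\<dots> = r\<^sup>2 * (Im (circ_coeff 1 (velo \<theta>) r x))\<^sup>2"
      by (simp add: flux_def a_def power_mult_distrib)
    also have "\<dots> \<le> r\<^sup>2 * (cmod (circ_coeff 1 (velo \<theta>) r x))\<^sup>2"
      by (intro mult_left_mono) (auto simp: cmod_power2)
    finally show "(2 * pi - 2 * a) * flux \<theta> r x - B * integral {0..2*pi} (\<lambda>t. r * dens \<epsilon> (x + circ r t)) + a\<^sup>2
       \<le> r\<^sup>2 * (cmod (circ_coeff 1 (velo \<theta>) r x))\<^sup>2" .
  qed
  hence "2 * pi * a - a\<^sup>2 - B * (2 * pi * r * E) \<le> r\<^sup>2 * integral Kc (\<lambda>x. (cmod (circ_coeff 1 (velo \<theta>) r x))\<^sup>2)"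
    by (simp add: algebra_simps power2_eq_square)
  moreover have "2 * pi * a - a\<^sup>2 - B * (2 * pi * r * E)
     = r\<^sup>2 * (2 * pi\<^sup>2 * h - pi\<^sup>2 * h\<^sup>2 * r\<^sup>2 - 64 * pi^3 * \<epsilon> / (\<theta>^4 * r) * E)"
    using r \<theta> by (simp add: a_def B_def field_simps power2_eq_square power3_eq_cube)
  ultimately have "r\<^sup>2 * (2 * pi\<^sup>2 * h - pi\<^sup>2 * h\<^sup>2 * r\<^sup>2 - 64 * pi^3 * \<epsilon> / (\<theta>^4 * r) * E)
      \<le> r\<^sup>2 * integral Kc (\<lambda>x. (cmod (circ_coeff 1 (velo \<theta>) r x))\<^sup>2)" by simp
  thus ?thesis using r by (simp add: E_def)
qed

text \<open>\<open>coeff_lower\<close> is integrated against \<open>2 / r\<close> and compared with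
  \<open>circ_coeff_square_function\<close>; both carry the factor \<open>4 * pi^2\<close>, which
  leaves the coefficient 1 at the logarithm. The bad circles contribute an integral of
  \<open>1 / r^2\<close>, hence the ratio \<open>\<epsilon> / r0\<close>, which is small if
  \<open>r0\<close> is a large multiple of \<open>\<epsilon>\<close>.\<close>

theorem smooth_lower_bound:
  assumes \<theta>: "0 < \<theta>" "\<theta> < 1" and \<epsilon>: "0 < \<epsilon>" "\<epsilon> \<le> r0" and r: "r0 \<le> r1"
  shows "h * ln (r1 / r0) - h\<^sup>2 * r1\<^sup>2 / 4
    \<le> (1 / (1 - \<theta>)\<^sup>2 + 32 * pi * \<epsilon> / (\<theta>^4 * r0)) * integral Kc (dens \<epsilon>)"
proof -
  define E where "E = integral Kc (dens \<epsilon>)"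
  have E0: "E \<ge> 0" unfolding E_def
    by (intro Henstock_Kurzweil_Integration.integral_nonneg integrable_Kc cont_dens \<epsilon> dens_nonneg)
  have r0: "r0 > 0" using \<epsilon> by simp
  define c where "c = 64 * pi^3 * \<epsilon> / \<theta>^4 * E"
  have c0: "c \<ge> 0" unfolding c_def using \<epsilon> \<theta> E0 by simp
  let ?I = "\<lambda>r. integral Kc (\<lambda>x. (cmod (circ_coeff 1 (velo \<theta>) r x))\<^sup>2)"
  have cI: "continuous_on UNIV ?I"
  proof -
    note cv = continuous_on_compose2[OF cont_velo[OF \<theta>(2)], OF _ subset_UNIV]
    have "continuous_on (UNIV \<times> UNIV) (\<lambda>p. circ_coeff 1 (velo \<theta>) (fst p) (snd p))"
      unfolding circ_coeff_def by (rule continuous_integral_param) (intro continuous_intros cv)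
    hence "continuous_on (UNIV \<times> cbox (-1/2,-1/2) (1/2,1/2)) (\<lambda>(r, x). (cmod (circ_coeff 1 (velo \<theta>) r x))\<^sup>2)"
      unfolding case_prod_beta by (intro continuous_intros) (auto intro: continuous_on_subset)
    from integral_continuous_on_param[OF this] show ?thesis unfolding Kc_def .
  qed
  define G where "G r = 4 * pi\<^sup>2 * h * ln r - pi\<^sup>2 * h\<^sup>2 * r\<^sup>2 + 2 * c / r" for r
  have "((\<lambda>r. 2 / r * (2 * pi\<^sup>2 * h - pi\<^sup>2 * h\<^sup>2 * r\<^sup>2 - c / r)) has_integral (G r1 - G r0)) {r0..r1}"
  proof (rule fundamental_theorem_of_calculus[OF r])
    fix x assume "x \<in> {r0..r1}"
    hence x: "x > 0" using r0 by simp
    have "(G has_real_derivative (2 / x * (2 * pi\<^sup>2 * h - pi\<^sup>2 * h\<^sup>2 * x\<^sup>2 - c / x))) (at x within {r0..r1})"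
      unfolding G_def[abs_def] using x
      by (auto intro!: derivative_eq_intros simp: field_simps power2_eq_square)
    thus "(G has_vector_derivative (2 / x * (2 * pi\<^sup>2 * h - pi\<^sup>2 * h\<^sup>2 * x\<^sup>2 - c / x))) (at x within {r0..r1})"
      by (simp add: has_real_derivative_iff_has_vector_derivative)
  qed
  hence "G r1 - G r0 \<le> integral {r0..r1} (\<lambda>r. 2 / r * ?I r)"
  proof (rule has_integral_le[OF _ integrable_integral])
    show "(\<lambda>r. 2 / r * ?I r) integrable_on {r0..r1}"
      using r0 by (intro integrable_continuous_interval continuous_intros continuous_on_subset[OF cI]) auto
    fix s assume s: "s \<in> {r0..r1}"
    have "2 * pi\<^sup>2 * h - pi\<^sup>2 * h\<^sup>2 * s\<^sup>2 - c / s \<le> ?I s"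
      using coeff_lower[OF \<theta> \<epsilon>(1), of s] s \<epsilon> by (simp add: c_def E_def)
    thus "2 / s * (2 * pi\<^sup>2 * h - pi\<^sup>2 * h\<^sup>2 * s\<^sup>2 - c / s) \<le> 2 / s * ?I s"
      using s r0 by (intro mult_left_mono) auto
  qed
  also have "\<dots> \<le> 4 * pi\<^sup>2 * integral Kc (\<lambda>x. (cmod (velo \<theta> x))\<^sup>2)"
    by (rule circ_coeff_square_function[OF cont_velo[OF \<theta>(2)] velo_periodic r0 r])
  also have "\<dots> \<le> 4 * pi\<^sup>2 * integral Kc (\<lambda>x. dens \<epsilon> x / (1 - \<theta>)\<^sup>2)"
    using \<theta> by (intro mult_left_mono integral_le integrable_Kc continuous_intros cont_velo cont_dens \<epsilon> velo_le) auto
  also have "\<dots> = 4 * pi\<^sup>2 * (E / (1 - \<theta>)\<^sup>2)" by (simp add: E_def)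
  finally have main: "G r1 - G r0 \<le> 4 * pi\<^sup>2 * (E / (1 - \<theta>)\<^sup>2)" .
  have "4 * pi\<^sup>2 * (h * ln (r1 / r0) - h\<^sup>2 * r1\<^sup>2 / 4 - c / (2 * pi\<^sup>2 * r0)) \<le> G r1 - G r0"
  proof -
    have "0 \<le> 2 * c / r1" "0 \<le> pi\<^sup>2 * h\<^sup>2 * r0\<^sup>2" using c0 r0 r by auto
    moreover have "4 * pi\<^sup>2 * (c / (2 * pi\<^sup>2 * r0)) = 2 * c / r0" by (simp add: field_simps)
    moreover have ln: "ln (r1 / r0) = ln r1 - ln r0" using r0 r by (simp add: ln_div)
    ultimately show ?thesis unfolding G_def ln by (simp add: algebra_simps)
  qed
  with main have "4 * pi\<^sup>2 * (h * ln (r1 / r0) - h\<^sup>2 * r1\<^sup>2 / 4 - c / (2 * pi\<^sup>2 * r0)) \<le> 4 * pi\<^sup>2 * (E / (1 - \<theta>)\<^sup>2)"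
    by linarith
  hence "h * ln (r1 / r0) - h\<^sup>2 * r1\<^sup>2 / 4 - c / (2 * pi\<^sup>2 * r0) \<le> E / (1 - \<theta>)\<^sup>2"
    by (rule mult_left_le_imp_le) simp
  moreover have "c / (2 * pi\<^sup>2 * r0) = 32 * pi * \<epsilon> / (\<theta>^4 * r0) * E"
    by (simp add: c_def field_simps power2_eq_square power3_eq_cube)
  ultimately show ?thesis unfolding E_def[symmetric] by (simp add: distrib_right)
qed

end

section \<open>Mollification and the lower bound\<close>

definition cutoff :: "real \<Rightarrow> complex \<Rightarrow> complex" where
  "cutoff m z = of_real (m / max m (cmod z)) * z"

lemma cutoff_le: "m > 0 \<Longrightarrow> cmod (cutoff m z) \<le> m"
  by (cases "cmod z \<le> m") (auto simp: cutoff_def norm_mult norm_divide max_def)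

lemma cutoff_id: "cmod z \<le> m \<Longrightarrow> m > 0 \<Longrightarrow> cutoff m z = z"
  by (auto simp: cutoff_def max_def)

lemma cutoff_diff_le:
  assumes "m > 0" shows "cmod (z - cutoff m z) \<le> cmod z"
proof -
  let ?q = "m / max m (cmod z)"
  have q: "0 \<le> ?q" "?q \<le> 1" using assms by (auto simp: divide_le_eq_1)
  have "z - cutoff m z = of_real (1 - ?q) * z" by (simp add: cutoff_def algebra_simps)
  hence "cmod (z - cutoff m z) = (1 - ?q) * cmod z"
    using q by (simp only: norm_mult norm_of_real abs_of_nonneg diff_ge_0_iff_ge)
  also have "\<dots> \<le> 1 * cmod z" using q by (intro mult_right_mono) auto
  finally show ?thesis by simp
qed

lemma continuous_cutoff: "m > 0 \<Longrightarrow> continuous_on S (cutoff m)"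
  unfolding cutoff_def by (intro continuous_intros) (auto simp: max_def)

lemma cutoff_measurable [measurable]: "m > 0 \<Longrightarrow> cutoff m \<in> borel_measurable borel"
  by (intro borel_measurable_continuous_onI continuous_cutoff)

lemma ennreal_norm_diff_sq:
  "ennreal ((cmod (a - c))\<^sup>2) \<le> 2 * ennreal ((cmod (a - b))\<^sup>2) + 2 * ennreal ((cmod (b - c))\<^sup>2)"
proof -
  have "cmod (a - c) \<le> cmod (a - b) + cmod (b - c)" using norm_triangle_ineq[of "a - b" "b - c"] by simp
  hence "(cmod (a - c))\<^sup>2 \<le> (cmod (a - b) + cmod (b - c))\<^sup>2" by (intro power_mono) auto
  also have "\<dots> \<le> 2 * (cmod (a - b))\<^sup>2 + 2 * (cmod (b - c))\<^sup>2"
    using sum_squares_bound[of "cmod (a - b)" "cmod (b - c)"] by (simp add: power2_eq_square algebra_simps)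
  finally have "ennreal ((cmod (a - c))\<^sup>2) \<le> ennreal (2 * (cmod (a - b))\<^sup>2 + 2 * (cmod (b - c))\<^sup>2)"
    by (rule ennreal_leI)
  thus ?thesis by (simp add: ennreal_plus ennreal_mult)
qed

text \<open>A Borel function is an almost everywhere limit of continuous functions, but without a
  dominating function. Truncation of the values at a large radius supplies one: \<open>u\<close> is
  compared with its truncation, and that with the truncated continuous approximants.\<close>

lemma L2_loc_approx_continuous:
  assumes u: "L2_loc u" and S: "compact S" and e: "e > (0::real)"
  shows "\<exists>g. continuous_on UNIV g \<and> (\<integral>\<^sup>+x. ennreal ((cmod (u x - g x))\<^sup>2) * indicator S x \<partial>lborel) < ennreal e"
proof -
  have um [measurable]: "u \<in> borel_measurable borel" and
    uf: "(\<integral>\<^sup>+x. ennreal ((cmod (u x))\<^sup>2) * indicator S x \<partial>lborel) < \<infinity>"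
    using u S by (auto simp: L2_loc_def)
  have Sm [measurable]: "S \<in> sets borel" using S by (simp add: borel_compact)
  have "u \<in> borel_measurable lebesgue" using um by (simp add: measurable_completion)
  hence "u measurable_on UNIV" by (rule lebesgue_measurable_imp_measurable_on) simp
  then obtain N G where N: "negligible N" and G: "\<And>n. continuous_on UNIV (G n)"
    and lim: "\<And>x. x \<notin> N \<Longrightarrow> (\<lambda>n. G n x) \<longlonglongrightarrow> u x"
    by (auto simp: measurable_on_def)
  have AElim: "AE x in lborel. (\<lambda>n. G n x) \<longlonglongrightarrow> u x"
  proof -
    have "AE x in lebesgue. x \<notin> N"
      using N by (intro AE_not_in) (simp add: negligible_iff_null_sets)
    hence "AE x in lborel. x \<notin> N" by (simp add: AE_completion_iff)
    thus ?thesis using lim by auto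
  qed
  have Gm [measurable]: "G n \<in> borel_measurable borel" for n
    by (intro borel_measurable_continuous_onI G)
  let ?T = "\<lambda>m z. cutoff (real (Suc m)) z"
  have "(\<lambda>m. \<integral>\<^sup>+x. ennreal ((cmod (u x - ?T m (u x)))\<^sup>2) * indicator S x \<partial>lborel)
     \<longlonglongrightarrow> (\<integral>\<^sup>+x. 0 \<partial>(lborel :: (real\<times>real) measure))"
  proof (rule nn_integral_dominated_convergence[where w = "\<lambda>x. ennreal ((cmod (u x))\<^sup>2) * indicator S x"])
    show "AE x in lborel. ennreal ((cmod (u x - ?T j (u x)))\<^sup>2) * indicator S x
       \<le> ennreal ((cmod (u x))\<^sup>2) * indicator S x" for j
      by (intro AE_I2 mult_right_mono ennreal_leI power_mono cutoff_diff_le) auto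
    show "AE x in lborel. (\<lambda>m. ennreal ((cmod (u x - ?T m (u x)))\<^sup>2) * indicator S x) \<longlonglongrightarrow> 0"
    proof (intro AE_I2 tendsto_eventually)
      fix x
      obtain n0 :: nat where n0: "cmod (u x) \<le> real n0" using real_arch_simple by blast
      show "\<forall>\<^sub>F m in sequentially. ennreal ((cmod (u x - ?T m (u x)))\<^sup>2) * indicator S x = 0"
        using eventually_ge_at_top[of n0]
      proof eventually_elim
        case (elim m)
        hence "cutoff (real (Suc m)) (u x) = u x" using n0 by (intro cutoff_id) auto
        thus ?case by simp
      qed
    qed
  qed (use uf in auto)
  hence "\<forall>\<^sub>F m in sequentially. (\<integral>\<^sup>+x. ennreal ((cmod (u x - ?T m (u x)))\<^sup>2) * indicator S x \<partial>lborel) < ennreal (e/4)"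
    using e by (intro order_tendstoD) auto
  then obtain m where m: "(\<integral>\<^sup>+x. ennreal ((cmod (u x - ?T m (u x)))\<^sup>2) * indicator S x \<partial>lborel) < ennreal (e/4)"
    by (meson eventually_happens sequentially_bot)
  have mpos: "real (Suc m) > 0" by simp
  note cutoff_measurable[OF mpos, measurable]
  have "(\<lambda>n. \<integral>\<^sup>+x. ennreal ((cmod (?T m (u x) - ?T m (G n x)))\<^sup>2) * indicator S x \<partial>lborel)
     \<longlonglongrightarrow> (\<integral>\<^sup>+x. 0 \<partial>(lborel :: (real\<times>real) measure))"
  proof (rule nn_integral_dominated_convergence[where w = "\<lambda>x. ennreal ((2 * real (Suc m))\<^sup>2) * indicator S x"])
    show "AE x in lborel. ennreal ((cmod (?T m (u x) - ?T m (G j x)))\<^sup>2) * indicator S x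
       \<le> ennreal ((2 * real (Suc m))\<^sup>2) * indicator S x" for j
    proof (intro AE_I2 mult_right_mono ennreal_leI power_mono)
      fix x
      show "cmod (?T m (u x) - ?T m (G j x)) \<le> 2 * real (Suc m)"
        using order_trans[OF norm_triangle_ineq4 add_mono[OF cutoff_le[OF mpos, of "u x"] cutoff_le[OF mpos, of "G j x"]]]
        by simp
    qed auto
    show "AE x in lborel. (\<lambda>n. ennreal ((cmod (?T m (u x) - ?T m (G n x)))\<^sup>2) * indicator S x) \<longlonglongrightarrow> 0"
      using AElim
    proof eventually_elim
      case (elim x)
      have "(\<lambda>n. ?T m (G n x)) \<longlonglongrightarrow> ?T m (u x)"
        by (rule continuous_on_tendsto_compose[OF continuous_cutoff[OF mpos, of UNIV] elim]) auto
      hence "(\<lambda>n. ennreal ((cmod (?T m (u x) - ?T m (G n x)))\<^sup>2) * indicator S x) \<longlonglongrightarrow> ennreal ((cmod (?T m (u x) - ?T m (u x)))\<^sup>2) * indicator S x"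
        by (intro tendsto_mult_ennreal tendsto_ennrealI tendsto_intros) (auto simp: indicator_def)
      thus ?case by simp
    qed
    show "(\<integral>\<^sup>+x. ennreal ((2 * real (Suc m))\<^sup>2) * indicator S x \<partial>lborel) < \<infinity>"
      using emeasure_compact_finite[OF S] by (simp add: nn_integral_cmult_indicator ennreal_mult_less_top)
  qed auto
  hence "\<forall>\<^sub>F n in sequentially. (\<integral>\<^sup>+x. ennreal ((cmod (?T m (u x) - ?T m (G n x)))\<^sup>2) * indicator S x \<partial>lborel) < ennreal (e/4)"
    using e by (intro order_tendstoD) auto
  then obtain n where n: "(\<integral>\<^sup>+x. ennreal ((cmod (?T m (u x) - ?T m (G n x)))\<^sup>2) * indicator S x \<partial>lborel) < ennreal (e/4)"
    by (meson eventually_happens sequentially_bot)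
  let ?g = "\<lambda>x. ?T m (G n x)"
  have "(\<integral>\<^sup>+x. ennreal ((cmod (u x - ?g x))\<^sup>2) * indicator S x \<partial>lborel)
     \<le> (\<integral>\<^sup>+x. 2 * (ennreal ((cmod (u x - ?T m (u x)))\<^sup>2) * indicator S x) + 2 * (ennreal ((cmod (?T m (u x) - ?g x))\<^sup>2) * indicator S x) \<partial>lborel)"
    by (intro nn_integral_mono) (use ennreal_norm_diff_sq in \<open>auto simp: indicator_def\<close>)
  also have "\<dots> = 2 * (\<integral>\<^sup>+x. ennreal ((cmod (u x - ?T m (u x)))\<^sup>2) * indicator S x \<partial>lborel)
     + 2 * (\<integral>\<^sup>+x. ennreal ((cmod (?T m (u x) - ?g x))\<^sup>2) * indicator S x \<partial>lborel)"
    by (subst nn_integral_add) (auto simp: nn_integral_cmult)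
  also have "\<dots> < 2 * ennreal (e/4) + 2 * ennreal (e/4)"
    using m n by (intro add_strict_mono ennreal_mult_strict_left_mono) auto
  also have "\<dots> = ennreal e"
    using ennreal_mult[of 2 "e/4"] ennreal_plus[of "e/2" "e/2"] e by simp
  finally show ?thesis
    by (intro exI[of _ ?g] conjI continuous_on_compose2[OF continuous_cutoff[OF mpos, of UNIV] G subset_UNIV])
qed

section \<open>Integral operators with kernels of bounded range\<close>

definition sq :: "real \<times> real \<Rightarrow> real \<Rightarrow> (real \<times> real) set" where
  "sq x r = cbox (fst x - r, snd x - r) (fst x + r, snd x + r)"

lemma mem_sq: "y \<in> sq x r \<longleftrightarrow> \<bar>fst y - fst x\<bar> \<le> r \<and> \<bar>snd y - snd x\<bar> \<le> r"
  by (cases y) (auto simp: sq_def cbox_Pair_eq abs_le_iff)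

lemma compact_sq [simp]: "compact (sq x r)" by (simp add: sq_def)

lemma sq_borel [measurable]: "sq x r \<in> sets borel" by (simp add: sq_def)

lemma L2_loc_borel: "L2_loc v \<Longrightarrow> v \<in> borel_measurable borel"
  by (simp add: L2_loc_def)

lemma L2_loc_integrable:
  assumes v: "L2_loc v" and S: "compact S"
  shows "integrable lborel (\<lambda>y. indicator S y * cmod (v y) :: real)"
proof (rule integrableI_bounded)
  have [measurable]: "v \<in> borel_measurable borel" "S \<in> sets borel"
    using v S by (auto simp: L2_loc_def borel_compact)
  show "(\<lambda>y. indicator S y * cmod (v y) :: real) \<in> borel_measurable lborel" by measurable
  have "(\<integral>\<^sup>+y. ennreal (norm (indicator S y * cmod (v y) :: real)) \<partial>lborel)
     \<le> (\<integral>\<^sup>+y. ennreal 1 * indicator S y + ennreal ((cmod (v y))\<^sup>2) * indicator S y \<partial>lborel)"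
  proof (rule nn_integral_mono)
    fix y
    have "cmod (v y) \<le> 1 + (cmod (v y))\<^sup>2"
      using zero_le_power2[of "cmod (v y) - 1/2"] by (simp add: power2_eq_square algebra_simps)
    thus "ennreal (norm (indicator S y * cmod (v y) :: real)) \<le> ennreal 1 * indicator S y + ennreal ((cmod (v y))\<^sup>2) * indicator S y"
      by (auto simp: indicator_def ennreal_plus[symmetric] simp del: ennreal_plus ennreal_1 intro!: ennreal_leI)
  qed
  also have "\<dots> = emeasure lborel S + (\<integral>\<^sup>+y. ennreal ((cmod (v y))\<^sup>2) * indicator S y \<partial>lborel)"
    by (subst nn_integral_add) auto
  also have "\<dots> < \<infinity>"
    using v S emeasure_compact_finite[OF S] by (auto simp: L2_loc_def less_top)
  finally show "(\<integral>\<^sup>+y. ennreal (norm (indicator S y * cmod (v y) :: real)) \<partial>lborel) < \<infinity>" .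
qed

lemma kernel_bound:
  fixes k :: "real \<times> real \<Rightarrow> real \<times> real \<Rightarrow> complex"
  assumes k: "continuous_on UNIV (\<lambda>p. k (fst p) (snd p))"
  shows "\<exists>C\<ge>0. \<forall>x\<in>sq x0 r. \<forall>y\<in>sq x0 s. cmod (k x y) \<le> C"
proof -
  have "compact ((\<lambda>p. k (fst p) (snd p)) ` (sq x0 r \<times> sq x0 s))"
    by (rule compact_continuous_image[OF continuous_on_subset[OF k]]) (auto intro: compact_Times)
  from compact_imp_bounded[OF this, unfolded bounded_iff]
  obtain C where "\<forall>z\<in>(\<lambda>p. k (fst p) (snd p)) ` (sq x0 r \<times> sq x0 s). cmod z \<le> C" ..
  hence C: "cmod (k x y) \<le> C" if "x \<in> sq x0 r" "y \<in> sq x0 s" for x y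
    using that by force
  have "cmod (k x y) \<le> max C 0" if "x \<in> sq x0 r" "y \<in> sq x0 s" for x y
    using C[OF that] by simp
  thus ?thesis by (metis max.cobounded2)
qed

locale local_kernel =
  fixes k :: "real \<times> real \<Rightarrow> real \<times> real \<Rightarrow> complex"
  assumes k: "continuous_on UNIV (\<lambda>p. k (fst p) (snd p))"
    and supp: "\<And>x y. y \<notin> sq x 1 \<Longrightarrow> k x y = 0"
begin

definition app :: "(real \<times> real \<Rightarrow> complex) \<Rightarrow> real \<times> real \<Rightarrow> complex" where
  "app v x = (\<integral>y. k x y * v y \<partial>lborel)"

lemma k_y: "continuous_on UNIV (k x)"
proof -
  have "continuous_on UNIV (\<lambda>y. (x, y))" by (intro continuous_intros)
  from continuous_on_compose2[OF k this] show ?thesis by simp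
qed

lemma k_x: "continuous_on UNIV (\<lambda>x. k x y)"
proof -
  have "continuous_on UNIV (\<lambda>x. (x, y))" by (intro continuous_intros)
  from continuous_on_compose2[OF k this] show ?thesis by simp
qed

lemma k_meas [measurable]: "k x \<in> borel_measurable borel"
  by (intro borel_measurable_continuous_onI k_y)

lemma bound: "\<exists>C\<ge>0. \<forall>x\<in>sq x0 1. \<forall>y. cmod (k x y) \<le> C * indicator (sq x0 2) y"
proof -
  obtain C where C: "C \<ge> 0" "\<And>x y. x \<in> sq x0 1 \<Longrightarrow> y \<in> sq x0 2 \<Longrightarrow> cmod (k x y) \<le> C"
    using kernel_bound[OF k, of x0 1 2] by blast
  have "cmod (k x y) \<le> C * indicator (sq x0 2) y" if "x \<in> sq x0 1" for x y
  proof (cases "y \<in> sq x0 2")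
    case True thus ?thesis using C that by auto
  next
    case False
    hence "y \<notin> sq x 1" using that by (auto simp: mem_sq abs_le_iff)
    thus ?thesis using supp False by simp
  qed
  thus ?thesis using C(1) by blast
qed

lemma kv_integrable:
  assumes v: "L2_loc v"
  shows "integrable lborel (\<lambda>y. k x y * v y)"
proof -
  obtain C where C: "C \<ge> 0" "\<And>y. cmod (k x y) \<le> C * indicator (sq x 2) y"
    using bound[of x] by (auto simp: mem_sq)
  have [measurable]: "v \<in> borel_measurable borel" using v by (rule L2_loc_borel)
  show ?thesis
  proof (rule Bochner_Integration.integrable_bound)
    show "integrable lborel (\<lambda>y. C * (indicator (sq x 2) y * cmod (v y)))"
      by (intro integrable_mult_right L2_loc_integrable v) simp
    show "AE y in lborel. norm (k x y * v y) \<le> norm (C * (indicator (sq x 2) y * cmod (v y)))"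
    proof (rule AE_I2)
      fix y
      show "norm (k x y * v y) \<le> norm (C * (indicator (sq x 2) y * cmod (v y)))"
        using mult_right_mono[OF C(2)[of y], of "cmod (v y)"] C(1) by (simp add: norm_mult mult.assoc)
    qed
  qed measurable
qed

lemma app_continuous:
  assumes v: "L2_loc v"
  shows "continuous_on UNIV (app v)"
proof (rule continuous_at_imp_continuous_on, rule ballI)
  fix x0
  have [measurable]: "v \<in> borel_measurable borel" using v by (rule L2_loc_borel)
  obtain C where C: "C \<ge> 0" "\<And>x y. x \<in> sq x0 1 \<Longrightarrow> cmod (k x y) \<le> C * indicator (sq x0 2) y"
    using bound[of x0] by auto
  show "isCont (app v) x0"
    unfolding continuous_at_sequentially
  proof (intro allI impI)
    fix X assume X: "X \<longlonglongrightarrow> x0"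
    have "\<forall>\<^sub>F n in sequentially. dist (X n) x0 < 1" using X by (rule tendstoD) simp
    then obtain n0 where n0: "\<And>n. n \<ge> n0 \<Longrightarrow> dist (X n) x0 < 1" by (auto simp: eventually_sequentially)
    have Xs: "X n \<in> sq x0 1" if "n \<ge> n0" for n
      using n0[OF that] dist_fst_le[of "X n" x0] dist_snd_le[of "X n" x0]
      by (auto simp: mem_sq dist_real_def)
    have "(\<lambda>n. app v (X (n + n0))) \<longlonglongrightarrow> app v x0"
      unfolding app_def
    proof (rule integral_dominated_convergence)
      show "integrable lborel (\<lambda>y. C * (indicator (sq x0 2) y * cmod (v y)))"
        by (intro integrable_mult_right L2_loc_integrable v) simp
      show "AE y in lborel. (\<lambda>n. k (X (n + n0)) y * v y) \<longlonglongrightarrow> k x0 y * v y"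
        using X by (intro AE_I2 tendsto_intros continuous_on_tendsto_compose[OF k_x] LIMSEQ_ignore_initial_segment) auto
      show "AE y in lborel. norm (k (X (n + n0)) y * v y) \<le> C * (indicator (sq x0 2) y * cmod (v y))" for n
      proof (rule AE_I2)
        fix y
        show "norm (k (X (n + n0)) y * v y) \<le> C * (indicator (sq x0 2) y * cmod (v y))"
          using mult_right_mono[OF C(2)[OF Xs[of "n + n0"], of y], of "cmod (v y)"] by (simp add: norm_mult mult.assoc)
      qed
    qed measurable
    hence "(\<lambda>n. app v (X n)) \<longlonglongrightarrow> app v x0" by (rule LIMSEQ_offset)
    thus "(app v \<circ> X) \<longlonglongrightarrow> app v x0" by (simp add: o_def)
  qed
qed

end

text \<open>Differentiation under the integral. The mean value inequality bounds the difference
  quotients of \<open>k\<close> by the supremum of \<open>k'\<close> near \<open>x\<close>, and this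
  provides the dominating function.\<close>

lemma app_vector_derivative:
  assumes k: "local_kernel k" and k': "local_kernel k'" and v: "L2_loc v" and e: "norm e = 1"
    and d: "\<And>x y. ((\<lambda>s. k (x + s *\<^sub>R e) y) has_vector_derivative k' x y) (at 0)"
  shows "((\<lambda>s. local_kernel.app k v (x + s *\<^sub>R e)) has_vector_derivative local_kernel.app k' v x) (at 0)"
proof -
  interpret k: local_kernel k by fact
  interpret k': local_kernel k' by fact
  have [measurable]: "v \<in> borel_measurable borel" using v by (rule L2_loc_borel)
  obtain C where C: "C \<ge> 0" "\<And>z y. z \<in> sq x 1 \<Longrightarrow> cmod (k' z y) \<le> C * indicator (sq x 2) y"
    using k'.bound[of x] by auto
  have d': "((\<lambda>s. k (x + s *\<^sub>R e) y) has_vector_derivative k' (x + s *\<^sub>R e) y) (at s)" for s y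
  proof -
    have "((\<lambda>t. t - s) has_vector_derivative 1) (at s)" by (auto intro!: derivative_eq_intros)
    moreover have "((\<lambda>t. k ((x + s *\<^sub>R e) + t *\<^sub>R e) y) has_vector_derivative k' (x + s *\<^sub>R e) y) (at (s - s))"
      using d[of "x + s *\<^sub>R e" y] by simp
    ultimately have "((\<lambda>t. k ((x + s *\<^sub>R e) + t *\<^sub>R e) y) \<circ> (\<lambda>t. t - s) has_vector_derivative 1 *\<^sub>R k' (x + s *\<^sub>R e) y) (at s)"
      by (rule vector_diff_chain_at)
    thus ?thesis by (simp add: o_def algebra_simps)
  qed
  have xs: "x + s *\<^sub>R e \<in> sq x 1" if "\<bar>s\<bar> \<le> 1" for s
  proof -
    have "norm (s *\<^sub>R e) \<le> 1" using that e by simp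
    moreover have "\<bar>fst (s *\<^sub>R e)\<bar> \<le> norm (s *\<^sub>R e)" "\<bar>snd (s *\<^sub>R e)\<bar> \<le> norm (s *\<^sub>R e)"
      by (metis norm_fst_le norm_snd_le real_norm_def prod.collapse)+
    ultimately show ?thesis by (simp add: mem_sq)
  qed
  have quot: "cmod (k (x + s *\<^sub>R e) y - k x y) \<le> C * indicator (sq x 2) y * \<bar>s\<bar>" if "\<bar>s\<bar> \<le> 1" for s y
  proof -
    have "cmod ((\<lambda>s. k (x + s *\<^sub>R e) y) s - (\<lambda>s. k (x + s *\<^sub>R e) y) 0) \<le> C * indicator (sq x 2) y * norm (s - 0)"
    proof (rule differentiable_bound[where S = "{-1..1}" and f' = "\<lambda>s t. t *\<^sub>R k' (x + s *\<^sub>R e) y"])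
      show "((\<lambda>s. k (x + s *\<^sub>R e) y) has_derivative (\<lambda>s. s *\<^sub>R k' (x + t *\<^sub>R e) y)) (at t within {-1..1})" for t
        using d'[of y t] unfolding has_vector_derivative_def by (rule has_derivative_at_withinI)
      show "onorm (\<lambda>s. s *\<^sub>R k' (x + t *\<^sub>R e) y) \<le> C * indicator (sq x 2) y" if "t \<in> {-1..1}" for t
        using C(2)[OF xs[of t], of y] that
        by (intro onorm_bound) (auto simp: C(1) mult.commute[of "\<bar>_\<bar>"] intro!: mult_right_mono)
    qed (use that in auto)
    thus ?thesis by simp
  qed
  define Q where "Q = (\<lambda>s y. inverse \<bar>s\<bar> *\<^sub>R (k (x + s *\<^sub>R e) y - k x y - s *\<^sub>R k' x y))"
  have Qlim: "((\<lambda>s. Q s y) \<longlongrightarrow> 0) (at 0)" for y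
  proof (rule tendsto_norm_zero_cancel)
    have "(\<lambda>s. norm (k (x + (0 + s) *\<^sub>R e) y - k (x + 0 *\<^sub>R e) y - s *\<^sub>R k' x y) / norm s) \<midarrow>0\<rightarrow> 0"
      using d[of x y] unfolding has_vector_derivative_def has_derivative_at by blast
    thus "((\<lambda>s. norm (Q s y)) \<longlongrightarrow> 0) (at 0)" by (simp add: Q_def divide_inverse mult.commute)
  qed
  have Qb: "cmod (Q s y) \<le> 2 * C * indicator (sq x 2) y" if "\<bar>s\<bar> \<le> 1" "s \<noteq> 0" for s y
  proof -
    have "x \<in> sq x 1" by (simp add: mem_sq)
    hence "cmod (s *\<^sub>R k' x y) \<le> C * indicator (sq x 2) y * \<bar>s\<bar>"
      using mult_left_mono[OF C(2)[of x y], of "\<bar>s\<bar>"] by (simp add: mult_ac)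
    with quot[OF that(1), of y] have "cmod (k (x + s *\<^sub>R e) y - k x y - s *\<^sub>R k' x y) \<le> 2 * C * indicator (sq x 2) y * \<bar>s\<bar>"
      using norm_triangle_ineq4[of "k (x + s *\<^sub>R e) y - k x y" "s *\<^sub>R k' x y"] by linarith
    moreover have "cmod (Q s y) * \<bar>s\<bar> = cmod (k (x + s *\<^sub>R e) y - k x y - s *\<^sub>R k' x y)"
      using that by (simp add: Q_def)
    ultimately have "cmod (Q s y) * \<bar>s\<bar> \<le> (2 * C * indicator (sq x 2) y) * \<bar>s\<bar>" by linarith
    thus ?thesis by (rule mult_right_le_imp_le) (use that in simp)
  qed
  have Qint: "inverse \<bar>s\<bar> *\<^sub>R (k.app v (x + s *\<^sub>R e) - k.app v x - s *\<^sub>R k'.app v x) = (\<integral>y. Q s y * v y \<partial>lborel)" for s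
  proof -
    have "(\<integral>y. Q s y * v y \<partial>lborel) = (\<integral>y. inverse \<bar>s\<bar> *\<^sub>R (k (x + s *\<^sub>R e) y * v y - k x y * v y - s *\<^sub>R (k' x y * v y)) \<partial>lborel)"
      by (intro Bochner_Integration.integral_cong) (auto simp: Q_def algebra_simps)
    also have "\<dots> = inverse \<bar>s\<bar> *\<^sub>R (\<integral>y. k (x + s *\<^sub>R e) y * v y - k x y * v y - s *\<^sub>R (k' x y * v y) \<partial>lborel)"
      by (rule integral_scaleR_right)
    also have "(\<integral>y. k (x + s *\<^sub>R e) y * v y - k x y * v y - s *\<^sub>R (k' x y * v y) \<partial>lborel)
        = (\<integral>y. k (x + s *\<^sub>R e) y * v y - k x y * v y \<partial>lborel) - (\<integral>y. s *\<^sub>R (k' x y * v y) \<partial>lborel)"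
      by (intro Bochner_Integration.integral_diff Bochner_Integration.integrable_diff integrable_scaleR_right k.kv_integrable k'.kv_integrable v)
    also have "(\<integral>y. k (x + s *\<^sub>R e) y * v y - k x y * v y \<partial>lborel) = k.app v (x + s *\<^sub>R e) - k.app v x"
      unfolding k.app_def by (intro Bochner_Integration.integral_diff k.kv_integrable v)
    also have "(\<integral>y. s *\<^sub>R (k' x y * v y) \<partial>lborel) = s *\<^sub>R k'.app v x"
      unfolding k'.app_def by (rule integral_scaleR_right)
    finally show ?thesis by simp
  qed
  have "((\<lambda>s. \<integral>y. Q s y * v y \<partial>lborel) \<longlongrightarrow> 0) (at 0)"
    unfolding LIMSEQ_SEQ_conv[symmetric]
  proof (intro allI impI)
    fix S :: "nat \<Rightarrow> real" assume S: "(\<forall>n. S n \<noteq> 0) \<and> S \<longlonglongrightarrow> 0"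
    have "\<forall>\<^sub>F n in sequentially. dist (S n) 0 < 1" using S by (intro tendstoD) auto
    then obtain n0 where n0: "\<And>n. n \<ge> n0 \<Longrightarrow> \<bar>S n\<bar> < 1" by (auto simp: eventually_sequentially dist_real_def)
    have [measurable]: "(\<lambda>y. Q s y) \<in> borel_measurable borel" for s unfolding Q_def by measurable
    have "(\<lambda>n. \<integral>y. Q (S (n + n0)) y * v y \<partial>lborel) \<longlonglongrightarrow> (\<integral>y. 0 \<partial>(lborel :: (real \<times> real) measure))"
    proof (rule integral_dominated_convergence)
      show "integrable lborel (\<lambda>y. 2 * C * (indicator (sq x 2) y * cmod (v y)))"
        by (intro integrable_mult_right L2_loc_integrable v) simp
      show "AE y in lborel. (\<lambda>n. Q (S (n + n0)) y * v y) \<longlonglongrightarrow> 0"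
      proof (rule AE_I2)
        fix y
        have "(\<lambda>n. Q (S n) y) \<longlonglongrightarrow> 0" using Qlim[of y] S unfolding LIMSEQ_SEQ_conv[symmetric] by blast
        hence "(\<lambda>n. Q (S (n + n0)) y) \<longlonglongrightarrow> 0" by (rule LIMSEQ_ignore_initial_segment)
        thus "(\<lambda>n. Q (S (n + n0)) y * v y) \<longlonglongrightarrow> 0" by (rule tendsto_mult_left_zero)
      qed
      show "AE y in lborel. norm (Q (S (n + n0)) y * v y) \<le> 2 * C * (indicator (sq x 2) y * cmod (v y))" for n
      proof (rule AE_I2)
        fix y
        have "cmod (Q (S (n + n0)) y) \<le> 2 * C * indicator (sq x 2) y"
          using S n0[of "n + n0"] by (intro Qb) auto
        from mult_right_mono[OF this, of "cmod (v y)"]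
        show "norm (Q (S (n + n0)) y * v y) \<le> 2 * C * (indicator (sq x 2) y * cmod (v y))"
          by (simp add: norm_mult mult.assoc)
      qed
    qed measurable
    hence "(\<lambda>n. \<integral>y. Q (S (n + n0)) y * v y \<partial>lborel) \<longlonglongrightarrow> 0" by simp
    thus "(\<lambda>n. \<integral>y. Q (S n) y * v y \<partial>lborel) \<longlonglongrightarrow> 0" by (rule LIMSEQ_offset)
  qed
  hence "((\<lambda>s. norm (inverse \<bar>s\<bar> *\<^sub>R (k.app v (x + s *\<^sub>R e) - k.app v x - s *\<^sub>R k'.app v x))) \<longlongrightarrow> 0) (at 0)"
    unfolding Qint by (rule tendsto_norm_zero)
  thus ?thesis
    unfolding has_vector_derivative_def has_derivative_at
    by (simp add: bounded_linear_scaleR_left divide_inverse mult.commute)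
qed

section \<open>A compactly supported C1 mollifier\<close>

lemma max_sq_deriv: "((\<lambda>s::real. (max 0 s)\<^sup>2) has_real_derivative 2 * max 0 s) (at s)"
proof (cases s "0::real" rule: linorder_cases)
  case greater
  have "((\<lambda>s. s\<^sup>2) has_real_derivative 2 * max 0 s) (at s)"
    using greater by (auto intro!: derivative_eq_intros)
  thus ?thesis
    by (rule has_field_derivative_transform_within_open[where S = "{0<..}"]) (use greater in auto)
next
  case less
  have "((\<lambda>s. 0) has_real_derivative 2 * max 0 s) (at s)"
    using less by (auto intro!: derivative_eq_intros)
  thus ?thesis
    by (rule has_field_derivative_transform_within_open[where S = "{..<0}"]) (use less in auto)
next
  case equal
  have "((\<lambda>y::real. max 0 y) \<longlongrightarrow> max 0 0) (at 0)" by (intro tendsto_intros)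
  moreover have "((max 0 y)\<^sup>2 - (max 0 0)\<^sup>2) / (y - 0) = max 0 y" for y :: real
    by (auto simp: max_def power2_eq_square)
  ultimately show ?thesis using equal by (simp add: has_field_derivative_iff)
qed

text \<open>A truncated polynomial serves because \<open>test_fn\<close> asks for continuous first
  derivatives only; squaring the positive part smooths the corners at 1 and -1.\<close>

definition bump :: "real \<Rightarrow> real" where "bump t = (max 0 (1 - t\<^sup>2))\<^sup>2"
definition bump' :: "real \<Rightarrow> real" where "bump' t = - 4 * t * max 0 (1 - t\<^sup>2)"

lemma bump_deriv: "(bump has_real_derivative bump' t) (at t)"
proof -
  have "((\<lambda>t. 1 - t\<^sup>2) has_real_derivative (- 2 * t)) (at t)" by (auto intro!: derivative_eq_intros)
  from DERIV_chain2[OF max_sq_deriv this] show ?thesis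
    by (simp add: bump_def[abs_def] bump'_def mult_ac)
qed

lemma continuous_bump [continuous_intros]: "continuous_on S f \<Longrightarrow> continuous_on S (\<lambda>x. bump (f x))"
  unfolding bump_def by (intro continuous_intros)

lemma continuous_bump' [continuous_intros]: "continuous_on S f \<Longrightarrow> continuous_on S (\<lambda>x. bump' (f x))"
  unfolding bump'_def by (intro continuous_intros)

lemma bump_nonneg: "0 \<le> bump t" by (simp add: bump_def)

lemma bump_zero: "1 \<le> \<bar>t\<bar> \<Longrightarrow> bump t = 0" "1 \<le> \<bar>t\<bar> \<Longrightarrow> bump' t = 0"
  using power_mono[of 1 "\<bar>t\<bar>" 2] by (auto simp: bump_def bump'_def max_def)

lemma bump_ge: "\<bar>t\<bar> \<le> 1/2 \<Longrightarrow> 1/2 \<le> bump t"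
proof -
  assume "\<bar>t\<bar> \<le> 1/2"
  hence "t\<^sup>2 \<le> (1/2)\<^sup>2" using power_mono[of "\<bar>t\<bar>" "1/2" 2] by simp
  hence "3/4 \<le> max 0 (1 - t\<^sup>2)" by (simp add: power2_eq_square)
  from power_mono[OF this, of 2] show ?thesis by (simp add: bump_def power2_eq_square)
qed

definition rho0 :: "real \<Rightarrow> real \<times> real \<Rightarrow> real" where
  "rho0 \<eta> y = bump (fst y / \<eta>) * bump (snd y / \<eta>)"

definition rho :: "real \<Rightarrow> real \<times> real \<Rightarrow> real" where
  "rho \<eta> y = rho0 \<eta> y / (\<integral>y. rho0 \<eta> y \<partial>lborel)"

text \<open>\<open>rho1\<close> and \<open>rho2\<close> are the partial derivatives of
  \<open>rho\<close>, see \<open>rho_deriv1\<close> and \<open>rho_deriv2\<close>.\<close>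

definition rho1 :: "real \<Rightarrow> real \<times> real \<Rightarrow> real" where
  "rho1 \<eta> y = bump' (fst y / \<eta>) / \<eta> * bump (snd y / \<eta>) / (\<integral>y. rho0 \<eta> y \<partial>lborel)"

definition rho2 :: "real \<Rightarrow> real \<times> real \<Rightarrow> real" where
  "rho2 \<eta> y = bump (fst y / \<eta>) * (bump' (snd y / \<eta>) / \<eta>) / (\<integral>y. rho0 \<eta> y \<partial>lborel)"

context
  fixes \<eta> :: real
  assumes \<eta>: "0 < \<eta>" "\<eta> \<le> 1"
begin

lemma rho0_nonneg: "0 \<le> rho0 \<eta> y" by (simp add: rho0_def bump_nonneg)

lemma rho0_supp: "y \<notin> sq 0 \<eta> \<Longrightarrow> rho0 \<eta> y = 0"
  using \<eta> bump_zero(1)[of "fst y / \<eta>"] bump_zero(1)[of "snd y / \<eta>"]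
  by (auto simp: rho0_def mem_sq)

lemma cont_rho0: "continuous_on S (rho0 \<eta>)"
  unfolding rho0_def using \<eta> by (intro continuous_intros) auto

lemma rho0_integrable: "integrable lborel (rho0 \<eta>)"
proof -
  have "integrable lborel (\<lambda>y. indicator (sq 0 \<eta>) y *\<^sub>R rho0 \<eta> y)"
    using borel_integrable_compact[of "sq 0 \<eta>" "rho0 \<eta>"] cont_rho0 by (simp add: set_integrable_def)
  moreover have "(\<lambda>y. indicator (sq 0 \<eta>) y *\<^sub>R rho0 \<eta> y) = rho0 \<eta>"
    using rho0_supp by (auto simp: indicator_def fun_eq_iff)
  ultimately show ?thesis by (simp only:)
qed

lemma rho0_pos: "(\<integral>y. rho0 \<eta> y \<partial>lborel) > 0"
proof -
  have "0 < (1/4) * measure lborel (sq (0::real\<times>real) (\<eta>/2))"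
    using \<eta> by (simp add: sq_def content_Pair)
  also have "\<dots> = (\<integral>y. (1/4) * indicator (sq 0 (\<eta>/2)) y \<partial>lborel)" by simp
  also have "\<dots> \<le> (\<integral>y. rho0 \<eta> y \<partial>lborel)"
  proof (rule integral_mono)
    show "integrable lborel (\<lambda>y::real\<times>real. (1/4) * indicator (sq 0 (\<eta>/2)) y :: real)"
      using emeasure_compact_finite[OF compact_sq[of 0 "\<eta>/2"]] by (intro integrable_mult_right integrable_real_indicator) auto
    fix y :: "real \<times> real"
    show "(1/4) * indicator (sq 0 (\<eta>/2)) y \<le> rho0 \<eta> y"
    proof (cases "y \<in> sq 0 (\<eta>/2)")
      case True
      hence "\<bar>fst y / \<eta>\<bar> \<le> 1/2" "\<bar>snd y / \<eta>\<bar> \<le> 1/2" using \<eta> by (auto simp: mem_sq field_simps)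
      hence "1/2 * (1/2) \<le> rho0 \<eta> y" unfolding rho0_def by (intro mult_mono bump_ge bump_nonneg) auto
      thus ?thesis using True by simp
    qed (simp add: rho0_nonneg)
  qed (rule rho0_integrable)
  finally show ?thesis .
qed

lemma rho_nonneg: "0 \<le> rho \<eta> y" using rho0_pos rho0_nonneg by (simp add: rho_def)

lemma rho_supp: assumes "y \<notin> sq 0 \<eta>" shows "rho \<eta> y = 0" "rho1 \<eta> y = 0" "rho2 \<eta> y = 0"
  using \<eta> bump_zero[of "fst y / \<eta>"] bump_zero[of "snd y / \<eta>"] rho0_supp[OF assms] assms
  by (auto simp: rho_def rho1_def rho2_def mem_sq)

lemma cont_rho: "continuous_on S (rho \<eta>)" "continuous_on S (rho1 \<eta>)" "continuous_on S (rho2 \<eta>)"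
  unfolding rho_def rho1_def rho2_def using \<eta> rho0_pos
  by (auto intro!: continuous_intros cont_rho0)

lemma rho_integral: "integrable lborel (rho \<eta>)" "(\<integral>y. rho \<eta> y \<partial>lborel) = 1"
  using rho0_integrable rho0_pos by (auto simp: rho_def[abs_def])

lemma rho0_Pair: "rho0 \<eta> (a, b) = bump (a / \<eta>) * bump (b / \<eta>)"
  by (simp add: rho0_def)

lemma rho_deriv1: "((\<lambda>t. rho \<eta> (t, b)) has_real_derivative rho1 \<eta> (a, b)) (at a)"
proof -
  have "((\<lambda>t. bump (t / \<eta>) * bump (b / \<eta>) / c) has_real_derivative (bump' (a / \<eta>) / \<eta> * bump (b / \<eta>) / c)) (at a)"
    if "c \<noteq> 0" for c
    using \<eta> that by (auto intro!: derivative_eq_intros DERIV_chain2[OF bump_deriv] simp: field_simps)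
  thus ?thesis using rho0_pos by (simp add: rho_def rho1_def rho0_Pair)
qed

lemma rho_deriv2: "((\<lambda>t. rho \<eta> (a, t)) has_real_derivative rho2 \<eta> (a, b)) (at b)"
proof -
  have "((\<lambda>t. bump (a / \<eta>) * bump (t / \<eta>) / c) has_real_derivative (bump (a / \<eta>) * (bump' (b / \<eta>) / \<eta>) / c)) (at b)"
    if "c \<noteq> 0" for c
    using \<eta> that by (auto intro!: derivative_eq_intros DERIV_chain2[OF bump_deriv] simp: field_simps)
  thus ?thesis using rho0_pos by (simp add: rho_def rho2_def rho0_Pair)
qed

end

text \<open>The phase is the parallel transport along the segment from \<open>y\<close> to \<open>x\<close>, which makes kernels of the form
  \<open>\<kappa> (x - y) * phase h x y\<close> commute with magnetic translations.\<close>

definition phase :: "real \<Rightarrow> real \<times> real \<Rightarrow> real \<times> real \<Rightarrow> complex" where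
  "phase h x y = cis (- (h / 2) * (fst x * snd y - snd x * fst y))"

lemma continuous_phase [continuous_intros]:
  fixes f g :: "'a::t2_space \<Rightarrow> real \<times> real"
  shows "continuous_on S f \<Longrightarrow> continuous_on S g \<Longrightarrow> continuous_on S (\<lambda>p. phase h (f p) (g p))"
  unfolding phase_def cis_conv_exp by (intro continuous_intros)

definition mk :: "real \<Rightarrow> (real \<times> real \<Rightarrow> real) \<Rightarrow> real \<times> real \<Rightarrow> real \<times> real \<Rightarrow> complex" where
  "mk h \<kappa> x y = of_real (\<kappa> (x - y)) * phase h x y"

lemma local_kernel_weighted:
  assumes \<kappa>: "continuous_on UNIV \<kappa>" and s: "\<And>y. y \<notin> sq 0 1 \<Longrightarrow> \<kappa> y = 0"
    and w: "continuous_on UNIV (\<lambda>p. w (fst p) (snd p))"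
  shows "local_kernel (\<lambda>x y. w x y * mk h \<kappa> x y)"
proof
  show "continuous_on UNIV (\<lambda>p. w (fst p) (snd p) * mk h \<kappa> (fst p) (snd p))"
    unfolding mk_def by (intro continuous_intros w continuous_on_compose2[OF \<kappa>]) auto
  fix x y assume "y \<notin> sq x 1"
  hence "x - y \<notin> sq 0 1" by (auto simp: mem_sq abs_minus_commute)
  thus "w x y * mk h \<kappa> x y = 0" by (simp add: mk_def s)
qed

lemma local_kernel_add: "local_kernel k \<Longrightarrow> local_kernel k' \<Longrightarrow> local_kernel (\<lambda>x y. k x y + k' x y)"
  by (auto simp: local_kernel_def intro!: continuous_intros)

section \<open>Derivatives of the magnetic mollification kernel\<close>

lemma cis_vector_derivative:
  assumes "(f has_real_derivative f') (at t)"
  shows "((\<lambda>t. cis (f t)) has_vector_derivative \<i> * of_real f' * cis (f t)) (at t)"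
proof -
  have "((\<lambda>t. \<i> * of_real (f t)) has_vector_derivative \<i> * of_real f') (at t)"
    using assms
    by (intro has_vector_derivative_mult_right has_vector_derivative_of_real)
       (auto simp flip: has_real_derivative_iff_has_vector_derivative)
  from field_vector_diff_chain_at[OF this DERIV_exp]
  show ?thesis by (simp add: o_def cis_conv_exp)
qed

text \<open>The derivatives of \<open>mk h (rho \<eta>)\<close> in the coordinates of
  \<open>x\<close>, then of \<open>y\<close>. In each of them the second summand comes from the
  phase, which depends on both points.\<close>

definition kx1 where "kx1 h \<eta> x y = mk h (rho1 \<eta>) x y + (- \<i> * of_real (h / 2 * snd y)) * mk h (rho \<eta>) x y"
definition kx2 where "kx2 h \<eta> x y = mk h (rho2 \<eta>) x y + (\<i> * of_real (h / 2 * fst y)) * mk h (rho \<eta>) x y"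
definition ky1 where "ky1 h \<eta> x y = (- 1) * mk h (rho1 \<eta>) x y + (\<i> * of_real (h / 2 * snd x)) * mk h (rho \<eta>) x y"
definition ky2 where "ky2 h \<eta> x y = (- 1) * mk h (rho2 \<eta>) x y + (- \<i> * of_real (h / 2 * fst x)) * mk h (rho \<eta>) x y"

context
  fixes \<eta> h :: real
  assumes \<eta>: "0 < \<eta>" "\<eta> \<le> 1"
begin

lemma rho_supp1: assumes "y \<notin> sq 0 1" shows "rho \<eta> y = 0" "rho1 \<eta> y = 0" "rho2 \<eta> y = 0"
proof -
  have "y \<notin> sq 0 \<eta>" using assms \<eta> by (auto simp: mem_sq)
  thus "rho \<eta> y = 0" "rho1 \<eta> y = 0" "rho2 \<eta> y = 0" using rho_supp[OF \<eta>] by auto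
qed

lemma local_kernels:
  "local_kernel (mk h (rho \<eta>))" "local_kernel (kx1 h \<eta>)" "local_kernel (kx2 h \<eta>)"
  "local_kernel (ky1 h \<eta>)" "local_kernel (ky2 h \<eta>)"
  "local_kernel (mk h (\<lambda>z. fst z * rho \<eta> z))" "local_kernel (mk h (\<lambda>z. snd z * rho \<eta> z))"
proof -
  have K: "local_kernel (\<lambda>x y. w x y * mk h (rho \<eta>) x y)" "local_kernel (\<lambda>x y. w x y * mk h (rho1 \<eta>) x y)"
     "local_kernel (\<lambda>x y. w x y * mk h (rho2 \<eta>) x y)"
    if "continuous_on UNIV (\<lambda>p. w (fst p) (snd p))" for w
    by (intro local_kernel_weighted cont_rho[OF \<eta>] rho_supp1 that; assumption)+
  have K1: "local_kernel (mk h (rho \<eta>))" "local_kernel (mk h (rho1 \<eta>))" "local_kernel (mk h (rho2 \<eta>))"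
    using K[of "\<lambda>_ _. 1"] by auto
  show "local_kernel (mk h (rho \<eta>))" by fact
  show "local_kernel (kx1 h \<eta>)" "local_kernel (kx2 h \<eta>)" "local_kernel (ky1 h \<eta>)" "local_kernel (ky2 h \<eta>)"
    unfolding kx1_def[abs_def] kx2_def[abs_def] ky1_def[abs_def] ky2_def[abs_def]
    by (intro local_kernel_add K K1 continuous_intros)+
  show "local_kernel (mk h (\<lambda>z. fst z * rho \<eta> z))" "local_kernel (mk h (\<lambda>z. snd z * rho \<eta> z))"
  proof -
    have "continuous_on UNIV (\<lambda>z. fst z * rho \<eta> z)" "continuous_on UNIV (\<lambda>z. snd z * rho \<eta> z)"
      by (intro continuous_intros cont_rho[OF \<eta>])+
    from this[THEN local_kernel_weighted[where w = "\<lambda>_ _. 1" and h = h]]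
    show "local_kernel (mk h (\<lambda>z. fst z * rho \<eta> z))" "local_kernel (mk h (\<lambda>z. snd z * rho \<eta> z))"
      by (simp_all add: rho_supp1)
  qed
qed

lemma mk_deriv_x1: "((\<lambda>s. mk h (rho \<eta>) (x + s *\<^sub>R (1, 0)) y) has_vector_derivative kx1 h \<eta> x y) (at 0)"
proof -
  have "((\<lambda>s. rho \<eta> (fst x + s - fst y, snd x - snd y)) has_real_derivative rho1 \<eta> (fst x + 0 - fst y, snd x - snd y) * 1) (at 0)"
    by (rule DERIV_chain2[OF rho_deriv1[OF \<eta>]]) (auto intro!: derivative_eq_intros)
  hence 1: "((\<lambda>s. complex_of_real (rho \<eta> (fst x + s - fst y, snd x - snd y))) has_vector_derivative of_real (rho1 \<eta> (x - y))) (at 0)"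
    by (intro has_vector_derivative_of_real) (simp add: minus_prod_def has_real_derivative_iff_has_vector_derivative)
  have "((\<lambda>s. - (h / 2) * ((fst x + s) * snd y - snd x * fst y)) has_real_derivative (- (h/2) * snd y)) (at 0)"
    by (auto intro!: derivative_eq_intros)
  from has_vector_derivative_mult[OF 1 cis_vector_derivative[OF this]]
  show ?thesis by (simp add: mk_def phase_def kx1_def plus_prod_def minus_prod_def algebra_simps)
qed

lemma mk_deriv_x2: "((\<lambda>s. mk h (rho \<eta>) (x + s *\<^sub>R (0, 1)) y) has_vector_derivative kx2 h \<eta> x y) (at 0)"
proof -
  have "((\<lambda>s. rho \<eta> (fst x - fst y, snd x + s - snd y)) has_real_derivative rho2 \<eta> (fst x - fst y, snd x + 0 - snd y) * 1) (at 0)"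
    by (rule DERIV_chain2[OF rho_deriv2[OF \<eta>]]) (auto intro!: derivative_eq_intros)
  hence 1: "((\<lambda>s. complex_of_real (rho \<eta> (fst x - fst y, snd x + s - snd y))) has_vector_derivative of_real (rho2 \<eta> (x - y))) (at 0)"
    by (intro has_vector_derivative_of_real) (simp add: minus_prod_def has_real_derivative_iff_has_vector_derivative)
  have "((\<lambda>s. - (h / 2) * (fst x * snd y - (snd x + s) * fst y)) has_real_derivative (h/2 * fst y)) (at 0)"
    by (auto intro!: derivative_eq_intros)
  from has_vector_derivative_mult[OF 1 cis_vector_derivative[OF this]]
  show ?thesis by (simp add: mk_def phase_def kx2_def plus_prod_def minus_prod_def algebra_simps)
qed

lemma mk_deriv_y1: "((\<lambda>s. mk h (rho \<eta>) x (y + s *\<^sub>R (1, 0))) has_vector_derivative ky1 h \<eta> x y) (at 0)"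
proof -
  have "((\<lambda>s. rho \<eta> (fst x - (fst y + s), snd x - snd y)) has_real_derivative rho1 \<eta> (fst x - (fst y + 0), snd x - snd y) * (- 1)) (at 0)"
    by (rule DERIV_chain2[OF rho_deriv1[OF \<eta>]]) (auto intro!: derivative_eq_intros)
  hence 1: "((\<lambda>s. complex_of_real (rho \<eta> (fst x - (fst y + s), snd x - snd y))) has_vector_derivative of_real (- rho1 \<eta> (x - y))) (at 0)"
    by (intro has_vector_derivative_of_real) (simp add: minus_prod_def has_real_derivative_iff_has_vector_derivative)
  have "((\<lambda>s. - (h / 2) * (fst x * snd y - snd x * (fst y + s))) has_real_derivative (h/2 * snd x)) (at 0)"
    by (auto intro!: derivative_eq_intros)
  from has_vector_derivative_mult[OF 1 cis_vector_derivative[OF this]]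
  show ?thesis by (simp add: mk_def phase_def ky1_def plus_prod_def minus_prod_def algebra_simps)
qed

lemma mk_deriv_y2: "((\<lambda>s. mk h (rho \<eta>) x (y + s *\<^sub>R (0, 1))) has_vector_derivative ky2 h \<eta> x y) (at 0)"
proof -
  have "((\<lambda>s. rho \<eta> (fst x - fst y, snd x - (snd y + s))) has_real_derivative rho2 \<eta> (fst x - fst y, snd x - (snd y + 0)) * (- 1)) (at 0)"
    by (rule DERIV_chain2[OF rho_deriv2[OF \<eta>]]) (auto intro!: derivative_eq_intros)
  hence 1: "((\<lambda>s. complex_of_real (rho \<eta> (fst x - fst y, snd x - (snd y + s)))) has_vector_derivative of_real (- rho2 \<eta> (x - y))) (at 0)"
    by (intro has_vector_derivative_of_real) (simp add: minus_prod_def has_real_derivative_iff_has_vector_derivative)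
  have "((\<lambda>s. - (h / 2) * (fst x * (snd y + s) - snd x * fst y)) has_real_derivative (- (h/2) * fst x)) (at 0)"
    by (auto intro!: derivative_eq_intros)
  from has_vector_derivative_mult[OF 1 cis_vector_derivative[OF this]]
  show ?thesis by (simp add: mk_def phase_def ky2_def plus_prod_def minus_prod_def algebra_simps)
qed

end

lemma Basis_real_prod: "(Basis :: (real \<times> real) set) = {(1, 0), (0, 1)}"
  by (auto simp: Basis_prod_def)

text \<open>For fixed \<open>x\<close> the kernel can be tested against in \<open>y\<close>, except
  that test functions are real; its real and imaginary parts are used separately. The pairs in the
  hypothesis treat both directions at once.\<close>

lemma weak_pderiv_kernel:
  assumes k: "local_kernel k" and k1: "local_kernel k1" and k2: "local_kernel k2"
    and d1: "\<And>x y. ((\<lambda>s. k x (y + s *\<^sub>R (1, 0))) has_vector_derivative k1 x y) (at 0)"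
    and d2: "\<And>x y. ((\<lambda>s. k x (y + s *\<^sub>R (0, 1))) has_vector_derivative k2 x y) (at 0)"
    and u: "L2_loc u" and g: "L2_loc g" and e: "(e, k') \<in> {((1, 0), k1), ((0, 1), k2)}"
    and w: "weak_pderiv u e g"
  shows "local_kernel.app k' u x = - local_kernel.app k g x"
proof -
  interpret k: local_kernel k by fact
  interpret k1: local_kernel k1 by fact
  interpret k2: local_kernel k2 by fact
  interpret k': local_kernel k' using e k1 k2 by auto
  have d': "((\<lambda>s. k x (y + s *\<^sub>R e)) has_vector_derivative k' x y) (at 0)" for y
    using e d1[of x y] d2[of x y] by auto
  have test: "test_fn (\<lambda>y. P (k x y))" if P: "bounded_linear P" for P :: "complex \<Rightarrow> real"
    unfolding test_fn_def
  proof (intro conjI ballI)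
    have "{y. P (k x y) \<noteq> 0} \<subseteq> sq x 1"
      using k.supp[of _ x] linear_simps(3)[OF P] by force
    thus "bounded {y. P (k x y) \<noteq> 0}" using bounded_subset[OF compact_imp_bounded[OF compact_sq]] by blast
    fix e :: "real \<times> real" assume "e \<in> Basis"
    hence ee: "e = (1, 0) \<or> e = (0, 1)" by (simp add: Basis_real_prod)
    have cP: "continuous_on UNIV (\<lambda>x. P x)" by (rule linear_continuous_on[OF P])
    have dP: "((\<lambda>t. P (f t)) has_real_derivative P f') (at t)" if "(f has_vector_derivative f') (at t)" for f f' t
      using bounded_linear.has_vector_derivative[OF P that] by (simp add: has_real_derivative_iff_has_vector_derivative)
    show "\<exists>d. continuous_on UNIV d \<and> (\<forall>y. ((\<lambda>t. P (k x (y + t *\<^sub>R e))) has_real_derivative d y) (at 0))"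
      using ee
    proof
      assume e: "e = (1, 0)"
      show ?thesis unfolding e
        by (intro exI[of _ "\<lambda>y. P (k1 x y)"] conjI allI dP d1 continuous_on_compose2[OF cP k1.k_y] subset_UNIV)
    next
      assume e: "e = (0, 1)"
      show ?thesis unfolding e
        by (intro exI[of _ "\<lambda>y. P (k2 x y)"] conjI allI dP d2 continuous_on_compose2[OF cP k2.k_y] subset_UNIV)
    qed
  qed
  have ider: "deriv (\<lambda>t. P (k x (y + t *\<^sub>R e))) 0 = P (k' x y)" if P: "bounded_linear P" for P :: "complex \<Rightarrow> real" and y
    using bounded_linear.has_vector_derivative[OF P d'[of y]]
    by (intro DERIV_imp_deriv) (simp add: has_real_derivative_iff_has_vector_derivative)
  have W: "(\<integral>y. u y * complex_of_real (P (k' x y)) \<partial>lborel) = - (\<integral>y. g y * complex_of_real (P (k x y)) \<partial>lborel)"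
    if P: "bounded_linear P" for P :: "complex \<Rightarrow> real"
    using w test[OF P] unfolding weak_pderiv_def ider[OF P, symmetric] by blast
  have int: "integrable lborel (\<lambda>y. v y * complex_of_real (P (q x y)))"
    if "local_kernel q" "L2_loc v" "P = Re \<or> P = Im" for q v P
  proof -
    interpret q: local_kernel q by fact
    have [measurable]: "v \<in> borel_measurable borel" using that by (simp add: L2_loc_borel)
    show ?thesis
    proof (rule Bochner_Integration.integrable_bound[OF q.kv_integrable[OF that(2)]])
      show "AE y in lborel. norm (v y * complex_of_real (P (q x y))) \<le> norm (q x y * v y)"
        using that(3) abs_Re_le_cmod abs_Im_le_cmod
        by (intro AE_I2) (auto simp: norm_mult mult.commute intro!: mult_right_mono mult_left_mono)
      show "(\<lambda>y. v y * complex_of_real (P (q x y))) \<in> borel_measurable lborel"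
        using that(3) by auto
    qed
  qed
  have split: "local_kernel.app q v x = (\<integral>y. v y * complex_of_real (Re (q x y)) \<partial>lborel) + \<i> * (\<integral>y. v y * complex_of_real (Im (q x y)) \<partial>lborel)"
    if q: "local_kernel q" and v: "L2_loc v" for q v
  proof -
    have "local_kernel.app q v x = (\<integral>y. v y * complex_of_real (Re (q x y)) + \<i> * (v y * complex_of_real (Im (q x y))) \<partial>lborel)"
      unfolding local_kernel.app_def[OF q]
      by (intro Bochner_Integration.integral_cong) (auto simp: complex_eq_iff)
    also have "\<dots> = (\<integral>y. v y * complex_of_real (Re (q x y)) \<partial>lborel) + \<i> * (\<integral>y. v y * complex_of_real (Im (q x y)) \<partial>lborel)"
      using int[OF q v] by (subst Bochner_Integration.integral_add) auto
    finally show ?thesis .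
  qed
  show ?thesis
    unfolding split[OF k'.local_kernel_axioms u] split[OF k g]
    by (simp add: W[OF bounded_linear_Re] W[OF bounded_linear_Im])
qed

section \<open>Local L2 functions, and magnetic periodicity of the mollification\<close>

lemma L2_loc_cmult:
  assumes u: "L2_loc u" and w: "continuous_on UNIV w"
  shows "L2_loc (\<lambda>x. w x * u x)"
proof -
  have [measurable]: "u \<in> borel_measurable borel" "w \<in> borel_measurable borel"
    using u w by (auto simp: L2_loc_def intro: borel_measurable_continuous_onI)
  have "(\<integral>\<^sup>+x. ennreal ((cmod (w x * u x))\<^sup>2) * indicator C x \<partial>lborel) < \<infinity>" if C: "compact C" for C
  proof -
    have [measurable]: "C \<in> sets borel" using C by (simp add: borel_compact)
    from compact_imp_bounded[OF compact_continuous_image[OF continuous_on_subset[OF w subset_UNIV] C], unfolded bounded_iff]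
    obtain B where B: "\<And>x. x \<in> C \<Longrightarrow> cmod (w x) \<le> B" by auto
    have "(\<integral>\<^sup>+x. ennreal ((cmod (w x * u x))\<^sup>2) * indicator C x \<partial>lborel)
       \<le> (\<integral>\<^sup>+x. ennreal (B\<^sup>2) * (ennreal ((cmod (u x))\<^sup>2) * indicator C x) \<partial>lborel)"
    proof (rule nn_integral_mono)
      fix x
      show "ennreal ((cmod (w x * u x))\<^sup>2) * indicator C x \<le> ennreal (B\<^sup>2) * (ennreal ((cmod (u x))\<^sup>2) * indicator C x)"
      proof (cases "x \<in> C")
        case True
        have "(cmod (w x * u x))\<^sup>2 \<le> B\<^sup>2 * (cmod (u x))\<^sup>2"
          unfolding norm_mult power_mult_distrib using B[OF True] by (intro mult_right_mono power_mono) auto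
        hence "ennreal ((cmod (w x * u x))\<^sup>2) \<le> ennreal (B\<^sup>2 * (cmod (u x))\<^sup>2)" by (rule ennreal_leI)
        thus ?thesis using True by (simp add: ennreal_mult)
      qed simp
    qed
    also have "\<dots> = ennreal (B\<^sup>2) * (\<integral>\<^sup>+x. ennreal ((cmod (u x))\<^sup>2) * indicator C x \<partial>lborel)"
      by (rule nn_integral_cmult) simp
    also have "\<dots> < \<infinity>" using u C by (simp add: L2_loc_def ennreal_mult_less_top)
    finally show ?thesis .
  qed
  thus ?thesis by (simp add: L2_loc_def)
qed

lemma L2_loc_const: "L2_loc (\<lambda>x. c)"
  using emeasure_compact_finite[where 'a = "real \<times> real"]
  by (auto simp: L2_loc_def nn_integral_cmult_indicator ennreal_mult_less_top borel_compact)

lemma L2_loc_continuous: "continuous_on UNIV g \<Longrightarrow> L2_loc g"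
  using L2_loc_cmult[OF L2_loc_const[of 1], of g] by simp

lemma L2_loc_diff:
  assumes u: "L2_loc u" and v: "L2_loc v" shows "L2_loc (\<lambda>x. u x - v x)"
proof -
  have [measurable]: "u \<in> borel_measurable borel" "v \<in> borel_measurable borel"
    using u v by (auto simp: L2_loc_def)
  have "(\<integral>\<^sup>+x. ennreal ((cmod (u x - v x))\<^sup>2) * indicator C x \<partial>lborel) < \<infinity>" if C: "compact C" for C
  proof -
    have [measurable]: "C \<in> sets borel" using C by (simp add: borel_compact)
    have "(\<integral>\<^sup>+x. ennreal ((cmod (u x - v x))\<^sup>2) * indicator C x \<partial>lborel)
      \<le> (\<integral>\<^sup>+x. 2 * (ennreal ((cmod (u x))\<^sup>2) * indicator C x) + 2 * (ennreal ((cmod (v x))\<^sup>2) * indicator C x) \<partial>lborel)"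
      using ennreal_norm_diff_sq[where b = 0] by (intro nn_integral_mono) (auto simp: indicator_def)
    also have "\<dots> = 2 * (\<integral>\<^sup>+x. ennreal ((cmod (u x))\<^sup>2) * indicator C x \<partial>lborel) + 2 * (\<integral>\<^sup>+x. ennreal ((cmod (v x))\<^sup>2) * indicator C x \<partial>lborel)"
      by (subst nn_integral_add) (auto simp: nn_integral_cmult)
    also have "\<dots> < \<infinity>" using u v C by (simp add: L2_loc_def ennreal_mult_less_top)
    finally show ?thesis .
  qed
  thus ?thesis by (simp add: L2_loc_def)
qed

lemma integral_lborel_shift:
  fixes f :: "real \<times> real \<Rightarrow> complex"
  shows "(\<integral>y. f (y + c) \<partial>lborel) = (\<integral>y. f y \<partial>lborel)"
proof -
  have "(\<integral>y. f y \<partial>lborel) = (\<integral>y. f y \<partial>(distr lborel borel ((+) c)))"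
    by (simp add: lborel_distr_plus)
  also have "\<dots> = (\<integral>y. f (c + y) \<partial>lborel)"
  proof (cases "f \<in> borel_measurable borel")
    case True thus ?thesis by (subst integral_distr) auto
  next
    \<comment> \<open>Neither integrand is measurable, hence both integrals have the default value
      0.\<close>
    case False
    hence "\<not> integrable lborel f" by auto
    moreover have "(\<lambda>y. f (c + y)) \<notin> borel_measurable borel"
    proof
      assume m: "(\<lambda>y. f (c + y)) \<in> borel_measurable borel"
      have "(\<lambda>y. - c + y) \<in> borel_measurable borel" by measurable
      from measurable_compose[OF this m] have "f \<in> borel_measurable borel" by simp
      with False show False by simp
    qed
    hence "\<not> integrable lborel (\<lambda>y. f (c + y))" by auto
    ultimately show ?thesis by (simp add: lborel_distr_plus not_integrable_integral_eq)
  qed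
  finally show ?thesis by (simp add: add.commute)
qed

lemma mollified_periodic:
  assumes "mag_periodic h u" and [measurable]: "u \<in> borel_measurable borel"
    and k: "local_kernel (mk h \<kappa>)"
  shows "local_kernel.app (mk h \<kappa>) u (a + 1, b) = cis (h * b / 2) * local_kernel.app (mk h \<kappa>) u (a, b)"
    and "local_kernel.app (mk h \<kappa>) u (a, b + 1) = cis (- h * a / 2) * local_kernel.app (mk h \<kappa>) u (a, b)"
proof -
  have ae1: "AE y in lborel. u (y + (1, 0)) = cis (h * snd y / 2) * u y"
    and ae2: "AE y in lborel. u (y + (0, 1)) = cis (- h * fst y / 2) * u y"
    using assms by (simp_all add: mag_periodic_def cis_conv_exp plus_prod_def)
  have [measurable]: "mk h \<kappa> x \<in> borel_measurable borel" for x
    by (rule local_kernel.k_meas[OF k])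
  have "local_kernel.app (mk h \<kappa>) u (a + 1, b) = (\<integral>y. mk h \<kappa> (a + 1, b) (y + (1, 0)) * u (y + (1, 0)) \<partial>lborel)"
    unfolding local_kernel.app_def[OF k] by (rule integral_lborel_shift[symmetric])
  also have "\<dots> = (\<integral>y. cis (h * b / 2) * (mk h \<kappa> (a, b) y * u y) \<partial>lborel)"
  proof (rule integral_cong_AE)
    show "AE y in lborel. mk h \<kappa> (a + 1, b) (y + (1, 0)) * u (y + (1, 0)) = cis (h * b / 2) * (mk h \<kappa> (a, b) y * u y)"
      using ae1
    proof eventually_elim
      case (elim y)
      have "phase h (a + 1, b) (y + (1, 0)) * cis (h * snd y / 2) = cis (h * b / 2) * phase h (a, b) y"
        unfolding phase_def cis_mult by (rule arg_cong[where f = cis]) (simp add: field_simps)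
      moreover have "((a + 1, b) - (y + (1, 0))) = (a, b) - y" by (cases y) simp
      moreover have "q * p * (c * w) = d * (q * p' * w)" if "p * c = d * p'" for p p' c d q w :: complex
        using that by (metis mult.assoc mult.commute)
      ultimately show ?case unfolding elim mk_def by (simp only:)
    qed
  qed measurable
  also have "\<dots> = cis (h * b / 2) * local_kernel.app (mk h \<kappa>) u (a, b)"
    unfolding local_kernel.app_def[OF k] by simp
  finally show "local_kernel.app (mk h \<kappa>) u (a + 1, b) = cis (h * b / 2) * local_kernel.app (mk h \<kappa>) u (a, b)" .
  have "local_kernel.app (mk h \<kappa>) u (a, b + 1) = (\<integral>y. mk h \<kappa> (a, b + 1) (y + (0, 1)) * u (y + (0, 1)) \<partial>lborel)"
    unfolding local_kernel.app_def[OF k] by (rule integral_lborel_shift[symmetric])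
  also have "\<dots> = (\<integral>y. cis (- h * a / 2) * (mk h \<kappa> (a, b) y * u y) \<partial>lborel)"
  proof (rule integral_cong_AE)
    show "AE y in lborel. mk h \<kappa> (a, b + 1) (y + (0, 1)) * u (y + (0, 1)) = cis (- h * a / 2) * (mk h \<kappa> (a, b) y * u y)"
      using ae2
    proof eventually_elim
      case (elim y)
      have "phase h (a, b + 1) (y + (0, 1)) * cis (- h * fst y / 2) = cis (- h * a / 2) * phase h (a, b) y"
        unfolding phase_def cis_mult by (rule arg_cong[where f = cis]) (simp add: field_simps)
      moreover have "((a, b + 1) - (y + (0, 1))) = (a, b) - y" by (cases y) simp
      moreover have "q * p * (c * w) = d * (q * p' * w)" if "p * c = d * p'" for p p' c d q w :: complex
        using that by (metis mult.assoc mult.commute)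
      ultimately show ?case unfolding elim mk_def by (simp only:)
    qed
  qed measurable
  also have "\<dots> = cis (- h * a / 2) * local_kernel.app (mk h \<kappa>) u (a, b)"
    unfolding local_kernel.app_def[OF k] by simp
  finally show "local_kernel.app (mk h \<kappa>) u (a, b + 1) = cis (- h * a / 2) * local_kernel.app (mk h \<kappa>) u (a, b)" .
qed

text \<open>The transformation laws of \<open>D1\<close> and \<open>D2\<close> follow from that of
  \<open>U\<close>: when the relation between \<open>U (z + e)\<close> and \<open>U z\<close> is
  differentiated, the derivative of the phase factor cancels the change of the vector potential
  under the translation.\<close>

lemma smooth_magneticI:
  fixes U D1 D2 :: "real \<times> real \<Rightarrow> complex"
  assumes deriv: "\<And>x. (U has_derivative (\<lambda>v. fst v *\<^sub>R (D1 x - \<i> * of_real (h * snd x / 2) * U x)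
      + snd v *\<^sub>R (D2 x + \<i> * of_real (h * fst x / 2) * U x))) (at x)"
    and D1: "continuous_on UNIV D1" and D2: "continuous_on UNIV D2"
    and per1: "\<And>x y. U (x + 1, y) = cis (h * y / 2) * U (x, y)"
    and per2: "\<And>x y. U (x, y + 1) = cis (- h * x / 2) * U (x, y)"
  shows "smooth_magnetic h U D1 D2"
proof
  let ?U1 = "\<lambda>x. D1 x - \<i> * of_real (h * snd x / 2) * U x"
  let ?U2 = "\<lambda>x. D2 x + \<i> * of_real (h * fst x / 2) * U x"
  have shift: "((\<lambda>z. U (z + e)) has_derivative (\<lambda>v. fst v *\<^sub>R ?U1 (x + e) + snd v *\<^sub>R ?U2 (x + e))) (at x)" for x e
    by (rule has_derivative_compose[of "\<lambda>z. z + e" "\<lambda>v. v" x UNIV U, simplified, OF _ deriv])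
       (auto intro!: derivative_eq_intros)
  have cisd: "((\<lambda>z. cis (f z)) has_derivative (\<lambda>v. \<i> * of_real (f v) * cis (f x))) (at x)"
    if "bounded_linear f" for f :: "real \<times> real \<Rightarrow> real" and x
  proof -
    have "((\<lambda>z. exp (\<i> * of_real (f z))) has_derivative (\<lambda>v. exp (\<i> * of_real (f x)) * (\<i> * of_real (f v)))) (at x)"
      by (rule has_derivative_compose[OF _ DERIV_exp[unfolded has_field_derivative_def], where f' = "\<lambda>v. \<i> * of_real (f v)"])
         (intro has_derivative_mult_right has_derivative_of_real bounded_linear_imp_has_derivative that)
    thus ?thesis by (simp add: cis_conv_exp mult_ac)
  qed
  have prod: "((\<lambda>z. cis (f z) * U z) has_derivative
      (\<lambda>v. cis (f x) * (fst v *\<^sub>R ?U1 x + snd v *\<^sub>R ?U2 x) + \<i> * of_real (f v) * cis (f x) * U x)) (at x)"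
    if "bounded_linear f" for f :: "real \<times> real \<Rightarrow> real" and x
    by (rule has_derivative_mult[OF cisd[OF that] deriv])
  fix a b :: real
  show "U (a + 1, b) = cis (h * b / 2) * U (a, b)" "U (a, b + 1) = cis (- h * a / 2) * U (a, b)"
    by (rule per1 per2)+
  let ?x = "(a, b)"
  have bl1: "bounded_linear (\<lambda>z::real\<times>real. h * snd z / 2)" and bl2: "bounded_linear (\<lambda>z::real\<times>real. - h * fst z / 2)"
    using bounded_linear_const_mult[OF bounded_linear_snd, of "h / 2"]
      bounded_linear_const_mult[OF bounded_linear_fst, of "- h / 2"] by simp_all
  have "(\<lambda>z. U (z + (1, 0))) = (\<lambda>z. cis (h * snd z / 2) * U z)"
    using per1 by (auto simp: fun_eq_iff)
  hence "(\<lambda>v. fst v *\<^sub>R ?U1 (?x + (1, 0)) + snd v *\<^sub>R ?U2 (?x + (1, 0))) =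
     (\<lambda>v. cis (h * b / 2) * (fst v *\<^sub>R ?U1 ?x + snd v *\<^sub>R ?U2 ?x) + \<i> * of_real (h * snd v / 2) * cis (h * b / 2) * U ?x)"
    using has_derivative_unique[OF shift[of "(1,0)" ?x]] prod[OF bl1, of ?x] by simp
  from fun_cong[OF this, of "(1, 0)"] fun_cong[OF this, of "(0, 1)"]
  have "D1 (a + 1, b) - \<i> * of_real (h * b / 2) * (cis (h * b / 2) * U (a, b)) = cis (h * b / 2) * (D1 (a, b) - \<i> * of_real (h * b / 2) * U (a, b))"
    "D2 (a + 1, b) + \<i> * of_real (h * (a + 1) / 2) * (cis (h * b / 2) * U (a, b)) = cis (h * b / 2) * (D2 (a, b) + \<i> * of_real (h * a / 2) * U (a, b))
      + \<i> * of_real (h / 2) * cis (h * b / 2) * U (a, b)"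
    by (simp_all add: per1)
  thus "D1 (a + 1, b) = cis (h * b / 2) * D1 (a, b)" "D2 (a + 1, b) = cis (h * b / 2) * D2 (a, b)"
    by (simp_all add: algebra_simps add_divide_distrib)
  have "(\<lambda>z. U (z + (0, 1))) = (\<lambda>z. cis (- h * fst z / 2) * U z)"
    using per2 by (auto simp: fun_eq_iff)
  hence "(\<lambda>v. fst v *\<^sub>R ?U1 (?x + (0, 1)) + snd v *\<^sub>R ?U2 (?x + (0, 1))) =
     (\<lambda>v. cis (- h * a / 2) * (fst v *\<^sub>R ?U1 ?x + snd v *\<^sub>R ?U2 ?x) + \<i> * of_real (- h * fst v / 2) * cis (- h * a / 2) * U ?x)"
    using has_derivative_unique[OF shift[of "(0,1)" ?x]] prod[OF bl2, of ?x] by simp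
  from fun_cong[OF this, of "(1, 0)"] fun_cong[OF this, of "(0, 1)"]
  have "D1 (a, b + 1) - \<i> * of_real (h * (b + 1) / 2) * (cis (- h * a / 2) * U (a, b)) = cis (- h * a / 2) * (D1 (a, b) - \<i> * of_real (h * b / 2) * U (a, b))
      + \<i> * of_real (- h / 2) * cis (- h * a / 2) * U (a, b)"
    "D2 (a, b + 1) + \<i> * of_real (h * a / 2) * (cis (- h * a / 2) * U (a, b)) = cis (- h * a / 2) * (D2 (a, b) + \<i> * of_real (h * a / 2) * U (a, b))"
    by (simp_all add: per2)
  thus "D1 (a, b + 1) = cis (- h * a / 2) * D1 (a, b)" "D2 (a, b + 1) = cis (- h * a / 2) * D2 (a, b)"
    by (simp_all add: algebra_simps add_divide_distrib)
qed (rule deriv D1 D2)+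

lemma has_derivative_real_prod:
  fixes U :: "real \<times> real \<Rightarrow> 'a::real_normed_vector"
  assumes d1: "\<And>x. ((\<lambda>s. U (x + s *\<^sub>R (1, 0))) has_vector_derivative U1 x) (at 0)"
    and d2: "\<And>x. ((\<lambda>s. U (x + s *\<^sub>R (0, 1))) has_vector_derivative U2 x) (at 0)"
    and c: "continuous_on UNIV U2"
  shows "(U has_derivative (\<lambda>v. fst v *\<^sub>R U1 x + snd v *\<^sub>R U2 x)) (at x)"
proof -
  obtain a b where x: "x = (a, b)" by (cases x)
  have sh: "((\<lambda>t. t - c) has_vector_derivative 1) (at c)" for c :: real
    by (auto intro!: derivative_eq_intros)
  have D1: "((\<lambda>s. U (s, b)) has_vector_derivative U1 (a, b)) (at a)"
  proof -
    have "((\<lambda>s. U ((a, b) + s *\<^sub>R (1, 0))) has_vector_derivative U1 (a, b)) (at (a - a))" using d1[of "(a,b)"] by simp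
    from vector_diff_chain_at[OF sh this] show ?thesis by (simp add: o_def)
  qed
  have D2: "((\<lambda>s. U (a, s)) has_vector_derivative U2 (a, b)) (at b)" for a b
  proof -
    have "((\<lambda>s. U ((a, b) + s *\<^sub>R (0, 1))) has_vector_derivative U2 (a, b)) (at (b - b))" using d2[of "(a,b)"] by simp
    from vector_diff_chain_at[OF sh this] show ?thesis by (simp add: o_def)
  qed
  have "((\<lambda>(s, t). U (s, t)) has_derivative (\<lambda>(tx, ty). tx *\<^sub>R U1 (a, b) + blinfun_apply (blinfun_scaleR_left (U2 (a, b))) ty)) (at (a, b) within UNIV \<times> UNIV)"
  proof (rule has_derivative_partialsI)
    show "((\<lambda>s. U (s, b)) has_derivative (\<lambda>tx. tx *\<^sub>R U1 (a, b))) (at a within UNIV)"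
      using D1 by (simp add: has_vector_derivative_def)
    show "((\<lambda>t. U (s, t)) has_derivative blinfun_apply (blinfun_scaleR_left (U2 (s, t)))) (at t within UNIV)" for s t
      using D2[of s t] by (simp add: has_vector_derivative_def)
    have "continuous_on UNIV (\<lambda>p. blinfun_scaleR_left (U2 (fst p, snd p)))"
      by (intro continuous_intros continuous_on_compose2[OF c]) auto
    thus "continuous (at (a, b) within UNIV \<times> UNIV) (\<lambda>(x, y). blinfun_scaleR_left (U2 (x, y)))"
      by (simp add: case_prod_unfold continuous_on_eq_continuous_within)
  qed auto
  thus ?thesis by (simp add: x case_prod_unfold)
qed

definition covd1 where "covd1 h u g1 y = g1 y - \<i> * complex_of_real (h * fst (A0 y)) * u y"
definition covd2 where "covd2 h u g2 y = g2 y - \<i> * complex_of_real (h * snd (A0 y)) * u y"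

lemma L2_loc_covd: "L2_loc u \<Longrightarrow> L2_loc g \<Longrightarrow> L2_loc (covd1 h u g)" "L2_loc u \<Longrightarrow> L2_loc g \<Longrightarrow> L2_loc (covd2 h u g)"
  unfolding covd1_def[abs_def] covd2_def[abs_def] A0_def
  by (intro L2_loc_diff L2_loc_cmult continuous_intros; (assumption | simp))+

definition moll where "moll h \<eta> u = local_kernel.app (mk h (rho \<eta>)) u"
text \<open>First moments of the kernel form the commutator of mollification and covariant
  differentiation, because the vector potential differs between \<open>x\<close> and
  \<open>y\<close>. The kernel lives at distances up to \<open>\<eta>\<close>, so they are of order
  \<open>\<eta>\<close>.\<close>

definition moll1 where "moll1 h \<eta> u = local_kernel.app (mk h (\<lambda>z. fst z * rho \<eta> z)) u"
definition moll2 where "moll2 h \<eta> u = local_kernel.app (mk h (\<lambda>z. snd z * rho \<eta> z)) u"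

lemma integral_lincomb3:
  fixes f g k :: "'a \<Rightarrow> complex"
  assumes "integrable M f" "integrable M g" "integrable M k"
  shows "(\<integral>y. f y + c * g y + d * k y \<partial>M) = (\<integral>y. f y \<partial>M) + c * (\<integral>y. g y \<partial>M) + d * (\<integral>y. k y \<partial>M)"
  using assms by simp

lemma mollified_smooth:
  assumes H: "H1_loc_grad u g1 g2" and per: "mag_periodic h u" and \<eta>: "0 < \<eta>" "\<eta> \<le> 1"
  shows "smooth_magnetic h (moll h \<eta> u)
     (\<lambda>x. moll h \<eta> (covd1 h u g1) x + \<i> * of_real h * moll2 h \<eta> u x)
     (\<lambda>x. moll h \<eta> (covd2 h u g2) x - \<i> * of_real h * moll1 h \<eta> u x)"
proof (rule smooth_magneticI)
  have u: "L2_loc u" and g1: "L2_loc g1" and g2: "L2_loc g2"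
    and w1: "weak_pderiv u (1, 0) g1" and w2: "weak_pderiv u (0, 1) g2"
    using H by (auto simp: H1_loc_grad_def)
  note lk = local_kernels[OF \<eta>, of h]
  have v1: "L2_loc (covd1 h u g1)" and v2: "L2_loc (covd2 h u g2)"
    using L2_loc_covd[OF u] g1 g2 by auto
  let ?k = "mk h (rho \<eta>)"
  have int: "integrable lborel (\<lambda>y. k x y * v y)" if "local_kernel k" "L2_loc v" for k v x
    using local_kernel.kv_integrable[OF that] .
  show "continuous_on UNIV (\<lambda>x. moll h \<eta> (covd1 h u g1) x + \<i> * of_real h * moll2 h \<eta> u x)"
       "continuous_on UNIV (\<lambda>x. moll h \<eta> (covd2 h u g2) x - \<i> * of_real h * moll1 h \<eta> u x)"
    unfolding moll_def moll1_def moll2_def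
    by (intro continuous_intros local_kernel.app_continuous lk v1 v2 u)+
  fix a b
  show "moll h \<eta> u (a + 1, b) = cis (h * b / 2) * moll h \<eta> u (a, b)"
    "moll h \<eta> u (a, b + 1) = cis (- h * a / 2) * moll h \<eta> u (a, b)"
    unfolding moll_def by (intro mollified_periodic per lk L2_loc_borel u)+
  have 1: "local_kernel.app (kx1 h \<eta>) u x = moll h \<eta> (covd1 h u g1) x + \<i> * of_real h * moll2 h \<eta> u x - \<i> * of_real (h * snd x / 2) * moll h \<eta> u x" for x
  proof -
    let ?k2 = "mk h (\<lambda>z. snd z * rho \<eta> z)"
    \<comment> \<open>The bracket has integral 0 by the definition of the weak derivative. Adding it
      cancels the derivatives of \<open>rho\<close> in \<open>kx1\<close> and \<open>ky1\<close>, so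
      that only the phase terms and the weak derivative of \<open>u\<close> remain.\<close>
    have L: "local_kernel.app (kx1 h \<eta>) u x = (\<integral>y. kx1 h \<eta> x y * u y + (ky1 h \<eta> x y * u y + ?k x y * g1 y) \<partial>lborel)"
    proof -
      have "local_kernel.app (ky1 h \<eta>) u x = - local_kernel.app ?k g1 x"
        by (rule weak_pderiv_kernel[OF lk(1,4,5) mk_deriv_y1[OF \<eta>] mk_deriv_y2[OF \<eta>] u g1 _ w1]) simp
      thus ?thesis
        by (subst Bochner_Integration.integral_add, simp add: int lk u)
           (simp_all add: int lk u g1 local_kernel.app_def[OF lk(1)] local_kernel.app_def[OF lk(2)] local_kernel.app_def[OF lk(4)])
    qed
    have R: "moll h \<eta> (covd1 h u g1) x + \<i> * of_real h * moll2 h \<eta> u x - \<i> * of_real (h * snd x / 2) * moll h \<eta> u x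
      = (\<integral>y. ?k x y * covd1 h u g1 y + \<i> * of_real h * (?k2 x y * u y) + (- \<i> * of_real (h * snd x / 2)) * (?k x y * u y) \<partial>lborel)"
      unfolding integral_lincomb3[OF int[OF lk(1) v1] int[OF lk(7) u] int[OF lk(1) u]]
      by (simp add: moll_def moll2_def local_kernel.app_def[OF lk(1)] local_kernel.app_def[OF lk(7)])
    show ?thesis unfolding L R
      by (intro Bochner_Integration.integral_cong refl)
         (simp add: kx1_def ky1_def covd1_def A0_def mk_def field_simps)
  qed
  have 2: "local_kernel.app (kx2 h \<eta>) u x = moll h \<eta> (covd2 h u g2) x - \<i> * of_real h * moll1 h \<eta> u x + \<i> * of_real (h * fst x / 2) * moll h \<eta> u x" for x
  proof -
    let ?k1 = "mk h (\<lambda>z. fst z * rho \<eta> z)"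
    have L: "local_kernel.app (kx2 h \<eta>) u x = (\<integral>y. kx2 h \<eta> x y * u y + (ky2 h \<eta> x y * u y + ?k x y * g2 y) \<partial>lborel)"
    proof -
      have "local_kernel.app (ky2 h \<eta>) u x = - local_kernel.app ?k g2 x"
        by (rule weak_pderiv_kernel[OF lk(1,4,5) mk_deriv_y1[OF \<eta>] mk_deriv_y2[OF \<eta>] u g2 _ w2]) simp
      thus ?thesis
        by (subst Bochner_Integration.integral_add, simp add: int lk u)
           (simp_all add: int lk u g2 local_kernel.app_def[OF lk(1)] local_kernel.app_def[OF lk(3)] local_kernel.app_def[OF lk(5)])
    qed
    have R: "moll h \<eta> (covd2 h u g2) x - \<i> * of_real h * moll1 h \<eta> u x + \<i> * of_real (h * fst x / 2) * moll h \<eta> u x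
      = (\<integral>y. ?k x y * covd2 h u g2 y + (- \<i> * of_real h) * (?k1 x y * u y) + (\<i> * of_real (h * fst x / 2)) * (?k x y * u y) \<partial>lborel)"
      unfolding integral_lincomb3[OF int[OF lk(1) v2] int[OF lk(6) u] int[OF lk(1) u]]
      by (simp add: moll_def moll1_def local_kernel.app_def[OF lk(1)] local_kernel.app_def[OF lk(6)])
    show ?thesis unfolding L R
      by (intro Bochner_Integration.integral_cong refl)
         (simp add: kx2_def ky2_def covd2_def A0_def mk_def field_simps)
  qed
  fix x
  have "(moll h \<eta> u has_derivative (\<lambda>v. fst v *\<^sub>R local_kernel.app (kx1 h \<eta>) u x + snd v *\<^sub>R local_kernel.app (kx2 h \<eta>) u x)) (at x)"
  proof (rule has_derivative_real_prod)
    show "((\<lambda>s. moll h \<eta> u (z + s *\<^sub>R (1, 0))) has_vector_derivative local_kernel.app (kx1 h \<eta>) u z) (at 0)" for z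
      unfolding moll_def by (rule app_vector_derivative[OF lk(1,2) u _ mk_deriv_x1[OF \<eta>]]) simp
    show "((\<lambda>s. moll h \<eta> u (z + s *\<^sub>R (0, 1))) has_vector_derivative local_kernel.app (kx2 h \<eta>) u z) (at 0)" for z
      unfolding moll_def by (rule app_vector_derivative[OF lk(1,3) u _ mk_deriv_x2[OF \<eta>]]) simp
    show "continuous_on UNIV (local_kernel.app (kx2 h \<eta>) u)"
      by (intro local_kernel.app_continuous lk u)
  qed
  thus "(moll h \<eta> u has_derivative (\<lambda>v. fst v *\<^sub>R (moll h \<eta> (covd1 h u g1) x + \<i> * of_real h * moll2 h \<eta> u x - \<i> * of_real (h * snd x / 2) * moll h \<eta> u x)
      + snd v *\<^sub>R (moll h \<eta> (covd2 h u g2) x - \<i> * of_real h * moll1 h \<eta> u x + \<i> * of_real (h * fst x / 2) * moll h \<eta> u x))) (at x)"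
    unfolding 1 2 .
qed

section \<open>L2 estimates for the magnetic mollification\<close>

lemma nn_integral_lborel_reflect_shift:
  fixes f :: "real \<times> real \<Rightarrow> ennreal"
  assumes [measurable]: "f \<in> borel_measurable borel"
  shows "(\<integral>\<^sup>+y. f (x - y) \<partial>lborel) = (\<integral>\<^sup>+y. f y \<partial>lborel)"
proof -
  have "(\<integral>\<^sup>+y. f y \<partial>lborel) = (\<integral>\<^sup>+y. f y \<partial>(density (distr lborel borel (\<lambda>y. x + (- 1) *\<^sub>R y)) (\<lambda>_. ennreal (\<bar>-1\<bar> ^ DIM(real \<times> real)))))"
    by (subst lborel_affine[of "-1" x]) auto
  also have "\<dots> = (\<integral>\<^sup>+y. f (x + (- 1) *\<^sub>R y) \<partial>lborel)"
    by (subst nn_integral_density, simp, simp, subst nn_integral_distr) auto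
  finally show ?thesis by simp
qed

lemma rho_nn_integral:
  assumes \<eta>: "0 < \<eta>" "\<eta> \<le> 1"
  shows "(\<integral>\<^sup>+y. ennreal (rho \<eta> y) \<partial>lborel) = 1"
  using nn_integral_eq_integral[OF rho_integral(1)[OF \<eta>]] rho_nonneg[OF \<eta>] rho_integral(2)[OF \<eta>] by simp

lemma rho_measurable [measurable]: "0 < \<eta> \<Longrightarrow> \<eta> \<le> 1 \<Longrightarrow> rho \<eta> \<in> borel_measurable borel"
  by (intro borel_measurable_continuous_onI cont_rho)

text \<open>Jensen's inequality for the probability density \<open>rho \<eta> (x - y)\<close>; the
  phase disappears in the modulus, and the factor \<open>C\<close> covers the moment
  kernels.\<close>

lemma mollifier_jensen:
  assumes \<eta>: "0 < \<eta>" "\<eta> \<le> 1" and v: "L2_loc v" and k: "local_kernel (mk h \<kappa>)"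
    and le: "\<And>z. \<bar>\<kappa> z\<bar> \<le> C * rho \<eta> z" and C: "C \<ge> 0"
  shows "ennreal ((cmod (local_kernel.app (mk h \<kappa>) v x))\<^sup>2) \<le> ennreal (C\<^sup>2) * (\<integral>\<^sup>+y. ennreal (rho \<eta> (x - y)) * ennreal ((cmod (v y))\<^sup>2) \<partial>lborel)"
proof -
  have [measurable]: "v \<in> borel_measurable borel" "rho \<eta> \<in> borel_measurable borel"
    using v \<eta> by (auto simp: L2_loc_borel)
  interpret kr: local_kernel "mk h (rho \<eta>)" using local_kernels(1)[OF \<eta>] .
  have cm: "cmod (mk h \<kappa> x y) = \<bar>\<kappa> (x - y)\<bar>" for \<kappa> y by (simp add: mk_def phase_def norm_mult)
  have ri: "integrable lborel (\<lambda>y. rho \<eta> (x - y) * cmod (v y))"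
    using Bochner_Integration.integrable_norm[OF kr.kv_integrable[OF v, of x]] rho_nonneg[OF \<eta>]
    by (simp add: norm_mult cm)
  define m where "m = (\<integral>y. rho \<eta> (x - y) * cmod (v y) \<partial>lborel)"
  have m0: "m \<ge> 0" unfolding m_def using rho_nonneg[OF \<eta>] by simp
  have "cmod (local_kernel.app (mk h \<kappa>) v x) \<le> (\<integral>y. cmod (mk h \<kappa> x y * v y) \<partial>lborel)"
    unfolding local_kernel.app_def[OF k] by (rule integral_norm_bound)
  also have "\<dots> \<le> (\<integral>y. C * (rho \<eta> (x - y) * cmod (v y)) \<partial>lborel)"
  proof (rule integral_mono)
    show "integrable lborel (\<lambda>y. cmod (mk h \<kappa> x y * v y))"
      by (intro Bochner_Integration.integrable_norm local_kernel.kv_integrable[OF k v])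
    show "integrable lborel (\<lambda>y. C * (rho \<eta> (x - y) * cmod (v y)))" using ri by simp
    show "cmod (mk h \<kappa> x y * v y) \<le> C * (rho \<eta> (x - y) * cmod (v y))" for y
      using mult_right_mono[OF le[of "x - y"], of "cmod (v y)"] by (simp add: norm_mult cm mult_ac)
  qed
  also have "\<dots> = C * m" by (simp add: m_def)
  finally have "(cmod (local_kernel.app (mk h \<kappa>) v x))\<^sup>2 \<le> (C * m)\<^sup>2" by (intro power_mono) auto
  hence 1: "ennreal ((cmod (local_kernel.app (mk h \<kappa>) v x))\<^sup>2) \<le> ennreal (C\<^sup>2) * ennreal (m\<^sup>2)"
    using ennreal_leI by (fastforce simp: power_mult_distrib ennreal_mult[symmetric])
  let ?I = "\<integral>\<^sup>+y. ennreal (rho \<eta> (x - y)) * ennreal ((cmod (v y))\<^sup>2) \<partial>lborel"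
  \<comment> \<open>The inequality \<open>2 * m * s \<le> s^2 + m^2\<close> at
    \<open>s = cmod (v y)\<close> is integrated against the density; then the finite summand
    \<open>m^2\<close> is cancelled.\<close>
  have "ennreal (2 * m\<^sup>2) = ennreal (2 * m) * ennreal m" using m0 by (simp add: ennreal_mult[symmetric] power2_eq_square)
  also have "ennreal m = (\<integral>\<^sup>+y. ennreal (rho \<eta> (x - y) * cmod (v y)) \<partial>lborel)"
    unfolding m_def using rho_nonneg[OF \<eta>] by (intro nn_integral_eq_integral[OF ri, symmetric]) auto
  also have "ennreal (2 * m) * \<dots> = (\<integral>\<^sup>+y. ennreal (2 * m) * ennreal (rho \<eta> (x - y) * cmod (v y)) \<partial>lborel)"
    by (rule nn_integral_cmult[symmetric]) measurable
  also have "\<dots> \<le> (\<integral>\<^sup>+y. ennreal (rho \<eta> (x - y)) * ennreal ((cmod (v y))\<^sup>2) + ennreal (m\<^sup>2) * ennreal (rho \<eta> (x - y)) \<partial>lborel)"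
  proof (rule nn_integral_mono)
    fix y
    have "2 * m * cmod (v y) \<le> (cmod (v y))\<^sup>2 + m\<^sup>2" using sum_squares_bound[of m "cmod (v y)"] by simp
    hence "rho \<eta> (x - y) * (2 * m * cmod (v y)) \<le> rho \<eta> (x - y) * ((cmod (v y))\<^sup>2 + m\<^sup>2)"
      using rho_nonneg[OF \<eta>] by (intro mult_left_mono) auto
    hence "ennreal (2 * m * (rho \<eta> (x - y) * cmod (v y))) \<le> ennreal (rho \<eta> (x - y) * (cmod (v y))\<^sup>2 + m\<^sup>2 * rho \<eta> (x - y))"
      by (intro ennreal_leI) (simp add: algebra_simps)
    thus "ennreal (2 * m) * ennreal (rho \<eta> (x - y) * cmod (v y)) \<le> ennreal (rho \<eta> (x - y)) * ennreal ((cmod (v y))\<^sup>2) + ennreal (m\<^sup>2) * ennreal (rho \<eta> (x - y))"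
      using rho_nonneg[OF \<eta>] m0 by (simp add: ennreal_mult ennreal_plus)
  qed
  also have "\<dots> = ?I + ennreal (m\<^sup>2) * (\<integral>\<^sup>+y. ennreal (rho \<eta> (x - y)) \<partial>lborel)"
    by (subst nn_integral_add) (auto simp: nn_integral_cmult)
  also have "(\<integral>\<^sup>+y. ennreal (rho \<eta> (x - y)) \<partial>lborel) = 1"
    using nn_integral_lborel_reflect_shift[of "\<lambda>y. ennreal (rho \<eta> y)" x] rho_nn_integral[OF \<eta>] by simp
  finally have "ennreal (m\<^sup>2) + ennreal (m\<^sup>2) \<le> ?I + ennreal (m\<^sup>2)"
    using m0 by (simp add: ennreal_plus[symmetric] del: ennreal_plus)
  hence "ennreal (m\<^sup>2) \<le> ?I" by (simp add: ennreal_add_left_cancel_le add.commute)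
  thus ?thesis using 1 by (meson mult_left_mono order_trans zero_le)
qed

text \<open>Fubini's theorem and total mass 1 enlarge only the domain, by the range of the kernel.
  With \<open>C = 1\<close> the kinetic energy therefore keeps its leading coefficient, and with
  \<open>C = \<eta>\<close> the commutators vanish in the limit.\<close>

lemma mollifier_L2:
  assumes \<eta>: "0 < \<eta>" "\<eta> \<le> 1" and v: "L2_loc v" and k: "local_kernel (mk h \<kappa>)"
    and le: "\<And>z. \<bar>\<kappa> z\<bar> \<le> C * rho \<eta> z" and C: "C \<ge> 0"
  shows "(\<integral>\<^sup>+x. ennreal ((cmod (local_kernel.app (mk h \<kappa>) v x))\<^sup>2) * indicator (sq 0 (1/2)) x \<partial>lborel)
    \<le> ennreal (C\<^sup>2) * (\<integral>\<^sup>+x. ennreal ((cmod (v x))\<^sup>2) * indicator (sq 0 (1/2 + \<eta>)) x \<partial>lborel)"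
proof -
  have [measurable]: "v \<in> borel_measurable borel" "rho \<eta> \<in> borel_measurable borel"
    using v \<eta> by (auto simp: L2_loc_borel)
  have "(\<integral>\<^sup>+x. ennreal ((cmod (local_kernel.app (mk h \<kappa>) v x))\<^sup>2) * indicator (sq 0 (1/2)) x \<partial>lborel)
    \<le> (\<integral>\<^sup>+x. ennreal (C\<^sup>2) * (\<integral>\<^sup>+y. ennreal (rho \<eta> (x - y)) * ennreal ((cmod (v y))\<^sup>2) * indicator (sq 0 (1/2)) x \<partial>lborel) \<partial>lborel)"
    using mollifier_jensen[OF assms] by (intro nn_integral_mono) (auto simp: indicator_def)
  also have "\<dots> = ennreal (C\<^sup>2) * (\<integral>\<^sup>+x. (\<integral>\<^sup>+y. ennreal (rho \<eta> (x - y)) * ennreal ((cmod (v y))\<^sup>2) * indicator (sq 0 (1/2)) x \<partial>lborel) \<partial>lborel)"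
    by (rule nn_integral_cmult) measurable
  also have "(\<integral>\<^sup>+x. (\<integral>\<^sup>+y. ennreal (rho \<eta> (x - y)) * ennreal ((cmod (v y))\<^sup>2) * indicator (sq 0 (1/2)) x \<partial>lborel) \<partial>lborel)
    = (\<integral>\<^sup>+y. (\<integral>\<^sup>+x. ennreal (rho \<eta> (x - y)) * ennreal ((cmod (v y))\<^sup>2) * indicator (sq 0 (1/2)) x \<partial>lborel) \<partial>lborel)"
    by (rule lborel_pair.Fubini'[symmetric]) measurable
  also have "\<dots> \<le> (\<integral>\<^sup>+y. ennreal ((cmod (v y))\<^sup>2) * indicator (sq 0 (1/2 + \<eta>)) y \<partial>lborel)"
  proof (rule nn_integral_mono)
    fix y
    show "(\<integral>\<^sup>+x. ennreal (rho \<eta> (x - y)) * ennreal ((cmod (v y))\<^sup>2) * indicator (sq 0 (1/2)) x \<partial>lborel) \<le> ennreal ((cmod (v y))\<^sup>2) * indicator (sq 0 (1/2 + \<eta>)) y"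
    proof (cases "y \<in> sq 0 (1/2 + \<eta>)")
      case True
      have "(\<integral>\<^sup>+x. ennreal (rho \<eta> (x - y)) * ennreal ((cmod (v y))\<^sup>2) * indicator (sq 0 (1/2)) x \<partial>lborel)
         \<le> (\<integral>\<^sup>+x. ennreal ((cmod (v y))\<^sup>2) * ennreal (rho \<eta> (x - y)) \<partial>lborel)"
        by (intro nn_integral_mono) (auto simp: indicator_def mult.commute)
      also have "\<dots> = ennreal ((cmod (v y))\<^sup>2) * (\<integral>\<^sup>+x. ennreal (rho \<eta> (x - y)) \<partial>lborel)"
        by (rule nn_integral_cmult) measurable
      also have "(\<integral>\<^sup>+x. ennreal (rho \<eta> (x - y)) \<partial>lborel) = (\<integral>\<^sup>+x. ennreal (rho \<eta> (0 - x)) \<partial>lborel)"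
        using nn_integral_lborel_reflect_shift[of "\<lambda>x. ennreal (rho \<eta> (0 - x))" y] by simp
      also have "\<dots> = 1"
        using nn_integral_lborel_reflect_shift[of "\<lambda>y. ennreal (rho \<eta> y)" 0] rho_nn_integral[OF \<eta>] by simp
      finally show ?thesis using True by simp
    next
      case False
      have z: "ennreal (rho \<eta> (x - y)) * ennreal ((cmod (v y))\<^sup>2) * indicator (sq 0 (1/2)) x = 0" for x
      proof (cases "x \<in> sq 0 (1/2)")
        case True
        hence "x - y \<notin> sq 0 \<eta>" using False by (auto simp: mem_sq abs_le_iff)
        thus ?thesis using rho_supp(1)[OF \<eta>] by simp
      qed simp
      show ?thesis unfolding z by simp
    qed
  qed
  finally show ?thesis by (simp add: mult_left_mono)
qed

lemma moll_L2_bounds: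
  assumes \<eta>: "0 < \<eta>" "\<eta> \<le> 1" and v: "L2_loc v"
  shows "(\<integral>\<^sup>+x. ennreal ((cmod (moll h \<eta> v x))\<^sup>2) * indicator (sq 0 (1/2)) x \<partial>lborel)
    \<le> (\<integral>\<^sup>+x. ennreal ((cmod (v x))\<^sup>2) * indicator (sq 0 (1/2 + \<eta>)) x \<partial>lborel)"
   and "(\<integral>\<^sup>+x. ennreal ((cmod (moll1 h \<eta> v x))\<^sup>2) * indicator (sq 0 (1/2)) x \<partial>lborel)
    \<le> ennreal (\<eta>\<^sup>2) * (\<integral>\<^sup>+x. ennreal ((cmod (v x))\<^sup>2) * indicator (sq 0 (1/2 + \<eta>)) x \<partial>lborel)"
   and "(\<integral>\<^sup>+x. ennreal ((cmod (moll2 h \<eta> v x))\<^sup>2) * indicator (sq 0 (1/2)) x \<partial>lborel)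
    \<le> ennreal (\<eta>\<^sup>2) * (\<integral>\<^sup>+x. ennreal ((cmod (v x))\<^sup>2) * indicator (sq 0 (1/2 + \<eta>)) x \<partial>lborel)"
proof -
  note lk = local_kernels[OF \<eta>, of h]
  have le: "\<bar>fst z * rho \<eta> z\<bar> \<le> \<eta> * rho \<eta> z" "\<bar>snd z * rho \<eta> z\<bar> \<le> \<eta> * rho \<eta> z" for z
    using rho_supp(1)[OF \<eta>, of z] rho_nonneg[OF \<eta>, of z]
    by (cases "z \<in> sq 0 \<eta>"; auto simp: abs_mult mem_sq intro!: mult_right_mono)+
  show "(\<integral>\<^sup>+x. ennreal ((cmod (moll h \<eta> v x))\<^sup>2) * indicator (sq 0 (1/2)) x \<partial>lborel)
    \<le> (\<integral>\<^sup>+x. ennreal ((cmod (v x))\<^sup>2) * indicator (sq 0 (1/2 + \<eta>)) x \<partial>lborel)"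
    using mollifier_L2[OF \<eta> v lk(1), of 1] rho_nonneg[OF \<eta>] by (simp add: moll_def)
  show "(\<integral>\<^sup>+x. ennreal ((cmod (moll1 h \<eta> v x))\<^sup>2) * indicator (sq 0 (1/2)) x \<partial>lborel)
    \<le> ennreal (\<eta>\<^sup>2) * (\<integral>\<^sup>+x. ennreal ((cmod (v x))\<^sup>2) * indicator (sq 0 (1/2 + \<eta>)) x \<partial>lborel)"
    unfolding moll1_def using \<eta> by (intro mollifier_L2[OF \<eta> v lk(6)] le) auto
  show "(\<integral>\<^sup>+x. ennreal ((cmod (moll2 h \<eta> v x))\<^sup>2) * indicator (sq 0 (1/2)) x \<partial>lborel)
    \<le> ennreal (\<eta>\<^sup>2) * (\<integral>\<^sup>+x. ennreal ((cmod (v x))\<^sup>2) * indicator (sq 0 (1/2 + \<eta>)) x \<partial>lborel)"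
    unfolding moll2_def using \<eta> by (intro mollifier_L2[OF \<eta> v lk(7)] le) auto
qed

lemma moll_diff:
  assumes \<eta>: "0 < \<eta>" "\<eta> \<le> 1" and "L2_loc u" "L2_loc v"
  shows "moll h \<eta> (\<lambda>x. u x - v x) x = moll h \<eta> u x - moll h \<eta> v x"
  unfolding moll_def local_kernel.app_def[OF local_kernels(1)[OF \<eta>]] right_diff_distrib
  by (intro Bochner_Integration.integral_diff local_kernel.kv_integrable[OF local_kernels(1)[OF \<eta>]] assms)

lemma moll_continuous_close:
  assumes g: "continuous_on UNIV g" and e: "e > (0::real)"
  shows "\<exists>\<eta>0>0. \<eta>0 \<le> 1 \<and> (\<forall>\<eta>. 0 < \<eta> \<longrightarrow> \<eta> \<le> \<eta>0 \<longrightarrow> (\<forall>x\<in>sq 0 (1/2). cmod (moll h \<eta> g x - g x) \<le> e))"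
proof -
  \<comment> \<open>The phase is 1 on the diagonal, so \<open>?F\<close> at \<open>(x, x)\<close> is
    \<open>g x\<close>, and uniform continuity of \<open>?F\<close> handles the phase and
    \<open>g\<close> together.\<close>
  let ?F = "\<lambda>p. phase h (fst p) (snd p) * g (snd p)"
  let ?K = "sq 0 2 \<times> sq 0 2 :: ((real \<times> real) \<times> (real \<times> real)) set"
  have "continuous_on ?K ?F" by (intro continuous_intros continuous_on_compose2[OF g]) auto
  hence "uniformly_continuous_on ?K ?F" by (rule compact_uniformly_continuous) (auto intro: compact_Times)
  from this[unfolded uniformly_continuous_on_def, rule_format, OF e]
  obtain d where d: "d > 0" "\<And>p q. p \<in> ?K \<Longrightarrow> q \<in> ?K \<Longrightarrow> dist q p < d \<Longrightarrow> dist (?F q) (?F p) < e" by blast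
  define \<eta>0 where "\<eta>0 = min 1 (d / 4)"
  have "cmod (moll h \<eta> g x - g x) \<le> e" if \<eta>: "0 < \<eta>" "\<eta> \<le> \<eta>0" and x: "x \<in> sq 0 (1/2)" for \<eta> x
  proof -
    have \<eta>1: "\<eta> \<le> 1" "\<eta> \<le> d / 4" using \<eta> by (auto simp: \<eta>0_def)
    note lk = local_kernels(1)[OF \<eta>(1) \<eta>1(1), of h]
    have rint: "integrable lborel (\<lambda>y. rho \<eta> (x - y))"
      and r1: "(\<integral>y. rho \<eta> (x - y) \<partial>lborel) = 1"
    proof -
      have [measurable]: "rho \<eta> \<in> borel_measurable borel" using \<eta> \<eta>1 by auto
      have n: "(\<integral>\<^sup>+y. ennreal (rho \<eta> (x - y)) \<partial>lborel) = 1"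
        using nn_integral_lborel_reflect_shift[of "\<lambda>y. ennreal (rho \<eta> y)" x] rho_nn_integral[OF \<eta>(1) \<eta>1(1)] by simp
      show "integrable lborel (\<lambda>y. rho \<eta> (x - y))"
        using n rho_nonneg[OF \<eta>(1) \<eta>1(1)] by (intro integrableI_nonneg) auto
      show "(\<integral>y. rho \<eta> (x - y) \<partial>lborel) = 1"
        using n rho_nonneg[OF \<eta>(1) \<eta>1(1)] by (subst integral_eq_nn_integral) auto
    qed
    have i1: "integrable lborel (\<lambda>y. mk h (rho \<eta>) x y * g y)"
      by (rule local_kernel.kv_integrable[OF lk L2_loc_continuous[OF g]])
    have i2: "integrable lborel (\<lambda>y. complex_of_real (rho \<eta> (x - y)) * g x)" using rint by simp
    have "moll h \<eta> g x - g x = (\<integral>y. mk h (rho \<eta>) x y * g y \<partial>lborel) - (\<integral>y. complex_of_real (rho \<eta> (x - y)) * g x \<partial>lborel)"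
      by (simp add: moll_def local_kernel.app_def[OF lk] r1)
    also have "\<dots> = (\<integral>y. mk h (rho \<eta>) x y * g y - complex_of_real (rho \<eta> (x - y)) * g x \<partial>lborel)"
      by (rule Bochner_Integration.integral_diff[OF i1 i2, symmetric])
    also have "cmod \<dots> \<le> (\<integral>y. cmod (mk h (rho \<eta>) x y * g y - complex_of_real (rho \<eta> (x - y)) * g x) \<partial>lborel)"
      by (rule integral_norm_bound)
    also have "\<dots> \<le> (\<integral>y. e * rho \<eta> (x - y) \<partial>lborel)"
    proof (rule integral_mono)
      show "integrable lborel (\<lambda>y. cmod (mk h (rho \<eta>) x y * g y - complex_of_real (rho \<eta> (x - y)) * g x))"
        by (intro Bochner_Integration.integrable_norm Bochner_Integration.integrable_diff i1 i2)
      show "integrable lborel (\<lambda>y. e * rho \<eta> (x - y))" using rint by simp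
      fix y
      show "cmod (mk h (rho \<eta>) x y * g y - complex_of_real (rho \<eta> (x - y)) * g x) \<le> e * rho \<eta> (x - y)"
      proof (cases "x - y \<in> sq 0 \<eta>")
        case True
        have "dist (x, y) (x, x) = norm (x - y)" by (simp add: dist_Pair_Pair dist_norm norm_minus_commute)
        also have "\<dots> \<le> \<bar>fst (x - y)\<bar> + \<bar>snd (x - y)\<bar>" using norm_Pair_le[of "fst (x - y)" "snd (x - y)"] by (simp only: prod.collapse real_norm_def)
        also have "\<dots> < d" using True \<eta>1 d(1) \<eta>(1) by (auto simp: mem_sq)
        finally have "dist (?F (x, y)) (?F (x, x)) < e"
          using True x \<eta>1 by (intro d(2)) (auto simp: mem_sq abs_le_iff)
        hence "cmod (phase h x y * g y - g x) \<le> e" by (simp add: dist_norm phase_def)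
        moreover have "mk h (rho \<eta>) x y * g y - complex_of_real (rho \<eta> (x - y)) * g x = of_real (rho \<eta> (x - y)) * (phase h x y * g y - g x)"
          by (simp add: mk_def algebra_simps)
        ultimately show ?thesis using rho_nonneg[OF \<eta>(1) \<eta>1(1), of "x - y"]
          by (simp add: norm_mult mult.commute[of e] mult_left_mono)
      next
        case False thus ?thesis using rho_supp(1)[OF \<eta>(1) \<eta>1(1)] by (simp add: mk_def)
      qed
    qed
    also have "\<dots> = e" using r1 by simp
    finally show ?thesis .
  qed
  moreover have "\<eta>0 > 0" "\<eta>0 \<le> 1" using d(1) by (auto simp: \<eta>0_def)
  ultimately show ?thesis by blast
qed

lemma moll_measurable: "0 < \<eta> \<Longrightarrow> \<eta> \<le> 1 \<Longrightarrow> L2_loc v \<Longrightarrow> moll h \<eta> v \<in> borel_measurable borel"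
  unfolding moll_def by (intro borel_measurable_continuous_onI local_kernel.app_continuous local_kernels)

lemma moll_converges:
  assumes u: "L2_loc u" and e: "e > (0::real)"
  shows "\<exists>\<eta>0>0. \<eta>0 \<le> 1 \<and> (\<forall>\<eta>. 0 < \<eta> \<longrightarrow> \<eta> \<le> \<eta>0 \<longrightarrow>
     (\<integral>\<^sup>+x. ennreal ((cmod (moll h \<eta> u x - u x))\<^sup>2) * indicator (sq 0 (1/2)) x \<partial>lborel) \<le> ennreal e)"
proof -
  obtain g where g: "continuous_on UNIV g"
    and gu: "(\<integral>\<^sup>+x. ennreal ((cmod (u x - g x))\<^sup>2) * indicator (sq 0 2) x \<partial>lborel) < ennreal (e/10)"
    \<comment> \<open>The three errors below enter with the weights 2, 4 and 4, which add up to
      10.\<close>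
    using L2_loc_approx_continuous[OF u compact_sq, of "e/10" 0 2] e by auto
  have Lg: "L2_loc g" by (rule L2_loc_continuous[OF g])
  have [measurable]: "u \<in> borel_measurable borel" "g \<in> borel_measurable borel"
    using u Lg by (auto simp: L2_loc_borel)
  obtain \<eta>0 where \<eta>0: "\<eta>0 > 0" "\<eta>0 \<le> 1" and close: "\<And>\<eta> x. 0 < \<eta> \<Longrightarrow> \<eta> \<le> \<eta>0 \<Longrightarrow> x \<in> sq 0 (1/2) \<Longrightarrow> cmod (moll h \<eta> g x - g x) \<le> sqrt (e/10)"
    using moll_continuous_close[OF g, of "sqrt (e/10)" h] e by auto
  have "(\<integral>\<^sup>+x. ennreal ((cmod (moll h \<eta> u x - u x))\<^sup>2) * indicator (sq 0 (1/2)) x \<partial>lborel) \<le> ennreal e"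
    if \<eta>': "0 < \<eta>" "\<eta> \<le> \<eta>0" for \<eta>
  proof -
    have \<eta>: "0 < \<eta>" "\<eta> \<le> 1" using \<eta>' \<eta>0 by auto
    note [measurable] = moll_measurable[OF \<eta> u] moll_measurable[OF \<eta> Lg]
    have A: "(\<integral>\<^sup>+x. ennreal ((cmod (moll h \<eta> u x - moll h \<eta> g x))\<^sup>2) * indicator (sq 0 (1/2)) x \<partial>lborel) \<le> ennreal (e/10)"
    proof -
      have "(\<integral>\<^sup>+x. ennreal ((cmod (moll h \<eta> u x - moll h \<eta> g x))\<^sup>2) * indicator (sq 0 (1/2)) x \<partial>lborel)
         \<le> (\<integral>\<^sup>+x. ennreal ((cmod (u x - g x))\<^sup>2) * indicator (sq 0 (1/2 + \<eta>)) x \<partial>lborel)"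
        using moll_L2_bounds(1)[OF \<eta> L2_loc_diff[OF u Lg]] unfolding moll_diff[OF \<eta> u Lg] .
      also have "\<dots> \<le> (\<integral>\<^sup>+x. ennreal ((cmod (u x - g x))\<^sup>2) * indicator (sq 0 2) x \<partial>lborel)"
        using \<eta> by (intro nn_integral_mono mult_left_mono) (auto simp: indicator_def mem_sq)
      finally show ?thesis using gu by simp
    qed
    have B: "(\<integral>\<^sup>+x. ennreal ((cmod (moll h \<eta> g x - g x))\<^sup>2) * indicator (sq 0 (1/2)) x \<partial>lborel) \<le> ennreal (e/10)"
    proof -
      have "(\<integral>\<^sup>+x. ennreal ((cmod (moll h \<eta> g x - g x))\<^sup>2) * indicator (sq 0 (1/2)) x \<partial>lborel)
        \<le> (\<integral>\<^sup>+x. ennreal (e/10) * indicator (sq (0::real\<times>real) (1/2)) x \<partial>lborel)"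
      proof (rule nn_integral_mono)
        fix x
        show "ennreal ((cmod (moll h \<eta> g x - g x))\<^sup>2) * indicator (sq 0 (1/2)) x \<le> ennreal (e/10) * indicator (sq 0 (1/2)) x"
          using power_mono[OF close[OF \<eta>', of x], of 2] e by (auto simp: indicator_def intro!: ennreal_leI)
      qed
      also have "\<dots> = ennreal (e/10)"
        by (simp add: nn_integral_cmult_indicator sq_def emeasure_lborel_cbox_eq content_Pair Basis_real_prod)
      finally show ?thesis .
    qed
    have Cc: "(\<integral>\<^sup>+x. ennreal ((cmod (g x - u x))\<^sup>2) * indicator (sq 0 (1/2)) x \<partial>lborel) \<le> ennreal (e/10)"
    proof -
      have "(\<integral>\<^sup>+x. ennreal ((cmod (g x - u x))\<^sup>2) * indicator (sq 0 (1/2)) x \<partial>lborel)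
        \<le> (\<integral>\<^sup>+x. ennreal ((cmod (u x - g x))\<^sup>2) * indicator (sq 0 2) x \<partial>lborel)"
        by (intro nn_integral_mono) (auto simp: indicator_def mem_sq norm_minus_commute)
      thus ?thesis using gu by simp
    qed
    have "(\<integral>\<^sup>+x. ennreal ((cmod (moll h \<eta> u x - u x))\<^sup>2) * indicator (sq 0 (1/2)) x \<partial>lborel)
      \<le> (\<integral>\<^sup>+x. 2 * (ennreal ((cmod (moll h \<eta> u x - moll h \<eta> g x))\<^sup>2) * indicator (sq 0 (1/2)) x)
          + (4 * (ennreal ((cmod (moll h \<eta> g x - g x))\<^sup>2) * indicator (sq 0 (1/2)) x)
          + 4 * (ennreal ((cmod (g x - u x))\<^sup>2) * indicator (sq 0 (1/2)) x)) \<partial>lborel)"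
    proof (rule nn_integral_mono)
      fix x
      have "ennreal ((cmod (moll h \<eta> u x - u x))\<^sup>2) \<le> 2 * ennreal ((cmod (moll h \<eta> u x - moll h \<eta> g x))\<^sup>2) + 2 * ennreal ((cmod (moll h \<eta> g x - u x))\<^sup>2)"
        by (rule ennreal_norm_diff_sq)
      also have "\<dots> \<le> 2 * ennreal ((cmod (moll h \<eta> u x - moll h \<eta> g x))\<^sup>2) + 2 * (2 * ennreal ((cmod (moll h \<eta> g x - g x))\<^sup>2) + 2 * ennreal ((cmod (g x - u x))\<^sup>2))"
        by (intro add_left_mono mult_left_mono ennreal_norm_diff_sq) auto
      also have "\<dots> = 2 * ennreal ((cmod (moll h \<eta> u x - moll h \<eta> g x))\<^sup>2) + (4 * ennreal ((cmod (moll h \<eta> g x - g x))\<^sup>2) + 4 * ennreal ((cmod (g x - u x))\<^sup>2))"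
        by (simp add: distrib_left mult.assoc[symmetric])
      finally show "ennreal ((cmod (moll h \<eta> u x - u x))\<^sup>2) * indicator (sq 0 (1/2)) x
        \<le> 2 * (ennreal ((cmod (moll h \<eta> u x - moll h \<eta> g x))\<^sup>2) * indicator (sq 0 (1/2)) x)
          + (4 * (ennreal ((cmod (moll h \<eta> g x - g x))\<^sup>2) * indicator (sq 0 (1/2)) x)
          + 4 * (ennreal ((cmod (g x - u x))\<^sup>2) * indicator (sq 0 (1/2)) x))"
        by (auto simp: indicator_def)
    qed
    also have "\<dots> = 2 * (\<integral>\<^sup>+x. ennreal ((cmod (moll h \<eta> u x - moll h \<eta> g x))\<^sup>2) * indicator (sq 0 (1/2)) x \<partial>lborel)
       + (4 * (\<integral>\<^sup>+x. ennreal ((cmod (moll h \<eta> g x - g x))\<^sup>2) * indicator (sq 0 (1/2)) x \<partial>lborel)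
       + 4 * (\<integral>\<^sup>+x. ennreal ((cmod (g x - u x))\<^sup>2) * indicator (sq 0 (1/2)) x \<partial>lborel))"
      by (simp add: nn_integral_add nn_integral_cmult)
    also have "\<dots> \<le> 2 * ennreal (e/10) + (4 * ennreal (e/10) + 4 * ennreal (e/10))"
      using A B Cc by (intro add_mono mult_left_mono) auto
    also have "\<dots> = ennreal e"
    proof -
      have "2 * ennreal (e/10) = ennreal (e/5)" "4 * ennreal (e/10) = ennreal (2*e/5)"
        using ennreal_mult[of 2 "e/10"] ennreal_mult[of 4 "e/10"] e by simp_all
      thus ?thesis using e ennreal_plus[of "e/5" "2*e/5 + 2*e/5"] ennreal_plus[of "2*e/5" "2*e/5"] by simp
    qed
    finally show ?thesis .
  qed
  thus ?thesis using \<eta>0 by blast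
qed

section \<open>Reduction of the lower bound to smooth functions\<close>

lemma Kc_sq: "Kc = sq 0 (1/2)"
  by (simp add: Kc_def sq_def)

lemma AE_K_sq: "AE x in lborel. (indicator K_sq x :: ennreal) = indicator (sq 0 (1/2)) x"
proof -
  have "negligible (sq 0 (1/2) - K_sq)"
    unfolding sq_def K_sq_def using negligible_frontier_interval[of "(-1/2,-1/2)::real\<times>real" "(1/2,1/2)"] by simp
  hence "AE x in lebesgue. x \<notin> sq 0 (1/2) - K_sq"
    by (intro AE_not_in) (simp add: negligible_iff_null_sets)
  hence "AE x in lborel. x \<notin> sq 0 (1/2) - K_sq" by (simp add: AE_completion_iff)
  moreover have "K_sq \<subseteq> sq 0 (1/2)" unfolding sq_def K_sq_def using box_subset_cbox[of "(-1/2,-1/2)::real\<times>real" "(1/2,1/2)"] by simp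
  ultimately show ?thesis by (auto simp: indicator_def elim!: eventually_mono)
qed

lemma integral_Kc_nn:
  fixes f :: "real \<times> real \<Rightarrow> real"
  assumes f: "continuous_on UNIV f" and nn: "\<And>x. f x \<ge> 0"
  shows "ennreal (integral Kc f) = (\<integral>\<^sup>+x. ennreal (f x) * indicator (sq 0 (1/2)) x \<partial>lborel)"
  using nn_integral_has_integral_lebesgue'[of "sq 0 (1/2)" f "integral Kc f"] nn integrable_integral[OF integrable_Kc[OF f]]
  by (simp add: Kc_sq)

lemma E2D_split:
  assumes u: "L2_loc u" and g1: "L2_loc g1" and g2: "L2_loc g2" and \<epsilon>: "\<epsilon> > 0"
  shows "E2D h \<epsilon> u g1 g2 = (\<integral>\<^sup>+x. ennreal ((cmod (covd1 h u g1 x))\<^sup>2) * indicator (sq 0 (1/2)) x \<partial>lborel)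
    + ((\<integral>\<^sup>+x. ennreal ((cmod (covd2 h u g2 x))\<^sup>2) * indicator (sq 0 (1/2)) x \<partial>lborel)
    + (\<integral>\<^sup>+x. ennreal (1 / (2 * \<epsilon>\<^sup>2) * (1 - (cmod (u x))\<^sup>2)\<^sup>2) * indicator (sq 0 (1/2)) x \<partial>lborel))"
proof -
  have [measurable]: "u \<in> borel_measurable borel" "covd1 h u g1 \<in> borel_measurable borel" "covd2 h u g2 \<in> borel_measurable borel"
    using u L2_loc_covd[OF u] g1 g2 by (auto simp: L2_loc_borel)
  have "E2D h \<epsilon> u g1 g2 = (\<integral>\<^sup>+x. ennreal ((cmod (covd1 h u g1 x))\<^sup>2) * indicator (sq 0 (1/2)) x
    + (ennreal ((cmod (covd2 h u g2 x))\<^sup>2) * indicator (sq 0 (1/2)) x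
    + ennreal (1 / (2 * \<epsilon>\<^sup>2) * (1 - (cmod (u x))\<^sup>2)\<^sup>2) * indicator (sq 0 (1/2)) x) \<partial>lborel)"
    unfolding E2D_def
  proof (rule nn_integral_cong_AE)
    show "AE x in lborel. ennreal ((cmod (g1 x - \<i> * complex_of_real (h * fst (A0 x)) * u x))\<^sup>2 +
         (cmod (g2 x - \<i> * complex_of_real (h * snd (A0 x)) * u x))\<^sup>2 + 1 / (2 * \<epsilon>\<^sup>2) * (1 - (cmod (u x))\<^sup>2)\<^sup>2) * indicator K_sq x =
      ennreal ((cmod (covd1 h u g1 x))\<^sup>2) * indicator (sq 0 (1/2)) x
    + (ennreal ((cmod (covd2 h u g2 x))\<^sup>2) * indicator (sq 0 (1/2)) x
    + ennreal (1 / (2 * \<epsilon>\<^sup>2) * (1 - (cmod (u x))\<^sup>2)\<^sup>2) * indicator (sq 0 (1/2)) x)"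
      using AE_K_sq
      by eventually_elim (simp add: covd1_def covd2_def ennreal_plus distrib_right add.assoc)
  qed
  also have "\<dots> = (\<integral>\<^sup>+x. ennreal ((cmod (covd1 h u g1 x))\<^sup>2) * indicator (sq 0 (1/2)) x \<partial>lborel)
    + ((\<integral>\<^sup>+x. ennreal ((cmod (covd2 h u g2 x))\<^sup>2) * indicator (sq 0 (1/2)) x \<partial>lborel)
    + (\<integral>\<^sup>+x. ennreal (1 / (2 * \<epsilon>\<^sup>2) * (1 - (cmod (u x))\<^sup>2)\<^sup>2) * indicator (sq 0 (1/2)) x \<partial>lborel))"
    by (simp add: nn_integral_add)
  finally show ?thesis .
qed

text \<open>The mollified kinetic energy is bounded by an integral over a slightly larger square;
  the excess vanishes as these squares shrink to the closed unit square.\<close>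

lemma L2_enlarged_limit:
  assumes v: "L2_loc v"
  shows "(\<lambda>n. \<integral>\<^sup>+x. ennreal ((cmod (v x))\<^sup>2) * indicator (sq 0 (1/2 + 1 / real (Suc n))) x \<partial>lborel)
    \<longlonglongrightarrow> (\<integral>\<^sup>+x. ennreal ((cmod (v x))\<^sup>2) * indicator (sq 0 (1/2)) x \<partial>lborel)"
proof (rule nn_integral_dominated_convergence[where w = "\<lambda>x. ennreal ((cmod (v x))\<^sup>2) * indicator (sq 0 2) x"])
  have [measurable]: "v \<in> borel_measurable borel" using v by (rule L2_loc_borel)
  show "(\<lambda>x. ennreal ((cmod (v x))\<^sup>2) * indicator (sq 0 (1/2 + 1 / real (Suc n))) x) \<in> borel_measurable lborel" for n
    by measurable
  show "(\<lambda>x. ennreal ((cmod (v x))\<^sup>2) * indicator (sq 0 (1/2)) x) \<in> borel_measurable lborel"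
     "(\<lambda>x. ennreal ((cmod (v x))\<^sup>2) * indicator (sq 0 2) x) \<in> borel_measurable lborel" by measurable
  show "AE x in lborel. ennreal ((cmod (v x))\<^sup>2) * indicator (sq 0 (1/2 + 1 / real (Suc n))) x \<le> ennreal ((cmod (v x))\<^sup>2) * indicator (sq 0 2) x" for n
  proof (intro AE_I2 mult_left_mono)
    fix x
    have "1/2 + 1 / real (Suc n) \<le> 2" by (simp add: field_simps)
    thus "(indicator (sq 0 (1/2 + 1 / real (Suc n))) x :: ennreal) \<le> indicator (sq 0 2) x"
      by (auto simp: indicator_def mem_sq simp del: of_nat_Suc)
  qed auto
  show "(\<integral>\<^sup>+x. ennreal ((cmod (v x))\<^sup>2) * indicator (sq 0 2) x \<partial>lborel) < \<infinity>"
    using v by (simp add: L2_loc_def)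
  show "AE x in lborel. (\<lambda>n. ennreal ((cmod (v x))\<^sup>2) * indicator (sq 0 (1/2 + 1 / real (Suc n))) x) \<longlonglongrightarrow> ennreal ((cmod (v x))\<^sup>2) * indicator (sq 0 (1/2)) x"
  proof (intro AE_I2 tendsto_eventually)
    fix x :: "real \<times> real"
    define d where "d = max \<bar>fst x\<bar> \<bar>snd x\<bar>"
    have m: "x \<in> sq 0 r \<longleftrightarrow> d \<le> r" for r by (auto simp: mem_sq d_def)
    show "\<forall>\<^sub>F n in sequentially. ennreal ((cmod (v x))\<^sup>2) * indicator (sq 0 (1/2 + 1 / real (Suc n))) x = ennreal ((cmod (v x))\<^sup>2) * indicator (sq 0 (1/2)) x"
    proof (cases "d \<le> 1/2")
      case True
      have "x \<in> sq 0 (1/2 + 1 / real (Suc n))" for n unfolding m using True by (simp add: add_increasing2)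
      thus ?thesis using True m[of "1/2"] by (intro always_eventually) simp
    next
      case False
      have "(\<lambda>n. 1 / real (Suc n)) \<longlonglongrightarrow> 0" using LIMSEQ_inverse_real_of_nat by (simp add: inverse_eq_divide)
      hence "\<forall>\<^sub>F n in sequentially. 1 / real (Suc n) < d - 1/2" using False by (intro order_tendstoD) auto
      thus ?thesis by eventually_elim (use False in \<open>simp add: indicator_def m\<close>)
    qed
  qed
qed

text \<open>Young's inequality with a weight: the main term keeps a factor close to 1, and the large
  factor \<open>1 + 1/\<tau>\<close> falls on a term that tends to 0 while \<open>\<tau>\<close> is
  fixed.\<close>

lemma sq_norm_add_le:
  fixes a b :: "'a::real_normed_vector"
  assumes "\<tau> > 0"
  shows "(norm (a + b))\<^sup>2 \<le> (1 + \<tau>) * (norm a)\<^sup>2 + (1 + 1/\<tau>) * (norm b)\<^sup>2"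
proof -
  have "(norm (a + b))\<^sup>2 \<le> (norm a + norm b)\<^sup>2" by (intro power_mono norm_triangle_ineq) auto
  also have "2 * norm a * norm b \<le> \<tau> * (norm a)\<^sup>2 + (1/\<tau>) * (norm b)\<^sup>2"
  proof -
    have "0 \<le> (\<tau> * norm a - norm b)\<^sup>2 / \<tau>" using assms by simp
    also have "\<dots> = \<tau> * (norm a)\<^sup>2 + (1/\<tau>) * (norm b)\<^sup>2 - 2 * norm a * norm b"
      using assms by (simp add: field_simps power2_eq_square)
    finally show ?thesis by simp
  qed
  hence "(norm a + norm b)\<^sup>2 \<le> (1 + \<tau>) * (norm a)\<^sup>2 + (1 + 1/\<tau>) * (norm b)\<^sup>2"
    by (simp add: power2_eq_square algebra_simps)
  finally show ?thesis .
qed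

lemma nn_integral_six:
  assumes [measurable]: "f1 \<in> borel_measurable M" "f2 \<in> borel_measurable M" "f3 \<in> borel_measurable M"
    "f4 \<in> borel_measurable M" "f5 \<in> borel_measurable M" "f6 \<in> borel_measurable M"
  shows "(\<integral>\<^sup>+x. a * (f1 x + (f2 x + f3 x)) + b * (c * (f4 x + f5 x) + d * f6 x) \<partial>M)
    = a * (integral\<^sup>N M f1 + (integral\<^sup>N M f2 + integral\<^sup>N M f3)) + b * (c * (integral\<^sup>N M f4 + integral\<^sup>N M f5) + d * integral\<^sup>N M f6)"
  by (simp add: nn_integral_add nn_integral_cmult)

text \<open>\<open>smooth_lower_bound\<close> is applied to mollifications of \<open>u\<close>. For
  fixed \<open>\<tau>\<close> all terms with the factor \<open>1 + 1/\<tau>\<close> tend to 0 with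
  the mollification parameter, and \<open>\<tau>\<close> tends to 0 afterwards. The potentials of
  \<open>u\<close> and of its mollification are compared pointwise, so convergence in L2 suffices
  although the potential is quartic.\<close>

theorem admissible_lower_bound:
  assumes H: "H1_loc_grad u g1 g2" and per: "mag_periodic h u"
    and \<theta>: "0 < \<theta>" "\<theta> < 1" and \<epsilon>: "0 < \<epsilon>" "\<epsilon> \<le> r0" and r: "r0 \<le> r1"
  shows "ennreal (h * ln (r1 / r0) - h\<^sup>2 * r1\<^sup>2 / 4)
    \<le> ennreal (1 / (1 - \<theta>)\<^sup>2 + 32 * pi * \<epsilon> / (\<theta>^4 * r0)) * E2D h \<epsilon> u g1 g2"
proof (cases "E2D h \<epsilon> u g1 g2 = \<infinity>")
  case True
  have "1 / (1 - \<theta>)\<^sup>2 + 32 * pi * \<epsilon> / (\<theta>^4 * r0) > 0"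
    using \<theta> \<epsilon> by (intro add_pos_nonneg) auto
  thus ?thesis unfolding True by (simp add: ennreal_mult_top)
next
  case False
  have u: "L2_loc u" and g1: "L2_loc g1" and g2: "L2_loc g2"
    using H by (auto simp: H1_loc_grad_def)
  note v1 = L2_loc_covd(1)[OF u g1, of h] and v2 = L2_loc_covd(2)[OF u g2, of h]
  have um [measurable]: "u \<in> borel_measurable borel" using u by (rule L2_loc_borel)
  define c where "c = 1 / (1 - \<theta>)\<^sup>2 + 32 * pi * \<epsilon> / (\<theta>^4 * r0)"
  have c: "c > 0" unfolding c_def using \<theta> \<epsilon> by (intro add_pos_nonneg) auto
  define LB where "LB = h * ln (r1 / r0) - h\<^sup>2 * r1\<^sup>2 / 4"
  define E where "E = E2D h \<epsilon> u g1 g2"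
  define \<eta> where "\<eta> n = 1 / real (Suc n)" for n
  have \<eta>: "0 < \<eta> n" "\<eta> n \<le> 1" for n by (auto simp: \<eta>_def)
  have \<eta>0: "\<eta> \<longlonglongrightarrow> 0" unfolding \<eta>_def using LIMSEQ_inverse_real_of_nat by (simp add: inverse_eq_divide)
  define A1 where "A1 n = (\<integral>\<^sup>+x. ennreal ((cmod (covd1 h u g1 x))\<^sup>2) * indicator (sq 0 (1/2 + \<eta> n)) x \<partial>lborel)" for n
  define A2 where "A2 n = (\<integral>\<^sup>+x. ennreal ((cmod (covd2 h u g2 x))\<^sup>2) * indicator (sq 0 (1/2 + \<eta> n)) x \<partial>lborel)" for n
  define P where "P = (\<integral>\<^sup>+x. ennreal (1 / (2 * \<epsilon>\<^sup>2) * (1 - (cmod (u x))\<^sup>2)\<^sup>2) * indicator (sq 0 (1/2)) x \<partial>lborel)"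
  define B where "B = (\<integral>\<^sup>+x. ennreal ((cmod (u x))\<^sup>2) * indicator (sq 0 2) x \<partial>lborel)"
  have B: "B < \<infinity>" unfolding B_def using u by (simp add: L2_loc_def)
  define q where "q n = (\<integral>\<^sup>+x. ennreal ((cmod (moll h (\<eta> n) u x - u x))\<^sup>2) * indicator (sq 0 (1/2)) x \<partial>lborel)" for n
  have q: "q \<longlonglongrightarrow> 0"
  proof (rule order_tendstoI)
    fix a :: ennreal assume "0 < a"
    then obtain b where b: "0 < b" "b < a" using dense by blast
    have bt: "b < top" using b(2) top_greatest by (rule order.strict_trans2)
    define e where "e = enn2real b"
    have "ennreal e = b" unfolding e_def using bt by (rule ennreal_enn2real)
    moreover have "e > 0" unfolding e_def using b(1) bt by (simp add: enn2real_positive_iff)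
    ultimately have e: "e > 0" "ennreal e < a" using b by simp_all
    obtain \<eta>0' where e0: "\<eta>0' > 0" and e1: "\<And>\<eta>'. 0 < \<eta>' \<Longrightarrow> \<eta>' \<le> \<eta>0' \<Longrightarrow>
     (\<integral>\<^sup>+x. ennreal ((cmod (moll h \<eta>' u x - u x))\<^sup>2) * indicator (sq 0 (1/2)) x \<partial>lborel) \<le> ennreal e"
      using moll_converges[OF u e(1), of h] by blast
    have "\<forall>\<^sub>F n in sequentially. \<eta> n < \<eta>0'" using \<eta>0 e0 by (rule order_tendstoD)
    thus "\<forall>\<^sub>F n in sequentially. q n < a"
    proof eventually_elim
      case (elim n)
      thus ?case using e1[OF \<eta>(1)[of n]] e(2) by (auto simp: q_def)
    qed
  qed simp
  have bound: "ennreal LB \<le> ennreal c * (ennreal (1 + \<tau>) * E)" if \<tau>: "\<tau> > 0" for \<tau>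
  proof -
    define R where "R n = ennreal (1 + \<tau>) * (A1 n + (A2 n + P)) + ennreal (1 + 1/\<tau>) *
        (ennreal (h\<^sup>2) * (ennreal ((\<eta> n)\<^sup>2) * B + ennreal ((\<eta> n)\<^sup>2) * B) + ennreal (1 / (2 * \<epsilon>\<^sup>2)) * q n)" for n
    have R: "ennreal LB \<le> ennreal c * R n" for n
    proof -
      let ?U = "moll h (\<eta> n) u"
      let ?V1 = "moll h (\<eta> n) (covd1 h u g1)" and ?V2 = "moll h (\<eta> n) (covd2 h u g2)"
      let ?W1 = "moll1 h (\<eta> n) u" and ?W2 = "moll2 h (\<eta> n) u"
      interpret S: smooth_magnetic h ?U "\<lambda>x. ?V1 x + \<i> * of_real h * ?W2 x" "\<lambda>x. ?V2 x - \<i> * of_real h * ?W1 x"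
        by (rule mollified_smooth[OF H per \<eta>])
      note lk = local_kernels[OF \<eta>, of h n]
      have [measurable]: "?U \<in> borel_measurable borel" "?V1 \<in> borel_measurable borel" "?V2 \<in> borel_measurable borel"
          "?W1 \<in> borel_measurable borel" "?W2 \<in> borel_measurable borel"
        unfolding moll_def moll1_def moll2_def
        by (intro borel_measurable_continuous_onI local_kernel.app_continuous lk u v1 v2)+
      have "LB \<le> c * integral Kc (S.dens \<epsilon>)"
        unfolding LB_def c_def by (rule S.smooth_lower_bound[OF \<theta> \<epsilon> r])
      hence "ennreal LB \<le> ennreal c * ennreal (integral Kc (S.dens \<epsilon>))"
        using c by (simp only: ennreal_mult'[symmetric] less_imp_le ennreal_leI)
      also have "ennreal (integral Kc (S.dens \<epsilon>)) = (\<integral>\<^sup>+x. ennreal (S.dens \<epsilon> x) * indicator (sq 0 (1/2)) x \<partial>lborel)"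
        by (rule integral_Kc_nn[OF S.cont_dens[OF \<epsilon>(1)] S.dens_nonneg])
      also have "\<dots> \<le> (\<integral>\<^sup>+x. ennreal (1 + \<tau>) * (ennreal ((cmod (?V1 x))\<^sup>2) * indicator (sq 0 (1/2)) x
           + (ennreal ((cmod (?V2 x))\<^sup>2) * indicator (sq 0 (1/2)) x + ennreal (1 / (2 * \<epsilon>\<^sup>2) * (1 - (cmod (u x))\<^sup>2)\<^sup>2) * indicator (sq 0 (1/2)) x))
         + ennreal (1 + 1/\<tau>) * (ennreal (h\<^sup>2) * (ennreal ((cmod (?W2 x))\<^sup>2) * indicator (sq 0 (1/2)) x + ennreal ((cmod (?W1 x))\<^sup>2) * indicator (sq 0 (1/2)) x)
           + ennreal (1 / (2 * \<epsilon>\<^sup>2)) * (ennreal ((cmod (?U x - u x))\<^sup>2) * indicator (sq 0 (1/2)) x)) \<partial>lborel)"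
      proof (rule nn_integral_mono)
        fix x
        have 1: "(cmod (?V1 x + \<i> * of_real h * ?W2 x))\<^sup>2 \<le> (1 + \<tau>) * (cmod (?V1 x))\<^sup>2 + (1 + 1/\<tau>) * (h\<^sup>2 * (cmod (?W2 x))\<^sup>2)"
          using sq_norm_add_le[OF \<tau>, of "?V1 x" "\<i> * of_real h * ?W2 x"] by (simp add: norm_mult power_mult_distrib)
        have 2: "(cmod (?V2 x - \<i> * of_real h * ?W1 x))\<^sup>2 \<le> (1 + \<tau>) * (cmod (?V2 x))\<^sup>2 + (1 + 1/\<tau>) * (h\<^sup>2 * (cmod (?W1 x))\<^sup>2)"
          using sq_norm_add_le[OF \<tau>, of "?V2 x" "- (\<i> * of_real h * ?W1 x)"] by (simp add: norm_mult power_mult_distrib)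
        \<comment> \<open>The function \<open>1 - cmod\<close> is Lipschitz with constant 1, and
          \<open>1 - (cmod (u x))^2\<close> has the additional factor \<open>1 + cmod (u x)\<close>,
          which is at least 1.\<close>
        have 3: "(1 - cmod (?U x))\<^sup>2 \<le> (1 + \<tau>) * (1 - (cmod (u x))\<^sup>2)\<^sup>2 + (1 + 1/\<tau>) * (cmod (?U x - u x))\<^sup>2"
        proof -
          have "(1 - cmod (?U x))\<^sup>2 \<le> (1 + \<tau>) * (1 - cmod (u x))\<^sup>2 + (1 + 1/\<tau>) * (cmod (u x) - cmod (?U x))\<^sup>2"
            using sq_norm_add_le[OF \<tau>, of "1 - cmod (u x)" "cmod (u x) - cmod (?U x)"] by simp
          moreover have "(1 - cmod (u x))\<^sup>2 \<le> (1 - (cmod (u x))\<^sup>2)\<^sup>2"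
          proof -
            have "(1 - (cmod (u x))\<^sup>2)\<^sup>2 = (1 - cmod (u x))\<^sup>2 * (1 + cmod (u x))\<^sup>2"
              by (simp add: power2_eq_square algebra_simps)
            moreover have "1 \<le> (1 + cmod (u x))\<^sup>2" by (simp add: one_le_power)
            ultimately show ?thesis by (simp add: mult_le_cancel_left1)
          qed
          moreover have "(cmod (u x) - cmod (?U x))\<^sup>2 \<le> (cmod (?U x - u x))\<^sup>2"
            using norm_triangle_ineq3[of "u x" "?U x"] by (intro abs_le_square_iff[THEN iffD1]) (simp add: norm_minus_commute)
          ultimately show ?thesis
            using \<tau> by (smt (verit, best) mult_left_mono zero_le_divide_1_iff)
        qed
        have "S.dens \<epsilon> x \<le> (1 + \<tau>) * ((cmod (?V1 x))\<^sup>2 + ((cmod (?V2 x))\<^sup>2 + 1 / (2 * \<epsilon>\<^sup>2) * (1 - (cmod (u x))\<^sup>2)\<^sup>2))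
          + (1 + 1/\<tau>) * (h\<^sup>2 * ((cmod (?W2 x))\<^sup>2 + (cmod (?W1 x))\<^sup>2) + 1 / (2 * \<epsilon>\<^sup>2) * (cmod (?U x - u x))\<^sup>2)"
          using add_mono[OF add_mono[OF 1 2] mult_left_mono[OF 3, of "1 / (2 * \<epsilon>\<^sup>2)"]]
          unfolding S.dens_def by (simp add: algebra_simps add_divide_distrib)
        hence "ennreal (S.dens \<epsilon> x) \<le> ennreal ((1 + \<tau>) * ((cmod (?V1 x))\<^sup>2 + ((cmod (?V2 x))\<^sup>2 + 1 / (2 * \<epsilon>\<^sup>2) * (1 - (cmod (u x))\<^sup>2)\<^sup>2))
          + (1 + 1/\<tau>) * (h\<^sup>2 * ((cmod (?W2 x))\<^sup>2 + (cmod (?W1 x))\<^sup>2) + 1 / (2 * \<epsilon>\<^sup>2) * (cmod (?U x - u x))\<^sup>2))"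
          by (rule ennreal_leI)
        also have "\<dots> = ennreal (1 + \<tau>) * (ennreal ((cmod (?V1 x))\<^sup>2)
           + (ennreal ((cmod (?V2 x))\<^sup>2) + ennreal (1 / (2 * \<epsilon>\<^sup>2) * (1 - (cmod (u x))\<^sup>2)\<^sup>2)))
         + ennreal (1 + 1/\<tau>) * (ennreal (h\<^sup>2) * (ennreal ((cmod (?W2 x))\<^sup>2) + ennreal ((cmod (?W1 x))\<^sup>2))
           + ennreal (1 / (2 * \<epsilon>\<^sup>2)) * (ennreal ((cmod (?U x - u x))\<^sup>2)))"
        proof -
          have nn: "0 \<le> (cmod (?V1 x))\<^sup>2" "0 \<le> (cmod (?V2 x))\<^sup>2" "0 \<le> 1 / (2 * \<epsilon>\<^sup>2) * (1 - (cmod (u x))\<^sup>2)\<^sup>2"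
             "0 \<le> (cmod (?W1 x))\<^sup>2" "0 \<le> (cmod (?W2 x))\<^sup>2" "0 \<le> 1 / (2 * \<epsilon>\<^sup>2)" "0 \<le> (cmod (?U x - u x))\<^sup>2" "0 \<le> h\<^sup>2" "0 \<le> 1 + \<tau>" "0 \<le> 1 + 1/\<tau>"
            using \<tau> by simp_all
          show ?thesis
            using nn by (simp only: ennreal_plus ennreal_mult add_nonneg_nonneg mult_nonneg_nonneg)
        qed
        finally show "ennreal (S.dens \<epsilon> x) * indicator (sq 0 (1/2)) x \<le> ennreal (1 + \<tau>) * (ennreal ((cmod (?V1 x))\<^sup>2) * indicator (sq 0 (1/2)) x
           + (ennreal ((cmod (?V2 x))\<^sup>2) * indicator (sq 0 (1/2)) x + ennreal (1 / (2 * \<epsilon>\<^sup>2) * (1 - (cmod (u x))\<^sup>2)\<^sup>2) * indicator (sq 0 (1/2)) x))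
         + ennreal (1 + 1/\<tau>) * (ennreal (h\<^sup>2) * (ennreal ((cmod (?W2 x))\<^sup>2) * indicator (sq 0 (1/2)) x + ennreal ((cmod (?W1 x))\<^sup>2) * indicator (sq 0 (1/2)) x)
           + ennreal (1 / (2 * \<epsilon>\<^sup>2)) * (ennreal ((cmod (?U x - u x))\<^sup>2) * indicator (sq 0 (1/2)) x))"
          by (cases "x \<in> sq 0 (1/2)") simp_all
      qed
      also have "\<dots> = ennreal (1 + \<tau>) * ((\<integral>\<^sup>+x. ennreal ((cmod (?V1 x))\<^sup>2) * indicator (sq 0 (1/2)) x \<partial>lborel)
           + ((\<integral>\<^sup>+x. ennreal ((cmod (?V2 x))\<^sup>2) * indicator (sq 0 (1/2)) x \<partial>lborel) + P))
         + ennreal (1 + 1/\<tau>) * (ennreal (h\<^sup>2) * ((\<integral>\<^sup>+x. ennreal ((cmod (?W2 x))\<^sup>2) * indicator (sq 0 (1/2)) x \<partial>lborel) + (\<integral>\<^sup>+x. ennreal ((cmod (?W1 x))\<^sup>2) * indicator (sq 0 (1/2)) x \<partial>lborel))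
           + ennreal (1 / (2 * \<epsilon>\<^sup>2)) * q n)"
        unfolding P_def q_def
        by (rule nn_integral_six) measurable
      also have "\<dots> \<le> R n"
      proof -
        have BB: "(\<integral>\<^sup>+x. ennreal ((cmod (u x))\<^sup>2) * indicator (sq 0 (1/2 + \<eta> n)) x \<partial>lborel) \<le> B"
          unfolding B_def using \<eta>[of n] by (intro mult_left_mono nn_integral_mono) (auto simp: indicator_def mem_sq)
        show ?thesis unfolding R_def A1_def A2_def
          by (intro add_mono mult_left_mono order_refl moll_L2_bounds(1)[OF \<eta>] v1 v2
              order_trans[OF moll_L2_bounds(2)[OF \<eta> u]] order_trans[OF moll_L2_bounds(3)[OF \<eta> u]] BB) auto
      qed
      finally show ?thesis by (simp add: mult_left_mono)
    qed
    have "(\<lambda>n. ennreal c * R n) \<longlonglongrightarrow> ennreal c * (ennreal (1 + \<tau>) * ((\<integral>\<^sup>+x. ennreal ((cmod (covd1 h u g1 x))\<^sup>2) * indicator (sq 0 (1/2)) x \<partial>lborel)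
      + ((\<integral>\<^sup>+x. ennreal ((cmod (covd2 h u g2 x))\<^sup>2) * indicator (sq 0 (1/2)) x \<partial>lborel) + P))
      + ennreal (1 + 1/\<tau>) * (ennreal (h\<^sup>2) * (ennreal (0\<^sup>2) * B + ennreal (0\<^sup>2) * B) + ennreal (1 / (2 * \<epsilon>\<^sup>2)) * 0))"
      unfolding R_def
    proof (intro tendsto_add ennreal_tendsto_cmult tendsto_const q)
      show "A1 \<longlonglongrightarrow> (\<integral>\<^sup>+x. ennreal ((cmod (covd1 h u g1 x))\<^sup>2) * indicator (sq 0 (1/2)) x \<partial>lborel)"
        unfolding A1_def \<eta>_def by (rule L2_enlarged_limit[OF v1])
      show "A2 \<longlonglongrightarrow> (\<integral>\<^sup>+x. ennreal ((cmod (covd2 h u g2 x))\<^sup>2) * indicator (sq 0 (1/2)) x \<partial>lborel)"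
        unfolding A2_def \<eta>_def by (rule L2_enlarged_limit[OF v2])
      show "(\<lambda>n. ennreal ((\<eta> n)\<^sup>2) * B) \<longlonglongrightarrow> ennreal (0\<^sup>2) * B"
        using ennreal_tendsto_cmult[OF B[unfolded infinity_ennreal_def] tendsto_ennrealI[OF tendsto_power[OF \<eta>0, of 2]]] by (simp only: mult.commute)
      show "(\<lambda>n. ennreal ((\<eta> n)\<^sup>2) * B) \<longlonglongrightarrow> ennreal (0\<^sup>2) * B"
        using ennreal_tendsto_cmult[OF B[unfolded infinity_ennreal_def] tendsto_ennrealI[OF tendsto_power[OF \<eta>0, of 2]]] by (simp only: mult.commute)
    qed auto
    also have "(ennreal (1 + \<tau>) * ((\<integral>\<^sup>+x. ennreal ((cmod (covd1 h u g1 x))\<^sup>2) * indicator (sq 0 (1/2)) x \<partial>lborel)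
      + ((\<integral>\<^sup>+x. ennreal ((cmod (covd2 h u g2 x))\<^sup>2) * indicator (sq 0 (1/2)) x \<partial>lborel) + P))
      + ennreal (1 + 1/\<tau>) * (ennreal (h\<^sup>2) * (ennreal (0\<^sup>2) * B + ennreal (0\<^sup>2) * B) + ennreal (1 / (2 * \<epsilon>\<^sup>2)) * 0)) = ennreal (1 + \<tau>) * E"
      unfolding E_def E2D_split[OF u g1 g2 \<epsilon>(1)] P_def by simp
    finally show ?thesis
      by (rule LIMSEQ_le_const) (use R in auto)
  qed
  obtain e where e: "E = ennreal e" "e \<ge> 0" using False unfolding E_def[symmetric] by (cases E) auto
  have "LB \<le> c * e"
  proof (rule field_le_epsilon)
    fix d :: real assume d: "d > 0"
    define \<tau> where "\<tau> = d / (c * e + 1)"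
    have ce: "c * e \<ge> 0" using c e by simp
    have \<tau>: "\<tau> > 0" using d ce by (simp add: \<tau>_def)
    have "ennreal LB \<le> ennreal (c * ((1 + \<tau>) * e))"
      using bound[OF \<tau>] c e \<tau> by (simp add: ennreal_mult)
    hence "LB \<le> c * ((1 + \<tau>) * e)"
      using c e \<tau> by (subst (asm) ennreal_le_iff) auto
    also have "\<dots> = c * e + \<tau> * (c * e)" by (simp add: algebra_simps)
    also have "\<tau> * (c * e) \<le> d" unfolding \<tau>_def using ce d by (simp add: field_simps)
    finally show "LB \<le> c * e + d" by simp
  qed
  hence "ennreal LB \<le> ennreal (c * e)" by (rule ennreal_leI)
  thus ?thesis using c e by (simp add: ennreal_mult LB_def c_def E_def)
qed

section \<open>Energy of a regularised section of the lowest Landau level\<close>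

lemma integral_lborel_box:
  fixes f :: "real \<times> real \<Rightarrow> complex"
  assumes f: "continuous_on UNIV f" and s: "\<And>x. x \<notin> sq 0 R \<Longrightarrow> f x = 0"
  shows "integrable lborel f" "(\<integral>x. f x \<partial>lborel) = integral (sq 0 R) f"
proof -
  have e: "(\<lambda>x. indicator (sq 0 R) x *\<^sub>R f x) = f" using s by (auto simp: indicator_def fun_eq_iff)
  have si: "set_integrable lborel (sq 0 R) f"
    unfolding set_integrable_def by (rule borel_integrable_compact) (auto intro: continuous_on_subset[OF f])
  show "integrable lborel f" using si unfolding set_integrable_def e .
  show "(\<integral>x. f x \<partial>lborel) = integral (sq 0 R) f"
    using set_borel_integral_eq_integral(2)[OF si] unfolding set_lebesgue_integral_def e by simp
qed

lemma shift_vector_derivative: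
  fixes U :: "real \<times> real \<Rightarrow> 'a::real_normed_vector"
  assumes "((\<lambda>s. U ((a, b) + s *\<^sub>R e)) has_vector_derivative d) (at 0)"
  shows "e = (1, 0) \<Longrightarrow> ((\<lambda>s. U (s, b)) has_vector_derivative d) (at a)"
    and "e = (0, 1) \<Longrightarrow> ((\<lambda>s. U (a, s)) has_vector_derivative d) (at b)"
proof -
  have sh: "((\<lambda>t. t - c) has_vector_derivative 1) (at c)" for c :: real
    by (auto intro!: derivative_eq_intros)
  have D: "((\<lambda>s. U ((a, b) + s *\<^sub>R e)) has_vector_derivative d) (at (c - c))" for c :: real using assms by simp
  show "e = (1, 0) \<Longrightarrow> ((\<lambda>s. U (s, b)) has_vector_derivative d) (at a)"
    using vector_diff_chain_at[OF sh D, of a] by (simp add: o_def)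
  show "e = (0, 1) \<Longrightarrow> ((\<lambda>s. U (a, s)) has_vector_derivative d) (at b)"
    using vector_diff_chain_at[OF sh D, of b] by (simp add: o_def)
qed

text \<open>On lines parallel to \<open>e\<close>, across a square outside which the test function
  vanishes, the fundamental theorem of calculus is applied to its product with \<open>u\<close>;
  Fubini's theorem collects the lines.\<close>

lemma weak_pderiv_C1:
  fixes u g :: "real \<times> real \<Rightarrow> complex"
  assumes u: "continuous_on UNIV u" and g: "continuous_on UNIV g"
    and e: "e = (1, 0) \<and> (\<forall>a b. ((\<lambda>s. u (s, b)) has_vector_derivative g (a, b)) (at a))
         \<or> e = (0, 1) \<and> (\<forall>a b. ((\<lambda>s. u (a, s)) has_vector_derivative g (a, b)) (at b))"
  shows "weak_pderiv u e g"
  unfolding weak_pderiv_def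
proof (intro allI impI)
  fix \<phi> assume t: "test_fn \<phi>"
  have "(1,0) \<in> (Basis :: (real\<times>real) set)" "(0,1) \<in> (Basis :: (real\<times>real) set)"
    by (simp_all add: Basis_real_prod)
  then obtain d1 d2 where d1: "continuous_on UNIV d1" "\<And>x. ((\<lambda>t. \<phi> (x + t *\<^sub>R (1,0))) has_real_derivative d1 x) (at 0)"
    and d2: "continuous_on UNIV d2" "\<And>x. ((\<lambda>t. \<phi> (x + t *\<^sub>R (0,1))) has_real_derivative d2 x) (at 0)"
    using t unfolding test_fn_def by metis
  define d where "d = (if e = (1, 0) then d1 else d2)"
  have d: "continuous_on UNIV d" "\<And>x. ((\<lambda>t. \<phi> (x + t *\<^sub>R e)) has_real_derivative d x) (at 0)"
    using e d1 d2 by (auto simp: d_def)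
  have dd: "deriv (\<lambda>t. \<phi> (x + t *\<^sub>R e)) 0 = d x" for x
    using d(2) by (rule DERIV_imp_deriv)
  have c\<phi>: "continuous_on UNIV \<phi>"
  proof -
    have "(\<phi> has_derivative (\<lambda>v. fst v *\<^sub>R d1 x + snd v *\<^sub>R d2 x)) (at x)" for x
      by (rule has_derivative_real_prod) (use d1 d2 in \<open>auto simp: has_real_derivative_iff_has_vector_derivative\<close>)
    thus ?thesis by (auto intro!: continuous_at_imp_continuous_on has_derivative_continuous)
  qed
  obtain B where B: "\<And>x. \<phi> x \<noteq> 0 \<Longrightarrow> norm x \<le> B" using t unfolding test_fn_def bounded_iff by auto
  define R where "R = \<bar>B\<bar> + 1"
  have \<phi>0: "\<phi> (a, b) = 0" if "\<bar>a\<bar> \<ge> R \<or> \<bar>b\<bar> \<ge> R" for a b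
  proof (rule ccontr)
    assume "\<phi> (a, b) \<noteq> 0"
    hence "norm (a, b) \<le> B" by (rule B)
    moreover have "\<bar>a\<bar> \<le> norm (a, b)" "\<bar>b\<bar> \<le> norm (a, b)" using norm_fst_le[of a b] norm_snd_le[of b a] by auto
    ultimately show False using that by (auto simp: R_def)
  qed
  have R: "R > 0" by (simp add: R_def)
  have \<phi>s: "\<phi> x = 0" if "x \<notin> sq 0 R" for x
    using that \<phi>0[of "fst x" "snd x"] by (auto simp: mem_sq)
  have ds: "d x = 0" if "x \<notin> sq 0 R" for x
  proof -
    have "open (- sq (0::real\<times>real) R)" by (simp add: open_Compl sq_def closed_cbox)
    hence "open ((\<lambda>t. x + t *\<^sub>R e) -` (- sq 0 R))"
      by (rule open_vimage) (intro continuous_intros)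
    moreover have "((\<lambda>_. 0) has_real_derivative 0) (at (0::real))" by simp
    ultimately have "((\<lambda>t. \<phi> (x + t *\<^sub>R e)) has_real_derivative 0) (at 0)"
      using that \<phi>s
      by (rule_tac has_field_derivative_transform_within_open[of "\<lambda>_. 0" 0 0 "(\<lambda>t. x + t *\<^sub>R e) -` (- sq 0 R)"]) simp_all
    thus ?thesis using d(2) DERIV_unique by blast
  qed
  let ?A = "\<lambda>x. u x * complex_of_real (d x)" and ?B = "\<lambda>x. g x * complex_of_real (\<phi> x)"
  have cA: "continuous_on UNIV ?A" "continuous_on UNIV ?B"
    by (intro continuous_intros u g d c\<phi>)+
  have A0: "?A x = 0" "?B x = 0" if "x \<notin> sq 0 R" for x using that \<phi>s ds by auto
  have sqR: "sq (0::real\<times>real) R = cbox (-R, -R) (R, R)" by (simp add: sq_def)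
  have cAB: "continuous_on (cbox (-R, -R) (R, R)) (\<lambda>x. ?A x + ?B x)"
    by (rule continuous_on_subset[OF continuous_on_add[OF cA]]) auto
  have "integral (sq 0 R) (\<lambda>x. ?A x + ?B x) = 0"
    using e
  proof
    assume e: "e = (1, 0) \<and> (\<forall>a b. ((\<lambda>s. u (s, b)) has_vector_derivative g (a, b)) (at a))"
    have "integral {-R..R} (\<lambda>a. ?A (a, b) + ?B (a, b)) = 0" for b
    proof -
      have "((\<lambda>a. ?A (a, b) + ?B (a, b)) has_integral (u (R, b) * complex_of_real (\<phi> (R, b)) - u (-R, b) * complex_of_real (\<phi> (-R, b)))) {-R..R}"
      proof (rule fundamental_theorem_of_calculus)
        fix a
        have "((\<lambda>a. \<phi> (a, b)) has_real_derivative d (a, b)) (at a)"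
          using shift_vector_derivative(1)[of \<phi> a b e "d (a,b)"] d(2)[of "(a,b)"] e by (simp add: has_real_derivative_iff_has_vector_derivative)
        from has_vector_derivative_mult[OF e[THEN conjunct2, rule_format, of b a] has_vector_derivative_of_real[OF this]]
        show "((\<lambda>a. u (a, b) * complex_of_real (\<phi> (a, b))) has_vector_derivative ?A (a, b) + ?B (a, b)) (at a within {-R..R})"
          by (rule has_vector_derivative_at_within)
      qed (use R in auto)
      thus ?thesis using R \<phi>0[of R b] \<phi>0[of "-R" b] by (simp add: integral_unique)
    qed
    moreover have "integral (sq 0 R) (\<lambda>x. ?A x + ?B x) = integral {-R..R} (\<lambda>b. integral {-R..R} (\<lambda>a. ?A (a, b) + ?B (a, b)))"
      unfolding sqR integral_prod_continuous[OF cAB]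
      using integral_swap_continuous[of "-R" "-R" R R "\<lambda>a b. ?A (a, b) + ?B (a, b)"] cAB by (simp add: case_prod_unfold)
    ultimately show ?thesis by simp
  next
    assume e: "e = (0, 1) \<and> (\<forall>a b. ((\<lambda>s. u (a, s)) has_vector_derivative g (a, b)) (at b))"
    have "integral {-R..R} (\<lambda>b. ?A (a, b) + ?B (a, b)) = 0" for a
    proof -
      have "((\<lambda>b. ?A (a, b) + ?B (a, b)) has_integral (u (a, R) * complex_of_real (\<phi> (a, R)) - u (a, -R) * complex_of_real (\<phi> (a, -R)))) {-R..R}"
      proof (rule fundamental_theorem_of_calculus)
        fix b
        have "((\<lambda>b. \<phi> (a, b)) has_real_derivative d (a, b)) (at b)"
          using shift_vector_derivative(2)[of \<phi> a b e "d (a,b)"] d(2)[of "(a,b)"] e by (simp add: has_real_derivative_iff_has_vector_derivative)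
        from has_vector_derivative_mult[OF e[THEN conjunct2, rule_format, of a b] has_vector_derivative_of_real[OF this]]
        show "((\<lambda>b. u (a, b) * complex_of_real (\<phi> (a, b))) has_vector_derivative ?A (a, b) + ?B (a, b)) (at b within {-R..R})"
          by (rule has_vector_derivative_at_within)
      qed (use R in auto)
      thus ?thesis using R \<phi>0[of a R] \<phi>0[of a "-R"] by (simp add: integral_unique)
    qed
    thus ?thesis unfolding sqR integral_prod_continuous[OF cAB] by simp
  qed
  moreover have "integral (sq 0 R) (\<lambda>x. ?A x + ?B x) = (\<integral>x. ?A x + ?B x \<partial>lborel)"
  proof (rule integral_lborel_box(2)[symmetric])
    show "continuous_on UNIV (\<lambda>x. ?A x + ?B x)" by (intro continuous_on_add cA)
    show "?A x + ?B x = 0" if "x \<notin> sq 0 R" for x by (simp only: A0[OF that] add_0_left)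
  qed
  moreover have "\<dots> = (\<integral>x. ?A x \<partial>lborel) + (\<integral>x. ?B x \<partial>lborel)"
    using integral_lborel_box(1)[OF cA(1) A0(1)] integral_lborel_box(1)[OF cA(2) A0(2)]
    by (rule Bochner_Integration.integral_add)
  ultimately show "(\<integral>x. u x * complex_of_real (deriv (\<lambda>t. \<phi> (x + t *\<^sub>R e)) 0) \<partial>lborel) = - (\<integral>x. g x * complex_of_real (\<phi> x) \<partial>lborel)"
    unfolding dd by (simp add: add_eq_0_iff)
qed

section \<open>The regularised section and its kinetic energy\<close>

lemma cont_Complex [continuous_intros]:
  "continuous_on S f \<Longrightarrow> continuous_on S g \<Longrightarrow> continuous_on S (\<lambda>x. Complex (f x) (g x))"
  by (simp add: Complex_eq continuous_intros)

text \<open>An entire function with the multipliers of a theta function. It represents the lowest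
  Landau level in the gauge where the translation by 1 acts trivially; \<open>ph\<close> below leads
  to the symmetric gauge of \<open>A0\<close>.\<close>

locale theta_section =
  fixes h c :: real and F F' F'' :: "complex \<Rightarrow> complex"
  assumes h: "h > 0" and c: "c > 0"
    and F: "\<And>z. (F has_field_derivative F' z) (at z)"
    and F': "\<And>z. (F' has_field_derivative F'' z) (at z)"
    and F'': "continuous_on UNIV F''"
    and per1: "\<And>z. F (z + 1) = F z"
    and per2: "\<And>z. F (z + \<i>) = exp (- \<i> * of_real h * z + of_real (h / 2)) * F z"
begin

definition Ga :: "real \<Rightarrow> complex" where "Ga b = of_real (exp (- h * b\<^sup>2 / 2))"
text \<open>\<open>W\<close> is the section in the Landau gauge. Holomorphy of \<open>F\<close>
  makes \<open>V\<close> and \<open>\<i> * V\<close> its two covariant derivatives, so a single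
  function carries the whole gradient; \<open>Y\<close> is the first covariant derivative of
  \<open>V\<close>.\<close>

definition W where "W a b = Ga b * F (Complex a b)"
definition V where "V a b = Ga b * (F' (Complex a b) + \<i> * of_real (h * b) * F (Complex a b))"
definition Y where "Y a b = Ga b * (F'' (Complex a b) + 2 * \<i> * of_real (h * b) * F' (Complex a b) - of_real ((h * b)\<^sup>2) * F (Complex a b))"

lemma cont_FF: "continuous_on UNIV F" "continuous_on UNIV F'"
  using F F' by (auto intro!: continuous_at_imp_continuous_on DERIV_isCont)

lemma cont_WVY [continuous_intros]:
  assumes "continuous_on S f" "continuous_on S g"
  shows "continuous_on S (\<lambda>x. W (f x) (g x))" "continuous_on S (\<lambda>x. V (f x) (g x))" "continuous_on S (\<lambda>x. Y (f x) (g x))"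
  unfolding W_def V_def Y_def Ga_def
  by (intro continuous_intros assms continuous_on_compose2[OF cont_FF(1)] continuous_on_compose2[OF cont_FF(2)]
      continuous_on_compose2[OF F''] subset_UNIV; simp)+

lemma Complex_deriv1: "((\<lambda>a. Complex a b) has_vector_derivative 1) (at a)"
  using has_vector_derivative_add[OF has_vector_derivative_of_real[OF DERIV_ident] has_vector_derivative_const]
  unfolding Complex_eq by simp

lemma Complex_deriv2: "((\<lambda>b. Complex a b) has_vector_derivative \<i>) (at b)"
  using has_vector_derivative_add[OF has_vector_derivative_const
      has_vector_derivative_mult_right[OF has_vector_derivative_of_real[OF DERIV_ident], of \<i>]]
  unfolding Complex_eq by simp

lemma comp_deriv:
  assumes "\<And>z. (G has_field_derivative G' z) (at z)"
  shows "((\<lambda>a. G (Complex a b)) has_vector_derivative G' (Complex a b)) (at a)"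
    "((\<lambda>b. G (Complex a b)) has_vector_derivative \<i> * G' (Complex a b)) (at b)"
  using field_vector_diff_chain_at[OF Complex_deriv1 assms] field_vector_diff_chain_at[OF Complex_deriv2 assms]
  by (simp_all add: o_def)

lemma Ga_deriv: "(Ga has_vector_derivative - of_real (h * b) * Ga b) (at b)"
proof -
  have "((\<lambda>b. exp (- h * b\<^sup>2 / 2)) has_real_derivative - (h * b) * exp (- h * b\<^sup>2 / 2)) (at b)"
    by (auto intro!: derivative_eq_intros)
  from has_vector_derivative_of_real[OF this] show ?thesis unfolding Ga_def[abs_def] by simp
qed

lemma of_real_lin_deriv: "((\<lambda>b. \<i> * of_real (h * b)) has_vector_derivative \<i> * of_real h) (at b)"
proof -
  have "((\<lambda>b. h * b) has_real_derivative h) (at b)" by (auto intro!: derivative_eq_intros)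
  from has_vector_derivative_mult_right[OF has_vector_derivative_of_real[OF this], of \<i>] show ?thesis .
qed

lemma W_deriv1: "((\<lambda>a. W a b) has_vector_derivative V a b - \<i> * of_real (h * b) * W a b) (at a)"
  using has_vector_derivative_mult_right[OF comp_deriv(1)[OF F, of b a], of "Ga b"]
  unfolding W_def V_def by (simp add: algebra_simps)

lemma W_deriv2: "((\<lambda>b. W a b) has_vector_derivative \<i> * V a b) (at b)"
  using has_vector_derivative_mult[OF Ga_deriv comp_deriv(2)[OF F, of a b]]
  unfolding W_def V_def by (simp add: algebra_simps)

lemma V_deriv1: "((\<lambda>a. V a b) has_vector_derivative Y a b - \<i> * of_real (h * b) * V a b) (at a)"
  using has_vector_derivative_mult_right[OF has_vector_derivative_add[OF comp_deriv(1)[OF F', of b a]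
      has_vector_derivative_mult_right[OF comp_deriv(1)[OF F, of b a], of "\<i> * of_real (h * b)"]], of "Ga b"]
  unfolding V_def Y_def by (simp add: algebra_simps power2_eq_square)

lemma V_deriv2: "((\<lambda>b. V a b) has_vector_derivative \<i> * Y a b + \<i> * of_real h * W a b) (at b)"
  using has_vector_derivative_mult[OF Ga_deriv has_vector_derivative_add[OF comp_deriv(2)[OF F', of a b]
      has_vector_derivative_mult[OF of_real_lin_deriv comp_deriv(2)[OF F, of a b]]]]
  unfolding V_def Y_def W_def by (simp add: algebra_simps power2_eq_square)

text \<open>The gradient of \<open>s\<close> has the components \<open>2 * Re Q\<close> and
  \<open>- 2 * Im Q\<close>, and by \<open>Q_norm\<close> its squared length is
  \<open>4 * s * p\<close>.\<close>

definition Q where "Q a b = cnj (W a b) * V a b"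
definition s where "s a b = (cmod (W a b))\<^sup>2"
definition p where "p a b = (cmod (V a b))\<^sup>2"

lemma cnj_deriv: "(f has_vector_derivative d) net \<Longrightarrow> ((\<lambda>x. cnj (f x)) has_vector_derivative cnj d) net"
  by (rule bounded_linear.has_vector_derivative[OF bounded_linear_cnj])

lemma Re_deriv: "(f has_vector_derivative d) net \<Longrightarrow> ((\<lambda>x. Re (f x)) has_real_derivative Re d) net"
  using bounded_linear.has_vector_derivative[OF bounded_linear_Re] by (auto simp: has_real_derivative_iff_has_vector_derivative)

lemma Im_deriv: "(f has_vector_derivative d) net \<Longrightarrow> ((\<lambda>x. Im (f x)) has_real_derivative Im d) net"
  using bounded_linear.has_vector_derivative[OF bounded_linear_Im] by (auto simp: has_real_derivative_iff_has_vector_derivative)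

lemma p_cnj: "of_real (p a b) = cnj (V a b) * V a b" "of_real (s a b) = cnj (W a b) * W a b"
  by (simp_all only: p_def s_def complex_norm_square mult.commute)

lemma s_Re: "s a b = Re (W a b * cnj (W a b))"
  by (simp only: s_def complex_norm_square[symmetric] Re_complex_of_real)

lemma s_deriv1: "((\<lambda>a. s a b) has_real_derivative 2 * Re (Q a b)) (at a)"
  unfolding s_Re using Re_deriv[OF has_vector_derivative_mult[OF W_deriv1[of b a] cnj_deriv[OF W_deriv1[of b a]]]]
  by (simp add: Q_def algebra_simps)

lemma s_deriv2: "((\<lambda>b. s a b) has_real_derivative - 2 * Im (Q a b)) (at b)"
  unfolding s_Re using Re_deriv[OF has_vector_derivative_mult[OF W_deriv2[of a b] cnj_deriv[OF W_deriv2[of a b]]]]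
  by (simp add: Q_def algebra_simps)

lemma Q_deriv1: "((\<lambda>a. Q a b) has_vector_derivative of_real (p a b) + cnj (W a b) * Y a b) (at a)"
  unfolding Q_def p_cnj using has_vector_derivative_mult[OF cnj_deriv[OF W_deriv1[of b a]] V_deriv1[of b a]]
  by (simp add: algebra_simps)

lemma Q_deriv2: "((\<lambda>b. Q a b) has_vector_derivative - \<i> * of_real (p a b) + \<i> * (cnj (W a b) * Y a b) + \<i> * of_real (h * s a b)) (at b)"
  unfolding Q_def of_real_mult p_cnj using has_vector_derivative_mult[OF cnj_deriv[OF W_deriv2[of a b]] V_deriv2[of a b]]
  by (simp add: algebra_simps)

lemma Q_norm: "(Re (Q a b))\<^sup>2 + (Im (Q a b))\<^sup>2 = s a b * p a b"
proof -
  have "(Re (Q a b))\<^sup>2 + (Im (Q a b))\<^sup>2 = (cmod (Q a b))\<^sup>2" by (simp only: cmod_power2)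
  thus ?thesis by (simp only: Q_def s_def p_def norm_mult power_mult_distrib complex_mod_cnj)
qed

lemma Complex_shift: "Complex (a + 1) b = Complex a b + 1" "Complex a (b + 1) = Complex a b + \<i>"
  by (simp_all add: complex_eq_iff)

lemma F'_per1: "F' (z + 1) = F' z"
proof -
  have "((\<lambda>z. F (z + 1)) has_field_derivative F' (z + 1)) (at z)"
    using F[of "z + 1"] by (simp add: DERIV_shift)
  thus ?thesis unfolding per1 using F DERIV_unique by blast
qed

lemma F'_per2: "F' (z + \<i>) = exp (- \<i> * of_real h * z + of_real (h / 2)) * (F' z - \<i> * of_real h * F z)"
proof -
  have 1: "((\<lambda>z. F (z + \<i>)) has_field_derivative F' (z + \<i>)) (at z)"
    using F[of "z + \<i>"] by (simp add: DERIV_shift)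
  have 2: "((\<lambda>z. exp (- \<i> * of_real h * z + of_real (h / 2)) * F z) has_field_derivative
      exp (- \<i> * of_real h * z + of_real (h / 2)) * (F' z - \<i> * of_real h * F z)) (at z)"
    by (auto intro!: derivative_eq_intros F simp: algebra_simps)
  show ?thesis using DERIV_unique[OF 1[unfolded per2] 2] .
qed

lemma W_per: "W (a + 1) b = W a b" "V (a + 1) b = V a b"
  by (simp_all add: W_def V_def Complex_shift per1 F'_per1)

lemma Ga_shift: "Ga (b + 1) * exp (- \<i> * of_real h * Complex a b + of_real (h / 2)) = cis (- h * a) * Ga b"
proof -
  have "Ga (b + 1) * exp (- \<i> * of_real h * Complex a b + of_real (h / 2))
      = exp (of_real (- h * (b + 1)\<^sup>2 / 2) + (- \<i> * of_real h * Complex a b + of_real (h / 2)))"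
    by (simp only: Ga_def exp_add exp_of_real)
  also have "of_real (- h * (b + 1)\<^sup>2 / 2) + (- \<i> * of_real h * Complex a b + of_real (h / 2)) = \<i> * of_real (- h * a) + of_real (- h * b\<^sup>2 / 2)"
    by (simp add: complex_eq_iff power2_eq_square field_simps)
  also have "exp \<dots> = cis (- h * a) * Ga b" unfolding exp_add cis_conv_exp Ga_def exp_of_real ..
  finally show ?thesis .
qed

lemma W_per2: "W a (b + 1) = cis (- h * a) * W a b"
  unfolding W_def Complex_shift per2 by (simp only: mult.assoc[symmetric] Ga_shift)

lemma V_per2: "V a (b + 1) = cis (- h * a) * V a b"
proof -
  have "V a (b + 1) = Ga (b + 1) * exp (- \<i> * of_real h * Complex a b + of_real (h / 2)) * (F' (Complex a b) + \<i> * of_real (h * b) * F (Complex a b))"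
    unfolding V_def Complex_shift per2 F'_per2 by (simp add: algebra_simps)
  thus ?thesis unfolding Ga_shift V_def by (simp only: mult.assoc)
qed

lemma s_per: "s (a + 1) b = s a b" "s a (b + 1) = s a b"
  by (simp_all add: s_def W_per W_per2 norm_mult)

lemma Q_per: "Q (a + 1) b = Q a b" "Q a (b + 1) = Q a b"
proof -
  show "Q (a + 1) b = Q a b" by (simp add: Q_def W_per)
  have "cnj (cis x * w) * (cis x * v) = cnj w * v" for x w v
  proof -
    have "cnj (cis x) * cis x = 1" by (simp add: cis_cnj cis_mult)
    thus ?thesis by (metis complex_cnj_mult mult.assoc mult.left_commute mult_1_left)
  qed
  thus "Q a (b + 1) = Q a b" by (simp only: Q_def W_per2 V_per2)
qed

definition g where "g t = 1 / sqrt (t + c\<^sup>2)" for t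
text \<open>The summand 2 is the smallest that works: at \<open>t = 0\<close> both sides of
  \<open>L_ineq\<close> equal \<open>2 / c^2\<close>.\<close>

definition L where "L t = (ln (1 + t / c\<^sup>2) + 2) / (4 * (t + c\<^sup>2))" for t
definition L' where "L' t = (1 - (ln (1 + t / c\<^sup>2) + 2)) / (4 * (t + c\<^sup>2)\<^sup>2)" for t

lemma s_nonneg: "s a b \<ge> 0" "p a b \<ge> 0" by (simp_all add: s_def p_def)

lemma pos: "t \<ge> 0 \<Longrightarrow> t + c\<^sup>2 > 0" "t \<ge> 0 \<Longrightarrow> 1 + t / c\<^sup>2 > 0"
  using c by (auto intro: add_nonneg_pos add_pos_nonneg)

lemma g_deriv: "t \<ge> 0 \<Longrightarrow> (g has_real_derivative - ((g t)^3 / 2)) (at t)"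
  unfolding g_def[abs_def] using pos[of t]
  by (auto intro!: derivative_eq_intros simp: field_simps power2_eq_square power3_eq_cube)

lemma L_deriv: "t \<ge> 0 \<Longrightarrow> (L has_real_derivative L' t) (at t)"
proof -
  assume t: "t \<ge> 0"
  have e: "1 + t / c\<^sup>2 = (t + c\<^sup>2) / c\<^sup>2" using c by (simp add: field_simps)
  show ?thesis unfolding L_def[abs_def] L'_def using pos[OF t] c
    by (auto intro!: derivative_eq_intros simp: e) (simp add: divide_simps power2_eq_square, simp add: algebra_simps)
qed

text \<open>The left-hand side at \<open>t = s\<close>, times \<open>p\<close>, is the kinetic energy density of \<open>u\<close> below; \<open>L\<close> is chosen so that
  the derivative of \<open>t * L t\<close> dominates it while \<open>t * L t\<close> itself grows only logarithmically.\<close>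

lemma L_ineq:
  assumes t: "t \<ge> 0"
  shows "2 * (g t)\<^sup>2 - 2 * t * (g t)^4 + t\<^sup>2 * (g t)^6 \<le> 4 * (t * L' t + L t)"
proof -
  define l where "l = ln (1 + t / c\<^sup>2)"
  have l: "l \<ge> 0" unfolding l_def using t c by simp
  define d where "d = t + c\<^sup>2"
  have d: "d > 0" "t \<le> d" "t \<ge> 0" using pos[OF t] t by (auto simp: d_def)
  have g2: "(g t)\<^sup>2 = 1 / d" using d by (simp add: g_def d_def power_divide)
  have "(g t)^4 = ((g t)\<^sup>2)\<^sup>2" "(g t)^6 = ((g t)\<^sup>2)^3" by (simp_all flip: power_mult)
  hence g46: "(g t)^4 = 1 / d\<^sup>2" "(g t)^6 = 1 / d^3" by (simp_all add: g2 power_divide)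
  have "2 * (g t)\<^sup>2 - 2 * t * (g t)^4 + t\<^sup>2 * (g t)^6 = (2 * d\<^sup>2 - 2 * t * d + t\<^sup>2) / d^3"
    unfolding g2 g46 using d by (simp add: field_simps power2_eq_square power3_eq_cube)
  also have "\<dots> \<le> (t * d * (1 - (l + 2)) + (l + 2) * d\<^sup>2) / d^3"
  proof (rule divide_right_mono)
    \<comment> \<open>The two sides of the polynomial inequality differ exactly by the sum of these
      two products.\<close>
    have "0 \<le> l * d * (d - t)" using l d by simp
    moreover have "0 \<le> t * (d - t)" using d by simp
    ultimately show "2 * d\<^sup>2 - 2 * t * d + t\<^sup>2 \<le> t * d * (1 - (l + 2)) + (l + 2) * d\<^sup>2"
      by (simp add: power2_eq_square algebra_simps)
  qed (use d in simp)
  also have "\<dots> = 4 * (t * L' t + L t)"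
    unfolding L'_def L_def l_def[symmetric] d_def[symmetric] using d by (simp add: field_simps power2_eq_square power3_eq_cube)
  finally show ?thesis .
qed

lemma cont_sQ [continuous_intros]:
  assumes "continuous_on A f" "continuous_on A k"
  shows "continuous_on A (\<lambda>x. s (f x) (k x))" "continuous_on A (\<lambda>x. p (f x) (k x))" "continuous_on A (\<lambda>x. Q (f x) (k x))"
  unfolding s_def p_def Q_def by (intro continuous_intros assms)+

lemma cont_g: "continuous_on A f \<Longrightarrow> continuous_on A k \<Longrightarrow> continuous_on A (\<lambda>x. g (s (f x) (k x)))"
  unfolding g_def using pos(1)[OF s_nonneg(1)] by (intro continuous_intros) (auto simp: less_imp_neq[symmetric])

lemma cont_L:
  assumes "continuous_on A f" "continuous_on A k"
  shows "continuous_on A (\<lambda>x. L (s (f x) (k x)))" "continuous_on A (\<lambda>x. L' (s (f x) (k x)))"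
proof -
  have nz: "4 * (s a b + c\<^sup>2) \<noteq> 0" "4 * (s a b + c\<^sup>2)\<^sup>2 \<noteq> 0" "1 + s a b / c\<^sup>2 > 0" "1 + s a b / c\<^sup>2 \<noteq> 0" "c\<^sup>2 \<noteq> 0" for a b
    using pos[OF s_nonneg(1), of a b] c by auto
  show "continuous_on A (\<lambda>x. L (s (f x) (k x)))" "continuous_on A (\<lambda>x. L' (s (f x) (k x)))"
    unfolding L_def L'_def by (intro continuous_intros assms ballI nz)+
qed

text \<open>The vector field is the gradient of \<open>s\<close> multiplied by \<open>L s\<close>.
  It is periodic, so its divergence has mean 0.\<close>

definition X1 where "X1 a b = L (s a b) * (2 * Re (Q a b))"
definition X2 where "X2 a b = L (s a b) * (- 2 * Im (Q a b))"
definition dX1 where "dX1 a b = L' (s a b) * (2 * Re (Q a b)) * (2 * Re (Q a b)) + 2 * (p a b + Re (cnj (W a b) * Y a b)) * L (s a b)"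
definition dX2 where "dX2 a b = L' (s a b) * (- 2 * Im (Q a b)) * (- 2 * Im (Q a b)) + - 2 * (- p a b + Re (cnj (W a b) * Y a b) + h * s a b) * L (s a b)"

lemma X1_deriv: "((\<lambda>a. X1 a b) has_real_derivative dX1 a b) (at a)"
proof -
  have 1: "((\<lambda>a. L (s a b)) has_real_derivative L' (s a b) * (2 * Re (Q a b))) (at a)"
    by (rule DERIV_chain2[OF L_deriv[OF s_nonneg(1)] s_deriv1])
  have 2: "((\<lambda>a. 2 * Re (Q a b)) has_real_derivative 2 * (p a b + Re (cnj (W a b) * Y a b))) (at a)"
    using DERIV_cmult[OF Re_deriv[OF Q_deriv1[of b a]], of 2] by simp
  show ?thesis unfolding X1_def dX1_def by (rule DERIV_mult[OF 1 2])
qed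

lemma X2_deriv: "((\<lambda>b. X2 a b) has_real_derivative dX2 a b) (at b)"
proof -
  have 1: "((\<lambda>b. L (s a b)) has_real_derivative L' (s a b) * (- 2 * Im (Q a b))) (at b)"
    by (rule DERIV_chain2[OF L_deriv[OF s_nonneg(1)] s_deriv2])
  have 2: "((\<lambda>b. - 2 * Im (Q a b)) has_real_derivative - 2 * (- p a b + Re (cnj (W a b) * Y a b) + h * s a b)) (at b)"
    using DERIV_cmult[OF Im_deriv[OF Q_deriv2[of a b]], of "-2"] by simp
  show ?thesis unfolding X2_def dX2_def by (rule DERIV_mult[OF 1 2])
qed

lemma cont_dX: "continuous_on UNIV (\<lambda>x. dX1 (fst x) (snd x))" "continuous_on UNIV (\<lambda>x. dX2 (fst x) (snd x))"
  unfolding dX1_def dX2_def by (intro continuous_intros cont_L cont_WVY)+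

lemma integral_dX: "integral Kc (\<lambda>x. dX1 (fst x) (snd x)) = 0" "integral Kc (\<lambda>x. dX2 (fst x) (snd x)) = 0"
proof -
  have z1: "integral {-1/2..1/2} (\<lambda>a. dX1 a b) = 0" for b
  proof -
    have "((\<lambda>a. dX1 a b) has_integral (X1 (1/2) b - X1 (-1/2) b)) {-1/2..1/2}"
      by (rule fundamental_theorem_of_calculus)
         (auto simp flip: has_real_derivative_iff_has_vector_derivative intro: X1_deriv[THEN has_field_derivative_at_within])
    moreover have "X1 (1/2) b = X1 (-1/2) b" using s_per(1)[of "-1/2" b] Q_per(1)[of "-1/2" b] by (simp add: X1_def)
    ultimately show ?thesis by (simp add: integral_unique)
  qed
  have z2: "integral {-1/2..1/2} (\<lambda>b. dX2 a b) = 0" for a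
  proof -
    have "((\<lambda>b. dX2 a b) has_integral (X2 a (1/2) - X2 a (-1/2))) {-1/2..1/2}"
      by (rule fundamental_theorem_of_calculus)
         (auto simp flip: has_real_derivative_iff_has_vector_derivative intro: X2_deriv[THEN has_field_derivative_at_within])
    moreover have "X2 a (1/2) = X2 a (-1/2)" using s_per(2)[of a "-1/2"] Q_per(2)[of a "-1/2"] by (simp add: X2_def)
    ultimately show ?thesis by (simp add: integral_unique)
  qed
  show "integral Kc (\<lambda>x. dX2 (fst x) (snd x)) = 0"
    unfolding integral_Kc[OF cont_dX(2)] fst_conv snd_conv z2 by simp
  have "continuous_on (cbox (-1/2,-1/2) (1/2,1/2)) (\<lambda>(a, b). dX1 a b)"
    unfolding case_prod_unfold by (rule continuous_on_subset[OF cont_dX(1)]) auto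
  from integral_swap_continuous[OF this]
  show "integral Kc (\<lambda>x. dX1 (fst x) (snd x)) = 0"
    unfolding integral_Kc[OF cont_dX(1)] fst_conv snd_conv cbox_interval z1 by simp
qed

text \<open>The squared gradient of \<open>s\<close> is \<open>4 * s * p\<close> and its Laplacian
  is \<open>4 * p - 2 * h * s\<close>; the second derivatives \<open>Y\<close> enter the two
  directions with opposite signs.\<close>

lemma divergence: "dX1 a b + dX2 a b = 4 * p a b * (s a b * L' (s a b) + L (s a b)) - 2 * h * (s a b * L (s a b))"
proof -
  have "dX1 a b + dX2 a b = 4 * L' (s a b) * ((Re (Q a b))\<^sup>2 + (Im (Q a b))\<^sup>2) + (4 * p a b - 2 * h * s a b) * L (s a b)"
    unfolding dX1_def dX2_def by (simp add: power2_eq_square algebra_simps)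
  thus ?thesis unfolding Q_norm by (simp add: algebra_simps)
qed

text \<open>The vanishing mean of the divergence trades the gradient term \<open>p\<close> for a
  function of \<open>s\<close> alone.\<close>

lemma kinetic_identity:
  "integral Kc (\<lambda>x. 4 * p (fst x) (snd x) * (s (fst x) (snd x) * L' (s (fst x) (snd x)) + L (s (fst x) (snd x))))
   = integral Kc (\<lambda>x. 2 * h * (s (fst x) (snd x) * L (s (fst x) (snd x))))"
proof -
  have 1: "(\<lambda>x. dX1 (fst x) (snd x)) integrable_on Kc" "(\<lambda>x. dX2 (fst x) (snd x)) integrable_on Kc"
    by (intro integrable_Kc cont_dX)+
  have 2: "(\<lambda>x. 2 * h * (s (fst x) (snd x) * L (s (fst x) (snd x)))) integrable_on Kc"
    by (intro integrable_Kc continuous_intros cont_L)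
  have "integral Kc (\<lambda>x. 4 * p (fst x) (snd x) * (s (fst x) (snd x) * L' (s (fst x) (snd x)) + L (s (fst x) (snd x))))
     = integral Kc (\<lambda>x. (dX1 (fst x) (snd x) + dX2 (fst x) (snd x)) + 2 * h * (s (fst x) (snd x) * L (s (fst x) (snd x))))"
    by (simp only: divergence diff_add_cancel)
  also have "\<dots> = integral Kc (\<lambda>x. 2 * h * (s (fst x) (snd x) * L (s (fst x) (snd x))))"
    using 1 2 by (simp only: Henstock_Kurzweil_Integration.integral_add integrable_add integral_dX add_0)
  finally show ?thesis .
qed

text \<open>The gauge change from the Landau gauge to the symmetric one. It turns the multipliers 1
  and \<open>cis (- h * a)\<close> of \<open>W\<close> into those required by
  \<open>mag_periodic\<close>.\<close>

definition ph where "ph a b = cis (h * a * b / 2)"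
definition u where "u x = ph (fst x) (snd x) * (W (fst x) (snd x) * of_real (g (s (fst x) (snd x))))"
definition G1 where "G1 x = ph (fst x) (snd x) * (V (fst x) (snd x) * of_real (g (s (fst x) (snd x)))
     - W (fst x) (snd x) * of_real ((g (s (fst x) (snd x)))^3 * Re (Q (fst x) (snd x))))"
definition G2 where "G2 x = ph (fst x) (snd x) * (\<i> * V (fst x) (snd x) * of_real (g (s (fst x) (snd x)))
     + W (fst x) (snd x) * of_real ((g (s (fst x) (snd x)))^3 * Im (Q (fst x) (snd x))))"
definition g1 where "g1 x = G1 x - \<i> * of_real (h * snd x / 2) * u x"
definition g2 where "g2 x = G2 x + \<i> * of_real (h * fst x / 2) * u x"

lemma cont_u: "continuous_on UNIV u" "continuous_on UNIV G1" "continuous_on UNIV G2" "continuous_on UNIV g1" "continuous_on UNIV g2"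
proof -
  show 1: "continuous_on UNIV u" "continuous_on UNIV G1" "continuous_on UNIV G2"
    unfolding u_def[abs_def] G1_def[abs_def] G2_def[abs_def] ph_def cis_conv_exp
    by (intro continuous_intros cont_g cont_WVY; simp)+
  show "continuous_on UNIV g1" "continuous_on UNIV g2"
    unfolding g1_def[abs_def] g2_def[abs_def] by (intro continuous_intros 1; simp)+
qed

lemma u_deriv1: "((\<lambda>a. u (a, b)) has_vector_derivative g1 (a, b)) (at a)"
proof -
  have "((\<lambda>a. h * a * b / 2) has_real_derivative h * b / 2) (at a)" by (auto intro!: derivative_eq_intros)
  hence 1: "((\<lambda>a. ph a b) has_vector_derivative \<i> * of_real (h * b / 2) * ph a b) (at a)"
    unfolding ph_def by (rule cis_vector_derivative)
  have 2: "((\<lambda>a. g (s a b)) has_real_derivative - ((g (s a b))^3 / 2) * (2 * Re (Q a b))) (at a)"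
    by (rule DERIV_chain2[OF g_deriv[OF s_nonneg(1)] s_deriv1])
  show ?thesis
    using has_vector_derivative_mult[OF 1 has_vector_derivative_mult[OF W_deriv1[of b a] has_vector_derivative_of_real[OF 2]]]
    unfolding u_def g1_def G1_def fst_conv snd_conv by (simp add: algebra_simps)
qed

lemma u_deriv2: "((\<lambda>b. u (a, b)) has_vector_derivative g2 (a, b)) (at b)"
proof -
  have "((\<lambda>b. h * a * b / 2) has_real_derivative h * a / 2) (at b)" by (auto intro!: derivative_eq_intros)
  hence 1: "((\<lambda>b. ph a b) has_vector_derivative \<i> * of_real (h * a / 2) * ph a b) (at b)"
    unfolding ph_def by (rule cis_vector_derivative)
  have 2: "((\<lambda>b. g (s a b)) has_real_derivative - ((g (s a b))^3 / 2) * (- 2 * Im (Q a b))) (at b)"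
    by (rule DERIV_chain2[OF g_deriv[OF s_nonneg(1)] s_deriv2])
  show ?thesis
    using has_vector_derivative_mult[OF 1 has_vector_derivative_mult[OF W_deriv2[of a b] has_vector_derivative_of_real[OF 2]]]
    unfolding u_def g2_def G2_def fst_conv snd_conv by (simp add: algebra_simps)
qed

lemma admissible: "H1_loc_grad u g1 g2" "mag_periodic h u"
proof -
  show "H1_loc_grad u g1 g2"
    unfolding H1_loc_grad_def
    using u_deriv1 u_deriv2 by (intro conjI L2_loc_continuous weak_pderiv_C1 cont_u) auto
  have A: "u (a + 1, b) = exp (\<i> * complex_of_real (h * b / 2)) * u (a, b)" for a b
  proof -
    have "ph (a + 1) b = cis (h * b / 2) * ph a b"
      unfolding ph_def cis_mult by (rule arg_cong[where f = cis]) (simp add: field_simps)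
    thus ?thesis by (simp add: u_def W_per s_per cis_conv_exp mult.assoc)
  qed
  have B: "u (a, b + 1) = exp (- \<i> * complex_of_real (h * a / 2)) * u (a, b)" for a b
  proof -
    have "ph a (b + 1) * cis (- h * a) = cis (- (h * a / 2)) * ph a b"
      unfolding ph_def cis_mult by (rule arg_cong[where f = cis]) (simp add: field_simps)
    hence "u (a, b + 1) = cis (- (h * a / 2)) * u (a, b)"
      unfolding u_def fst_conv snd_conv W_per2 s_per(2) by (simp only: mult.assoc[symmetric])
    thus ?thesis by (simp add: cis_conv_exp)
  qed
  show "mag_periodic h u"
    unfolding mag_periodic_def using A[of "fst _" "snd _"] B[of "fst _" "snd _"] by auto
qed

text \<open>After expansion of the squares, \<open>Q\<close> enters only through its squared modulus
  \<open>s * p\<close>. What remains is \<open>p\<close> times the left-hand side of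
  \<open>L_ineq\<close>.\<close>

lemma kinetic_pointwise:
  "(cmod (G1 (a, b)))\<^sup>2 + (cmod (G2 (a, b)))\<^sup>2 \<le> 4 * p a b * (s a b * L' (s a b) + L (s a b))"
proof -
  let ?g = "g (s a b)"
  have exp: "(cmod (v - w * of_real x))\<^sup>2 = (cmod v)\<^sup>2 - 2 * x * Re (cnj w * v) + x\<^sup>2 * (cmod w)\<^sup>2" for v w and x :: real
    unfolding cmod_power2 by (simp add: power2_eq_square algebra_simps)
  have n: "cmod (ph a b) = 1" by (simp add: ph_def)
  have 1: "(cmod (G1 (a, b)))\<^sup>2 = ?g\<^sup>2 * p a b - 2 * (?g^3 * Re (Q a b)) * (?g * Re (Q a b)) + (?g^3 * Re (Q a b))\<^sup>2 * s a b"
    unfolding G1_def fst_conv snd_conv norm_mult n mult_1_left exp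
    by (simp add: norm_mult power_mult_distrib p_def s_def Q_def algebra_simps)
  have 2: "(cmod (G2 (a, b)))\<^sup>2 = ?g\<^sup>2 * p a b - 2 * (- (?g^3 * Im (Q a b))) * (- (?g * Im (Q a b))) + (?g^3 * Im (Q a b))\<^sup>2 * s a b"
  proof -
    have e: "\<i> * V a b * of_real ?g + W a b * of_real (?g^3 * Im (Q a b)) = \<i> * V a b * of_real ?g - W a b * of_real (- (?g^3 * Im (Q a b)))" by simp
    have r: "Re (cnj (W a b) * (\<i> * V a b * of_real ?g)) = - (?g * Im (Q a b))"
      by (simp add: Q_def algebra_simps)
    show ?thesis unfolding G2_def fst_conv snd_conv norm_mult n mult_1_left e exp r
      by (simp add: norm_mult power_mult_distrib p_def s_def)
  qed
  have "(cmod (G1 (a, b)))\<^sup>2 + (cmod (G2 (a, b)))\<^sup>2 = 2 * ?g\<^sup>2 * p a b - 2 * ?g^4 * ((Re (Q a b))\<^sup>2 + (Im (Q a b))\<^sup>2)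
     + ?g^6 * s a b * ((Re (Q a b))\<^sup>2 + (Im (Q a b))\<^sup>2)"
    unfolding 1 2 by (simp add: power_mult_distrib power2_eq_square power3_eq_cube power4_eq_xxxx power_numeral_reduce algebra_simps)
  also have "\<dots> = p a b * (2 * ?g\<^sup>2 - 2 * s a b * ?g^4 + (s a b)\<^sup>2 * ?g^6)"
    unfolding Q_norm by (simp add: power2_eq_square algebra_simps)
  also have "\<dots> \<le> p a b * (4 * (s a b * L' (s a b) + L (s a b)))"
    by (intro mult_left_mono L_ineq s_nonneg)
  finally show ?thesis by (simp add: algebra_simps)
qed

text \<open>For \<open>c^2 = \<epsilon>^2 * h\<close> the logarithm is
  \<open>2 * ln (1 / (\<epsilon> * sqrt h))\<close> up to a bounded error, so the factor
  \<open>h / 2\<close> gives the leading coefficient 1. The last integral is the potential, as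
  \<open>1 - (cmod (u x))^2 = c^2 / (s + c^2)\<close>.\<close>

theorem energy_bound:
  assumes S: "\<And>a b. s a b \<le> S" and \<epsilon>: "\<epsilon> > 0"
  shows "E2D h \<epsilon> u g1 g2 \<le> ennreal (h / 2 * (ln (1 + S / c\<^sup>2) + 2)
     + 1 / (2 * \<epsilon>\<^sup>2) * integral Kc (\<lambda>x. (c\<^sup>2 / (s (fst x) (snd x) + c\<^sup>2))\<^sup>2))"
proof -
  let ?P = "\<lambda>x. (c\<^sup>2 / (s (fst x) (snd x) + c\<^sup>2))\<^sup>2"
  let ?e = "\<lambda>x. (cmod (G1 x))\<^sup>2 + (cmod (G2 x))\<^sup>2 + 1 / (2 * \<epsilon>\<^sup>2) * (1 - (cmod (u x))\<^sup>2)\<^sup>2"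
  have ce: "continuous_on UNIV ?e" by (intro continuous_intros cont_u)
  have sc: "s a b + c\<^sup>2 \<noteq> 0" for a b using pos(1)[OF s_nonneg(1), of a b] by simp
  have cP: "continuous_on UNIV ?P" by (intro continuous_intros) (use sc in auto)
  have "E2D h \<epsilon> u g1 g2 = (\<integral>\<^sup>+x. ennreal (?e x) * indicator (sq 0 (1/2)) x \<partial>lborel)"
    unfolding E2D_def
  proof (rule nn_integral_cong_AE)
    show "AE x in lborel. ennreal ((cmod (g1 x - \<i> * complex_of_real (h * fst (A0 x)) * u x))\<^sup>2 +
         (cmod (g2 x - \<i> * complex_of_real (h * snd (A0 x)) * u x))\<^sup>2 + 1 / (2 * \<epsilon>\<^sup>2) * (1 - (cmod (u x))\<^sup>2)\<^sup>2) * indicator K_sq x =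
       ennreal (?e x) * indicator (sq 0 (1/2)) x"
      using AE_K_sq
    proof eventually_elim
      case (elim x)
      have "g1 x - \<i> * complex_of_real (h * fst (A0 x)) * u x = G1 x" "g2 x - \<i> * complex_of_real (h * snd (A0 x)) * u x = G2 x"
        by (simp_all add: g1_def g2_def A0_def)
      thus ?case unfolding elim by (simp only:)
    qed
  qed
  also have "\<dots> = ennreal (integral Kc ?e)"
    by (rule integral_Kc_nn[OF ce, symmetric]) simp
  also have "integral Kc ?e \<le> h / 2 * (ln (1 + S / c\<^sup>2) + 2) + 1 / (2 * \<epsilon>\<^sup>2) * integral Kc ?P"
  proof -
    let ?k = "\<lambda>x. 4 * p (fst x) (snd x) * (s (fst x) (snd x) * L' (s (fst x) (snd x)) + L (s (fst x) (snd x)))"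
    have ck: "continuous_on UNIV ?k" by (intro continuous_intros cont_L)
    have e1: "integral Kc ?e \<le> integral Kc (\<lambda>x. ?k x + 1 / (2 * \<epsilon>\<^sup>2) * ?P x)"
    proof (rule integral_le)
      show "?e integrable_on Kc" by (rule integrable_Kc[OF ce])
      show "(\<lambda>x. ?k x + 1 / (2 * \<epsilon>\<^sup>2) * ?P x) integrable_on Kc" by (intro integrable_Kc continuous_intros ck cP)
      fix x :: "real \<times> real"
      have "(cmod (u x))\<^sup>2 = s (fst x) (snd x) / (s (fst x) (snd x) + c\<^sup>2)"
      proof -
        have "(cmod (u x))\<^sup>2 = s (fst x) (snd x) * (g (s (fst x) (snd x)))\<^sup>2"
          by (simp only: u_def norm_mult norm_of_real ph_def norm_cis power_mult_distrib power2_abs s_def[symmetric] mult_1_left power_one)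
        also have "(g (s (fst x) (snd x)))\<^sup>2 = 1 / (s (fst x) (snd x) + c\<^sup>2)"
          using pos(1)[OF s_nonneg(1), of "fst x" "snd x"] by (simp add: g_def power_divide)
        finally show ?thesis by simp
      qed
      hence "1 - (cmod (u x))\<^sup>2 = c\<^sup>2 / (s (fst x) (snd x) + c\<^sup>2)"
        using sc[of "fst x" "snd x"] by (simp add: field_simps)
      thus "?e x \<le> ?k x + 1 / (2 * \<epsilon>\<^sup>2) * ?P x"
        using kinetic_pointwise[of "fst x" "snd x"] by simp
    qed
    have e2: "integral Kc (\<lambda>x. ?k x + 1 / (2 * \<epsilon>\<^sup>2) * ?P x) = integral Kc ?k + 1 / (2 * \<epsilon>\<^sup>2) * integral Kc ?P"
    proof -
      have "(\<lambda>x. 1 / (2 * \<epsilon>\<^sup>2) * ?P x) integrable_on Kc"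
        by (rule integrable_Kc[OF continuous_on_mult[OF continuous_on_const cP]])
      from Henstock_Kurzweil_Integration.integral_add[OF integrable_Kc[OF ck] this] show ?thesis
        by (simp only: integral_mult_right)
    qed
    have e3: "integral Kc ?k \<le> integral Kc (\<lambda>x::real\<times>real. h / 2 * (ln (1 + S / c\<^sup>2) + 2))"
      unfolding kinetic_identity
    proof (rule integral_le)
      show "(\<lambda>x. 2 * h * (s (fst x) (snd x) * L (s (fst x) (snd x)))) integrable_on Kc"
        by (intro integrable_Kc continuous_intros cont_L)
      show "(\<lambda>x::real\<times>real. h / 2 * (ln (1 + S / c\<^sup>2) + 2)) integrable_on Kc"
        by (intro integrable_Kc continuous_intros)
      fix x :: "real \<times> real"
      let ?s = "s (fst x) (snd x)"
      have s0: "0 \<le> ?s" by (rule s_nonneg)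
      have "?s / (?s + c\<^sup>2) \<le> 1" using pos(1)[OF s0] by simp
      moreover have "0 \<le> ln (1 + ?s / c\<^sup>2)" using s0 c by simp
      moreover have "ln (1 + ?s / c\<^sup>2) \<le> ln (1 + S / c\<^sup>2)"
        using S[of "fst x" "snd x"] s0 c by (subst ln_le_cancel_iff) (auto intro!: divide_right_mono add_pos_nonneg)
      ultimately have "?s / (?s + c\<^sup>2) * (ln (1 + ?s / c\<^sup>2) + 2) \<le> 1 * (ln (1 + S / c\<^sup>2) + 2)"
        by (intro mult_mono) auto
      hence "h / 2 * (?s / (?s + c\<^sup>2) * (ln (1 + ?s / c\<^sup>2) + 2)) \<le> h / 2 * (1 * (ln (1 + S / c\<^sup>2) + 2))"
        using h by (intro mult_left_mono) auto
      moreover have "2 * h * (?s * L ?s) = h / 2 * (?s / (?s + c\<^sup>2) * (ln (1 + ?s / c\<^sup>2) + 2))"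
      proof -
        have "2 * h * (S * ((l + 2) / (4 * d))) = h / 2 * (S / d * (l + 2))" for S l d :: real by simp
        thus ?thesis unfolding L_def .
      qed
      ultimately show "2 * h * (?s * L ?s) \<le> h / 2 * (ln (1 + S / c\<^sup>2) + 2)"
        by (simp only: mult_1_left)
    qed
    have e4: "integral Kc (\<lambda>x::real\<times>real. h / 2 * (ln (1 + S / c\<^sup>2) + 2)) = h / 2 * (ln (1 + S / c\<^sup>2) + 2)" using content_Kc by (simp add: Kc_def)
    show ?thesis using e1 unfolding e2 using e3 unfolding e4 by linarith
  qed
  finally show ?thesis by (simp add: ennreal_leI)
qed

end

section \<open>Sparse theta series\<close>

lemma abs_le_power2: "\<bar>x\<bar> \<le> b \<Longrightarrow> x\<^sup>2 \<le> (b::real)\<^sup>2"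
  using power_mono[of "\<bar>x\<bar>" b 2] by simp

lemma has_sum_geometric_int:
  fixes r :: real
  assumes r: "0 \<le> r" "r < 1"
  shows "((\<lambda>k::int. r ^ nat \<bar>k\<bar>) has_sum (1 + r) / (1 - r)) UNIV"
proof -
  have g: "(\<lambda>n. r ^ n) sums (1 / (1 - r))" using r by (intro geometric_sums) auto
  have 1: "((\<lambda>k::int. r ^ nat \<bar>k\<bar>) has_sum (1 / (1 - r))) (range int)"
    by (subst has_sum_reindex) (auto simp: o_def r intro!: sums_nonneg_imp_has_sum g)
  have "(\<lambda>n. r * r ^ n) sums (r * (1 / (1 - r)))" by (rule sums_mult[OF g])
  hence 2: "((\<lambda>k::int. r ^ nat \<bar>k\<bar>) has_sum (r * (1 / (1 - r)))) (range (\<lambda>n. - int n - 1))"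
    by (subst has_sum_reindex) (auto simp: o_def r inj_on_def nat_add_distrib intro!: sums_nonneg_imp_has_sum)
  have "range int \<inter> range (\<lambda>n. - int n - 1) = {}" by auto
  from has_sum_Un_disjoint[OF 1 2 this]
  have "((\<lambda>k::int. r ^ nat \<bar>k\<bar>) has_sum (1 / (1 - r) + r * (1 / (1 - r)))) (range int \<union> range (\<lambda>n. - int n - 1))" .
  moreover have "range int \<union> range (\<lambda>n. - int n - 1) = UNIV"
  proof -
    have "k \<in> range int \<union> range (\<lambda>n. - int n - 1)" for k :: int
    proof (cases "k \<ge> 0")
      case True thus ?thesis by (auto intro!: image_eqI[of _ _ "nat k"])
    next
      case False
      hence "k = - int (nat (- k - 1)) - 1" by simp
      thus ?thesis by blast
    qed
    thus ?thesis by auto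
  qed
  moreover have "1 / (1 - r) + r * (1 / (1 - r)) = (1 + r) / (1 - r)" by (simp add: add_divide_distrib)
  ultimately show ?thesis by simp
qed

text \<open>\<open>N\<close> is the number of flux quanta and \<open>m\<close> the number of theta
  series in use. An even \<open>m\<close> makes the parity of the index \<open>m\<close>-periodic.
  The bound \<open>N \<ge> 400\<close> keeps the rounding errors small:
  \<open>\<beta> \<ge> 10/11\<close>, and a shift of \<open>jj\<close> by 1 moves a Gaussian by at
  most \<open>1/20\<close>.\<close>

locale theta_params =
  fixes N m :: nat
  assumes N: "N \<ge> 400" and m: "sqrt (real N) \<le> real m" "real m \<le> sqrt (real N) + 2" "even m"
begin

text \<open>Among the \<open>N\<close> theta series of level \<open>N\<close> only \<open>m \<approx> \<surd>N\<close> are used. After multiplication by the Landau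
  weight the terms are Gaussians at height distance about \<open>1 / \<surd>N\<close>, comparable to their width, so that at every
  height the terms of even index or those of odd index are dominated by a single one.\<close>

definition jj :: "int \<Rightarrow> int" where "jj i = (i * int N) div int m"
definition T :: "int \<Rightarrow> complex \<Rightarrow> complex" where
  "T i z = exp (2 * pi * \<i> * of_int (jj i) * z - of_real (pi * (of_int (jj i))\<^sup>2 / N))"
definition \<beta> :: real where "\<beta> = sqrt N / m"

lemma sqrtN: "sqrt (real N) \<ge> 20"
proof -
  have "sqrt (20\<^sup>2) \<le> sqrt (real N)" using N by (subst real_sqrt_le_iff) simp
  thus ?thesis by simp
qed

lemma m_pos: "m > 0" using m(1) sqrtN by (cases m) auto

lemma beta: "10/11 \<le> \<beta>" "\<beta> \<le> 1"
  using m m_pos sqrtN by (auto simp: \<beta>_def field_simps)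

lemma jj_bounds: "\<beta> * of_int i - 1/20 \<le> of_int (jj i) / sqrt N" "of_int (jj i) / sqrt N \<le> \<beta> * of_int i"
proof -
  have mm: "int m > 0" using m_pos by simp
  have "i * int N = jj i * int m + (i * int N) mod int m" by (simp add: jj_def)
  hence 1: "jj i * int m \<le> i * int N" "i * int N < jj i * int m + int m"
    using pos_mod_sign[OF mm, of "i * int N"] pos_mod_bound[OF mm, of "i * int N"] by linarith+
  have "real_of_int (jj i * int m) \<le> real_of_int (i * int N)" using 1(1) by (simp only: of_int_le_iff)
  hence r1: "of_int (jj i) * real m \<le> of_int i * real N" by simp
  have "real_of_int (i * int N) < real_of_int (jj i * int m + int m)" using 1(2) by (simp only: of_int_less_iff)
  hence r2: "of_int i * real N < of_int (jj i) * real m + real m" by simp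
  have s: "real N = sqrt N * sqrt N" by simp
  have s0: "sqrt N > 0" using N by simp
  have "of_int (jj i) \<le> of_int i * (sqrt N * sqrt N) / real m" using r1 m_pos by (simp add: field_simps)
  thus "of_int (jj i) / sqrt N \<le> \<beta> * of_int i" using s0 by (simp add: \<beta>_def field_simps)
  have "of_int i * (sqrt N * sqrt N) / real m - 1 \<le> of_int (jj i)" using r2 m_pos by (simp add: field_simps)
  hence "(of_int i * (sqrt N * sqrt N) / real m - 1) / sqrt N \<le> of_int (jj i) / sqrt N"
    using s0 by (intro divide_right_mono) auto
  moreover have "(of_int i * (sqrt N * sqrt N) / real m - 1) / sqrt N = \<beta> * of_int i - 1 / sqrt N"
  proof -
    have "(a * (q * q) / m' - 1) / q = q / m' * a - 1 / q" if "q > 0" "m' > 0" for a q m' :: real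
      using that by (simp add: field_simps)
    from this[of "sqrt N" "real m" "of_int i"] show ?thesis using s0 m_pos unfolding \<beta>_def by linarith
  qed
  ultimately have "\<beta> * of_int i - 1 / sqrt N \<le> of_int (jj i) / sqrt N" by linarith
  moreover have "1 / sqrt N \<le> 1/20" using sqrtN N by (intro divide_left_mono) auto
  ultimately show "\<beta> * of_int i - 1/20 \<le> of_int (jj i) / sqrt N" by linarith
qed

text \<open>The modulus of \<open>T i\<close> after multiplication by the Landau weight: a Gaussian
  in the height, centred at \<open>- jj i / N\<close>.\<close>

definition e :: "int \<Rightarrow> real \<Rightarrow> real" where "e i y = exp (- pi * (sqrt N * y + of_int (jj i) / sqrt N)\<^sup>2)"

lemma norm_T: "cmod (T i z) = exp (pi * N * (Im z)\<^sup>2) * e i (Im z)"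
proof -
  have N0: "real N > 0" using N by simp
  have "cmod (T i z) = exp (- 2 * pi * of_int (jj i) * Im z - pi * (of_int (jj i))\<^sup>2 / N)"
    by (simp add: T_def norm_exp_eq_Re)
  also have "- 2 * pi * of_int (jj i) * Im z - pi * (of_int (jj i))\<^sup>2 / N
    = pi * N * (Im z)\<^sup>2 + - pi * (sqrt N * Im z + of_int (jj i) / sqrt N)\<^sup>2"
    using N0 by (simp add: power2_sum power_mult_distrib power_divide field_simps power2_eq_square[of "real N"])
  finally show ?thesis by (simp only: e_def exp_add)
qed

lemma jj_shift: "jj (i + int m) = jj i + int N"
proof -
  have "(i + int m) * int N = i * int N + int N * int m" by (simp add: algebra_simps)
  thus ?thesis unfolding jj_def using m_pos by simp
qed

lemma T_per1: "T i (z + 1) = T i z"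
proof -
  have "exp (2 * pi * \<i> * of_int (jj i)) = 1"
    unfolding exp_eq_1 by (intro conjI exI[of _ "jj i"]) simp_all
  moreover have "T i (z + 1) = exp (2 * pi * \<i> * of_int (jj i)) * T i z"
    unfolding T_def exp_add[symmetric] by (rule arg_cong[where f = exp]) (simp add: algebra_simps)
  ultimately show ?thesis by simp
qed

text \<open>Translation by \<open>\<i>\<close> permutes the terms up to one common factor, by the
  shift of \<open>jj\<close> in \<open>jj_shift\<close>. Coefficients of period \<open>m\<close>
  therefore produce sections for \<open>h = 2 * pi * N\<close>.\<close>

lemma T_per2: "T i (z + \<i>) = exp (- \<i> * of_real (2 * pi * N) * z + of_real (2 * pi * N / 2)) * T (i + int m) z"
proof -
  have N0: "complex_of_nat N \<noteq> 0" using N by simp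
  show ?thesis
    unfolding T_def jj_shift exp_add[symmetric]
    by (rule arg_cong[where f = exp]) (use N0 in \<open>simp add: field_simps power2_eq_square\<close>)
qed

lemma r_range: "exp (- (pi * \<beta>\<^sup>2 / 4)) < 1" "0 \<le> exp (- (pi * \<beta>\<^sup>2 / 4))"
  using beta by auto

text \<open>Uniform on bounded heights, as the holomorphy of the series requires; in
  \<open>e_sum_bound\<close> the central index depends on \<open>y\<close>. The decay comes from
  \<open>(x + v)^2 \<ge> x^2 / 2 - v^2\<close> and \<open>|i| \<le> i^2\<close>.\<close>

lemma e_local_bound:
  assumes "\<bar>y\<bar> \<le> B"
  shows "e i y \<le> exp (pi * (sqrt N * B + 1)\<^sup>2) * exp (- (pi * \<beta>\<^sup>2 / 4)) ^ nat \<bar>i\<bar>"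
proof -
  define x where "x = \<beta> * of_int i"
  define v where "v = sqrt N * y + of_int (jj i) / sqrt N - x"
  have v: "\<bar>v\<bar> \<le> sqrt N * B + 1"
  proof -
    have "\<bar>sqrt N * y\<bar> \<le> sqrt N * B" using assms by (simp add: abs_mult mult_left_mono)
    thus ?thesis using jj_bounds[of i] by (simp add: v_def x_def)
  qed
  hence v2: "v\<^sup>2 \<le> (sqrt N * B + 1)\<^sup>2" by (rule abs_le_power2)
  have "0 \<le> (x + 2 * v)\<^sup>2" by simp
  hence "x\<^sup>2 / 2 - v\<^sup>2 \<le> (x + v)\<^sup>2" by (simp add: power2_eq_square algebra_simps)
  moreover have "\<beta>\<^sup>2 * \<bar>of_int i\<bar> \<le> x\<^sup>2"
  proof -
    have "\<bar>of_int i :: real\<bar> \<le> (of_int i)\<^sup>2"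
    proof -
      have "\<bar>i\<bar> \<le> \<bar>i\<bar> * \<bar>i\<bar>" using mult_right_mono[of 1 "\<bar>i\<bar>" "\<bar>i\<bar>"] by (cases "i = 0") simp_all
      hence "real_of_int \<bar>i\<bar> \<le> real_of_int (\<bar>i\<bar> * \<bar>i\<bar>)" by (simp only: of_int_le_iff)
      thus ?thesis by (simp add: power2_eq_square)
    qed
    thus ?thesis by (simp add: x_def power_mult_distrib mult_left_mono)
  qed
  ultimately have "\<beta>\<^sup>2 * \<bar>of_int i\<bar> / 4 - (sqrt N * B + 1)\<^sup>2 \<le> (x + v)\<^sup>2" using v2 mult_nonneg_nonneg[OF zero_le_power2[of \<beta>] abs_ge_zero[of "of_int i"]] by linarith
  hence "pi * (\<beta>\<^sup>2 * \<bar>of_int i\<bar> / 4 - (sqrt N * B + 1)\<^sup>2) \<le> pi * (x + v)\<^sup>2" by (intro mult_left_mono) auto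
  hence "e i y \<le> exp (pi * (sqrt N * B + 1)\<^sup>2 + real (nat \<bar>i\<bar>) * (- (pi * \<beta>\<^sup>2 / 4)))"
    by (simp add: e_def v_def algebra_simps)
  thus ?thesis by (simp only: exp_add exp_of_nat_mult)
qed

lemma e_nonneg: "0 \<le> e i y" by (simp add: e_def)

text \<open>Rounding to the index \<open>i0\<close> nearest to the height costs at most
  \<open>1/2\<close>, and the integer part in \<open>jj\<close> adds at most
  \<open>1/20\<close>.\<close>

lemma near_index: "\<exists>i0. \<forall>k. \<bar>sqrt N * y + of_int (jj (i0 + k)) / sqrt N - \<beta> * of_int k\<bar> \<le> 11/20"
proof -
  define i0 where "i0 = round (- (sqrt N * y) / \<beta>)"
  have "\<bar>of_int i0 - (- (sqrt N * y) / \<beta>)\<bar> \<le> 1/2" unfolding i0_def by (rule of_int_round_abs_le)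
  hence "\<beta> * \<bar>of_int i0 - (- (sqrt N * y) / \<beta>)\<bar> \<le> 1 * (1/2)" using beta by (intro mult_mono) auto
  moreover have "\<beta> * \<bar>of_int i0 - (- (sqrt N * y) / \<beta>)\<bar> = \<bar>\<beta> * of_int i0 + sqrt N * y\<bar>"
  proof -
    have "\<beta> * \<bar>of_int i0 - (- (sqrt N * y) / \<beta>)\<bar> = \<bar>\<beta> * (of_int i0 - (- (sqrt N * y) / \<beta>))\<bar>"
      using beta by (simp add: abs_mult)
    also have "\<beta> * (of_int i0 - (- (sqrt N * y) / \<beta>)) = \<beta> * of_int i0 + sqrt N * y" using beta by (simp add: field_simps)
    finally show ?thesis .
  qed
  ultimately have i0: "\<bar>\<beta> * of_int i0 + sqrt N * y\<bar> \<le> 1/2" by simp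
  have "\<bar>sqrt N * y + of_int (jj (i0 + k)) / sqrt N - \<beta> * of_int k\<bar> \<le> 11/20" for k
  proof -
    have A: "\<beta> * of_int (i0 + k) = \<beta> * of_int i0 + \<beta> * of_int k" by (simp add: distrib_left)
    show ?thesis using i0 jj_bounds[of "i0 + k"] unfolding A abs_le_iff by linarith
  qed
  thus ?thesis by blast
qed

text \<open>The distance to the centre is at least \<open>q * |k|\<close>. Replacing
  \<open>k^2\<close> by \<open>|k|\<close> turns the Gaussian bound into a geometric one with an
  explicit sum; 3 stands for \<open>pi\<close>.\<close>

lemma gauss_decay:
  fixes d :: real
  assumes d: "\<bar>d - b * of_int k\<bar> \<le> 11/20" and b: "b - 11/20 \<ge> q" "q > 0" "b \<ge> 0"
  shows "exp (- pi * d\<^sup>2) \<le> exp (- 3 * q\<^sup>2) ^ nat \<bar>k\<bar>"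
proof (cases "k = 0")
  case False
  define n where "n = real (nat \<bar>k\<bar>)"
  have n: "n \<ge> 1" "n = \<bar>of_int k\<bar>" using False by (auto simp: n_def)
  have "b * n = \<bar>b * of_int k\<bar>" unfolding n(2) abs_mult using b(3) by simp
  hence "\<bar>d\<bar> \<ge> b * n - 11/20" using d by linarith
  moreover have "b * n - 11/20 \<ge> (b - 11/20) * n" using n(1) by (simp add: left_diff_distrib)
  moreover have "(b - 11/20) * n \<ge> q * n" using b(1) n(1) by (intro mult_right_mono) auto
  ultimately have "q * n \<le> \<bar>d\<bar>" by linarith
  moreover have "0 \<le> q * n" using b(2) n(1) by simp
  ultimately have "(q * n)\<^sup>2 \<le> d\<^sup>2" using power_mono[of "q * n" "\<bar>d\<bar>" 2] by simp
  moreover have "q\<^sup>2 * n \<le> (q * n)\<^sup>2"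
  proof -
    have "n \<le> n\<^sup>2" using n(1) by (simp add: power2_eq_square)
    thus ?thesis by (simp add: power_mult_distrib mult_left_mono)
  qed
  ultimately have "q\<^sup>2 * n \<le> d\<^sup>2" by linarith
  hence "3 * (q\<^sup>2 * n) \<le> pi * d\<^sup>2" using pi_gt3 n(1) by (intro mult_mono) auto
  hence "exp (- pi * d\<^sup>2) \<le> exp (n * (- 3 * q\<^sup>2))" by (simp add: algebra_simps)
  thus ?thesis unfolding n_def by (simp only: exp_of_nat_mult)
qed simp

lemma e_sum_bound: "\<exists>i0. \<forall>k. e (i0 + k) y \<le> (50/69) ^ nat \<bar>k\<bar>"
proof -
  obtain i0 where i0: "\<And>k. \<bar>sqrt N * y + of_int (jj (i0 + k)) / sqrt N - \<beta> * of_int k\<bar> \<le> 11/20"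
    using near_index by blast
  \<comment> \<open>\<open>359/1000\<close> lies just below \<open>10/11 - 11/20\<close>, and the
    two-sided geometric series with ratio \<open>50/69\<close> has the sum
    \<open>119/19 < 7\<close>.\<close>
  have x: "exp (- 3 * (359/1000)\<^sup>2) \<le> (50/69 :: real)"
  proof -
    have "69/50 \<le> 1 + 3 * (359/1000 :: real)\<^sup>2" by (simp add: power2_eq_square)
    also have "\<dots> \<le> exp (3 * (359/1000)\<^sup>2)" by (rule exp_ge_add_one_self)
    finally have "inverse (exp (3 * (359/1000 :: real)\<^sup>2)) \<le> inverse (69/50)" by (intro le_imp_inverse_le) auto
    thus ?thesis by (simp add: exp_minus)
  qed
  have "e (i0 + k) y \<le> (50/69) ^ nat \<bar>k\<bar>" for k
  proof -
    have "e (i0 + k) y \<le> exp (- 3 * (359/1000)\<^sup>2) ^ nat \<bar>k\<bar>"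
      unfolding e_def using beta by (intro gauss_decay[OF i0]) auto
    also have "\<dots> \<le> (50/69) ^ nat \<bar>k\<bar>" by (intro power_mono x) auto
    finally show ?thesis .
  qed
  thus ?thesis by blast
qed

text \<open>Within one parity class the spacing doubles to \<open>2 * \<beta>\<close>. All terms
  except the nearest then add up to at most \<open>2/15\<close>, less than the \<open>1/3\<close>
  that the nearest one guarantees.\<close>

lemma e_parity_bound: "\<exists>i0. e i0 y \<ge> 1/3 \<and> (\<forall>k. e (i0 + 2 * k) y \<le> (1/16) ^ nat \<bar>k\<bar>)"
proof -
  obtain i0 where i0: "\<And>k. \<bar>sqrt N * y + of_int (jj (i0 + k)) / sqrt N - \<beta> * of_int k\<bar> \<le> 11/20"
    using near_index by blast
  \<comment> \<open>\<open>126/100\<close> lies below \<open>2 * (10/11) - 11/20\<close>.\<close>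
  have x: "exp (- 3 * (126/100)\<^sup>2) \<le> (1/16 :: real)"
  proof -
    have "(2::real)^4 \<le> exp 1 ^ 4" using exp_ge_add_one_self[of 1] by (intro power_mono) auto
    also have "\<dots> = exp 4" using exp_of_nat_mult[of 4 "1::real"] by simp
    also have "\<dots> \<le> exp (3 * (126/100)\<^sup>2)" by (simp add: power2_eq_square)
    finally have "inverse (exp (3 * (126/100 :: real)\<^sup>2)) \<le> inverse (2^4)" by (intro le_imp_inverse_le) auto
    thus ?thesis by (simp add: exp_minus)
  qed
  have "e (i0 + 2 * k) y \<le> (1/16) ^ nat \<bar>k\<bar>" for k
  proof -
    have "\<bar>sqrt N * y + of_int (jj (i0 + 2 * k)) / sqrt N - (2 * \<beta>) * of_int k\<bar> \<le> 11/20"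
      using i0[of "2 * k"] by (simp add: mult_ac)
    hence "e (i0 + 2 * k) y \<le> exp (- 3 * (126/100)\<^sup>2) ^ nat \<bar>k\<bar>"
      unfolding e_def using beta by (intro gauss_decay) auto
    also have "\<dots> \<le> (1/16) ^ nat \<bar>k\<bar>" by (intro power_mono x) auto
    finally show ?thesis .
  qed
  moreover have "e i0 y \<ge> 1/3"
  proof -
    define d where "d = sqrt N * y + of_int (jj i0) / sqrt N"
    have "\<bar>d\<bar> \<le> 11/20" using i0[of 0] by (simp add: d_def)
    hence "d\<^sup>2 \<le> (11/20)\<^sup>2" by (rule abs_le_power2)
    hence "pi * d\<^sup>2 \<le> (16/5) * (11/20)\<^sup>2" using pi_less_4 pi_approx by (intro mult_mono) auto
    hence "- 1 \<le> - pi * d\<^sup>2" by (simp add: power2_eq_square)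
    hence "exp (-1) \<le> e i0 y" by (simp add: e_def d_def)
    moreover have "exp (-1) \<ge> (1/3 :: real)"
      using exp_le by (simp add: exp_minus field_simps)
    ultimately show ?thesis by linarith
  qed
  ultimately show ?thesis by blast
qed

section \<open>The theta series as entire functions\<close>

definition Th :: "(int \<Rightarrow> complex) \<Rightarrow> complex \<Rightarrow> complex" where "Th c z = infsum (\<lambda>i. c i * T i z) UNIV"

lemma e_has_sum: "\<exists>S\<le>7. ((\<lambda>i. e i y) has_sum S) UNIV"
proof -
  obtain i0 where i0: "\<And>k. e (i0 + k) y \<le> (50/69) ^ nat \<bar>k\<bar>" using e_sum_bound by blast
  have g: "((\<lambda>k::int. (50/69::real) ^ nat \<bar>k\<bar>) has_sum (1 + 50/69) / (1 - 50/69)) UNIV"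
    by (rule has_sum_geometric_int) auto
  have bij: "bij_betw (\<lambda>k. i0 + k) UNIV UNIV" by (rule bij_betw_byWitness[where f' = "\<lambda>k. k - i0"]) auto
  have "(\<lambda>k. e (i0 + k) y) summable_on UNIV"
    by (rule summable_on_comparison_test[OF has_sum_imp_summable[OF g]]) (auto simp: i0 e_nonneg)
  then obtain S where S: "((\<lambda>k. e (i0 + k) y) has_sum S) UNIV" by (auto simp: summable_on_def)
  have "S \<le> (1 + 50/69) / (1 - 50/69)" by (rule has_sum_mono[OF S g]) (rule i0)
  moreover have "((\<lambda>i. e i y) has_sum S) UNIV" using S has_sum_reindex_bij_betw[OF bij] by blast
  ultimately show ?thesis by (intro exI[of _ S]) auto
qed

lemma T_summable:
  assumes c: "\<And>i. cmod (c i) \<le> 1"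
  shows "(\<lambda>i. norm (c i * T i z)) summable_on UNIV"
proof -
  obtain S where S: "((\<lambda>i. e i (Im z)) has_sum S) UNIV" using e_has_sum by blast
  have "(\<lambda>i. exp (pi * N * (Im z)\<^sup>2) * e i (Im z)) summable_on UNIV"
    by (rule summable_on_cmult_right[OF has_sum_imp_summable[OF S]])
  thus ?thesis
    by (rule summable_on_comparison_test) (use c in \<open>auto simp: norm_mult norm_T mult_left_le_one_le e_nonneg\<close>)
qed

lemma Th_bound:
  assumes c: "\<And>i. cmod (c i) \<le> 1"
  shows "cmod (Th c z) \<le> 7 * exp (pi * N * (Im z)\<^sup>2)"
proof -
  obtain S where S: "S \<le> 7" "((\<lambda>i. e i (Im z)) has_sum S) UNIV" using e_has_sum by blast
  have 1: "((\<lambda>i. c i * T i z) has_sum Th c z) UNIV"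
    unfolding Th_def using abs_summable_summable[OF T_summable[OF c]] by simp
  have "cmod (Th c z) \<le> exp (pi * N * (Im z)\<^sup>2) * S"
    by (rule norm_infsum_le[OF 1 has_sum_cmult_right[OF S(2)]])
       (use c in \<open>auto simp: norm_mult norm_T mult_left_le_one_le e_nonneg\<close>)
  also have "\<dots> \<le> exp (pi * N * (Im z)\<^sup>2) * 7" using S by (intro mult_left_mono) auto
  finally show ?thesis by simp
qed

lemma Th_per1: "Th c (z + 1) = Th c z"
  by (simp add: Th_def T_per1)

lemma Th_per2:
  assumes c: "\<And>i. c (i + int m) = c i"
  shows "Th c (z + \<i>) = exp (- \<i> * of_real (2 * pi * N) * z + of_real (2 * pi * N / 2)) * Th c z"
proof -
  let ?E = "exp (- \<i> * of_real (2 * pi * N) * z + of_real (2 * pi * N / 2))"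
  have bij: "bij_betw (\<lambda>i. i + int m) UNIV UNIV" by (rule bij_betw_byWitness[where f' = "\<lambda>k. k - int m"]) auto
  have "Th c (z + \<i>) = infsum (\<lambda>i. ?E * (c (i + int m) * T (i + int m) z)) UNIV"
    unfolding Th_def T_per2 c by (simp only: mult.left_commute)
  also have "\<dots> = ?E * infsum (\<lambda>i. c (i + int m) * T (i + int m) z) UNIV"
    by (rule infsum_cmult_right')
  also have "infsum (\<lambda>i. c (i + int m) * T (i + int m) z) UNIV = Th c z"
    unfolding Th_def by (rule infsum_reindex_bij_betw[OF bij])
  finally show ?thesis .
qed

lemma Th_holomorphic:
  assumes c: "\<And>i. cmod (c i) \<le> 1"
  shows "Th c holomorphic_on UNIV"
proof -
  \<comment> \<open>The integers are enumerated by \<open>int_decode\<close>, because the comparison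
    criterion for holomorphic series runs over the natural numbers.\<close>
  let ?f = "\<lambda>n z. c (int_decode n) * T (int_decode n) z"
  have bnd: "\<exists>d h. 0 < d \<and> summable h \<and> range h \<subseteq> \<real>\<^sub>\<ge>\<^sub>0 \<and> (\<forall>\<^sub>F n in sequentially. \<forall>y\<in>ball x d \<inter> UNIV. cmod (?f n y) \<le> cmod (h n))" for x
  proof -
    define B where "B = \<bar>Im x\<bar> + 1"
    define K where "K = exp (pi * N * B\<^sup>2) * exp (pi * (sqrt N * B + 1)\<^sup>2)"
    define r where "r = exp (- (pi * \<beta>\<^sup>2 / 4))"
    define h where "h n = K * r ^ nat \<bar>int_decode n\<bar>" for n
    have r: "0 \<le> r" "r < 1" using r_range by (auto simp: r_def)
    have "((\<lambda>k::int. r ^ nat \<bar>k\<bar>) has_sum (1 + r) / (1 - r)) UNIV" by (rule has_sum_geometric_int[OF r])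
    hence "((\<lambda>n. r ^ nat \<bar>int_decode n\<bar>) has_sum (1 + r) / (1 - r)) UNIV"
      using has_sum_reindex_bij_betw[of int_decode UNIV UNIV "\<lambda>k. r ^ nat \<bar>k\<bar>"] bij_int_decode by (simp add: bij_def bij_betw_def)
    hence "summable (\<lambda>n. r ^ nat \<bar>int_decode n\<bar>)" using has_sum_imp_sums sums_summable by blast
    hence h: "summable h" unfolding h_def by (rule summable_mult)
    have K0: "K \<ge> 0" by (simp add: K_def)
    have "cmod (?f n y) \<le> h n" if "y \<in> ball x 1" for n y
    proof -
      have "\<bar>Im y - Im x\<bar> \<le> cmod (y - x)" using abs_Im_le_cmod[of "y - x"] by simp
      hence yB: "\<bar>Im y\<bar> \<le> B" using that by (simp add: B_def dist_norm norm_minus_commute)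
      have "(Im y)\<^sup>2 \<le> B\<^sup>2" using yB by (rule abs_le_power2)
      hence "exp (pi * N * (Im y)\<^sup>2) \<le> exp (pi * N * B\<^sup>2)" by (simp add: mult_left_mono)
      have "cmod (?f n y) \<le> 1 * cmod (T (int_decode n) y)" unfolding norm_mult by (intro mult_right_mono c) auto
      also have "\<dots> = exp (pi * N * (Im y)\<^sup>2) * e (int_decode n) (Im y)" by (simp add: norm_T)
      also have "\<dots> \<le> exp (pi * N * B\<^sup>2) * (exp (pi * (sqrt N * B + 1)\<^sup>2) * r ^ nat \<bar>int_decode n\<bar>)"
        unfolding r_def by (intro mult_mono e_local_bound yB e_nonneg) (use \<open>exp (pi * N * (Im y)\<^sup>2) \<le> exp (pi * N * B\<^sup>2)\<close> in auto)
      finally show ?thesis by (simp add: h_def K_def mult_ac)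
    qed
    hence "cmod (?f n y) \<le> cmod (complex_of_real (h n))" if "y \<in> ball x 1" for n y
    proof -
      have "h n \<ge> 0" using K0 r by (simp add: h_def)
      hence "cmod (complex_of_real (h n)) = h n" by (simp only: norm_of_real abs_of_nonneg)
      thus ?thesis using \<open>\<And>n y. y \<in> ball x 1 \<Longrightarrow> cmod (?f n y) \<le> h n\<close>[OF that] by simp
    qed
    moreover have "range (\<lambda>n. complex_of_real (h n)) \<subseteq> \<real>\<^sub>\<ge>\<^sub>0" using K0 r by (auto simp: h_def)
    moreover have "summable (\<lambda>n. complex_of_real (h n))" using h by (simp add: summable_of_real)
    ultimately show ?thesis by (intro exI[of _ 1] exI[of _ "\<lambda>n. complex_of_real (h n)"]) auto
  qed
  have dif: "?f n field_differentiable (at x)" for n x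
    unfolding T_def field_differentiable_def by (rule exI) (auto intro!: derivative_eq_intros)
  obtain g where g: "\<forall>x \<in> UNIV. ((\<lambda>n. ?f n x) sums g x) \<and> g field_differentiable (at x)"
  proof (rule series_differentiable_comparison_complex[OF open_UNIV])
    show "?f n field_differentiable (at x)" for n x by (rule dif)
    show "\<exists>d h. 0 < d \<and> summable h \<and> range h \<subseteq> \<real>\<^sub>\<ge>\<^sub>0 \<and> (\<forall>\<^sub>F n in sequentially. \<forall>y\<in>ball x d \<inter> UNIV. cmod (?f n y) \<le> cmod (h n))" for x
      by (rule bnd)
  qed
  have "Th c x = g x" for x
  proof -
    have "((\<lambda>i. c i * T i x) has_sum Th c x) UNIV"
      unfolding Th_def using abs_summable_summable[OF T_summable[OF c]] by simp
    hence "((\<lambda>n. ?f n x) has_sum Th c x) UNIV"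
      using has_sum_reindex_bij_betw[of int_decode UNIV UNIV "\<lambda>i. c i * T i x"] bij_int_decode by (simp add: bij_def bij_betw_def)
    hence "(\<lambda>n. ?f n x) sums Th c x" by (rule has_sum_imp_sums)
    thus ?thesis using g sums_unique2 by blast
  qed
  hence "Th c = g" by auto
  thus ?thesis using g by (simp add: holomorphic_on_def field_differentiable_at_within)
qed

definition ev :: "int \<Rightarrow> complex" where "ev i = (if even i then 1 else 0)"
definition od :: "int \<Rightarrow> complex" where "od i = (if even i then 0 else 1)"

lemma evod: "cmod (ev i) \<le> 1" "cmod (od i) \<le> 1" "ev (i + int m) = ev i" "od (i + int m) = od i"
  using m(3) by (auto simp: ev_def od_def)

text \<open>The sequence \<open>c\<close> selects the parity class of the dominant index, hence it
  is \<open>ev\<close> or \<open>od\<close>. The dominant term minus all others leaves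
  \<open>1/3 - 2/15 = 1/5\<close>.\<close>

lemma Th_lower: "cmod (Th ev z) \<ge> exp (pi * N * (Im z)\<^sup>2) / 5 \<or> cmod (Th od z) \<ge> exp (pi * N * (Im z)\<^sup>2) / 5"
proof -
  obtain i0 where i0: "e i0 (Im z) \<ge> 1/3" and k: "\<And>k. e (i0 + 2 * k) (Im z) \<le> (1/16) ^ nat \<bar>k\<bar>"
    using e_parity_bound by blast
  define c where "c i = (if even (i - i0) then 1 else 0 :: complex)" for i
  have c1: "cmod (c i) \<le> 1" for i by (simp add: c_def)
  let ?M = "exp (pi * N * (Im z)\<^sup>2)"
  have "cmod (Th c z) \<ge> ?M / 5"
  proof -
    have "infsum (\<lambda>i. c i * T i z) (range (\<lambda>k. i0 + 2 * k)) = Th c z"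
      unfolding Th_def
    proof (rule infsum_cong_neutral)
      fix x assume "x \<in> UNIV - range (\<lambda>k. i0 + 2 * k)"
      hence "x \<noteq> i0 + 2 * k" for k by auto
      hence "x - i0 \<noteq> 2 * k" for k by (metis add.commute diff_add_cancel)
      hence "odd (x - i0)" by (meson evenE)
      thus "c x * T x z = 0" by (simp add: c_def)
    qed auto
    hence T1: "Th c z = infsum (\<lambda>k. T (i0 + 2 * k) z) UNIV"
      by (subst (asm) infsum_reindex) (auto simp: inj_on_def o_def c_def)
    have g: "((\<lambda>k::int. (1/16::real) ^ nat \<bar>k\<bar>) has_sum (1 + 1/16) / (1 - 1/16)) UNIV"
      by (rule has_sum_geometric_int) auto
    have nb: "cmod (T (i0 + 2 * k) z) \<le> ?M * (1/16) ^ nat \<bar>k\<bar>" for k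
      unfolding norm_T using k[of k] by (intro mult_left_mono) auto
    have gs: "((\<lambda>k::int. ?M * (1/16::real) ^ nat \<bar>k\<bar>) has_sum ?M * ((1 + 1/16) / (1 - 1/16))) UNIV"
      by (rule has_sum_cmult_right[OF g])
    have abs: "(\<lambda>k. norm (T (i0 + 2 * k) z)) summable_on UNIV"
      by (rule summable_on_comparison_test[OF has_sum_imp_summable[OF gs]]) (auto simp: nb)
    have sm: "(\<lambda>k. T (i0 + 2 * k) z) summable_on UNIV" by (rule abs_summable_summable[OF abs])
    have s0: "((\<lambda>k. T (i0 + 2 * k) z) has_sum (Th c z - T i0 z)) (UNIV - {0})"
    proof -
      have "((\<lambda>k. T (i0 + 2 * k) z) has_sum Th c z) UNIV" unfolding T1 using sm by simp
      moreover have "((\<lambda>k. T (i0 + 2 * k) z) has_sum T i0 z) {0}"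
        using has_sum_finite[of "{0::int}" "\<lambda>k. T (i0 + 2 * k) z"] by simp
      ultimately show ?thesis by (rule has_sum_Diff) auto
    qed
    have g0: "((\<lambda>k::int. ?M * (1/16::real) ^ nat \<bar>k\<bar>) has_sum (?M * ((1 + 1/16) / (1 - 1/16)) - ?M)) (UNIV - {0})"
    proof -
      have "((\<lambda>k::int. ?M * (1/16::real) ^ nat \<bar>k\<bar>) has_sum ?M) {0}"
        using has_sum_finite[of "{0::int}" "\<lambda>k. ?M * (1/16::real) ^ nat \<bar>k\<bar>"] by simp
      from has_sum_Diff[OF gs this] show ?thesis by auto
    qed
    have "cmod (Th c z - T i0 z) \<le> ?M * ((1 + 1/16) / (1 - 1/16)) - ?M"
      by (rule norm_infsum_le[OF s0 g0]) (rule nb)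
    also have "\<dots> = ?M * (2/15)" by simp
    finally have 1: "cmod (Th c z - T i0 z) \<le> ?M * (2/15)" .
    have "cmod (T i0 z) \<ge> ?M * (1/3)" unfolding norm_T by (intro mult_left_mono i0) auto
    thus ?thesis using 1 norm_triangle_ineq2[of "T i0 z" "T i0 z - Th c z"] by (simp add: norm_minus_commute)
  qed
  moreover have "c = ev \<or> c = od"
    by (cases "even i0") (auto simp: c_def ev_def od_def fun_eq_iff)
  ultimately show ?thesis by auto
qed

end

section \<open>Averaging over the coefficient\<close>

lemma arctan_integral_bound:
  fixes l \<xi> :: real
  assumes "l > 0"
  shows "integral {-1..1} (\<lambda>x. 1 / (1 + l\<^sup>2 * (x + \<xi>)\<^sup>2)) \<le> pi / l"
proof -
  have deriv: "((\<lambda>x. arctan (l * (x + \<xi>)) / l) has_real_derivative 1 / (1 + l\<^sup>2 * (x + \<xi>)\<^sup>2)) (at x)" for x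
  proof -
    have "((\<lambda>x. l * (x + \<xi>)) has_real_derivative l) (at x)" by (auto intro!: derivative_eq_intros)
    from DERIV_cdivide[OF DERIV_chain2[OF DERIV_arctan this], of l] show ?thesis
      using assms by (simp add: power_mult_distrib inverse_eq_divide)
  qed
  have "((\<lambda>x. 1 / (1 + l\<^sup>2 * (x + \<xi>)\<^sup>2)) has_integral (arctan (l * (1 + \<xi>)) / l - arctan (l * (-1 + \<xi>)) / l)) {-1..1}"
    by (rule fundamental_theorem_of_calculus)
       (auto simp flip: has_real_derivative_iff_has_vector_derivative intro: has_field_derivative_at_within[OF deriv])
  hence "integral {-1..1} (\<lambda>x. 1 / (1 + l\<^sup>2 * (x + \<xi>)\<^sup>2)) = (arctan (l * (1 + \<xi>)) - arctan (l * (-1 + \<xi>))) / l"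
    by (simp add: integral_unique diff_divide_distrib)
  also have "\<dots> \<le> pi / l"
    using arctan_bounded[of "l * (1 + \<xi>)"] arctan_bounded[of "l * (-1 + \<xi>)"] assms
    by (intro divide_right_mono) auto
  finally show ?thesis .
qed

definition Ibox :: "(real \<times> real) set" where "Ibox = cbox (-1, -1) (1, 1)"

definition affine_sq :: "complex \<Rightarrow> complex \<Rightarrow> real \<times> real \<Rightarrow> real" where
  "affine_sq p q a = (cmod (Complex (fst a) (snd a) * p + q))\<^sup>2"

text \<open>In terms of \<open>a + q / p\<close> the integrand is a fixed profile at scale
  \<open>c / cmod p\<close>. The inequality \<open>(1 + A) * (1 + B) \<le> (1 + A + B)^2\<close>
  separates the two real variables, and each factor integrates to at most \<open>pi / l\<close>,
  wherever the zero \<open>- q / p\<close> lies.\<close>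

lemma affine_average_nondegenerate:
  assumes p: "p \<noteq> 0" and c: "c > 0"
  shows "integral Ibox (\<lambda>a. (c\<^sup>2 / (affine_sq p q a + c\<^sup>2))\<^sup>2) \<le> pi\<^sup>2 * c\<^sup>2 / (cmod p)\<^sup>2"
proof -
  define x where "x = q / p"
  define l where "l = cmod p / c"
  have l: "l > 0" using p c by (simp add: l_def)
  let ?f = "\<lambda>\<xi> t. 1 / (1 + l\<^sup>2 * (t + \<xi>)\<^sup>2) :: real"
  have pos: "1 + l\<^sup>2 * t\<^sup>2 > 0" for t by (simp add: add_pos_nonneg)
  have nn: "affine_sq p q a \<ge> 0" for a by (simp add: affine_sq_def)
  have s: "affine_sq p q a = (cmod p)\<^sup>2 * ((fst a + Re x)\<^sup>2 + (snd a + Im x)\<^sup>2)" for a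
  proof -
    have "Complex (fst a) (snd a) * p + q = p * (Complex (fst a) (snd a) + x)" using p by (simp add: x_def algebra_simps)
    thus ?thesis unfolding affine_sq_def by (simp add: norm_mult power_mult_distrib) (simp add: cmod_power2)
  qed
  have cf: "continuous_on A (\<lambda>a. ?f \<xi> (g a))" if "continuous_on A g" for A and g :: "real \<times> real \<Rightarrow> real" and \<xi>
    using pos by (intro continuous_intros that) (auto simp: less_imp_neq[symmetric])
  have "integral Ibox (\<lambda>a. (c\<^sup>2 / (affine_sq p q a + c\<^sup>2))\<^sup>2) \<le> integral Ibox (\<lambda>a. ?f (Re x) (fst a) * ?f (Im x) (snd a))"
  proof (rule integral_le)
    have "affine_sq p q a + c\<^sup>2 \<noteq> 0" for a using nn[of a] c by (smt (verit) zero_less_power2)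
    thus "(\<lambda>a. (c\<^sup>2 / (affine_sq p q a + c\<^sup>2))\<^sup>2) integrable_on Ibox"
      unfolding Ibox_def affine_sq_def by (intro integrable_continuous continuous_intros) auto
    show "(\<lambda>a. ?f (Re x) (fst a) * ?f (Im x) (snd a)) integrable_on Ibox"
      unfolding Ibox_def by (intro integrable_continuous continuous_on_mult cf continuous_intros)
    fix a
    let ?A = "l\<^sup>2 * (fst a + Re x)\<^sup>2" and ?B = "l\<^sup>2 * (snd a + Im x)\<^sup>2"
    have AB: "?A \<ge> 0" "?B \<ge> 0" by simp_all
    have "affine_sq p q a + c\<^sup>2 = c\<^sup>2 * (1 + ?A + ?B)"
      unfolding s l_def using c by (simp add: field_simps)
    hence "(c\<^sup>2 / (affine_sq p q a + c\<^sup>2))\<^sup>2 = 1 / (1 + ?A + ?B)\<^sup>2" using c by (simp add: power_divide)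
    also have "\<dots> \<le> 1 / ((1 + ?A) * (1 + ?B))"
    proof (rule divide_left_mono)
      have "(1 + A) * (1 + B) \<le> (1 + A + B)\<^sup>2" if "A \<ge> 0" "B \<ge> 0" for A B :: real
      proof -
        have "(1 + A + B)\<^sup>2 = (1 + A) * (1 + B) + (A + B + A\<^sup>2 + B\<^sup>2 + A * B)"
          by (simp add: power2_eq_square algebra_simps)
        moreover have "0 \<le> A + B + A\<^sup>2 + B\<^sup>2 + A * B" using that by simp
        ultimately show ?thesis by linarith
      qed
      from this[OF AB] show "(1 + ?A) * (1 + ?B) \<le> (1 + ?A + ?B)\<^sup>2" .
      show "0 < (1 + ?A + ?B)\<^sup>2 * ((1 + ?A) * (1 + ?B))" proof -
        have "0 < 1 + ?A + ?B" "0 < 1 + ?A" "0 < 1 + ?B" using AB by linarith+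
        thus ?thesis by (metis mult_pos_pos zero_less_power)
      qed
    qed simp
    finally show "(c\<^sup>2 / (affine_sq p q a + c\<^sup>2))\<^sup>2 \<le> ?f (Re x) (fst a) * ?f (Im x) (snd a)" by simp
  qed
  also have "\<dots> = integral {-1..1} (?f (Re x)) * integral {-1..1} (?f (Im x))"
  proof -
    have "continuous_on (cbox (-1, -1) (1, 1)) (\<lambda>a. ?f (Re x) (fst a) * ?f (Im x) (snd a))"
      by (intro continuous_on_mult cf continuous_intros)
    from integral_prod_continuous[OF this] show ?thesis
      unfolding Ibox_def fst_conv snd_conv Henstock_Kurzweil_Integration.integral_mult_right
        Henstock_Kurzweil_Integration.integral_mult_left by (simp only: cbox_interval)
  qed
  also have "\<dots> \<le> (pi / l) * (pi / l)"
  proof (rule mult_mono)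
    have "continuous_on {-1..1} (?f (Im x))"
    proof (intro continuous_intros ballI)
      show "1 + l\<^sup>2 * (t + Im x)\<^sup>2 \<noteq> 0" for t using pos[of "t + Im x"] by linarith
    qed
    thus "0 \<le> integral {-1..1} (?f (Im x))"
      by (intro Henstock_Kurzweil_Integration.integral_nonneg integrable_continuous_interval) auto
  qed (use l in \<open>auto intro: arctan_integral_bound\<close>)
  also have "\<dots> = pi\<^sup>2 * c\<^sup>2 / (cmod p)\<^sup>2" by (simp add: l_def power2_eq_square)
  finally show ?thesis .
qed

lemma measure_Ibox: "integral Ibox (\<lambda>a. k) = 4 * (k::real)"
  unfolding Ibox_def by (simp add: content_Pair)

text \<open>If \<open>cmod p \<ge> 1/20\<close> the previous lemma applies. Otherwise
  \<open>q\<close> is the large coefficient, and \<open>cmod a \<le> 2\<close> on the box gives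
  \<open>cmod (a * p + q) \<ge> 1/5 - 1/10\<close>, so the integrand itself is of order
  \<open>c^4\<close>.\<close>

lemma affine_average:
  assumes c: "0 < c" "c \<le> 1" and pq: "cmod p \<ge> 1/5 \<or> cmod q \<ge> 1/5"
  shows "integral Ibox (\<lambda>a. (c\<^sup>2 / (affine_sq p q a + c\<^sup>2))\<^sup>2) \<le> 40000 * c\<^sup>2"
proof (cases "cmod p \<ge> 1/20")
  case True
  have "integral Ibox (\<lambda>a. (c\<^sup>2 / (affine_sq p q a + c\<^sup>2))\<^sup>2) \<le> pi\<^sup>2 * c\<^sup>2 / (cmod p)\<^sup>2"
    using True c by (intro affine_average_nondegenerate) auto
  also have "\<dots> \<le> 4\<^sup>2 * c\<^sup>2 / (1/20)\<^sup>2"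
    using True pi_less_4 by (intro frac_le mult_right_mono power_mono) auto
  also have "\<dots> \<le> 40000 * c\<^sup>2" by (simp add: power_divide)
  finally show ?thesis .
next
  case False
  hence q: "cmod q \<ge> 1/5" using pq by auto
  have nn: "affine_sq p q a \<ge> 0" for a by (simp add: affine_sq_def)
  have "affine_sq p q a + c\<^sup>2 \<noteq> 0" for a using nn[of a] c by (smt (verit) zero_less_power2)
  hence int: "(\<lambda>a. (c\<^sup>2 / (affine_sq p q a + c\<^sup>2))\<^sup>2) integrable_on Ibox"
    unfolding Ibox_def affine_sq_def by (intro integrable_continuous continuous_intros) auto
  have "integral Ibox (\<lambda>a. (c\<^sup>2 / (affine_sq p q a + c\<^sup>2))\<^sup>2) \<le> integral Ibox (\<lambda>a::real\<times>real. 10000 * c\<^sup>2)"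
  proof (rule integral_le[OF int])
    show "(\<lambda>a::real\<times>real. 10000 * c\<^sup>2) integrable_on Ibox" unfolding Ibox_def by (rule integrable_const)
    fix a assume "a \<in> Ibox"
    hence "\<bar>fst a\<bar> \<le> 1" "\<bar>snd a\<bar> \<le> 1" by (cases a; auto simp: Ibox_def cbox_Pair_eq)+
    hence "cmod (Complex (fst a) (snd a)) \<le> 2" using cmod_le[of "Complex (fst a) (snd a)"] by simp
    hence "cmod (Complex (fst a) (snd a) * p) \<le> 2 * (1/20)" unfolding norm_mult using False by (intro mult_mono) auto
    hence "1/10 \<le> cmod (Complex (fst a) (snd a) * p + q)"
      using q norm_triangle_ineq2[of q "- (Complex (fst a) (snd a) * p)"] by (simp add: add.commute)
    from power_mono[OF this, of 2] have s: "1/100 \<le> affine_sq p q a" by (simp add: affine_sq_def power2_eq_square)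
    have "c\<^sup>2 / (affine_sq p q a + c\<^sup>2) \<le> c\<^sup>2 / (1/100)"
    proof (rule divide_left_mono)
      show "1/100 \<le> affine_sq p q a + c\<^sup>2" using s zero_le_power2[of c] by linarith
      thus "0 < (affine_sq p q a + c\<^sup>2) * (1/100)" by simp
    qed simp
    hence "(c\<^sup>2 / (affine_sq p q a + c\<^sup>2))\<^sup>2 \<le> (c\<^sup>2 / (1/100))\<^sup>2" using nn[of a] by (intro power_mono) auto
    also have "\<dots> = 10000 * (c\<^sup>2 * c\<^sup>2)" by (simp add: power2_eq_square)
    also have "\<dots> \<le> 10000 * (c\<^sup>2 * 1)" using c by (intro mult_left_mono) (auto simp: power_le_one)
    finally show "(c\<^sup>2 / (affine_sq p q a + c\<^sup>2))\<^sup>2 \<le> 10000 * c\<^sup>2" by simp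
  qed
  also have "\<dots> = 40000 * c\<^sup>2" unfolding measure_Ibox by simp
  finally show ?thesis .
qed

section \<open>The competitor\<close>

context theta_params
begin

definition wp :: "real \<times> real \<Rightarrow> complex" where "wp x = of_real (exp (- pi * N * (snd x)\<^sup>2)) * Th ev (Complex (fst x) (snd x))"
definition wq :: "real \<times> real \<Rightarrow> complex" where "wq x = of_real (exp (- pi * N * (snd x)\<^sup>2)) * Th od (Complex (fst x) (snd x))"

lemma wpq_bounds: "cmod (wp x) \<le> 7" "cmod (wq x) \<le> 7" "cmod (wp x) \<ge> 1/5 \<or> cmod (wq x) \<ge> 1/5"
proof -
  let ?M = "exp (pi * N * (snd x)\<^sup>2)" and ?z = "Complex (fst x) (snd x)"
  have M: "exp (- pi * N * (snd x)\<^sup>2) = 1 / ?M" by (simp add: exp_minus inverse_eq_divide)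
  have 1: "cmod (wp x) = cmod (Th ev ?z) / ?M" "cmod (wq x) = cmod (Th od ?z) / ?M"
    unfolding wp_def wq_def M by (simp_all add: norm_mult norm_divide)
  show "cmod (wp x) \<le> 7" "cmod (wq x) \<le> 7"
    unfolding 1 using Th_bound[where c = ev and z = ?z, OF evod(1)] Th_bound[where c = od and z = ?z, OF evod(2)] by (simp_all add: divide_le_eq)
  show "cmod (wp x) \<ge> 1/5 \<or> cmod (wq x) \<ge> 1/5"
    unfolding 1 using Th_lower[of ?z] by (simp add: field_simps)
qed

lemma cont_wpq: "continuous_on UNIV wp" "continuous_on UNIV wq"
  unfolding wp_def wq_def
  by (intro continuous_intros continuous_on_compose2[OF holomorphic_on_imp_continuous_on[OF Th_holomorphic[OF evod(1)]]]
      continuous_on_compose2[OF holomorphic_on_imp_continuous_on[OF Th_holomorphic[OF evod(2)]]] subset_UNIV)+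

lemma theta_section_exists:
  assumes c: "c > 0"
  defines "F \<equiv> \<lambda>a z. a * Th ev z + Th od z"
  shows "theta_section (2 * pi * N) c (F a) (deriv (F a)) (deriv (deriv (F a)))"
proof
  have hol: "F a holomorphic_on UNIV"
    unfolding F_def by (intro holomorphic_intros Th_holomorphic evod)
  have hol': "deriv (F a) holomorphic_on UNIV" by (rule holomorphic_deriv[OF hol open_UNIV])
  have hol'': "deriv (deriv (F a)) holomorphic_on UNIV" by (rule holomorphic_deriv[OF hol' open_UNIV])
  show "2 * pi * real N > 0" using N by simp
  show "c > 0" by fact
  show "(F a has_field_derivative deriv (F a) z) (at z)" for z
    by (rule holomorphic_derivI[OF hol open_UNIV]) simp
  show "(deriv (F a) has_field_derivative deriv (deriv (F a)) z) (at z)" for z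
    by (rule holomorphic_derivI[OF hol' open_UNIV]) simp
  show "continuous_on UNIV (deriv (deriv (F a)))" by (rule holomorphic_on_imp_continuous_on[OF hol''])
  show "F a (z + 1) = F a z" for z by (simp add: F_def Th_per1)
  show "F a (z + \<i>) = exp (- \<i> * of_real (2 * pi * N) * z + of_real (2 * pi * N / 2)) * F a z" for z
    unfolding F_def Th_per2[where c = ev, OF evod(3)] Th_per2[where c = od, OF evod(4)] by (simp only: distrib_left mult.left_commute)
qed

theorem competitor:
  assumes \<epsilon>: "\<epsilon> > 0" and small: "\<epsilon> * sqrt (2 * pi * N) \<le> 1"
  shows "\<exists>u g1 g2. H1_loc_grad u g1 g2 \<and> mag_periodic (2 * pi * N) u \<and>
     E2D (2 * pi * N) \<epsilon> u g1 g2 \<le> ennreal ((2 * pi * N) / 2 * (ln (1 + 441 / (\<epsilon>\<^sup>2 * (2 * pi * N))) + 2) + 10000 * (2 * pi * N))"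
proof -
  define h where "h = 2 * pi * N"
  have h: "h > 0" using N by (simp add: h_def)
  \<comment> \<open>A simple zero of the weighted section typically has a slope of order
    \<open>sqrt h\<close>, so the regularisation acts within a distance of order
    \<open>\<epsilon>\<close>, the core radius.\<close>
  define c where "c = \<epsilon> * sqrt h"
  have c: "0 < c" "c \<le> 1" using \<epsilon> h small by (auto simp: c_def h_def)
  have c2: "c\<^sup>2 = \<epsilon>\<^sup>2 * h" using h by (simp add: c_def power_mult_distrib)
  let ?s = "\<lambda>a x. affine_sq (wp x) (wq x) a"
  let ?J = "\<lambda>a x. (c\<^sup>2 / (?s a x + c\<^sup>2))\<^sup>2"
  have nz: "?s a x + c\<^sup>2 \<noteq> 0" for a x using c by (smt (verit) affine_sq_def zero_le_power2 zero_less_power2)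
  have cJ: "continuous_on UNIV (\<lambda>y. ?J (fst y) (snd y))"
    unfolding affine_sq_def
    by (intro continuous_intros continuous_on_compose2[OF cont_wpq(1)] continuous_on_compose2[OF cont_wpq(2)] subset_UNIV)
       (use nz in \<open>auto simp: affine_sq_def\<close>)
  \<comment> \<open>First moment method: the box has area 4, so the mean over \<open>a\<close> is at
    most \<open>10000 * c^2\<close> by \<open>affine_average\<close>. The factor 2 in the claim
    leaves room for non-strict inequalities.\<close>
  have "\<exists>a\<in>Ibox. integral Kc (?J a) \<le> 20000 * c\<^sup>2"
  proof (rule ccontr)
    assume "\<not> ?thesis"
    hence big: "integral Kc (?J a) > 20000 * c\<^sup>2" if "a \<in> Ibox" for a using that by (auto simp: not_le)
    have cont: "continuous_on UNIV (\<lambda>a. integral Kc (?J a))"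
      using integral_continuous_on_param[of UNIV "(-1/2,-1/2)" "(1/2,1/2)" ?J] cJ
      unfolding Kc_def by (auto simp: case_prod_unfold intro: continuous_on_subset)
    have "4 * (20000 * c\<^sup>2) = integral Ibox (\<lambda>a. 20000 * c\<^sup>2)" by (rule measure_Ibox[symmetric])
    also have "\<dots> \<le> integral Ibox (\<lambda>a. integral Kc (?J a))"
    proof (rule integral_le)
      show "(\<lambda>a::real\<times>real. 20000 * c\<^sup>2) integrable_on Ibox" unfolding Ibox_def by (rule integrable_const)
      show "(\<lambda>a. integral Kc (?J a)) integrable_on Ibox"
        unfolding Ibox_def by (rule integrable_continuous) (rule continuous_on_subset[OF cont], simp)
    qed (use big in \<open>auto intro: less_imp_le\<close>)
    also have "\<dots> = integral Kc (\<lambda>x. integral Ibox (\<lambda>a. ?J a x))"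
    proof -
      have "continuous_on (cbox ((-1,-1), (-1/2,-1/2)) ((1,1), (1/2,1/2))) (\<lambda>(a, x). ?J a x)"
        unfolding case_prod_unfold by (rule continuous_on_subset[OF cJ]) simp
      from integral_swap_continuous[OF this] show ?thesis unfolding Ibox_def Kc_def .
    qed
    also have "\<dots> \<le> integral Kc (\<lambda>x::real\<times>real. 40000 * c\<^sup>2)"
    proof (rule integral_le)
      have "continuous_on (UNIV \<times> cbox (-1,-1) (1,1)) (\<lambda>(x, a). ?J a x)"
        unfolding case_prod_unfold
        by (rule continuous_on_compose2[OF cJ, of _ "\<lambda>y. (snd y, fst y)", simplified]) (intro continuous_intros)
      from integral_continuous_on_param[OF this]
      show "(\<lambda>x. integral Ibox (\<lambda>a. ?J a x)) integrable_on Kc"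
        unfolding Ibox_def by (rule integrable_Kc)
      show "(\<lambda>x::real\<times>real. 40000 * c\<^sup>2) integrable_on Kc" by (intro integrable_Kc continuous_intros)
    qed (use affine_average[OF c wpq_bounds(3)] in auto)
    also have "\<dots> = 40000 * c\<^sup>2" using content_Kc by (simp add: Kc_def)
    finally show False using c by simp
  qed
  then obtain a where a: "a \<in> Ibox" "integral Kc (?J a) \<le> 20000 * c\<^sup>2" by blast
  let ?a = "Complex (fst a) (snd a)"
  let ?F = "\<lambda>z. ?a * Th ev z + Th od z"
  interpret S: theta_section h c ?F "deriv ?F" "deriv (deriv ?F)"
    unfolding h_def by (rule theta_section_exists[OF c(1)])
  have s_eq: "S.s b b' = ?s a (b, b')" for b b'
  proof -
    have "S.W b b' = ?a * wp (b, b') + wq (b, b')"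
      by (simp only: S.W_def S.Ga_def) (simp add: wp_def wq_def h_def algebra_simps)
    thus ?thesis by (simp add: S.s_def affine_sq_def)
  qed
  \<comment> \<open>\<open>441 = 21^2\<close>, where \<open>21 = 2 * 7 + 7\<close> comes from
    \<open>cmod a \<le> 2\<close> and the bound 7 for both weighted series.\<close>
  have "S.s b b' \<le> 441" for b b'
  proof -
    have "\<bar>fst a\<bar> \<le> 1" "\<bar>snd a\<bar> \<le> 1" using a(1) by (cases a; auto simp: Ibox_def cbox_Pair_eq)+
    hence "cmod ?a \<le> 2" using cmod_le[of ?a] by simp
    hence "cmod (?a * wp (b, b')) \<le> 2 * 7" unfolding norm_mult using wpq_bounds(1)[of "(b, b')"] by (intro mult_mono) auto
    hence "cmod (?a * wp (b, b') + wq (b, b')) \<le> 21"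
      using wpq_bounds(2)[of "(b, b')"] norm_triangle_ineq[of "?a * wp (b, b')" "wq (b, b')"] by linarith
    from power_mono[OF this, of 2] show ?thesis by (simp add: s_eq affine_sq_def)
  qed
  from S.energy_bound[OF this \<epsilon>]
  have "E2D h \<epsilon> S.u S.g1 S.g2 \<le> ennreal (h / 2 * (ln (1 + 441 / c\<^sup>2) + 2) + 1 / (2 * \<epsilon>\<^sup>2) * integral Kc (?J a))"
    by (simp add: s_eq)
  also have "\<dots> \<le> ennreal (h / 2 * (ln (1 + 441 / c\<^sup>2) + 2) + 10000 * h)"
  proof (rule ennreal_leI)
    have "1 / (2 * \<epsilon>\<^sup>2) * integral Kc (?J a) \<le> 1 / (2 * \<epsilon>\<^sup>2) * (20000 * c\<^sup>2)"
      using a(2) by (intro mult_left_mono) auto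
    also have "\<dots> = 10000 * h" using \<epsilon> by (simp add: c2)
    finally show "h / 2 * (ln (1 + 441 / c\<^sup>2) + 2) + 1 / (2 * \<epsilon>\<^sup>2) * integral Kc (?J a) \<le> h / 2 * (ln (1 + 441 / c\<^sup>2) + 2) + 10000 * h"
      by simp
  qed
  finally have "E2D h \<epsilon> S.u S.g1 S.g2 \<le> ennreal (h / 2 * (ln (1 + 441 / (\<epsilon>\<^sup>2 * h)) + 2) + 10000 * h)"
    unfolding c2 .
  thus ?thesis using S.admissible unfolding h_def by blast
qed

end

section \<open>The asymptotics of the ground state energy\<close>

lemma m_p_le:
  assumes "H1_loc_grad u g1 g2" "mag_periodic h u" "E2D h \<epsilon> u g1 g2 \<le> ennreal B" "0 \<le> B"
  shows "m_p h \<epsilon> \<le> B"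
proof -
  have "(INF ugg \<in> {(u, g1, g2). H1_loc_grad u g1 g2 \<and> mag_periodic h u}.
      E2D h \<epsilon> (fst ugg) (fst (snd ugg)) (snd (snd ugg))) \<le> ennreal B"
    using assms by (intro INF_lower2[of "(u, g1, g2)"]) auto
  from enn2real_mono[OF this] show ?thesis using assms(4) by (simp add: m_p_def)
qed

text \<open>\<open>enn2real\<close> sends infinity to 0, so a competitor of finite energy is needed
  before a lower bound for the infimum passes to \<open>m_p\<close>.\<close>

lemma m_p_ge:
  assumes ex: "H1_loc_grad u g1 g2" "mag_periodic h u" "E2D h \<epsilon> u g1 g2 \<le> ennreal B"
    and le: "\<And>u g1 g2. H1_loc_grad u g1 g2 \<Longrightarrow> mag_periodic h u \<Longrightarrow> ennreal L \<le> E2D h \<epsilon> u g1 g2"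
  shows "L \<le> m_p h \<epsilon>"
proof (cases "L \<ge> 0")
  case True
  let ?I = "INF ugg \<in> {(u, g1, g2). H1_loc_grad u g1 g2 \<and> mag_periodic h u}.
      E2D h \<epsilon> (fst ugg) (fst (snd ugg)) (snd (snd ugg))"
  have "?I \<le> ennreal B"
    using ex by (intro INF_lower2[of "(u, g1, g2)"]) auto
  hence "?I < top" using ennreal_less_top by (rule order.strict_trans1)
  moreover have "ennreal L \<le> ?I"
  proof (rule INF_greatest)
    fix x assume "x \<in> {(u, g1, g2). H1_loc_grad u g1 g2 \<and> mag_periodic h u}"
    hence "H1_loc_grad (fst x) (fst (snd x)) (snd (snd x))" "mag_periodic h (fst x)" by (simp_all add: case_prod_unfold)
    thus "ennreal L \<le> E2D h \<epsilon> (fst x) (fst (snd x)) (snd (snd x))" by (rule le)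
  qed
  ultimately have "enn2real (ennreal L) \<le> enn2real ?I" by (intro enn2real_mono)
  thus ?thesis using True by (simp add: m_p_def)
next
  case False
  moreover have "0 \<le> m_p h \<epsilon>" by (simp add: m_p_def)
  ultimately show ?thesis by linarith
qed

lemma flux_quanta:
  assumes h: "h > 0" "h / (2 * pi) \<in> \<int>" "h \<ge> 800 * pi"
  obtains N where "N \<ge> 400" "h = 2 * pi * real N"
proof -
  obtain k :: int where k: "h / (2 * pi) = of_int k" using h(2) by (auto elim: Ints_cases)
  have hk: "h = 2 * pi * of_int k" using k by (simp add: field_simps)
  have "2 * pi * of_int k \<ge> 2 * pi * 400" using h(3) unfolding hk by simp
  hence "(of_int k :: real) \<ge> 400" by (rule mult_left_le_imp_le) simp
  hence "k \<ge> 400" by linarith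
  thus ?thesis using that[of "nat k"] hk by simp
qed

lemma even_columns:
  fixes N :: nat
  obtains m where "sqrt (real N) \<le> real m" "real m \<le> sqrt (real N) + 2" "even m"
proof -
  define k where "k = nat \<lceil>sqrt (real N) / 2\<rceil>"
  have k: "real k = of_int \<lceil>sqrt (real N) / 2\<rceil>" by (simp add: k_def)
  have "sqrt (real N) / 2 \<le> real k" "real k < sqrt (real N) / 2 + 1" unfolding k by linarith+
  hence "sqrt (real N) \<le> real (2 * k)" "real (2 * k) \<le> sqrt (real N) + 2" by simp_all
  thus ?thesis using that[of "2 * k"] by simp
qed

text \<open>The lower bound uses circles from \<open>M * \<epsilon>\<close>, well outside the cores,
  to \<open>1 / sqrt h\<close>, the vortex distance: this choice yields the terms
  \<open>ln M\<close> and \<open>1/4\<close>. All errors are of order \<open>h\<close> or in the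
  prefactor governed by \<open>\<theta>\<close> and \<open>M\<close>, and the bounds hold for each
  such \<open>h\<close> and \<open>\<epsilon>\<close>.\<close>

lemma energy_two_sided:
  assumes h: "h > 0" "h / (2 * pi) \<in> \<int>" "h \<ge> 800 * pi" and \<epsilon>: "\<epsilon> > 0" and small: "\<epsilon> * sqrt h \<le> 1"
    and \<theta>: "0 < \<theta>" "\<theta> < 1" and M: "M \<ge> 1" "M * (\<epsilon> * sqrt h) \<le> 1"
  shows "m_p h \<epsilon> \<le> h * ln (1 / (\<epsilon> * sqrt h)) + 10300 * h"
    and "h * (ln (1 / (\<epsilon> * sqrt h)) - ln M - 1/4) \<le> (1 / (1 - \<theta>)\<^sup>2 + 32 * pi / (\<theta>^4 * M)) * m_p h \<epsilon>"
proof -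
  obtain N where Nh: "N \<ge> 400" "h = 2 * pi * real N" using flux_quanta[OF h] .
  obtain m where m: "sqrt (real N) \<le> real m" "real m \<le> sqrt (real N) + 2" "even m" by (rule even_columns)
  interpret theta_params N m by standard fact+
  define d where "d = \<epsilon> * sqrt h"
  have d: "0 < d" "d \<le> 1" using h \<epsilon> small by (auto simp: d_def)
  have d2: "\<epsilon>\<^sup>2 * h = d\<^sup>2" using h by (simp add: d_def power_mult_distrib)
  define B where "B = h / 2 * (ln (1 + 441 / d\<^sup>2) + 2) + 10000 * h"
  obtain u g1 g2 where u: "H1_loc_grad u g1 g2" "mag_periodic h u" "E2D h \<epsilon> u g1 g2 \<le> ennreal B"
    using competitor[OF \<epsilon>] small unfolding Nh(2)[symmetric] B_def d2 by blast
  have "0 \<le> ln (1 + 441 / d\<^sup>2)" by simp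
  hence B0: "B \<ge> 0" unfolding B_def using h by (intro add_nonneg_nonneg mult_nonneg_nonneg) auto
  have "ln (1 + 441 / d\<^sup>2) \<le> ln (442 * (1 / d)\<^sup>2)"
  proof (subst ln_le_cancel_iff)
    have "d\<^sup>2 \<le> 1" using d by (simp add: power_le_one)
    thus "1 + 441 / d\<^sup>2 \<le> 442 * (1 / d)\<^sup>2" using d by (simp add: power_divide divide_simps)
  qed (use d in \<open>auto intro: add_pos_nonneg\<close>)
  also have "\<dots> = ln 442 + 2 * ln (1 / d)" using d by (simp add: ln_mult ln_realpow)
  also have "ln 442 \<le> (441 :: real)" using ln_le_minus_one[of 442] by simp
  finally have "B \<le> h / 2 * (441 + 2 * ln (1 / d) + 2) + 10000 * h"
    unfolding B_def using h by (intro add_right_mono mult_left_mono) auto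
  also have "\<dots> \<le> h * ln (1 / d) + 10300 * h" using h by (simp add: algebra_simps)
  finally have "B \<le> h * ln (1 / d) + 10300 * h" .
  with m_p_le[OF u B0] show "m_p h \<epsilon> \<le> h * ln (1 / (\<epsilon> * sqrt h)) + 10300 * h" unfolding d_def by linarith
  define D where "D = 1 / (1 - \<theta>)\<^sup>2 + 32 * pi / (\<theta>^4 * M)"
  have D: "D > 0" unfolding D_def using \<theta> M by (intro add_pos_nonneg) auto
  define L where "L = h * (ln (1 / d) - ln M - 1/4)"
  have "L / D \<le> m_p h \<epsilon>"
  proof (rule m_p_ge[OF u])
    fix u g1 g2 assume a: "H1_loc_grad u g1 g2" "mag_periodic h u"
    have r1: "\<epsilon> \<le> M * \<epsilon>" using \<epsilon> M by simp
    have r2: "M * \<epsilon> \<le> 1 / sqrt h" using M h by (simp add: field_simps)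
    have e1: "h * ln ((1 / sqrt h) / (M * \<epsilon>)) - h\<^sup>2 * (1 / sqrt h)\<^sup>2 / 4 = L"
    proof -
      have a1: "(1 / sqrt h) / (M * \<epsilon>) = (1 / d) / M" by (simp add: d_def)
      have a2: "ln ((1 / d) / M) = ln (1 / d) - ln M" using d M by (subst ln_div) auto
      have a3: "h\<^sup>2 * (1 / sqrt h)\<^sup>2 = h" using h by (simp add: power_divide power2_eq_square)
      show ?thesis unfolding a1 a2 a3 L_def by (simp add: right_diff_distrib)
    qed
    have e2: "1 / (1 - \<theta>)\<^sup>2 + 32 * pi * \<epsilon> / (\<theta>^4 * (M * \<epsilon>)) = D" using \<epsilon> by (simp add: D_def)
    have "ennreal L \<le> ennreal D * E2D h \<epsilon> u g1 g2"
      using admissible_lower_bound[OF a \<theta> \<epsilon> r1 r2] unfolding e1 e2 .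
    hence "ennreal (1 / D) * ennreal L \<le> ennreal (1 / D) * (ennreal D * E2D h \<epsilon> u g1 g2)"
      by (rule mult_left_mono) simp
    also have "\<dots> = E2D h \<epsilon> u g1 g2"
      using D by (simp add: mult.assoc[symmetric] ennreal_mult[symmetric])
    finally show "ennreal (L / D) \<le> E2D h \<epsilon> u g1 g2"
      using D by (simp add: ennreal_mult'[symmetric])
  qed
  hence "L \<le> D * m_p h \<epsilon>" using D by (simp add: field_simps)
  thus "h * (ln (1 / (\<epsilon> * sqrt h)) - ln M - 1/4) \<le> (1 / (1 - \<theta>)\<^sup>2 + 32 * pi / (\<theta>^4 * M)) * m_p h \<epsilon>"
    unfolding L_def D_def d_def .
qed

text \<open>\<open>quant\<close> is flux quantisation. The two translation laws, composed in either
  order, differ by the factor \<open>exp (\<i> * h)\<close>, so for other values of \<open>h\<close>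
  an admissible function vanishes almost everywhere. Its energy
  \<open>1 / (2 * \<epsilon>^2)\<close> would be far larger than the stated asymptotics, because
  \<open>\<epsilon> * sqrt h\<close> tends to 0.\<close>

theorem theorem2p2:
  fixes h :: "real \<Rightarrow> real"
  assumes hpos: "\<forall>\<epsilon>>0. h \<epsilon> > 0"
    and quant: "\<forall>\<epsilon>>0. h \<epsilon> / (2 * pi) \<in> \<int>"
    and lower: "(\<lambda>\<epsilon>. \<bar>ln \<epsilon>\<bar>) \<in> o[at_right 0](h)"
    and upper: "h \<in> o[at_right 0](\<lambda>\<epsilon>. 1 / \<epsilon>\<^sup>2)"
  shows "(\<lambda>\<epsilon>. m_p (h \<epsilon>) \<epsilon>) \<sim>[at_right 0] (\<lambda>\<epsilon>. h \<epsilon> * ln (1 / (\<epsilon> * sqrt (h \<epsilon>))))"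
proof -
  define d where "d \<epsilon> = \<epsilon> * sqrt (h \<epsilon>)" for \<epsilon>
  define l where "l \<epsilon> = ln (1 / d \<epsilon>)" for \<epsilon>
  have pos: "\<forall>\<^sub>F \<epsilon> in at_right 0. (0::real) < \<epsilon>" by (rule eventually_at_right_less)
  have dpos: "\<forall>\<^sub>F \<epsilon> in at_right 0. 0 < d \<epsilon>"
    using pos by eventually_elim (use hpos in \<open>simp add: d_def\<close>)
  have "((\<lambda>\<epsilon>. h \<epsilon> / (1 / \<epsilon>\<^sup>2)) \<longlongrightarrow> 0) (at_right 0)" by (rule smalloD_tendsto[OF upper])
  hence "((\<lambda>\<epsilon>. sqrt (h \<epsilon> / (1 / \<epsilon>\<^sup>2))) \<longlongrightarrow> sqrt 0) (at_right 0)" by (rule tendsto_real_sqrt)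
  moreover have "\<forall>\<^sub>F \<epsilon> in at_right 0. sqrt (h \<epsilon> / (1 / \<epsilon>\<^sup>2)) = d \<epsilon>"
    using pos by eventually_elim (simp add: d_def real_sqrt_mult)
  ultimately have d0: "(d \<longlongrightarrow> 0) (at_right 0)" by (simp add: tendsto_cong)
  have l_inf: "filterlim l at_top (at_right 0)"
    unfolding l_def[abs_def] using filterlim_compose[OF ln_at_top filterlim_inverse_at_top[OF d0 dpos]]
    by (simp add: inverse_eq_divide)
  \<comment> \<open>The lower growth condition acts here: \<open>h\<close> eventually exceeds every
    constant, in particular \<open>800 * pi\<close>, so that at least 400 flux quanta are
    available.\<close>
  have h_inf: "filterlim h at_top (at_right 0)"
  proof (rule filterlim_at_top_mono)
    show "filterlim (\<lambda>\<epsilon>::real. - ln \<epsilon>) at_top (at_right 0)"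
      using ln_at_0 by (simp add: filterlim_uminus_at_top)
    show "\<forall>\<^sub>F \<epsilon> in at_right 0. - ln \<epsilon> \<le> h \<epsilon>"
      using landau_o.smallD[OF lower zero_less_one] pos by eventually_elim (use hpos in force)
  qed
  show ?thesis
  proof (rule asymp_equivI', rule tendstoI)
    fix e :: real assume e: "e > 0"
    define k where "k = min (e / 2) 1"
    have k: "0 < k" "k \<le> 1" "k < e" using e by (auto simp: k_def)
    \<comment> \<open>For \<open>\<theta> \<le> 1/4\<close> one has
      \<open>1 / (1 - \<theta>)^2 \<le> 1 + 4 * \<theta>\<close>, which is \<open>1 + k/4\<close>.
      With \<open>\<theta>\<close> fixed, \<open>M\<close> makes the bad-circle term at most
      \<open>k/4\<close> as well; both are chosen before \<open>\<epsilon>\<close>.\<close>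
    define \<theta> where "\<theta> = k / 16"
    have \<theta>: "0 < \<theta>" "\<theta> < 1" "\<theta> \<le> 1/4" using k by (auto simp: \<theta>_def)
    define M where "M = 128 * pi / (\<theta>^4 * k) + 1"
    have M: "M \<ge> 1" using \<theta> k by (simp add: M_def)
    define D where "D = 1 / (1 - \<theta>)\<^sup>2 + 32 * pi / (\<theta>^4 * M)"
    have D: "D \<le> 1 + k / 2" "D > 0"
    proof -
      have "0 \<le> \<theta> * (2 - 7 * \<theta> + 4 * \<theta>\<^sup>2)" using \<theta> by (intro mult_nonneg_nonneg) auto
      hence "1 \<le> (1 + 4 * \<theta>) * (1 - \<theta>)\<^sup>2" by (simp add: power2_eq_square algebra_simps)
      hence "1 / (1 - \<theta>)\<^sup>2 \<le> 1 + k / 4" using \<theta> by (simp add: divide_le_eq \<theta>_def)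
      moreover have "32 * pi / (\<theta>^4 * M) \<le> k / 4"
      proof -
        have "\<theta>^4 * M * k = 128 * pi + \<theta>^4 * k" using \<theta> k by (simp add: M_def field_simps)
        hence "128 * pi \<le> \<theta>^4 * M * k" using \<theta> k by simp
        moreover have "\<theta>^4 * M > 0" using \<theta> M by simp
        ultimately show ?thesis by (simp add: divide_le_eq mult_ac)
      qed
      ultimately show "D \<le> 1 + k / 2" by (simp add: D_def)
      show "D > 0" unfolding D_def using \<theta> M by (intro add_pos_nonneg) auto
    qed
    \<comment> \<open>The larger of the two constants multiplying \<open>h\<close> in
      \<open>energy_two_sided\<close>; eventually it is at most the fraction \<open>k/4\<close> of
      the logarithm.\<close>
    define K where "K = max 10300 (ln M + 1/4)"
    have ev1: "\<forall>\<^sub>F \<epsilon> in at_right 0. d \<epsilon> < 1 / M" using M by (intro order_tendstoD[OF d0]) auto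
    have ev2: "\<forall>\<^sub>F \<epsilon> in at_right 0. 4 * K / k \<le> l \<epsilon>" using l_inf by (simp add: filterlim_at_top)
    have ev3: "\<forall>\<^sub>F \<epsilon> in at_right 0. 800 * pi \<le> h \<epsilon>" using h_inf by (simp add: filterlim_at_top)
    show "\<forall>\<^sub>F \<epsilon> in at_right 0. dist (m_p (h \<epsilon>) \<epsilon> / (h \<epsilon> * ln (1 / (\<epsilon> * sqrt (h \<epsilon>))))) 1 < e"
      using pos ev1 ev2 ev3
    proof eventually_elim
      case (elim \<epsilon>)
      have h: "h \<epsilon> > 0" "h \<epsilon> / (2 * pi) \<in> \<int>" using hpos quant elim(1) by auto
      have dM: "M * (\<epsilon> * sqrt (h \<epsilon>)) \<le> 1" using elim(2) M by (simp add: d_def field_simps)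
      have "1 / M \<le> 1" using M by simp
      hence d1: "\<epsilon> * sqrt (h \<epsilon>) \<le> 1" using elim(2) by (simp add: d_def)
      have K: "K > 0" "10300 \<le> K" "ln M + 1/4 \<le> K" by (auto simp: K_def)
      have "4 * K / k > 0" using K k by simp
      hence l0: "l \<epsilon> > 0" using elim(3) by linarith
      have Kl: "K \<le> l \<epsilon> * (k / 4)" using elim(3) k by (simp add: field_simps)
      note two = energy_two_sided[OF h elim(4,1) d1 \<theta>(1,2) M dM]
      have hl: "h \<epsilon> * l \<epsilon> > 0" using h l0 by simp
      define R where "R = m_p (h \<epsilon>) \<epsilon> / (h \<epsilon> * l \<epsilon>)"
      have mR: "m_p (h \<epsilon>) \<epsilon> = h \<epsilon> * l \<epsilon> * R" using h l0 by (simp add: R_def)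
      have "m_p (h \<epsilon>) \<epsilon> \<le> h \<epsilon> * l \<epsilon> + 10300 * h \<epsilon>" using two(1) by (simp add: l_def d_def)
      also have "\<dots> \<le> h \<epsilon> * l \<epsilon> + (l \<epsilon> * (k / 4)) * h \<epsilon>"
        using K Kl h by (intro add_left_mono mult_right_mono) auto
      also have "\<dots> = h \<epsilon> * l \<epsilon> * (1 + k / 4)" by (simp add: algebra_simps)
      finally have up: "R \<le> 1 + k / 4" unfolding mR by (rule mult_left_le_imp_le[OF _ hl])
      have "h \<epsilon> * l \<epsilon> * (1 - k / 4) = h \<epsilon> * (l \<epsilon> - l \<epsilon> * (k / 4))" by (simp add: algebra_simps)
      also have "\<dots> \<le> h \<epsilon> * (l \<epsilon> - ln M - 1/4)" using K Kl h by (intro mult_left_mono) auto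
      also have "\<dots> \<le> D * m_p (h \<epsilon>) \<epsilon>" using two(2) by (simp add: l_def d_def D_def)
      also have "\<dots> = h \<epsilon> * l \<epsilon> * (D * R)" unfolding mR by simp
      finally have lo: "1 - k / 4 \<le> D * R" by (rule mult_left_le_imp_le[OF _ hl])
      have "R > 0"
      proof (rule ccontr)
        assume "\<not> R > 0"
        hence "D * R \<le> 0" using D by (simp add: mult_nonneg_nonpos)
        thus False using lo k by simp
      qed
      hence "D * R \<le> (1 + k / 2) * R" using D by (intro mult_right_mono) auto
      with lo have lo2: "1 - k / 4 \<le> (1 + k / 2) * R" by linarith
      have "(1 + k / 2) * (1 - k) \<le> 1 - k / 4" using k by (simp add: algebra_simps)
      with lo2 have "(1 + k / 2) * (1 - k) \<le> (1 + k / 2) * R" by linarith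
      hence "1 - k \<le> R" using k by simp
      with up k have "\<bar>R - 1\<bar> < e" by (simp add: abs_less_iff)
      thus ?case by (simp add: dist_real_def R_def l_def d_def)
    qed
  qed
qed

end
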